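(* Let $k>0$ be fixed, $d_u>0$, $d_v\ge0$, and let $(u^k,v^k)$ be the solution of problem $(P_1^k)$ (on $\mathbb{R}\times(0,T)$ for every $T>0$) with initial data $u_0^k,v_0^k\in C^2(\mathbb{R})$ with $0\le u_0^k,v_0^k\le M$ such that $$\|u_0^k-u_0^\infty\|_{L^1(\mathbb{R})}<\infty,\qquad \|v_0^k-v_0^\infty\|_{L^1(\mathbb{R})}<\infty,$$ and $u_0^k(x)\to U_0,\,0$ and $v_0^k(x)\to 0,\,V_0$ as $x\to-\infty,\,\infty$ respectively. Then for each $J>0$ there exists a sequence $t_n\to\infty$ such that, as $t_n\to\infty$, $$\frac1{\sqrt{t_n}}\int_{-J\sqrt{t_n}}^{J\sqrt{t_n}}\left|u^k(y,t_n)-f^+\left(\frac{y}{\sqrt{t_n}}\right)\right|^2dy\to0 \quad\text{and}\quad \frac1{\sqrt{t_n}}\int_{-J\sqrt{t_n}}^{J\sqrt{t_n}}\left|v^k(y,t_n)+f^-\left(\frac{y}{\sqrt{t_n}}\right)\right|^2dy\to0,$$ where $f^+=\max\{f,0\}$, $f^-=\min\{f,0\}$, and $f:\mathbb{R}\to\mathbb{R}$ is the following self-similar profile. For $\eta\le a$, $$f(\eta)=U_0\left(1-\frac{\int_{-\infty}^{\eta}e^{-s^2/(4d_u)}\,ds}{\int_{-\infty}^{a}e^{-s^2/(4d_u)}\,ds}\right).$$ If $d_v>0$, then $f(\eta)=-V_0\left(1-\frac{\int_{\eta}^{\infty}e^{-s^2/(4d_v)}ds}{\int_{a}^{\infty}e^{-s^2/(4d_v)}ds}\right)$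 for $\eta>a$, and $a\in\mathbb{R}$ is the unique root of $d_uU_0\int_a^\infty e^{\frac{a^2-s^2}{4d_v}}ds=d_vV_0\int_{-\infty}^a e^{\frac{a^2-s^2}{4d_u}}ds$. If $d_v=0$, then $f(\eta)=-V_0$ for $\eta>a$, and $a>0$ is the unique root of $U_0=\frac{V_0a}{2d_u}\int_{-\infty}^a e^{\frac{a^2-s^2}{4d_u}}ds$.
   Context: $\mathbb{R}^+=[0,\infty)$, $Q_T=\mathbb{R}\times(0,T)$; $U_0,V_0>0$, $M\ge\max\{U_0,V_0\}$; $u_0^\infty=U_0$ for $x<0$, $0$ for $x>0$; $v_0^\infty=0$ for $x<0$, $V_0$ for $x>0$. $F:\mathbb{R}^+\times\mathbb{R}^+\to\mathbb{R}^+$ satisfies (i) $F\in C^{0,\alpha}(\mathbb{R}^+\times\mathbb{R}^+)$ for some $\alpha>0$; (ii) $F(u,0)=F(0,v)=0$ for all $u,v\in\mathbb{R}^+$ and $F(u,v)>0$ for $u,v>0$; (iii) $F(\cdot,v)$ and $F(u,\cdot)$ are non-decreasing for all $u,v\in\mathbb{R}^+$. Problem $(P_1^k)$: $u_t=d_uu_{xx}-kF(u,v)$, $v_t=d_vv_{xx}-kF(u,v)$ in $Q_T$, $u(\cdot,0)=u_0^k$, $v(\cdot,0)=v_0^k$ on $\mathbb{R}$ (terms multiplied by $d_v$ are absent when $d_v=0$). Solutions satisfy $0\le u^k,v^k\le M$. If $d_v>0$ they are classical, with $u^k,v^k\in C^{2,1}(\mathbb{R}\times[\delta,T])\cap C^0(\mathbb{R}\times[0,T])\cap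 W^{2,1}_p((-J,J)\times(0,T))$ for all $\delta,J>0$, $p\ge1$. If $d_v=0$ they are weak, with $u^k\in W^{2,1}_p((-J,J)\times(0,T))$, $v^k\in W^{1,\infty}(0,T;L^\infty((-J,J)))$ for all $J>0$, $p\ge1$, and for all $\psi\in C^{2,1}(\overline{Q_T})$ with $\psi(\cdot,T)=0$ and $\operatorname{supp}\psi\subset[-J,J]\times[0,T]$ for some $J>0$: $\iint_{Q_T}u^k\psi_t+\iint_{Q_T}\{d_uu^k\psi_{xx}-kF(u^k,v^k)\psi\}=-\int_{\mathbb{R}}u_0^k\psi(\cdot,0)$ and $\iint_{Q_T}v^k\psi_t-\iint_{Q_T}kF(u^k,v^k)\psi=-\int_{\mathbb{R}}v_0^k\psi(\cdot,0)$. *)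

theory Defs
  imports "HOL-Probability.Essential_Supremum"
begin

text \<open>
  Functions of space and time are curried, space first: \<open>u x t\<close>.  The reaction rate \<open>F\<close> is a
  function on all of \<open>real \<times> real\<close>, but only its values on the closed quadrant are ever
  constrained.
\<close>

section \<open>Data of the problem\<close>

definition C2_real :: "(real \<Rightarrow> real) \<Rightarrow> bool" where
  "C2_real g \<longleftrightarrow> (\<exists>g' g''. (\<forall>x. (g has_real_derivative g' x) (at x)) \<and>
      (\<forall>x. (g' has_real_derivative g'' x) (at x)) \<and> continuous_on UNIV g'')"

text \<open>Hoelder continuity is uniform on each compact subset of \<open>S\<close>, with a common exponent, so that
  unbounded rates such as \<open>F u v = u * v\<close> are admitted; globally Hoelder functions are covered.\<close>

definition Hoelder_on :: "real \<Rightarrow> (real \<times> real) set \<Rightarrow> (real \<Rightarrow> real \<Rightarrow> real) \<Rightarrow> bool" where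
  "Hoelder_on \<alpha> S F \<longleftrightarrow> (\<forall>K. compact K \<and> K \<subseteq> S \<longrightarrow>
      (\<exists>C. \<forall>(u, v)\<in>K. \<forall>(u', v')\<in>K. \<bar>F u v - F u' v'\<bar> \<le> C * dist (u, v) (u', v') powr \<alpha>))"

definition reaction_rate :: "(real \<Rightarrow> real \<Rightarrow> real) \<Rightarrow> bool" where
  "reaction_rate F \<longleftrightarrow>
      (\<forall>u\<ge>0. \<forall>v\<ge>0. F u v \<ge> 0) \<and>
      (\<exists>\<alpha>>0. Hoelder_on \<alpha> ({0..} \<times> {0..}) F) \<and>
      (\<forall>u\<ge>0. F u 0 = 0) \<and> (\<forall>v\<ge>0. F 0 v = 0) \<and> (\<forall>u>0. \<forall>v>0. F u v > 0) \<and>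
      (\<forall>v\<ge>0. mono_on {0..} (\<lambda>u. F u v)) \<and> (\<forall>u\<ge>0. mono_on {0..} (\<lambda>v. F u v))"

text \<open>The limiting initial data; the value at the single point \<open>0\<close> is immaterial.\<close>

definition u0_inf :: "real \<Rightarrow> real \<Rightarrow> real" where
  "u0_inf U0 x = (if x < 0 then U0 else 0)"

definition v0_inf :: "real \<Rightarrow> real \<Rightarrow> real" where
  "v0_inf V0 x = (if x > 0 then V0 else 0)"

section \<open>Function spaces\<close>

text \<open>\<open>C21_on I w wx wxx wt\<close>: \<open>w\<close> is of class \<open>C\<^sup>2\<^sup>,\<^sup>1\<close> on \<open>\<real> \<times> I\<close> with the given derivatives.
  Time derivatives at endpoints of the interval \<open>I\<close> are one-sided.\<close>

definition C21_on :: "real set \<Rightarrow> (real \<Rightarrow> real \<Rightarrow> real) \<Rightarrow> (real \<Rightarrow> real \<Rightarrow> real) \<Rightarrow>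
    (real \<Rightarrow> real \<Rightarrow> real) \<Rightarrow> (real \<Rightarrow> real \<Rightarrow> real) \<Rightarrow> bool" where
  "C21_on I w wx wxx wt \<longleftrightarrow>
      (\<forall>x. \<forall>t\<in>I. ((\<lambda>y. w y t) has_real_derivative wx x t) (at x) \<and>
                  ((\<lambda>y. wx y t) has_real_derivative wxx x t) (at x) \<and>
                  ((\<lambda>s. w x s) has_real_derivative wt x t) (at t within I)) \<and>
      continuous_on (UNIV \<times> I) (\<lambda>(x, t). w x t) \<and>
      continuous_on (UNIV \<times> I) (\<lambda>(x, t). wx x t) \<and>
      continuous_on (UNIV \<times> I) (\<lambda>(x, t). wxx x t) \<and>
      continuous_on (UNIV \<times> I) (\<lambda>(x, t). wt x t)"

primrec Ck2 :: "nat \<Rightarrow> (real \<Rightarrow> real \<Rightarrow> real) \<Rightarrow> bool" where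
  "Ck2 0 \<phi> \<longleftrightarrow> continuous_on UNIV (\<lambda>(x, t). \<phi> x t)"
| "Ck2 (Suc n) \<phi> \<longleftrightarrow> (\<exists>\<phi>x \<phi>t.
      (\<forall>x t. ((\<lambda>y. \<phi> y t) has_real_derivative \<phi>x x t) (at x) \<and>
             ((\<lambda>s. \<phi> x s) has_real_derivative \<phi>t x t) (at t)) \<and> Ck2 n \<phi>x \<and> Ck2 n \<phi>t)"

definition test_fun2 :: "(real \<times> real) set \<Rightarrow> (real \<Rightarrow> real \<Rightarrow> real) \<Rightarrow> bool" where
  "test_fun2 \<Omega> \<phi> \<longleftrightarrow> (\<forall>n. Ck2 n \<phi>) \<and>
      (\<exists>K. compact K \<and> K \<subseteq> \<Omega> \<and> (\<forall>x t. (x, t) \<notin> K \<longrightarrow> \<phi> x t = 0))"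

definition test_fun1 :: "real set \<Rightarrow> (real \<Rightarrow> real) \<Rightarrow> bool" where
  "test_fun1 I \<phi> \<longleftrightarrow> (\<forall>n t. ((deriv ^^ n) \<phi>) field_differentiable (at t)) \<and>
      (\<exists>K. compact K \<and> K \<subseteq> I \<and> (\<forall>t. t \<notin> K \<longrightarrow> \<phi> t = 0))"

definition Lp2 :: "real \<Rightarrow> (real \<times> real) set \<Rightarrow> (real \<Rightarrow> real \<Rightarrow> real) \<Rightarrow> bool" where
  "Lp2 p \<Omega> g \<longleftrightarrow> (\<lambda>(x, t). g x t) \<in> borel_measurable (lebesgue_on \<Omega>) \<and>
      integrable (lebesgue_on \<Omega>) (\<lambda>(x, t). \<bar>g x t\<bar> powr p)"

definition weak_dx :: "(real \<times> real) set \<Rightarrow> (real \<Rightarrow> real \<Rightarrow> real) \<Rightarrow> (real \<Rightarrow> real \<Rightarrow> real) \<Rightarrow> bool" where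
  "weak_dx \<Omega> g h \<longleftrightarrow> (\<forall>\<phi>. test_fun2 \<Omega> \<phi> \<longrightarrow>
      (\<integral>(x, t). g x t * deriv (\<lambda>y. \<phi> y t) x \<partial>lebesgue_on \<Omega>) =
      - (\<integral>(x, t). h x t * \<phi> x t \<partial>lebesgue_on \<Omega>))"

definition weak_dt :: "(real \<times> real) set \<Rightarrow> (real \<Rightarrow> real \<Rightarrow> real) \<Rightarrow> (real \<Rightarrow> real \<Rightarrow> real) \<Rightarrow> bool" where
  "weak_dt \<Omega> g h \<longleftrightarrow> (\<forall>\<phi>. test_fun2 \<Omega> \<phi> \<longrightarrow>
      (\<integral>(x, t). g x t * deriv (\<lambda>s. \<phi> x s) t \<partial>lebesgue_on \<Omega>) =
      - (\<integral>(x, t). h x t * \<phi> x t \<partial>lebesgue_on \<Omega>))"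

text \<open>The parabolic Sobolev space \<open>W\<^sup>2\<^sup>,\<^sup>1\<^sub>p(\<Omega>)\<close>: two weak space derivatives, one weak time derivative.\<close>

definition W21p :: "real \<Rightarrow> (real \<times> real) set \<Rightarrow> (real \<Rightarrow> real \<Rightarrow> real) \<Rightarrow> bool" where
  "W21p p \<Omega> u \<longleftrightarrow> Lp2 p \<Omega> u \<and> (\<exists>ux uxx ut. Lp2 p \<Omega> ux \<and> Lp2 p \<Omega> uxx \<and> Lp2 p \<Omega> ut \<and>
      weak_dx \<Omega> u ux \<and> weak_dx \<Omega> ux uxx \<and> weak_dt \<Omega> u ut)"

definition Linf_norm :: "real set \<Rightarrow> (real \<Rightarrow> real) \<Rightarrow> ereal" where
  "Linf_norm S g = esssup (lebesgue_on S) (\<lambda>x. ereal \<bar>g x\<bar>)"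

definition Linf :: "real set \<Rightarrow> (real \<Rightarrow> real) \<Rightarrow> bool" where
  "Linf S g \<longleftrightarrow> g \<in> borel_measurable (lebesgue_on S) \<and> Linf_norm S g < \<infinity>"

text \<open>The Bochner space \<open>L\<^sup>\<infinity>(0,T; L\<^sup>\<infinity>(S))\<close>.  The map \<open>t \<mapsto> w(\<cdot>,t)\<close> has to be strongly measurable,
  i.e. almost everywhere a norm limit of simple \<open>L\<^sup>\<infinity>(S)\<close>-valued functions.  As elements of
  \<open>L\<^sup>\<infinity>(S)\<close> are represented by functions, \<open>w\<close> is also required to be jointly measurable; then
  Bochner integrals in \<open>t\<close> are represented by the pointwise integrals for a.e. \<open>x\<close>.\<close>

definition Linf_simple :: "real \<Rightarrow> real set \<Rightarrow> (real \<Rightarrow> real \<Rightarrow> real) \<Rightarrow> bool" where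
  "Linf_simple T S s \<longleftrightarrow> finite (s ` {0<..<T}) \<and>
      (\<forall>h \<in> s ` {0<..<T}. Linf S h \<and> {t \<in> {0<..<T}. s t = h} \<in> sets lebesgue)"

definition Linf_Linf :: "real \<Rightarrow> real set \<Rightarrow> (real \<Rightarrow> real \<Rightarrow> real) \<Rightarrow> bool" where
  "Linf_Linf T S w \<longleftrightarrow>
      (\<lambda>(x, t). w x t) \<in> borel_measurable (lebesgue_on (S \<times> {0<..<T})) \<and>
      (\<exists>s. (\<forall>n. Linf_simple T S (s n)) \<and>
           (AE t in lebesgue_on {0<..<T}. (\<lambda>n. Linf_norm S (\<lambda>x. s n t x - w x t)) \<longlonglongrightarrow> 0)) \<and>
      (\<exists>C::real. AE t in lebesgue_on {0<..<T}. Linf_norm S (\<lambda>x. w x t) \<le> ereal C)"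

text \<open>\<open>W\<^sup>1\<^sup>,\<^sup>\<infinity>(0,T; L\<^sup>\<infinity>(S))\<close>.  The distributional derivative is that of an \<open>L\<^sup>\<infinity>(S)\<close>-valued function: the
  \<open>L\<^sup>\<infinity>(S)\<close>-valued integrals of \<open>v \<phi>'\<close> and \<open>- w \<phi>\<close> over \<open>(0,T)\<close> agree for every scalar test function.\<close>

definition W1inf_Linf :: "real \<Rightarrow> real set \<Rightarrow> (real \<Rightarrow> real \<Rightarrow> real) \<Rightarrow> bool" where
  "W1inf_Linf T S v \<longleftrightarrow> Linf_Linf T S v \<and> (\<exists>w. Linf_Linf T S w \<and>
      (\<forall>\<phi>. test_fun1 {0<..<T} \<phi> \<longrightarrow> (AE x in lebesgue_on S.
          (\<integral>t. v x t * deriv \<phi> t \<partial>lebesgue_on {0<..<T}) =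
          - (\<integral>t. w x t * \<phi> t \<partial>lebesgue_on {0<..<T}))))"

section \<open>Solutions on \<open>\<real> \<times> (0,T)\<close>\<close>

definition classical_solution :: "real \<Rightarrow> real \<Rightarrow> real \<Rightarrow> (real \<Rightarrow> real \<Rightarrow> real) \<Rightarrow> (real \<Rightarrow> real) \<Rightarrow>
    (real \<Rightarrow> real) \<Rightarrow> real \<Rightarrow> real \<Rightarrow> (real \<Rightarrow> real \<Rightarrow> real) \<Rightarrow> (real \<Rightarrow> real \<Rightarrow> real) \<Rightarrow> bool" where
  "classical_solution du dv k F u0 v0 M T u v \<longleftrightarrow>
      (\<forall>x. \<forall>t\<in>{0..T}. 0 \<le> u x t \<and> u x t \<le> M \<and> 0 \<le> v x t \<and> v x t \<le> M) \<and>
      continuous_on (UNIV \<times> {0..T}) (\<lambda>(x, t). u x t) \<and>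
      continuous_on (UNIV \<times> {0..T}) (\<lambda>(x, t). v x t) \<and>
      (\<forall>J>0. \<forall>p\<ge>1. W21p p ({-J<..<J} \<times> {0<..<T}) u \<and> W21p p ({-J<..<J} \<times> {0<..<T}) v) \<and>
      (\<forall>\<delta>. 0 < \<delta> \<and> \<delta> < T \<longrightarrow> (\<exists>ux uxx ut vx vxx vt.
          C21_on {\<delta>..T} u ux uxx ut \<and> C21_on {\<delta>..T} v vx vxx vt \<and>
          (\<forall>x. \<forall>t\<in>{\<delta><..<T}. ut x t = du * uxx x t - k * F (u x t) (v x t) \<and>
                              vt x t = dv * vxx x t - k * F (u x t) (v x t)))) \<and>
      (\<forall>x. u x 0 = u0 x \<and> v x 0 = v0 x)"

text \<open>For \<open>d\<^sub>v = 0\<close> solutions live in Lebesgue spaces, hence the bounds hold almost everywhere.\<close>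

definition weak_solution :: "real \<Rightarrow> real \<Rightarrow> (real \<Rightarrow> real \<Rightarrow> real) \<Rightarrow> (real \<Rightarrow> real) \<Rightarrow>
    (real \<Rightarrow> real) \<Rightarrow> real \<Rightarrow> real \<Rightarrow> (real \<Rightarrow> real \<Rightarrow> real) \<Rightarrow> (real \<Rightarrow> real \<Rightarrow> real) \<Rightarrow> bool" where
  "weak_solution du k F u0 v0 M T u v \<longleftrightarrow>
      (AE (x, t) in lebesgue_on (UNIV \<times> {0<..<T}).
          0 \<le> u x t \<and> u x t \<le> M \<and> 0 \<le> v x t \<and> v x t \<le> M) \<and>
      (\<forall>J>0. \<forall>p\<ge>1. W21p p ({-J<..<J} \<times> {0<..<T}) u) \<and>
      (\<forall>J>0. W1inf_Linf T {-J<..<J} v) \<and>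
      (\<forall>\<psi> \<psi>x \<psi>xx \<psi>t. C21_on {0..T} \<psi> \<psi>x \<psi>xx \<psi>t \<and> (\<forall>x. \<psi> x T = 0) \<and>
          (\<exists>J>0. \<forall>x. \<forall>t\<in>{0..T}. \<bar>x\<bar> > J \<longrightarrow> \<psi> x t = 0) \<longrightarrow>
        (\<integral>(x, t). u x t * \<psi>t x t \<partial>lebesgue_on (UNIV \<times> {0<..<T})) +
        (\<integral>(x, t). du * u x t * \<psi>xx x t - k * F (u x t) (v x t) * \<psi> x t
            \<partial>lebesgue_on (UNIV \<times> {0<..<T})) = - (\<integral>x. u0 x * \<psi> x 0 \<partial>lebesgue) \<and>
        (\<integral>(x, t). v x t * \<psi>t x t \<partial>lebesgue_on (UNIV \<times> {0<..<T})) -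
        (\<integral>(x, t). k * F (u x t) (v x t) * \<psi> x t
            \<partial>lebesgue_on (UNIV \<times> {0<..<T})) = - (\<integral>x. v0 x * \<psi> x 0 \<partial>lebesgue))"

definition solution :: "real \<Rightarrow> real \<Rightarrow> real \<Rightarrow> (real \<Rightarrow> real \<Rightarrow> real) \<Rightarrow> (real \<Rightarrow> real) \<Rightarrow>
    (real \<Rightarrow> real) \<Rightarrow> real \<Rightarrow> real \<Rightarrow> (real \<Rightarrow> real \<Rightarrow> real) \<Rightarrow> (real \<Rightarrow> real \<Rightarrow> real) \<Rightarrow> bool" where
  "solution du dv k F u0 v0 M T u v \<longleftrightarrow>
      (if dv > 0 then classical_solution du dv k F u0 v0 M T u v
       else weak_solution du k F u0 v0 M T u v)"

section \<open>The self-similar profile\<close>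

definition interface_eq :: "real \<Rightarrow> real \<Rightarrow> real \<Rightarrow> real \<Rightarrow> real \<Rightarrow> bool" where
  "interface_eq du dv U0 V0 a \<longleftrightarrow>
      (if dv > 0 then
         du * U0 * (\<integral>s\<in>{a..}. exp ((a\<^sup>2 - s\<^sup>2) / (4 * dv)) \<partial>lborel) =
         dv * V0 * (\<integral>s\<in>{..a}. exp ((a\<^sup>2 - s\<^sup>2) / (4 * du)) \<partial>lborel)
       else
         a > 0 \<and>
         U0 = V0 * a / (2 * du) * (\<integral>s\<in>{..a}. exp ((a\<^sup>2 - s\<^sup>2) / (4 * du)) \<partial>lborel))"

definition profile :: "real \<Rightarrow> real \<Rightarrow> real \<Rightarrow> real \<Rightarrow> real \<Rightarrow> real \<Rightarrow> real" where
  "profile du dv U0 V0 a \<eta> =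
      (if \<eta> \<le> a then
         U0 * (1 - (\<integral>s\<in>{..\<eta>}. exp (- s\<^sup>2 / (4 * du)) \<partial>lborel) /
                   (\<integral>s\<in>{..a}. exp (- s\<^sup>2 / (4 * du)) \<partial>lborel))
       else if dv > 0 then
         - V0 * (1 - (\<integral>s\<in>{\<eta>..}. exp (- s\<^sup>2 / (4 * dv)) \<partial>lborel) /
                     (\<integral>s\<in>{a..}. exp (- s\<^sup>2 / (4 * dv)) \<partial>lborel))
       else - V0)"

end

theory Submission
  imports Defs "HOL-Probability.Probability"
begin

text \<open>
  The difference \<open>w = u - v\<close> satisfies \<open>w\<^sub>t = (d\<^sub>u u - d\<^sub>v v)\<^sub>x\<^sub>x\<close>, in which the reaction has cancelled.  Under the parabolic
  rescaling \<open>(x,t) \<mapsto> (l x, l\<^sup>2 t)\<close> the reaction rate becomes \<open>l\<^sup>2 k\<close>, hence \<open>m = min u v\<close> tends to \<open>0\<close> in the mean, while the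
  self-similar solution \<open>f(x / sqrt t)\<close> of \<open>w\<^sub>t = (d\<^sub>u w\<^sup>+ + d\<^sub>v w\<^sup>-)\<^sub>x\<^sub>x\<close> is invariant and the \<open>L\<^sup>1\<close> distance of the initial data from
  their limits decays like \<open>1 / l\<close>.  The difference \<open>z\<close> of \<open>w\<close> and the self-similar solution satisfies \<open>z\<^sub>t = G\<^sub>x\<^sub>x\<close>, and by
  monotonicity \<open>z G \<ge> c G\<^sup>2 - C m\<close>.  A weighted estimate in the negative Sobolev norm, in which \<open>z\<close> is
  replaced by its antiderivative in \<open>x\<close>, therefore gives \<open>\<integral>\<integral> z G \<rightarrow> 0\<close> without any compactness, and \<open>z G\<close> controls the
  squared errors of \<open>u\<close> and, if \<open>d\<^sub>v > 0\<close>, of \<open>v\<close>.  A good time in \<open>(T/2, T)\<close> for each \<open>l = n + 1\<close> yields the sequence.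
\<close>

section \<open>Integrals and test functions\<close>

text \<open>The equation for u alone yields just a bound on the integral of the rescaled reaction;
  the comparison itself has to use the difference, from which the reaction is absent. The functions
  are merely bounded, so integrals over the line are weighted by rho(x) = 1 / (1 + x^2). As |rho'|
  <= rho, the weight costs a term |S| |G| in the energy identity, S being the antiderivative of z;
  the dissipation c G^2 and a short time interval absorb it. The L1 distance of the initial data
  enters as a sup bound for S at time 0. One slab of fixed length T is enough, because scaling by l
  maps it to times of order l^2. Convergence holds in the mean over this slab, hence the passage to
  a sequence of times; for weak solutions, moreover, a time slice has a meaning for almost every
  time only. If dv = 0 the flux does not see v where u - v and the profile are both negative. There
  v lies below its initial value, and its deficit is recovered from the weighted mean of z, which
  tends to 0 because G does.\<close>

lemma deriv_under_integral:
  fixes K K' :: "real \<Rightarrow> 'a \<Rightarrow> real"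
  assumes e: "e > 0"
    and d: "\<And>x y. \<bar>x - x0\<bar> < e \<Longrightarrow> ((\<lambda>x. K x y) has_real_derivative K' x y) (at x)"
    and i: "\<And>x. \<bar>x - x0\<bar> < e \<Longrightarrow> integrable M (K x)"
    and w: "integrable M w"
    and b: "\<And>x y. \<bar>x - x0\<bar> < e \<Longrightarrow> \<bar>K' x y\<bar> \<le> w y"
  shows "((\<lambda>x. \<integral>y. K x y \<partial>M) has_real_derivative (\<integral>y. K' x0 y \<partial>M)) (at x0)"
  unfolding has_field_derivative_iff tendsto_at_iff_sequentially comp_def
proof (intro allI impI)
  fix X :: "nat \<Rightarrow> real"
  assume X0: "\<forall>i. X i \<in> UNIV - {x0}" and X: "X \<longlonglongrightarrow> x0"
  from X e obtain N where N: "\<And>n. n \<ge> N \<Longrightarrow> \<bar>X n - x0\<bar> < e"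
    by (metis LIMSEQ_D real_norm_def)
  define Y where "Y n = X (n + N)" for n
  have Y: "Y \<longlonglongrightarrow> x0" "\<And>n. \<bar>Y n - x0\<bar> < e" "\<And>n. Y n \<noteq> x0"
    unfolding Y_def using LIMSEQ_ignore_initial_segment[OF X] N X0 by auto
  have q: "(\<lambda>n. (K (Y n) y - K x0 y) / (Y n - x0)) \<longlonglongrightarrow> K' x0 y" for y
  proof -
    have "((\<lambda>x. (K x y - K x0 y) / (x - x0)) \<longlongrightarrow> K' x0 y) (at x0)"
      using d[of x0 y] e by (simp add: has_field_derivative_iff)
    then show ?thesis
      unfolding tendsto_at_iff_sequentially comp_def using Y by auto
  qed
  have m: "(\<lambda>y. (K (Y n) y - K x0 y) / (Y n - x0)) \<in> borel_measurable M" for n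
    using i[of "Y n"] i[of x0] Y e by (auto intro!: borel_measurable_divide borel_measurable_diff)
  have bd: "\<bar>(K (Y n) y - K x0 y) / (Y n - x0)\<bar> \<le> w y" for n y
  proof -
    have "norm (K (Y n) y - K x0 y) \<le> w y * norm (Y n - x0)"
    proof (rule field_differentiable_bound[of "ball x0 e" "\<lambda>x. K x y" "\<lambda>x. K' x y"])
      show "((\<lambda>x. K x y) has_field_derivative K' z y) (at z within ball x0 e)" if "z \<in> ball x0 e" for z
        using d[of z y] that by (simp add: dist_real_def abs_minus_commute has_field_derivative_at_within)
      show "norm (K' z y) \<le> w y" if "z \<in> ball x0 e" for z
        using b[of z y] that by (simp add: dist_real_def abs_minus_commute)
    qed (use Y(2) e in \<open>auto simp: dist_real_def abs_minus_commute\<close>)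
    then show ?thesis using Y(3)[of n] by (simp add: abs_divide divide_le_eq)
  qed
  have "(\<lambda>n. \<integral>y. (K (Y n) y - K x0 y) / (Y n - x0) \<partial>M) \<longlonglongrightarrow> (\<integral>y. K' x0 y \<partial>M)"
  proof (rule integral_dominated_convergence[where w=w])
    show "K' x0 \<in> borel_measurable M"
      by (rule borel_measurable_LIMSEQ_real[OF q m])
  qed (use m w q bd in auto)
  moreover have "(\<integral>y. (K (Y n) y - K x0 y) / (Y n - x0) \<partial>M)
      = ((\<integral>y. K (Y n) y \<partial>M) - (\<integral>y. K x0 y \<partial>M)) / (Y n - x0)" for n
    using Bochner_Integration.integral_diff[OF i[OF Y(2)[of n]] i[of x0]] e by simp
  ultimately have "(\<lambda>n. ((\<integral>y. K (Y n) y \<partial>M) - (\<integral>y. K x0 y \<partial>M)) / (Y n - x0))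
      \<longlonglongrightarrow> (\<integral>y. K' x0 y \<partial>M)" by (simp only:)
  then show "(\<lambda>n. ((\<integral>y. K (X n) y \<partial>M) - (\<integral>y. K x0 y \<partial>M)) / (X n - x0))
      \<longlonglongrightarrow> (\<integral>y. K' x0 y \<partial>M)"
    unfolding Y_def by (rule LIMSEQ_offset)
qed

lemma integrable_bounded_Icc:
  fixes f :: "real \<Rightarrow> real"
  assumes [measurable]: "f \<in> borel_measurable borel" and "\<And>x. a \<le> x \<Longrightarrow> x \<le> b \<Longrightarrow> \<bar>f x\<bar> \<le> B"
  shows "integrable lborel (\<lambda>x. indicator {a..b} x * f x)"
proof (rule Bochner_Integration.integrable_bound[where f="\<lambda>x. \<bar>B\<bar> * indicator {a..b} x"])
  show "integrable lborel (\<lambda>x. \<bar>B\<bar> * indicator {a..b} x :: real)"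
    by (intro integrable_mult_right integrable_real_indicator) (auto simp: emeasure_lborel_Icc_eq)
qed (use assms(2) in \<open>force split: split_indicator\<close>)+

lemma FTC_bounded:
  fixes A f :: "real \<Rightarrow> real"
  assumes ab: "a \<le> b" and A: "continuous_on {a..b} A"
    and d: "\<And>x. a < x \<Longrightarrow> x < b \<Longrightarrow> (A has_real_derivative f x) (at x)"
    and [measurable]: "f \<in> borel_measurable borel"
    and B: "\<And>x. a \<le> x \<Longrightarrow> x \<le> b \<Longrightarrow> \<bar>f x\<bar> \<le> B"
  shows "(\<integral>x. indicator {a..b} x * f x \<partial>lborel) = A b - A a"
proof -
  have si: "set_integrable lborel {a..b} f"
    using integrable_bounded_Icc[OF assms(4) B] by (simp add: set_integrable_def)
  have "(f has_integral (A b - A a)) {a..b}"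
    by (rule fundamental_theorem_of_calculus_interior[OF ab A])
      (use d in \<open>auto simp: has_real_derivative_iff_has_vector_derivative\<close>)
  moreover have "(f has_integral (LINT x:{a..b}|lborel. f x)) {a..b}"
    by (metis (no_types, lifting) has_integral_integral set_borel_integral_eq_integral si)
  ultimately have "(LINT x:{a..b}|lborel. f x) = A b - A a"
    by (rule has_integral_unique[rotated])
  then show ?thesis by (simp add: set_lebesgue_integral_def)
qed

lemma integral_deriv_eq_0:
  fixes A f :: "real \<Rightarrow> real"
  assumes d: "\<And>x. (A has_real_derivative f x) (at x)"
    and f: "integrable lborel f"
    and B: "\<And>x. \<bar>f x\<bar> \<le> B"
    and lim: "(A \<longlongrightarrow> 0) at_top" "(A \<longlongrightarrow> 0) at_bot"
  shows "(\<integral>x. f x \<partial>lborel) = 0"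
proof -
  have m[measurable]: "f \<in> borel_measurable borel" using f by auto
  have "(\<integral>x. indicator {- real n..real n} x * f x \<partial>lborel) = A (real n) - A (- real n)" for n
    by (rule FTC_bounded[OF _ _ d m B])
      (auto intro!: DERIV_continuous_on has_field_derivative_at_within[OF d])
  moreover have "(\<lambda>n. \<integral>x. indicator {- real n..real n} x * f x \<partial>lborel) \<longlonglongrightarrow> (\<integral>x. f x \<partial>lborel)"
  proof (rule integral_dominated_convergence[where w="\<lambda>x. \<bar>f x\<bar>"])
    have "(\<lambda>n. indicator {- real n..real n} x * f x) \<longlonglongrightarrow> f x" for x
    proof (rule tendsto_eventually)
      obtain N :: nat where "\<bar>x\<bar> \<le> real N" using real_arch_simple by blast
      then show "\<forall>\<^sub>F n in sequentially. indicator {- real n..real n} x * f x = f x"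
        by (intro eventually_sequentiallyI[of N]) (auto simp: indicator_def)
    qed
    then show "AE x in lborel. (\<lambda>n. indicator {- real n..real n} x * f x) \<longlonglongrightarrow> f x" by simp
  qed (use f in \<open>auto split: split_indicator\<close>)
  moreover have "(\<lambda>n. A (real n) - A (- real n)) \<longlonglongrightarrow> 0 - 0"
    by (intro tendsto_diff filterlim_compose[OF lim(1)] filterlim_compose[OF lim(2)]
        filterlim_real_sequentially filterlim_uminus_at_bot_at_top[THEN filterlim_compose])
  ultimately show ?thesis
    by (metis (no_types, lifting) LIMSEQ_unique diff_self ext)
qed

lemma integral_deriv_compact_eq_0:
  fixes A f :: "real \<Rightarrow> real"
  assumes d: "\<And>x. (A has_real_derivative f x) (at x)"
    and f: "f \<in> borel_measurable borel"
    and B: "\<And>x. \<bar>f x\<bar> \<le> B"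
    and z: "\<And>x. \<bar>x\<bar> > R \<Longrightarrow> A x = 0" "\<And>x. \<bar>x\<bar> > R \<Longrightarrow> f x = 0"
  shows "(\<integral>x. f x \<partial>lborel) = 0"
proof (rule integral_deriv_eq_0[OF d _ B])
  have "f = (\<lambda>x. indicator {-R..R} x * f x)"
    using z(2) by (force simp: indicator_def fun_eq_iff not_le)
  then show "integrable lborel f"
    using integrable_bounded_Icc[OF f B, of "-R" R] by simp
  show "(A \<longlongrightarrow> 0) at_top"
    by (rule tendsto_eventually, rule eventually_at_top_linorderI[of "\<bar>R\<bar> + 1"]) (use z in auto)
  show "(A \<longlongrightarrow> 0) at_bot"
    by (rule tendsto_eventually, rule eventually_at_bot_linorderI[of "-\<bar>R\<bar> - 1"]) (use z in auto)
qed

text \<open>The predicate \<open>measurable_on\<close> supplies continuous approximations off a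
  negligible set. Truncating them at B and -B keeps continuity and convergence, because h takes its
  values in [-B, B].\<close>

lemma bounded_borel_continuous_approx:
  fixes h :: "'a::euclidean_space \<Rightarrow> real"
  assumes h: "h \<in> borel_measurable borel" and B: "\<And>x. \<bar>h x\<bar> \<le> B"
  obtains g where "\<And>n. continuous_on UNIV (g n)" "\<And>n x. \<bar>g n x\<bar> \<le> B"
    "AE x in lborel. (\<lambda>n. g n x) \<longlonglongrightarrow> h x"
proof -
  have "h \<in> borel_measurable lebesgue" using h by (simp add: measurable_completion)
  then have "h measurable_on UNIV"
    by (intro lebesgue_measurable_imp_measurable_on) (auto simp: lebesgue_on_UNIV_eq)
  then obtain N g where N: "negligible N" and g: "\<And>n. continuous_on UNIV (g n)"
    and lim: "\<And>x. x \<notin> N \<Longrightarrow> (\<lambda>n. g n x) \<longlonglongrightarrow> h x"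
    unfolding measurable_on_UNIV measurable_on_def by (auto simp: indicator_def)
  define g' where "g' n x = max (- B) (min B (g n x))" for n x
  have "B \<ge> 0" using B[of undefined] by linarith
  have lim': "(\<lambda>n. g' n x) \<longlonglongrightarrow> h x" if "x \<notin> N" for x
  proof -
    have "(\<lambda>n. g' n x) \<longlonglongrightarrow> max (- B) (min B (h x))"
      unfolding g'_def by (intro tendsto_max tendsto_min tendsto_const lim that)
    also have "max (- B) (min B (h x)) = h x" using B[of x] by auto
    finally show ?thesis .
  qed
  show ?thesis
  proof (rule that[of g'])
    show "continuous_on UNIV (g' n)" for n
      unfolding g'_def by (intro continuous_intros g)
    show "\<bar>g' n x\<bar> \<le> B" for n x unfolding g'_def using \<open>B \<ge> 0\<close> by auto
    have "AE x in lebesgue. x \<notin> N"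
      using N by (simp add: negligible_iff_null_sets AE_not_in)
    then show "AE x in lborel. (\<lambda>n. g' n x) \<longlonglongrightarrow> h x"
      unfolding AE_completion_iff by (rule AE_mp) (simp add: lim')
  qed
qed

text \<open>Inserting bounded continuous approximations of h itself for g gives in the limit that
  h^2 has integral 0 over the interval.\<close>

lemma AE_zero_if_orthogonal_continuous:
  fixes h :: "real \<Rightarrow> real"
  assumes h[measurable]: "h \<in> borel_measurable borel" and B: "\<And>x. \<bar>h x\<bar> \<le> B"
    and o: "\<And>g. continuous_on UNIV g \<Longrightarrow> (\<integral>x. indicator {a..b} x * (h x * g x) \<partial>lborel) = 0"
  shows "AE x in lborel. x \<in> {a..b} \<longrightarrow> h x = 0"
proof -
  obtain g where g: "\<And>n. continuous_on UNIV (g n)" "\<And>n x. \<bar>g n x\<bar> \<le> B"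
    "AE x in lborel. (\<lambda>n. g n x) \<longlonglongrightarrow> h x"
    using bounded_borel_continuous_approx[OF h B] by blast
  have [measurable]: "g n \<in> borel_measurable borel" for n
    by (rule borel_measurable_continuous_onI[OF g(1)])
  have B2: "\<bar>h x * y\<bar> \<le> B * B" if "\<bar>y\<bar> \<le> B" for x y
    using mult_mono[OF B[of x] that] B[of x] by (simp add: abs_mult)
  have "(\<lambda>n. \<integral>x. indicator {a..b} x * (h x * g n x) \<partial>lborel) \<longlonglongrightarrow> (\<integral>x. indicator {a..b} x * (h x * h x) \<partial>lborel)"
  proof (rule integral_dominated_convergence[where w="\<lambda>x. indicator {a..b} x * (B * B)"])
    show "AE x in lborel. (\<lambda>n. indicator {a..b} x * (h x * g n x)) \<longlonglongrightarrow> indicator {a..b} x * (h x * h x)"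
      using g(3) by (rule AE_mp) (auto intro!: AE_I2 tendsto_intros)
    show "integrable lborel (\<lambda>x. indicator {a..b} x * (B * B))" 
      by (rule integrable_bounded_Icc) auto
  qed (use g(2) B2 in \<open>auto split: split_indicator\<close>)
  then have "(\<integral>x. indicator {a..b} x * (h x * h x) \<partial>lborel) = 0"
    using o[OF g(1)] LIMSEQ_unique[OF _ tendsto_const] by auto
  moreover have "integrable lborel (\<lambda>x. indicator {a..b} x * (h x * h x))"
    by (rule integrable_bounded_Icc[where B="B * B"]) (measurable, rule B2[OF B])
  ultimately have "AE x in lborel. indicator {a..b} x * (h x * h x) = 0"
    by (subst (asm) integral_nonneg_eq_0_iff_AE) (auto split: split_indicator)
  then show ?thesis by (rule AE_mp) auto
qed

section \<open>A finite weighted measure on space-time\<close>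

text \<open>An integrable positive weight whose derivatives are dominated by the weight itself. A
  cut-off cannot serve: by Gronwall, a weight with |rho'| <= rho that vanishes somewhere vanishes
  identically.\<close>

definition rho :: "real \<Rightarrow> real" where "rho x = 1 / (1 + x\<^sup>2)"
definition rho1 :: "real \<Rightarrow> real" where "rho1 x = - 2 * x * (rho x)\<^sup>2"
definition rho2 :: "real \<Rightarrow> real" where "rho2 x = 8 * x\<^sup>2 * (rho x) ^ 3 - 2 * (rho x)\<^sup>2"

lemma rho_pos: "0 < rho x"
  unfolding rho_def by (simp add: add_pos_nonneg)

lemma rho_le_1: "rho x \<le> 1"
  unfolding rho_def by (simp add: divide_le_eq_1 add_pos_nonneg)

lemma rho_mult: "rho x * (1 + x\<^sup>2) = 1"
proof -
  have "1 + x\<^sup>2 \<noteq> 0" by (smt (verit) zero_le_power2)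
  then show ?thesis by (metis rho_def nonzero_eq_divide_eq)
qed

lemma DERIV_rho: "(rho has_real_derivative rho1 x) (at x)"
proof -
  have "1 + x\<^sup>2 \<noteq> 0" by (smt (verit) zero_le_power2)
  then show ?thesis
    unfolding rho_def[abs_def] rho1_def
    by (auto intro!: derivative_eq_intros simp: field_simps power2_eq_square)
qed

lemma DERIV_rho1: "(rho1 has_real_derivative rho2 x) (at x)"
  unfolding rho1_def[abs_def] rho2_def
  by (rule derivative_eq_intros DERIV_rho refl | simp)+
     (simp add: rho1_def algebra_simps power2_eq_square power3_eq_cube)

lemma abs_rho1_le: "\<bar>rho1 x\<bar> \<le> rho x"
proof -
  have "2 * \<bar>x\<bar> \<le> 1 + x\<^sup>2" using sum_squares_bound[of 1 "\<bar>x\<bar>"] by simp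
  then have "2 * \<bar>x\<bar> * rho x * rho x \<le> (1 + x\<^sup>2) * rho x * rho x"
    using rho_pos[of x] by (intro mult_right_mono) auto
  also have "\<dots> = rho x" using rho_mult[of x] by (simp add: mult.commute)
  finally show ?thesis using rho_pos[of x]
    by (simp add: rho1_def abs_mult power2_eq_square mult.assoc)
qed

lemma abs_rho2_le: "\<bar>rho2 x\<bar> \<le> 10 * rho x"
proof -
  have r: "0 < rho x" "rho x \<le> 1" by (rule rho_pos rho_le_1)+
  have "x\<^sup>2 * rho x \<le> 1" using rho_mult[of x] r by (simp add: algebra_simps)
  then have "x\<^sup>2 * rho x * (rho x * rho x) \<le> 1 * (rho x * rho x)"
    using r by (intro mult_right_mono) auto
  moreover have "rho x * rho x \<le> rho x" using mult_left_mono[of "rho x" 1 "rho x"] r by simp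
  moreover have "0 \<le> x\<^sup>2 * rho x * (rho x * rho x)" "0 \<le> rho x * rho x" using r by auto
  ultimately show ?thesis
    unfolding rho2_def by (simp add: power2_eq_square power3_eq_cube mult.assoc)
qed

text \<open>Makes small translations bounded in the weighted L1 space, as the convergence of
  mollifications requires. The constant comes from x^2 <= 2 (x + h)^2 + 2 h^2 with h^2 <= 1.\<close>

lemma rho_shift: "\<bar>h\<bar> \<le> 1 \<Longrightarrow> rho (x + h) \<le> 3 * rho x"
proof -
  assume h: "\<bar>h\<bar> \<le> 1"
  then have h2: "h\<^sup>2 \<le> 1" by (simp add: abs_square_le_1)
  have "(x + 2 * h)\<^sup>2 \<ge> 0" by simp
  then have "x\<^sup>2 \<le> 2 * (x + h)\<^sup>2 + 2 * h\<^sup>2" by (simp add: power2_eq_square algebra_simps)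
  then have "1 + x\<^sup>2 \<le> 3 * (1 + (x + h)\<^sup>2)" using h2 zero_le_power2[of "x + h"] by (simp only: distrib_left)
  moreover have "1 + x\<^sup>2 > 0" "1 + (x + h)\<^sup>2 > 0" by (simp_all add: add_pos_nonneg)
  ultimately show ?thesis
    unfolding rho_def by (simp add: field_simps)
qed

lemma borel_rho[measurable]: "rho \<in> borel_measurable borel"
  unfolding rho_def[abs_def] by measurable

lemma borel_rho1[measurable]: "rho1 \<in> borel_measurable borel"
  unfolding rho1_def[abs_def] by measurable

lemma borel_rho2[measurable]: "rho2 \<in> borel_measurable borel"
  unfolding rho2_def[abs_def] by measurable

lemma integrable_rho: "integrable lborel rho"
  using integrable_inverse_1_plus_square
  by (simp add: set_integrable_def rho_def[abs_def] inverse_eq_divide einterval_eq_UNIV)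

lemma rho_tendsto_0: "(rho \<longlongrightarrow> 0) at_top" "(rho \<longlongrightarrow> 0) at_bot"
  unfolding rho_def[abs_def] by real_asymp+

text \<open>Densities, in contrast to restricted spaces, keep the whole plane as the space and the
  Borel sets as the sigma-algebra, so measurability does not depend on T. The measures are finite,
  so bounded Borel functions are integrable and may be integrated in either order.\<close>

definition Mx :: "real measure" where "Mx = density lborel rho"
definition Mt :: "real \<Rightarrow> real measure" where "Mt T = density lborel (indicator {0..T} :: real \<Rightarrow> real)"
definition Q :: "real \<Rightarrow> (real \<times> real) measure" where "Q T = Mx \<Otimes>\<^sub>M Mt T"

lemma sets_Mx[measurable_cong, simp]: "sets Mx = sets borel"
  and sets_Mt[measurable_cong, simp]: "sets (Mt T) = sets borel"
  and space_Mx[simp]: "space Mx = UNIV"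
  and space_Mt[simp]: "space (Mt T) = UNIV"
  unfolding Mx_def Mt_def by auto

lemma sets_Q[measurable_cong, simp]: "sets (Q T) = sets (borel \<Otimes>\<^sub>M borel)"
  and space_Q[simp]: "space (Q T) = UNIV"
  unfolding Q_def by (auto intro!: sets_pair_measure_cong simp: space_pair_measure)

lemma finite_Mx: "finite_measure Mx"
proof
  have "emeasure Mx (space Mx) = (\<integral>\<^sup>+x. rho x \<partial>lborel)"
    unfolding Mx_def by (simp add: emeasure_density)
  also have "\<dots> < \<infinity>"
    using integrable_rho rho_pos by (simp add: nn_integral_eq_integral less_imp_le)
  finally show "emeasure Mx (space Mx) \<noteq> \<infinity>" by simp
qed

lemma finite_Mt: "finite_measure (Mt T)"
proof
  have "emeasure (Mt T) (space (Mt T)) = emeasure lborel {0..T}"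
    unfolding Mt_def by (simp add: emeasure_density ennreal_indicator)
  also have "\<dots> < \<infinity>"
    by (simp add: emeasure_lborel_Icc_eq)
  finally show "emeasure (Mt T) (space (Mt T)) \<noteq> \<infinity>" by simp
qed

interpretation Mx: finite_measure Mx by (rule finite_Mx)
interpretation Mt: finite_measure "Mt T" for T by (rule finite_Mt)
interpretation Mxt: pair_sigma_finite Mx "Mt T" for T ..

lemma finite_Q: "finite_measure (Q T)"
  unfolding Q_def by (rule finite_measure_pair_measure) (rule finite_Mx finite_Mt)+ 

interpretation Q: finite_measure "Q T" for T by (rule finite_Q)

lemma integral_Mx:
  fixes f :: "real \<Rightarrow> real"
  assumes "f \<in> borel_measurable borel" shows "(\<integral>x. f x \<partial>Mx) = (\<integral>x. rho x * f x \<partial>lborel)"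
  unfolding Mx_def using assms rho_pos by (subst integral_density) (auto simp: less_imp_le)

lemma integral_Mt:
  fixes f :: "real \<Rightarrow> real"
  assumes "f \<in> borel_measurable borel"
  shows "(\<integral>s. f s \<partial>Mt T) = (\<integral>s. indicator {0..T} s * f s \<partial>lborel)"
  unfolding Mt_def using integral_density[of f lborel "indicator {0..T}"] assms by simp

lemma AE_Mx: "(AE x in Mx. P x) \<longleftrightarrow> (AE x in lborel. P x)"
  unfolding Mx_def by (subst AE_density) (auto simp: rho_pos)

lemma AE_Mt: "(AE s in Mt T. P s) \<longleftrightarrow> (AE s in lborel. 0 \<le> s \<and> s \<le> T \<longrightarrow> P s)"
  unfolding Mt_def by (subst AE_density) (auto simp: indicator_def intro!: AE_cong)

lemma AE_Q_I:
  assumes "AE p in lborel \<Otimes>\<^sub>M lborel. P p" shows "AE p in Q T. P p"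
proof -
  have "Q T = density (lborel \<Otimes>\<^sub>M lborel) (\<lambda>(x, t). ennreal (rho x) * ennreal (indicator {0..T} t))"
    unfolding Q_def Mx_def Mt_def
    by (rule pair_measure_density) (auto intro: finite_measure.axioms(1) finite_Mx finite_Mt simp flip: Mx_def Mt_def
      simp: lborel.sigma_finite_measure_axioms Mt.sigma_finite_measure_axioms)
  moreover have "AE p in density (lborel \<Otimes>\<^sub>M lborel) (\<lambda>(x, t). ennreal (rho x) * ennreal (indicator {0..T} t)). P p"
    by (subst AE_density) (use assms in auto)
  ultimately show ?thesis by (simp only:)
qed

lemma measure_Mt: "T \<ge> 0 \<Longrightarrow> measure (Mt T) UNIV = T"
  using integral_Mt[of "\<lambda>_. 1" T] by simp

lemma measure_Q: "T \<ge> 0 \<Longrightarrow> measure (Q T) UNIV = measure Mx UNIV * T"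
proof -
  assume T: "T \<ge> 0"
  have "emeasure (Q T) (UNIV \<times> UNIV) = emeasure Mx UNIV * emeasure (Mt T) UNIV"
    unfolding Q_def by (rule Mt.emeasure_pair_measure_Times) auto
  then show ?thesis using measure_Mt[OF T] by (simp add: measure_def enn2real_mult)
qed

lemma (in finite_measure) integrable_boundedI:
  fixes f :: "'a \<Rightarrow> real"
  assumes "f \<in> borel_measurable M" "\<And>x. \<bar>f x\<bar> \<le> B" shows "integrable M f"
  by (rule integrable_const_bound[where B=B]) (use assms in auto)

lemma Q_iterated:
  fixes f :: "real \<times> real \<Rightarrow> real"
  assumes f: "f \<in> borel_measurable (borel \<Otimes>\<^sub>M borel)" and B: "\<And>p. \<bar>f p\<bar> \<le> B"
  shows "(\<integral>p. f p \<partial>Q T) = (\<integral>s. (\<integral>x. f (x, s) \<partial>Mx) \<partial>Mt T)"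
    and "(\<integral>p. f p \<partial>Q T) = (\<integral>x. (\<integral>s. f (x, s) \<partial>Mt T) \<partial>Mx)"
proof -
  have i: "integrable (Mx \<Otimes>\<^sub>M Mt T) f"
    using Q.integrable_boundedI[of f T B] f B unfolding Q_def by auto
  show "(\<integral>p. f p \<partial>Q T) = (\<integral>s. (\<integral>x. f (x, s) \<partial>Mx) \<partial>Mt T)"
    using Mxt.integral_snd[of T "\<lambda>x s. f (x, s)"] i by (simp add: Q_def)
  show "(\<integral>p. f p \<partial>Q T) = (\<integral>x. (\<integral>s. f (x, s) \<partial>Mt T) \<partial>Mx)"
    using Mxt.integral_fst'[OF i] by (simp add: Q_def)
qed

text \<open>At most two derivatives of a test function occur, so class C^2 is enough and admits
  piecewise polynomial bumps. The derivatives are parameters because they appear in the equations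
  that are tested.\<close>

definition test2 :: "(real \<Rightarrow> real) \<Rightarrow> (real \<Rightarrow> real) \<Rightarrow> (real \<Rightarrow> real) \<Rightarrow> bool" where
  "test2 \<phi> \<phi>1 \<phi>2 \<longleftrightarrow> (\<forall>x. (\<phi> has_real_derivative \<phi>1 x) (at x)) \<and>
     (\<forall>x. (\<phi>1 has_real_derivative \<phi>2 x) (at x)) \<and> continuous_on UNIV \<phi>2 \<and>
     (\<exists>R. \<forall>x. \<bar>x\<bar> > R \<longrightarrow> \<phi> x = 0)"

lemma DERIV_eq_0_outside:
  fixes \<phi> :: "real \<Rightarrow> real"
  assumes "\<And>x. \<bar>x\<bar> > R \<Longrightarrow> \<phi> x = 0" "(\<phi> has_real_derivative d) (at x)" "\<bar>x\<bar> > R"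
  shows "d = 0"
proof -
  have "open {x::real. \<bar>x\<bar> > R}" by (intro open_Collect_less continuous_intros)
  then have "((\<lambda>x. 0) has_real_derivative d) (at x)"
    by (rule has_field_derivative_transform_within_open[OF assms(2)]) (use assms in auto)
  then show ?thesis using DERIV_const DERIV_unique by blast
qed

lemma continuous_compact_bounded:
  fixes f :: "real \<Rightarrow> real"
  assumes "continuous_on UNIV f" "\<And>x. \<bar>x\<bar> > R \<Longrightarrow> f x = 0"
  obtains B where "B \<ge> 0" "\<And>x. \<bar>f x\<bar> \<le> B"
proof -
  have "bounded (f ` {-R..R})"
    by (intro compact_imp_bounded compact_continuous_image continuous_on_subset[OF assms(1)]) auto
  then obtain B where B: "B > 0" "\<And>x. x \<in> {-R..R} \<Longrightarrow> \<bar>f x\<bar> \<le> B"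
    unfolding bounded_pos by auto
  have "\<bar>f x\<bar> \<le> B" for x
  proof (cases "\<bar>x\<bar> > R")
    case False
    then show ?thesis by (intro B(2)) auto
  qed (use B assms in auto)
  then show ?thesis using that[of B] B by auto
qed

lemma test2E:
  assumes "test2 \<phi> \<phi>1 \<phi>2"
  obtains R B where "R > 0" "B > 0"
    "\<And>x. \<bar>x\<bar> > R \<Longrightarrow> \<phi> x = 0" "\<And>x. \<bar>x\<bar> > R \<Longrightarrow> \<phi>1 x = 0" "\<And>x. \<bar>x\<bar> > R \<Longrightarrow> \<phi>2 x = 0"
    "\<And>x. \<bar>\<phi> x\<bar> \<le> B" "\<And>x. \<bar>\<phi>1 x\<bar> \<le> B" "\<And>x. \<bar>\<phi>2 x\<bar> \<le> B"
proof -
  note a = assms[unfolded test2_def]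
  from a obtain R0 where R0: "\<And>x. \<bar>x\<bar> > R0 \<Longrightarrow> \<phi> x = 0" by blast
  have c: "continuous_on UNIV \<phi>" "continuous_on UNIV \<phi>1" "continuous_on UNIV \<phi>2"
    using a by (meson DERIV_continuous_on has_field_derivative_at_within)+
  have z1: "\<phi>1 x = 0" if "\<bar>x\<bar> > R0" for x using DERIV_eq_0_outside[of R0 \<phi>, OF R0 _ that] a by blast
  have z2: "\<phi>2 x = 0" if "\<bar>x\<bar> > R0" for x using DERIV_eq_0_outside[of R0 \<phi>1, OF z1 _ that] a by blast
  obtain B0 where B0: "B0 \<ge> 0" "\<And>x. \<bar>\<phi> x\<bar> \<le> B0" using continuous_compact_bounded[OF c(1) R0] by blast
  obtain B1 where B1: "B1 \<ge> 0" "\<And>x. \<bar>\<phi>1 x\<bar> \<le> B1" using continuous_compact_bounded[OF c(2) z1] by blast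
  obtain B2 where B2: "B2 \<ge> 0" "\<And>x. \<bar>\<phi>2 x\<bar> \<le> B2" using continuous_compact_bounded[OF c(3) z2] by blast
  show ?thesis
  proof (rule that[of "\<bar>R0\<bar> + 1" "B0 + B1 + B2 + 1"])
    show "\<bar>\<phi> x\<bar> \<le> B0 + B1 + B2 + 1" "\<bar>\<phi>1 x\<bar> \<le> B0 + B1 + B2 + 1" "\<bar>\<phi>2 x\<bar> \<le> B0 + B1 + B2 + 1" for x
      using B0(1) B1(1) B2(1) B0(2)[of x] B1(2)[of x] B2(2)[of x] by linarith+
  qed (use R0 z1 z2 B0 B1 B2 in auto)
qed

lemma test2_borel:
  assumes "test2 \<phi> \<phi>1 \<phi>2"
  shows "\<phi> \<in> borel_measurable borel" "\<phi>1 \<in> borel_measurable borel" "\<phi>2 \<in> borel_measurable borel"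
  using assms unfolding test2_def
  by (meson DERIV_continuous_on has_field_derivative_at_within borel_measurable_continuous_onI)+

lemma integrable_bounded_support:
  fixes f :: "real \<Rightarrow> real"
  assumes "f \<in> borel_measurable borel" "\<And>x. \<bar>f x\<bar> \<le> B" "\<And>x. \<bar>x\<bar> > R \<Longrightarrow> f x = 0"
  shows "integrable lborel f"
proof -
  have "f = (\<lambda>x. indicator {-R..R} x * f x)"
    using assms(3) by (force simp: indicator_def fun_eq_iff not_le)
  then show ?thesis
    using integrable_bounded_Icc[OF assms(1,2), of "-R" R] by simp
qed

lemma test2_integrable:
  assumes "test2 \<phi> \<phi>1 \<phi>2"
  shows "integrable lborel \<phi>" "integrable lborel \<phi>1" "integrable lborel \<phi>2"
proof -
  obtain R B where "R > 0" "B > 0"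
    "\<And>x. \<bar>x\<bar> > R \<Longrightarrow> \<phi> x = 0" "\<And>x. \<bar>x\<bar> > R \<Longrightarrow> \<phi>1 x = 0" "\<And>x. \<bar>x\<bar> > R \<Longrightarrow> \<phi>2 x = 0"
    "\<And>x. \<bar>\<phi> x\<bar> \<le> B" "\<And>x. \<bar>\<phi>1 x\<bar> \<le> B" "\<And>x. \<bar>\<phi>2 x\<bar> \<le> B"
    using test2E[OF assms] by blast
  then show "integrable lborel \<phi>" "integrable lborel \<phi>1" "integrable lborel \<phi>2"
    using test2_borel[OF assms] integrable_bounded_support by blast+
qed

lemma integrable_mult_bounded:
  fixes f g :: "'a \<Rightarrow> real"
  assumes "integrable M g" "f \<in> borel_measurable M" "\<And>x. \<bar>f x\<bar> \<le> B"
  shows "integrable M (\<lambda>x. f x * g x)"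
proof (rule Bochner_Integration.integrable_bound[where f="\<lambda>x. B * g x"])
  show "AE x in M. norm (f x * g x) \<le> norm (B * g x)"
    using assms(3) by (auto simp: abs_mult intro!: mult_mono order_trans[OF assms(3) abs_ge_self] AE_I2)
qed (use assms in auto)

lemma abs_integral_mult_le:
  fixes f g :: "'a \<Rightarrow> real"
  assumes "integrable M g" "f \<in> borel_measurable M" "\<And>x. \<bar>f x\<bar> \<le> B"
  shows "\<bar>\<integral>x. f x * g x \<partial>M\<bar> \<le> B * (\<integral>x. \<bar>g x\<bar> \<partial>M)"
proof -
  have "\<bar>\<integral>x. f x * g x \<partial>M\<bar> \<le> (\<integral>x. \<bar>f x * g x\<bar> \<partial>M)" by (rule integral_abs_bound)
  also have "\<dots> \<le> (\<integral>x. B * \<bar>g x\<bar> \<partial>M)"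
  proof (rule integral_mono)
    show "integrable M (\<lambda>x. \<bar>f x * g x\<bar>)"
      by (rule integrable_abs, rule integrable_mult_bounded[OF assms])
  qed (use assms in \<open>auto simp: abs_mult intro!: mult_right_mono\<close>)
  finally show ?thesis by simp
qed

section \<open>Polynomial cut-offs and mollifiers\<close>

lemma DERIV_max0_power:
  "((\<lambda>s::real. (max 0 s) ^ (n + 2)) has_real_derivative (n + 2) * (max 0 s) ^ (n + 1)) (at s)"
proof -
  consider "s < 0" | "s > 0" | "s = 0" by linarith
  then show ?thesis
  proof cases
    case 1
    have "((\<lambda>s::real. (max 0 s) ^ (n + 2)) has_real_derivative 0) (at s)"
      by (rule has_field_derivative_transform_within_open[of "\<lambda>_. 0" _ _ "{..<0}"]) (use 1 in \<open>auto simp: max_def\<close>)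
    then show ?thesis using 1 by (simp add: max_def)
  next
    case 2
    have "((\<lambda>s::real. s ^ (n + 2)) has_real_derivative (n + 2) * s ^ (n + 1)) (at s)"
      using DERIV_pow[of "n + 2" s] by simp
    then have "((\<lambda>s::real. (max 0 s) ^ (n + 2)) has_real_derivative (n + 2) * s ^ (n + 1)) (at s)"
      by (rule has_field_derivative_transform_within_open[of _ _ _ "{0<..}"]) (use 2 in \<open>auto simp: max_def\<close>)
    then show ?thesis using 2 by (simp add: max_def add.commute)
  next
    case 3
    have "((\<lambda>h::real. (max 0 h) ^ (n + 2) / h) \<longlongrightarrow> 0) (at 0)"
    proof (rule Lim_null_comparison[where g="\<lambda>h. \<bar>h\<bar> ^ (n + 1)"])
      show "\<forall>\<^sub>F h in at (0::real). norm ((max 0 h) ^ (n + 2) / h) \<le> \<bar>h\<bar> ^ (n + 1)"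
      proof (intro always_eventually allI)
        fix h :: real
        show "norm ((max 0 h) ^ (n + 2) / h) \<le> \<bar>h\<bar> ^ (n + 1)"
          using zero_le_power_abs[of h "n + 1"]
          by (cases "h > 0") (simp_all add: max_def)
      qed
      show "((\<lambda>h::real. \<bar>h\<bar> ^ (n + 1)) \<longlongrightarrow> 0) (at 0)"
        by (auto intro!: tendsto_eq_intros)
    qed
    then show ?thesis using 3 by (simp add: has_field_derivative_iff)
  qed
qed

text \<open>The exponent 3 is the smallest that makes a power of the positive part of 1 - (x / R)^2
  twice continuously differentiable across |x| = R.\<close>

definition bump :: "real \<Rightarrow> real \<Rightarrow> real" where "bump R x = (max 0 (1 - (x / R)\<^sup>2)) ^ 3"
definition bump1 :: "real \<Rightarrow> real \<Rightarrow> real" where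
  "bump1 R x = 3 * (max 0 (1 - (x / R)\<^sup>2))\<^sup>2 * (- 2 * x / R\<^sup>2)"
definition bump2 :: "real \<Rightarrow> real \<Rightarrow> real" where
  "bump2 R x = 6 * max 0 (1 - (x / R)\<^sup>2) * (- 2 * x / R\<^sup>2)\<^sup>2 + 3 * (max 0 (1 - (x / R)\<^sup>2))\<^sup>2 * (- 2 / R\<^sup>2)"

lemma bump_outside: "(R::real) > 0 \<Longrightarrow> \<bar>x\<bar> > R \<Longrightarrow> max 0 (1 - (x / R)\<^sup>2) = 0"
proof -
  assume "R > 0" "\<bar>x\<bar> > R"
  then have "\<bar>x / R\<bar> > 1" using divide_strict_right_mono[of R "\<bar>x\<bar>" R] by (simp add: abs_divide)
  then have "(x / R)\<^sup>2 > 1" by (metis abs_square_le_1 not_le)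
  then show ?thesis by auto
qed

lemma test2_bump: assumes "R > 0" shows "test2 (bump R) (bump1 R) (bump2 R)"
  unfolding test2_def
proof (intro conjI allI)
  have i: "((\<lambda>x. 1 - (x / R)\<^sup>2) has_real_derivative (- 2 * x / R\<^sup>2)) (at x)" for x
    using assms by (auto intro!: derivative_eq_intros simp: power2_eq_square)
  show "(bump R has_real_derivative bump1 R x) (at x)" for x
    using DERIV_chain2[OF DERIV_max0_power[of 1 "1 - (x / R)\<^sup>2"] i[of x]]
    by (simp add: bump_def[abs_def] bump1_def eval_nat_numeral)
  have "((\<lambda>x. (max 0 (1 - (x / R)\<^sup>2))\<^sup>2) has_real_derivative 2 * max 0 (1 - (x / R)\<^sup>2) * (- 2 * x / R\<^sup>2)) (at x)" for x
    using DERIV_chain2[OF DERIV_max0_power[of 0 "1 - (x / R)\<^sup>2"] i[of x]]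
    by (simp add: eval_nat_numeral)
  note sq = DERIV_cmult[OF this, of 3]
  have lin: "((\<lambda>x. - 2 * x / R\<^sup>2) has_real_derivative - 2 / R\<^sup>2) (at x)" for x
    by (rule DERIV_cdivide) (auto intro!: derivative_eq_intros)
  show "(bump1 R has_real_derivative bump2 R x) (at x)" for x
    unfolding bump1_def[abs_def] bump2_def
    by (rule DERIV_cong[OF DERIV_mult[OF sq lin]]) (simp add: algebra_simps power2_eq_square)
  show "continuous_on UNIV (bump2 R)"
    unfolding bump2_def[abs_def] using assms by (intro continuous_intros) auto
  show "\<exists>Ra. \<forall>x. Ra < \<bar>x\<bar> \<longrightarrow> bump R x = 0"
    using bump_outside[OF assms] unfolding bump_def by (intro exI[of _ R]) auto
qed

lemma bump_nonneg: "0 \<le> bump R x" unfolding bump_def by auto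
lemma bump_le_1: "bump R x \<le> 1" unfolding bump_def by (intro power_le_one) auto

lemma integral_bump_pos: assumes "R > 0" shows "0 < (\<integral>x. bump R x \<partial>lborel)"
proof -
  have i: "integrable lborel (bump R)" using test2_integrable[OF test2_bump[OF assms]] by simp
  have pos: "bump R x > 0" if "x \<in> {0..R/2}" for x
  proof -
    have "\<bar>x / R\<bar> < 1" using that assms by (auto simp: abs_divide)
    then have "(x / R)\<^sup>2 < 1" by (simp add: abs_square_less_1)
    then show ?thesis unfolding bump_def by auto
  qed
  have "\<not> (AE x in lborel. bump R x = 0)"
  proof
    assume "AE x in lborel. bump R x = 0"
    then have "AE x in lborel. x \<notin> {0..R/2}" by (rule AE_mp) (use pos in force)
    then have "emeasure lborel {0..R/2} = 0" by (subst (asm) AE_iff_measurable[of "{0..R/2}"]) auto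
    then show False using assms by (simp add: emeasure_lborel_Icc_eq)
  qed
  then have "(\<integral>x. bump R x \<partial>lborel) \<noteq> 0"
    using integral_nonneg_eq_0_iff_AE[OF i] bump_nonneg by auto
  moreover have "(\<integral>x. bump R x \<partial>lborel) \<ge> 0" by (simp add: bump_nonneg)
  ultimately show ?thesis by simp
qed

lemma test2_cmult: "test2 \<phi> \<phi>1 \<phi>2 \<Longrightarrow> test2 (\<lambda>x. c * \<phi> x) (\<lambda>x. c * \<phi>1 x) (\<lambda>x. c * \<phi>2 x)"
  unfolding test2_def by (auto intro!: DERIV_cmult continuous_intros) 

lemma mollifier_exists:
  assumes "\<epsilon> > 0"
  obtains \<kappa> \<kappa>1 \<kappa>2 where "test2 \<kappa> \<kappa>1 \<kappa>2" "\<And>x. \<kappa> x \<ge> 0" "(\<integral>x. \<kappa> x \<partial>lborel) = 1"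
    "\<And>x. \<bar>x\<bar> > \<epsilon> \<Longrightarrow> \<kappa> x = 0"
proof (rule that)
  show "test2 (\<lambda>x. (1 / (\<integral>x. bump \<epsilon> x \<partial>lborel)) * bump \<epsilon> x) (\<lambda>x. (1 / (\<integral>x. bump \<epsilon> x \<partial>lborel)) * bump1 \<epsilon> x)
     (\<lambda>x. (1 / (\<integral>x. bump \<epsilon> x \<partial>lborel)) * bump2 \<epsilon> x)"
    by (rule test2_cmult[OF test2_bump[OF assms]])
qed (use integral_bump_pos[OF assms] bump_nonneg bump_outside[OF assms] in \<open>auto simp: bump_def\<close>)

lemma test2_reflect:
  assumes "test2 \<kappa> \<kappa>1 \<kappa>2"
  shows "test2 (\<lambda>y. \<kappa> (x - y)) (\<lambda>y. - \<kappa>1 (x - y)) (\<lambda>y. \<kappa>2 (x - y))"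
  unfolding test2_def
proof (intro conjI allI)
  note a = assms[unfolded test2_def]
  have i: "((\<lambda>y. x - y) has_real_derivative - 1) (at y)" for y by (auto intro!: derivative_eq_intros)
  show "((\<lambda>y. \<kappa> (x - y)) has_real_derivative - \<kappa>1 (x - y)) (at y)" for y
    using DERIV_chain2[OF _ i[of y], of \<kappa>] a by force
  have "((\<lambda>y. \<kappa>1 (x - y)) has_real_derivative - \<kappa>2 (x - y)) (at y)" for y
    using DERIV_chain2[OF _ i[of y], of \<kappa>1] a by force
  then show "((\<lambda>y. - \<kappa>1 (x - y)) has_real_derivative \<kappa>2 (x - y)) (at y)" for y
    using DERIV_minus by fastforce
  show "continuous_on UNIV (\<lambda>y. \<kappa>2 (x - y))"
    using a by (auto intro!: continuous_on_compose2[of UNIV \<kappa>2] continuous_intros)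
  from a obtain R where "\<forall>x. R < \<bar>x\<bar> \<longrightarrow> \<kappa> x = 0" by blast
  then show "\<exists>R. \<forall>y. R < \<bar>y\<bar> \<longrightarrow> \<kappa> (x - y) = 0"
    by (intro exI[of _ "R + \<bar>x\<bar>"]) auto
qed

section \<open>Mollification in space\<close>

text \<open>Convolution of g with the kernel \<open>\<kappa>\<close>. With the kernel taken at x -
  y, its value at x is the pairing of g with a reflected test function, so an equation tested
  against all test functions becomes a pointwise equation for the mollification.\<close>

definition cv :: "(real \<Rightarrow> real) \<Rightarrow> (real \<Rightarrow> real) \<Rightarrow> real \<Rightarrow> real" where
  "cv \<kappa> g x = (\<integral>y. g y * \<kappa> (x - y) \<partial>lborel)"

lemma DERIV_imp_continuous_on:
  fixes f f' :: "real \<Rightarrow> real"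
  assumes "\<And>x. (f has_real_derivative f' x) (at x)"
  shows "continuous_on S f"
  by (rule DERIV_continuous_on, rule has_field_derivative_at_within, rule assms)

lemma DERIV_shift_diff:
  fixes f f' :: "real \<Rightarrow> real"
  assumes "\<And>x. (f has_real_derivative f' x) (at x)"
  shows "((\<lambda>x. f (x - y)) has_real_derivative f' (x - y)) (at x)"
  using DERIV_chain2[OF assms DERIV_diff[OF DERIV_ident DERIV_const]] by simp

lemma DERIV_reflect:
  fixes f f' :: "real \<Rightarrow> real"
  assumes "\<And>x. (f has_real_derivative f' x) (at x)"
  shows "((\<lambda>y. f (x - y)) has_real_derivative - f' (x - y)) (at y)"
  using DERIV_chain2[OF assms DERIV_diff[OF DERIV_const DERIV_ident]] by simp

lemma lborel_integral_reflect:
  fixes f :: "real \<Rightarrow> real"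
  shows "(\<integral>y. f (x - y) \<partial>lborel) = (\<integral>y. f y \<partial>lborel)"
  using lborel_integral_real_affine[of "-1" f x] by simp

lemma lborel_integrable_reflect:
  fixes f :: "real \<Rightarrow> real"
  assumes "integrable lborel f"
  shows "integrable lborel (\<lambda>y. f (x - y))"
  using lborel_integrable_real_affine[OF assms, of "-1" x] by simp

lemma cv_bound:
  assumes "g \<in> borel_measurable borel" "\<And>y. \<bar>g y\<bar> \<le> B" "integrable lborel \<kappa>"
  shows "\<bar>cv \<kappa> g x\<bar> \<le> B * (\<integral>y. \<bar>\<kappa> y\<bar> \<partial>lborel)"
  using abs_integral_mult_le[OF lborel_integrable_reflect[OF assms(3)], of g B x] assms(1,2)
    lborel_integral_reflect[of "\<lambda>y. \<bar>\<kappa> y\<bar>" x]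
  by (simp add: cv_def)

lemma cv_measurable[measurable (raw)]:
  assumes [measurable]: "w \<in> borel_measurable (borel \<Otimes>\<^sub>M borel)" "\<kappa> \<in> borel_measurable borel"
    "f \<in> borel_measurable M" "g \<in> borel_measurable M"
  shows "(\<lambda>p. cv \<kappa> (\<lambda>y. w (y, g p)) (f p)) \<in> borel_measurable M"
  unfolding cv_def by measurable

lemma cv_deriv:
  assumes g[measurable]: "g \<in> borel_measurable borel" and B: "\<And>y. \<bar>g y\<bar> \<le> B"
    and d: "\<And>x. (\<kappa> has_real_derivative \<kappa>' x) (at x)"
    and z: "\<And>x. \<bar>x\<bar> > R \<Longrightarrow> \<kappa> x = 0"
    and C: "\<And>x. \<bar>\<kappa>' x\<bar> \<le> C" "integrable lborel \<kappa>"
  shows "(cv \<kappa> g has_real_derivative cv \<kappa>' g x) (at x)"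
  unfolding cv_def[abs_def]
proof (rule deriv_under_integral[where e=1 and w="\<lambda>y. indicator {x - R - 1..x + R + 1} y * (B * C)"])
  have B0: "B \<ge> 0" using B[of 0] by linarith
  show "((\<lambda>x. g y * \<kappa> (x - y)) has_real_derivative g y * \<kappa>' (x' - y)) (at x')" for x' y
    by (rule DERIV_cmult[OF DERIV_shift_diff[OF d]])
  show "integrable lborel (\<lambda>y. g y * \<kappa> (x' - y))" for x'
    by (rule integrable_mult_bounded[OF lborel_integrable_reflect[OF C(2)] _ B]) measurable
  show "\<bar>g y * \<kappa>' (x' - y)\<bar> \<le> indicator {x - R - 1..x + R + 1} y * (B * C)" if "\<bar>x' - x\<bar> < 1" for x' y
  proof (cases "y \<in> {x - R - 1..x + R + 1}")
    case True
    then show ?thesis using mult_mono[OF B[of y] C(1)[of "x' - y"]] B0 by (simp add: abs_mult)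
  next
    case False
    then have "\<bar>x' - y\<bar> > R" using that by auto
    then have "\<kappa>' (x' - y) = 0" using DERIV_eq_0_outside[of R \<kappa>, OF z d] by blast
    then show ?thesis using False by simp
  qed
  show "integrable lborel (\<lambda>y. indicator {x - R - 1..x + R + 1} y * (B * C))"
    by (rule integrable_bounded_Icc[where B="\<bar>B * C\<bar>"]) auto
qed simp

text \<open>The counterpart of \<open>cv_deriv\<close> for a bounded kernel that does not decay,
  namely the antiderivative of a mollifier; integrability is asked of g instead.\<close>

lemma cv_deriv_integrable:
  assumes g: "integrable lborel g"
    and d: "\<And>x. (N has_real_derivative \<kappa> x) (at x)"
    and C: "\<And>x. \<bar>\<kappa> x\<bar> \<le> C" "\<And>x. \<bar>N x\<bar> \<le> C'" and N[measurable]: "N \<in> borel_measurable borel"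
  shows "(cv N g has_real_derivative cv \<kappa> g x) (at x)"
  unfolding cv_def[abs_def]
proof (rule deriv_under_integral[where e=1 and w="\<lambda>y. C * \<bar>g y\<bar>"])
  show "((\<lambda>x. g y * N (x - y)) has_real_derivative g y * \<kappa> (x' - y)) (at x')" for x' y
    by (rule DERIV_cmult[OF DERIV_shift_diff[OF d]])
  show "integrable lborel (\<lambda>y. g y * N (x' - y))" for x'
    by (subst mult.commute, rule integrable_mult_bounded[OF g _ C(2)]) measurable
  show "\<bar>g y * \<kappa> (x' - y)\<bar> \<le> C * \<bar>g y\<bar>" for x' y
    using mult_left_mono[OF C(1)[of "x' - y"], of "\<bar>g y\<bar>"] by (simp add: abs_mult mult.commute)
qed (use g in auto)

text \<open>The antiderivative is the distribution function of the kernel, obtained as its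
  convolution with the Heaviside function; positivity and mass 1 bound it by 1. This bound turns the
  L1 norm of an initial datum into a sup bound for its mollified antiderivative.\<close>

lemma kernel_antiderivative:
  assumes k: "test2 \<kappa> \<kappa>1 \<kappa>2" "\<And>x. \<kappa> x \<ge> 0" "(\<integral>x. \<kappa> x \<partial>lborel) = 1"
  obtains N where "\<And>x. (N has_real_derivative \<kappa> x) (at x)" "\<And>x. \<bar>N x\<bar> \<le> 1" "N \<in> borel_measurable borel"
proof -
  obtain R B where R: "R > 0" "B > 0"
    "\<And>x. \<bar>x\<bar> > R \<Longrightarrow> \<kappa> x = 0" "\<And>x. \<bar>x\<bar> > R \<Longrightarrow> \<kappa>1 x = 0" "\<And>x. \<bar>\<kappa>1 x\<bar> \<le> B"
    by (rule test2E[OF k(1)]) blast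
  have d: "(\<kappa> has_real_derivative \<kappa>1 x) (at x)" for x using k(1) unfolding test2_def by blast
  note b[measurable] = test2_borel[OF k(1)]
  define H where "H = (\<lambda>y::real. indicator {0..} y :: real)"
  have H[measurable]: "H \<in> borel_measurable borel" and H1: "\<And>y. \<bar>H y\<bar> \<le> 1"
    unfolding H_def by (auto simp: indicator_def)
  have D: "(cv \<kappa> H has_real_derivative cv \<kappa>1 H x) (at x)" for x
    by (rule cv_deriv[OF H H1 d R(3) R(5) test2_integrable(1)[OF k(1)]])
  have "cv \<kappa>1 H x = \<kappa> x" for x
  proof -
    \<comment> \<open>Beyond L the shifted kernel vanishes, which reduces the half-line integral to
      a bounded interval.\<close>
    define L where "L = \<bar>x\<bar> + R + 1"
    have "cv \<kappa>1 H x = (\<integral>y. indicator {0..L} y * \<kappa>1 (x - y) \<partial>lborel)"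
      unfolding cv_def
    proof (rule Bochner_Integration.integral_cong[OF refl])
      fix y show "H y * \<kappa>1 (x - y) = indicator {0..L} y * \<kappa>1 (x - y)"
      proof (cases "y > L")
        case True
        then have "\<bar>x - y\<bar> > R" unfolding L_def by linarith
        then show ?thesis by (simp add: R(4))
      qed (simp add: H_def indicator_def)
    qed
    also have "\<dots> = - \<kappa> (x - L) - (- \<kappa> (x - 0))"
    proof (rule FTC_bounded[where B=B])
      show D': "((\<lambda>y. - \<kappa> (x - y)) has_real_derivative \<kappa>1 (x - y)) (at y)" for y
        using DERIV_minus[OF DERIV_reflect[of \<kappa> \<kappa>1, OF d]] by simp
      from D' show "continuous_on {0..L} (\<lambda>y. - \<kappa> (x - y))"
        by (rule DERIV_imp_continuous_on)
      show "0 \<le> L" using R(1) by (simp add: L_def)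
    qed (use R(5) in simp_all)
    also have "\<kappa> (x - L) = 0" by (rule R(3)) (use R in \<open>auto simp: L_def\<close>)
    finally show ?thesis by simp
  qed
  with D have "(cv \<kappa> H has_real_derivative \<kappa> x) (at x)" for x by simp
  moreover have "\<bar>cv \<kappa> H x\<bar> \<le> 1" for x
    using cv_bound[OF H H1 test2_integrable(1)[OF k(1)], of x] by (simp only: abs_of_nonneg[OF k(2)] k(3))
  moreover have "cv \<kappa> H \<in> borel_measurable borel"
    by (rule borel_measurable_continuous_onI) (rule DERIV_imp_continuous_on[OF D])
  ultimately show ?thesis using that by blast
qed

lemma rho_integral_shift:
  fixes f :: "real \<Rightarrow> real"
  assumes f[measurable]: "f \<in> borel_measurable borel" and B: "\<And>x. \<bar>f x\<bar> \<le> B" and nn: "\<And>x. 0 \<le> f x"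
    and h: "\<bar>h\<bar> \<le> 1"
  shows "(\<integral>x. f (x - h) \<partial>Mx) \<le> 3 * (\<integral>x. f x \<partial>Mx)"
proof -
  have i: "integrable lborel (\<lambda>x. f x * rho x)"
    by (rule integrable_mult_bounded[OF integrable_rho _ B]) measurable
  have i2: "integrable lborel (\<lambda>x. rho (x + h) * f x)"
    using lborel_integrable_real_affine[OF integrable_rho, of 1 h]
    by (subst mult.commute, intro integrable_mult_bounded[OF _ _ B]) (auto simp: add.commute)
  have "(\<integral>x. f (x - h) \<partial>Mx) = (\<integral>x. rho x * f (x - h) \<partial>lborel)"
    by (rule integral_Mx) measurable
  also have "\<dots> = (\<integral>x. rho (x + h) * f x \<partial>lborel)"
    using lborel_integral_real_affine[of 1 "\<lambda>x. rho x * f (x - h)" h] by (simp add: add.commute)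
  also have "\<dots> \<le> (\<integral>x. 3 * (rho x * f x) \<partial>lborel)"
  proof (rule integral_mono[OF i2])
    show "integrable lborel (\<lambda>x. 3 * (rho x * f x))" using i by (simp add: mult.commute)
    show "rho (x + h) * f x \<le> 3 * (rho x * f x)" for x
      using mult_right_mono[OF rho_shift[OF h, of x] nn[of x]] by simp
  qed
  also have "\<dots> = 3 * (\<integral>x. f x \<partial>Mx)"
    by (simp add: integral_Mx)
  finally show ?thesis .
qed

lemma Q_integral_shift:
  fixes f :: "real \<times> real \<Rightarrow> real"
  assumes f[measurable]: "f \<in> borel_measurable (borel \<Otimes>\<^sub>M borel)" and B: "\<And>p. \<bar>f p\<bar> \<le> B" and nn: "\<And>p. 0 \<le> f p"
    and h: "\<bar>h\<bar> \<le> 1"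
  shows "(\<integral>p. f (fst p - h, snd p) \<partial>Q T) \<le> 3 * (\<integral>p. f p \<partial>Q T)"
proof -
  have m: "(\<lambda>s. \<integral>x. f (x - h, s) \<partial>Mx) \<in> borel_measurable borel" "(\<lambda>s. \<integral>x. f (x, s) \<partial>Mx) \<in> borel_measurable borel"
    by measurable
  have bd: "\<bar>\<integral>x. f (x - h, s) \<partial>Mx\<bar> \<le> B * measure Mx UNIV" for s h
    using abs_integral_mult_le[of Mx "\<lambda>_. 1" "\<lambda>x. f (x - h, s)" B, OF _ _ B] by simp
  have "(\<integral>p. f (fst p - h, snd p) \<partial>Q T) = (\<integral>s. (\<integral>x. f (x - h, s) \<partial>Mx) \<partial>Mt T)"
    by (subst Q_iterated(1)[where B=B]) (measurable, rule B, simp)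
  also have "\<dots> \<le> (\<integral>s. 3 * (\<integral>x. f (x, s) \<partial>Mx) \<partial>Mt T)"
  proof (rule integral_mono)
    show "integrable (Mt T) (\<lambda>s. \<integral>x. f (x - h, s) \<partial>Mx)"
      by (rule Mt.integrable_boundedI[where B="B * measure Mx UNIV"]) (simp add: m, rule bd)
    show "integrable (Mt T) (\<lambda>s. 3 * (\<integral>x. f (x, s) \<partial>Mx))"
      using Mt.integrable_boundedI[of "\<lambda>s. \<integral>x. f (x, s) \<partial>Mx" T "B * measure Mx UNIV"] m(2) bd[of 0] by simp
    show "(\<integral>x. f (x - h, s) \<partial>Mx) \<le> 3 * (\<integral>x. f (x, s) \<partial>Mx)" for s
      by (rule rho_integral_shift[where f="\<lambda>x. f (x, s)", OF _ B nn h]) measurable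
  qed
  also have "\<dots> = 3 * (\<integral>p. f p \<partial>Q T)"
    by (subst Q_iterated(1)[OF f B]) simp
  finally show ?thesis .
qed

text \<open>Continuous bounded approximations of z are dense enough: for a fixed one dominated
  convergence applies, and translating the approximation error costs a factor 3 by
  \<open>rho_shift\<close>. The budget is 3 e / 8 + e / 2 + e / 8 = e.\<close>

lemma translation_continuous:
  fixes z :: "real \<times> real \<Rightarrow> real"
  assumes z[measurable]: "z \<in> borel_measurable (borel \<Otimes>\<^sub>M borel)" and B: "\<And>p. \<bar>z p\<bar> \<le> B" and e: "e > 0"
  obtains \<delta> where "\<delta> > 0" "\<And>h. \<bar>h\<bar> \<le> \<delta> \<Longrightarrow> (\<integral>p. \<bar>z (fst p - h, snd p) - z p\<bar> \<partial>Q T) \<le> e"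
proof -
  have B0: "B \<ge> 0" using B[of undefined] by linarith
  have "z \<in> borel_measurable borel" using z by (simp add: borel_prod)
  then obtain g where g: "\<And>n. continuous_on UNIV (g n)" "\<And>n p. \<bar>g n p\<bar> \<le> B"
    "AE p in lborel. (\<lambda>n. g n p) \<longlonglongrightarrow> z p"
    using bounded_borel_continuous_approx[of z B] B by blast
  have gm[measurable]: "g n \<in> borel_measurable (borel \<Otimes>\<^sub>M borel)" for n
    using borel_measurable_continuous_onI[OF g(1)] by (simp add: borel_prod)
  have ae: "AE p in Q T. (\<lambda>n. g n p) \<longlonglongrightarrow> z p"
    by (rule AE_Q_I) (use g(3) in \<open>simp only: lborel_prod\<close>)
  have b2: "\<bar>a - b\<bar> \<le> 2 * B" if "\<bar>a\<bar> \<le> B" "\<bar>b\<bar> \<le> B" for a b using that by linarith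
  have "(\<lambda>n. \<integral>p. \<bar>g n p - z p\<bar> \<partial>Q T) \<longlonglongrightarrow> (\<integral>p. 0 \<partial>Q T)"
  proof (rule integral_dominated_convergence[where w="\<lambda>_. 2 * B"])
    show "AE p in Q T. (\<lambda>n. \<bar>g n p - z p\<bar>) \<longlonglongrightarrow> 0"
      using ae by (rule AE_mp) (intro AE_I2 impI tendsto_rabs_zero LIM_zero)
  qed (use b2[OF g(2) B] in auto)
  then have "\<forall>\<^sub>F n in sequentially. (\<integral>p. \<bar>g n p - z p\<bar> \<partial>Q T) < e / 8"
    using e by (intro order_tendstoD) auto
  then obtain n where n: "(\<integral>p. \<bar>g n p - z p\<bar> \<partial>Q T) < e / 8"
    by (meson eventually_happens trivial_limit_sequentially)
  have "((\<lambda>h. \<integral>p. \<bar>g n (fst p - h, snd p) - g n p\<bar> \<partial>Q T) \<longlongrightarrow> 0) (at 0)"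
    unfolding tendsto_at_iff_sequentially comp_def
  proof (intro allI impI)
    fix X :: "nat \<Rightarrow> real" assume X: "X \<longlonglongrightarrow> 0"
    have "(\<lambda>i. \<integral>p. \<bar>g n (fst p - X i, snd p) - g n p\<bar> \<partial>Q T) \<longlonglongrightarrow> (\<integral>p. 0 \<partial>Q T)"
    proof (rule integral_dominated_convergence[where w="\<lambda>_. 2 * B"])
      have "(\<lambda>i. g n (fst p - X i, snd p)) \<longlonglongrightarrow> g n (fst p - 0, snd p)" for p
        by (rule continuous_on_tendsto_compose[OF g(1)[of n]])
          (intro tendsto_Pair tendsto_diff tendsto_const X UNIV_I always_eventually allI)+
      then show "AE p in Q T. (\<lambda>i. \<bar>g n (fst p - X i, snd p) - g n p\<bar>) \<longlonglongrightarrow> 0"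
        by (auto intro!: tendsto_rabs_zero LIM_zero)
    qed (use b2[OF g(2) g(2)] in auto)
    then show "(\<lambda>i. \<integral>p. \<bar>g n (fst p - X i, snd p) - g n p\<bar> \<partial>Q T) \<longlonglongrightarrow> 0" by simp
  qed
  then have "\<forall>\<^sub>F h in at 0. (\<integral>p. \<bar>g n (fst p - h, snd p) - g n p\<bar> \<partial>Q T) < e / 2"
    using e by (intro order_tendstoD) auto
  then obtain d where d: "d > 0" "\<And>h. h \<noteq> 0 \<Longrightarrow> \<bar>h\<bar> < d \<Longrightarrow> (\<integral>p. \<bar>g n (fst p - h, snd p) - g n p\<bar> \<partial>Q T) < e / 2"
    unfolding eventually_at by (auto simp: dist_real_def)
  show ?thesis
  proof (rule that[of "min (d / 2) 1"])
    fix h :: real assume h: "\<bar>h\<bar> \<le> min (d / 2) 1"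
    have 1: "(\<integral>p. \<bar>g n (fst p - h, snd p) - g n p\<bar> \<partial>Q T) \<le> e / 2"
      using d(2)[of h] h d(1) e by (cases "h = 0") auto
    have 2: "(\<integral>p. \<bar>g n (fst p - h, snd p) - z (fst p - h, snd p)\<bar> \<partial>Q T) \<le> 3 * (\<integral>p. \<bar>g n p - z p\<bar> \<partial>Q T)"
      by (rule Q_integral_shift[where f="\<lambda>p. \<bar>g n p - z p\<bar>" and B="2 * B"]) (use b2[OF g(2) B] h in auto)
    have i: "integrable (Q T) (\<lambda>p. \<bar>g n p - z p\<bar>)" "integrable (Q T) (\<lambda>p. \<bar>g n (fst p - h, snd p) - g n p\<bar>)"
      "integrable (Q T) (\<lambda>p. \<bar>g n (fst p - h, snd p) - z (fst p - h, snd p)\<bar>)"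
      "integrable (Q T) (\<lambda>p. \<bar>z (fst p - h, snd p) - z p\<bar>)"
      by (rule Q.integrable_boundedI[where B="2 * B"]; use b2 g(2) B in simp)+
    have "(\<integral>p. \<bar>z (fst p - h, snd p) - z p\<bar> \<partial>Q T)
      \<le> (\<integral>p. \<bar>g n (fst p - h, snd p) - z (fst p - h, snd p)\<bar> + (\<bar>g n (fst p - h, snd p) - g n p\<bar> + \<bar>g n p - z p\<bar>) \<partial>Q T)"
      by (rule integral_mono) (use i in auto)
    also have "\<dots> = (\<integral>p. \<bar>g n (fst p - h, snd p) - z (fst p - h, snd p)\<bar> \<partial>Q T)
       + ((\<integral>p. \<bar>g n (fst p - h, snd p) - g n p\<bar> \<partial>Q T) + (\<integral>p. \<bar>g n p - z p\<bar> \<partial>Q T))"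
      using i by simp
    finally show "(\<integral>p. \<bar>z (fst p - h, snd p) - z p\<bar> \<partial>Q T) \<le> e" using 1 2 n e by linarith
  qed (use d in auto)
qed

text \<open>Regarding the kernel as a probability measure K, mollification is an average of
  translations, and Fubini on the product of \<open>Q T\<close> and K averages their errors. The
  bound is uniform over all kernels supported in [-\<delta>, \<delta>], so a common kernel can
  mollify several functions.\<close>

lemma mollification_approx:
  fixes z :: "real \<times> real \<Rightarrow> real"
  assumes z[measurable]: "z \<in> borel_measurable (borel \<Otimes>\<^sub>M borel)" and B: "\<And>p. \<bar>z p\<bar> \<le> B" and e: "e > 0"
  obtains \<delta> where "\<delta> > 0"
    "\<And>\<kappa> \<kappa>1 \<kappa>2. test2 \<kappa> \<kappa>1 \<kappa>2 \<Longrightarrow> (\<And>x. \<kappa> x \<ge> 0) \<Longrightarrow> (\<integral>x. \<kappa> x \<partial>lborel) = 1 \<Longrightarrow>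
      (\<And>x. \<bar>x\<bar> > \<delta> \<Longrightarrow> \<kappa> x = 0) \<Longrightarrow> (\<integral>p. \<bar>cv \<kappa> (\<lambda>y. z (y, snd p)) (fst p) - z p\<bar> \<partial>Q T) \<le> e"
proof -
  have b2: "\<bar>a - b\<bar> \<le> 2 * B" if "\<bar>a\<bar> \<le> B" "\<bar>b\<bar> \<le> B" for a b using that by linarith
  obtain \<delta> where \<delta>: "\<delta> > 0" "\<And>h. \<bar>h\<bar> \<le> \<delta> \<Longrightarrow> (\<integral>p. \<bar>z (fst p - h, snd p) - z p\<bar> \<partial>Q T) \<le> e"
    using translation_continuous[OF z B e] by blast
  show ?thesis
  proof (rule that[OF \<delta>(1)])
    fix \<kappa> \<kappa>1 \<kappa>2 assume k: "test2 \<kappa> \<kappa>1 \<kappa>2" "\<And>x. \<kappa> x \<ge> 0" "(\<integral>x. \<kappa> x \<partial>lborel) = 1" "\<And>x. \<bar>x\<bar> > \<delta> \<Longrightarrow> \<kappa> x = 0"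
    note [measurable] = test2_borel[OF k(1)]
    note ik = test2_integrable(1)[OF k(1)]
    define K where "K = density lborel \<kappa>"
    have [simp, measurable_cong]: "sets K = sets borel" "space K = UNIV" unfolding K_def by auto
    have intK: "(\<integral>r. f r \<partial>K) = (\<integral>r. \<kappa> r * f r \<partial>lborel)" if "f \<in> borel_measurable borel" for f :: "real \<Rightarrow> real"
      unfolding K_def using that k(2) by (subst integral_density) auto
    have "finite_measure K"
    proof
      have "emeasure K (space K) = (\<integral>\<^sup>+x. \<kappa> x \<partial>lborel)" unfolding K_def by (simp add: emeasure_density)
      also have "\<dots> = ennreal 1" using k ik by (simp add: nn_integral_eq_integral)
      finally show "emeasure K (space K) \<noteq> \<infinity>" by simp
    qed
    interpret K: finite_measure K by fact
    interpret QK: pair_sigma_finite "Q T" K ..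
    have K1: "measure K UNIV = 1" using intK[of "\<lambda>_. 1"] k(3) by simp
    have fQK: "finite_measure (Q T \<Otimes>\<^sub>M K)" by (rule finite_measure_pair_measure) (fact, rule finite_Q)
    define d where "d q = (case q of (p, r) \<Rightarrow> \<bar>z (fst p - r, snd p) - z p\<bar>)" for q :: "(real \<times> real) \<times> real"
    have dm[measurable]: "d \<in> borel_measurable (Q T \<Otimes>\<^sub>M K)" unfolding d_def by measurable
    have db: "\<bar>d q\<bar> \<le> 2 * B" for q unfolding d_def using b2[OF B B] by (auto split: prod.split)
    have di: "integrable (Q T \<Otimes>\<^sub>M K) d"
      by (rule finite_measure.integrable_boundedI[OF fQK dm, where B="2 * B"]) (rule db)
    have pw: "\<bar>cv \<kappa> (\<lambda>y. z (y, snd p)) (fst p) - z p\<bar> \<le> (\<integral>r. d (p, r) \<partial>K)" for p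
    proof -
      have "cv \<kappa> (\<lambda>y. z (y, snd p)) (fst p) = (\<integral>r. \<kappa> r * z (fst p - r, snd p) \<partial>lborel)"
        unfolding cv_def using lborel_integral_reflect[of "\<lambda>y. \<kappa> y * z (fst p - y, snd p)" "fst p"]
        by (simp add: mult.commute)
      also have "\<dots> = (\<integral>r. z (fst p - r, snd p) \<partial>K)" by (rule intK[symmetric]) measurable
      finally have "cv \<kappa> (\<lambda>y. z (y, snd p)) (fst p) - z p = (\<integral>r. z (fst p - r, snd p) - z p \<partial>K)"
        using K.integrable_boundedI[of "\<lambda>r. z (fst p - r, snd p)" B, OF _ B] K1 by simp
      also have "\<bar>\<dots>\<bar> \<le> (\<integral>r. \<bar>z (fst p - r, snd p) - z p\<bar> \<partial>K)" by (rule integral_abs_bound)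
      finally show ?thesis by (simp add: d_def)
    qed
    have cvb: "\<bar>cv \<kappa> (\<lambda>y. z (y, snd p)) (fst p)\<bar> \<le> B" for p
      using cv_bound[of "\<lambda>y. z (y, snd p)" B \<kappa> "fst p", OF _ B ik] by (simp add: abs_of_nonneg[OF k(2)] k(3))
    have "(\<integral>p. \<bar>cv \<kappa> (\<lambda>y. z (y, snd p)) (fst p) - z p\<bar> \<partial>Q T) \<le> (\<integral>p. (\<integral>r. d (p, r) \<partial>K) \<partial>Q T)"
    proof (rule integral_mono[OF _ _ pw])
      show "integrable (Q T) (\<lambda>p. \<integral>r. d (p, r) \<partial>K)"
        by (rule QK.integrable_fst'[OF di])
      show "integrable (Q T) (\<lambda>p. \<bar>cv \<kappa> (\<lambda>y. z (y, snd p)) (fst p) - z p\<bar>)"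
        by (rule Q.integrable_boundedI[where B="2 * B"])
          (measurable, simp, rule b2[OF cvb B])
    qed
    also have "\<dots> = (\<integral>r. (\<integral>p. d (p, r) \<partial>Q T) \<partial>K)"
      using QK.integral_fst'[OF di] QK.integral_snd[of "\<lambda>p r. d (p, r)"] di by simp
    also have "\<dots> \<le> (\<integral>r. e \<partial>K)"
    proof (rule integral_mono_AE)
      show "integrable K (\<lambda>r. \<integral>p. d (p, r) \<partial>Q T)"
        using QK.integrable_snd[of "\<lambda>p r. d (p, r)"] di by simp
      have "AE r in K. \<bar>r\<bar> \<le> \<delta>"
        unfolding K_def using k(4) by (subst AE_density) (auto simp: not_le intro!: AE_I2 leI)
      then show "AE r in K. (\<integral>p. d (p, r) \<partial>Q T) \<le> e"
        by (rule AE_mp) (use \<delta>(2) in \<open>auto simp: d_def\<close>)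
    qed auto
    also have "\<dots> = e" using K1 by simp
    finally show "(\<integral>p. \<bar>cv \<kappa> (\<lambda>y. z (y, snd p)) (fst p) - z p\<bar> \<partial>Q T) \<le> e" .
  qed
qed

text \<open>The product a s * a r is symmetric, so its integral over the square is twice that over
  the triangle r <= s. This takes the place of the chain rule for the square of an antiderivative of
  a function that is merely measurable in time.\<close>

lemma square_of_integral:
  fixes a :: "real \<Rightarrow> real"
  assumes [measurable]: "a \<in> borel_measurable borel" and B: "\<And>s. \<bar>a s\<bar> \<le> B"
  shows "(\<integral>s. a s \<partial>Mt t)\<^sup>2 = 2 * (\<integral>s. a s * (\<integral>r. a r \<partial>Mt s) \<partial>Mt t)"
proof -
  interpret P: pair_sigma_finite "Mt t" "Mt t" ..
  have fP: "finite_measure (Mt t \<Otimes>\<^sub>M Mt t)" by (rule finite_measure_pair_measure) (rule finite_Mt)+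
  have B0: "B \<ge> 0" using B[of 0] by linarith
  define h where "h p = (if snd p \<le> fst p then a (fst p) * a (snd p) else 0)" for p :: "real \<times> real"
  have hm: "h \<in> borel_measurable (Mt t \<Otimes>\<^sub>M Mt t)" unfolding h_def by measurable
  have hb: "\<bar>h p\<bar> \<le> B * B" for p
    unfolding h_def using B0 by (auto simp: abs_mult intro!: mult_mono B)
  have hi: "integrable (Mt t \<Otimes>\<^sub>M Mt t) h" by (rule finite_measure.integrable_boundedI[OF fP hm, where B="B * B"]) (rule hb)
  have ai: "integrable (Mt t) a" by (rule Mt.integrable_boundedI[where B=B]) (simp, rule B)
  have i1: "integrable (Mt t) (\<lambda>r. if r \<le> s then a s * a r else 0)" "integrable (Mt t) (\<lambda>r. if s \<le> r then a r * a s else 0)" for s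
    by (rule Mt.integrable_boundedI[where B="B * B"]; use B B0 in \<open>auto simp: abs_mult intro!: mult_mono\<close>)+
  have e1: "(\<integral>r. h (s, r) \<partial>Mt t) = a s * (\<integral>r. a r \<partial>Mt s)" if "s \<le> t" for s
  proof -
    have "(\<integral>r. h (s, r) \<partial>Mt t) = (\<integral>r. indicator {0..t} r * (if r \<le> s then a s * a r else 0) \<partial>lborel)"
      by (subst integral_Mt) (simp_all add: h_def cong: if_cong)
    also have "\<dots> = (\<integral>r. a s * (indicator {0..s} r * a r) \<partial>lborel)"
      by (rule Bochner_Integration.integral_cong) (use that in \<open>auto simp: indicator_def\<close>)
    finally show ?thesis by (simp add: integral_Mt)
  qed
  have ae: "AE s in Mt t. s \<le> t" by (simp add: AE_Mt)
  have m1: "(\<lambda>s. \<integral>r. a r \<partial>Mt s) \<in> borel_measurable borel"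
    by (simp add: integral_Mt indicator_def) measurable
  have I: "(\<integral>s. (\<integral>r. h (s, r) \<partial>Mt t) \<partial>Mt t) = (\<integral>s. a s * (\<integral>r. a r \<partial>Mt s) \<partial>Mt t)"
    by (rule integral_cong_AE) (use hm m1 ae e1 in auto)
  have sw: "(\<integral>s. (\<integral>r. h (s, r) \<partial>Mt t) \<partial>Mt t) = (\<integral>s. (\<integral>r. h (r, s) \<partial>Mt t) \<partial>Mt t)"
    using P.integral_fst'[OF hi] P.integral_snd[of "\<lambda>x y. h (x, y)"] hi by simp
  have "(\<integral>r. h (s, r) \<partial>Mt t) + (\<integral>r. h (r, s) \<partial>Mt t) = a s * (\<integral>r. a r \<partial>Mt t)" for s
  proof -
    have "(\<integral>r. h (s, r) \<partial>Mt t) + (\<integral>r. h (r, s) \<partial>Mt t) = (\<integral>r. h (s, r) + h (r, s) \<partial>Mt t)"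
      using i1[of s] by (simp add: h_def cong: if_cong)
    also have "\<dots> = (\<integral>r. a s * a r \<partial>Mt t)"
    proof (rule integral_cong_AE)
      \<comment> \<open>The diagonal is counted in both triangles, but it is a null set.\<close>
      have "AE r in Mt t. r \<noteq> s" using AE_lborel_singleton[of s] by (auto simp: AE_Mt elim: AE_mp)
      then show "AE r in Mt t. h (s, r) + h (r, s) = a s * a r"
        by (rule AE_mp) (auto simp: h_def)
    qed (auto simp: h_def cong: if_cong)
    finally show ?thesis by simp
  qed
  then have "(\<integral>s. (\<integral>r. h (s, r) \<partial>Mt t) + (\<integral>r. h (r, s) \<partial>Mt t) \<partial>Mt t) = (\<integral>s. a s \<partial>Mt t)\<^sup>2"
    by (simp add: power2_eq_square)
  moreover have "integrable (Mt t) (\<lambda>s. \<integral>r. h (s, r) \<partial>Mt t)" "integrable (Mt t) (\<lambda>s. \<integral>r. h (r, s) \<partial>Mt t)"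
    using P.integrable_fst'[OF hi] P.integrable_snd[of "\<lambda>x y. h (x, y)"] hi by auto
  ultimately show ?thesis using I sw by simp
qed

section \<open>Evolution equations and the energy estimate\<close>

text \<open>\<open>evol w w0 \<Phi> h\<close> is the equation \<open>w\<^sub>t = \<Phi>\<^sub>x\<^sub>x - h\<close>, \<open>w(\<cdot>,0) = w0\<close>, tested with functions of \<open>x\<close> alone and
  integrated in time.  Both kinds of solutions satisfy it, and it is stable under differences and parabolic scaling.\<close>

definition evol :: "(real \<times> real \<Rightarrow> real) \<Rightarrow> (real \<Rightarrow> real) \<Rightarrow> (real \<times> real \<Rightarrow> real) \<Rightarrow> (real \<times> real \<Rightarrow> real) \<Rightarrow> bool" where
  "evol w w0 \<Phi> h \<longleftrightarrow> (\<forall>\<phi> \<phi>1 \<phi>2. test2 \<phi> \<phi>1 \<phi>2 \<longrightarrow> (AE t in lborel. 0 < t \<longrightarrow>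
     (\<integral>x. w (x, t) * \<phi> x \<partial>lborel) = (\<integral>x. w0 x * \<phi> x \<partial>lborel)
       + (\<integral>s. (\<integral>x. \<Phi> (x, s) * \<phi>2 x - h (x, s) * \<phi> x \<partial>lborel) \<partial>Mt t)))"

lemma Mt_integral_mono:
  fixes f :: "real \<Rightarrow> real"
  assumes f[measurable]: "f \<in> borel_measurable borel" and B: "\<And>s. \<bar>f s\<bar> \<le> B" and nn: "\<And>s. 0 \<le> f s" and t: "t \<le> T"
  shows "(\<integral>s. f s \<partial>Mt t) \<le> (\<integral>s. f s \<partial>Mt T)"
proof -
  have "(\<integral>s. indicator {0..t} s * f s \<partial>lborel) \<le> (\<integral>s. indicator {0..T} s * f s \<partial>lborel)"
    by (intro integral_mono integrable_bounded_Icc[OF f B]) (use t nn in \<open>auto simp: indicator_def\<close>)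
  then show ?thesis by (simp add: integral_Mt)
qed

lemma abs_integral_bounded:
  fixes f :: "'a \<Rightarrow> real"
  assumes "finite_measure M" "f \<in> borel_measurable M" "\<And>x. \<bar>f x\<bar> \<le> B"
  shows "\<bar>\<integral>x. f x \<partial>M\<bar> \<le> B * measure M (space M)"
  using abs_integral_mult_le[of M "\<lambda>_. 1" f B, OF _ assms(2,3)] assms(1)
  by (simp add: finite_measure.integrable_const)

lemma Mx_marginal:
  fixes f :: "real \<times> real \<Rightarrow> real"
  assumes f[measurable]: "f \<in> borel_measurable (borel \<Otimes>\<^sub>M borel)" and B: "\<And>p. \<bar>f p\<bar> \<le> B"
  shows "(\<lambda>s. \<integral>x. f (x, s) \<partial>Mx) \<in> borel_measurable borel"
    and "\<bar>\<integral>x. f (x, s) \<partial>Mx\<bar> \<le> B * measure Mx UNIV"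
proof -
  show "(\<lambda>s. \<integral>x. f (x, s) \<partial>Mx) \<in> borel_measurable borel" by measurable
  show "\<bar>\<integral>x. f (x, s) \<partial>Mx\<bar> \<le> B * measure Mx UNIV"
    using abs_integral_bounded[OF finite_Mx, of "\<lambda>x. f (x, s)" B, OF _ B] by simp
qed

lemma Q_integral_mono:
  fixes f :: "real \<times> real \<Rightarrow> real"
  assumes f[measurable]: "f \<in> borel_measurable (borel \<Otimes>\<^sub>M borel)" and B: "\<And>p. \<bar>f p\<bar> \<le> B" and nn: "\<And>p. 0 \<le> f p" and t: "t \<le> T"
  shows "(\<integral>p. f p \<partial>Q t) \<le> (\<integral>p. f p \<partial>Q T)"
  unfolding Q_iterated(1)[OF f B]
  by (rule Mt_integral_mono[where B="B * measure Mx UNIV", OF Mx_marginal(1)[OF f B] Mx_marginal(2)[OF f B] _ t])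
     (simp add: nn)

lemma measure_Mt_le: "t \<le> T \<Longrightarrow> 0 \<le> T \<Longrightarrow> measure (Mt t) UNIV \<le> T"
  using Mt_integral_mono[of "\<lambda>_. 1" 1 t T] measure_Mt[of T] by simp

text \<open>Here the measure itself varies with p; writing its density as a condition on r moves the
  dependence into a jointly measurable integrand.\<close>

lemma tint_measurable[measurable (raw)]:
  assumes [measurable]: "w \<in> borel_measurable (borel \<Otimes>\<^sub>M borel)" "f \<in> borel_measurable M" "g \<in> borel_measurable M"
  shows "(\<lambda>p. \<integral>r. (w (f p, r) :: real) \<partial>Mt (g p)) \<in> borel_measurable M"
proof -
  have "(\<lambda>p. \<integral>r. w (f p, r) \<partial>Mt (g p)) = (\<lambda>p. \<integral>r. (if 0 \<le> r \<and> r \<le> g p then w (f p, r) else 0) \<partial>lborel)"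
    by (auto simp: integral_Mt indicator_def intro!: Bochner_Integration.integral_cong)
  then show ?thesis by simp
qed

lemma bounded_mult_rho_tendsto_0:
  fixes f :: "real \<Rightarrow> real"
  assumes "\<And>x. \<bar>f x\<bar> \<le> B"
  shows "((\<lambda>x. rho x * f x) \<longlongrightarrow> 0) at_top" "((\<lambda>x. rho x * f x) \<longlongrightarrow> 0) at_bot"
proof -
  have "norm (rho x * f x) \<le> rho x * B" for x
    using assms[of x] rho_pos[of x] by (simp add: abs_mult mult_left_mono)
  then have e: "\<forall>\<^sub>F x in F. norm (rho x * f x) \<le> rho x * B" for F by simp
  show "((\<lambda>x. rho x * f x) \<longlongrightarrow> 0) at_top" "((\<lambda>x. rho x * f x) \<longlongrightarrow> 0) at_bot"
    by (rule Lim_null_comparison[OF e], rule tendsto_mult_left_zero, rule rho_tendsto_0)+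
qed

text \<open>The derivative of rho S g has integral 0, since rho decays and S g is bounded. The term
  with rho' is estimated by |rho'| <= rho, which is why an inequality results.\<close>

lemma integral_parts_rho:
  fixes S g :: "real \<Rightarrow> real"
  assumes dS: "\<And>x. (S has_real_derivative S' x) (at x)" and dg: "\<And>x. (g has_real_derivative g' x) (at x)"
    and b: "\<And>x. \<bar>S x\<bar> \<le> C" "\<And>x. \<bar>S' x\<bar> \<le> C" "\<And>x. \<bar>g x\<bar> \<le> C" "\<And>x. \<bar>g' x\<bar> \<le> C"
    and m[measurable]: "S \<in> borel_measurable borel" "S' \<in> borel_measurable borel" "g \<in> borel_measurable borel" "g' \<in> borel_measurable borel"
  shows "(\<integral>x. g' x * S x \<partial>Mx) \<le> (\<integral>x. \<bar>S x\<bar> * \<bar>g x\<bar> \<partial>Mx) - (\<integral>x. S' x * g x \<partial>Mx)"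
proof -
  have C0: "C \<ge> 0" using b(1)[of 0] by linarith
  have bb: "\<bar>p * q\<bar> \<le> C * C" if "\<bar>p\<bar> \<le> C" "\<bar>q\<bar> \<le> C" for p q
    using that C0 by (auto simp: abs_mult intro!: mult_mono)
  have ir: "integrable lborel (\<lambda>x. f x * rho x)" if "f \<in> borel_measurable borel" "\<And>x. \<bar>f x\<bar> \<le> C * C" for f
    by (rule integrable_mult_bounded[OF integrable_rho _ that(2)]) (use that(1) in simp)
  have i1: "integrable lborel (\<lambda>x. (S' x * g x) * rho x)" "integrable lborel (\<lambda>x. (g' x * S x) * rho x)"
    "integrable lborel (\<lambda>x. (\<bar>S x\<bar> * \<bar>g x\<bar>) * rho x)"
    by (rule ir, measurable, rule bb, rule b, rule b, rule ir, measurable, rule bb, rule b, rule b,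
        rule ir, measurable, subst abs_mult[symmetric], subst abs_abs, rule bb, rule b, rule b)
  have i2: "integrable lborel (\<lambda>x. rho1 x * (S x * g x))"
  proof (rule Bochner_Integration.integrable_bound[OF i1(3)])
    show "AE x in lborel. norm (rho1 x * (S x * g x)) \<le> norm ((\<bar>S x\<bar> * \<bar>g x\<bar>) * rho x)"
      using mult_right_mono[OF abs_rho1_le, of "\<bar>S _\<bar> * \<bar>g _\<bar>"] rho_pos
      by (auto simp: abs_mult mult.commute mult.left_commute less_imp_le)
  qed simp
  define f where "f x = rho1 x * (S x * g x) + ((S' x * g x) * rho x + (g' x * S x) * rho x)" for x
  have fi: "integrable lborel f" unfolding f_def using i1 i2 by simp
  have "(\<integral>x. f x \<partial>lborel) = 0"
  proof (rule integral_deriv_eq_0[OF _ fi])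
    show "((\<lambda>x. rho x * (S x * g x)) has_real_derivative f x) (at x)" for x
      unfolding f_def by (rule DERIV_cong[OF DERIV_mult[OF DERIV_rho DERIV_mult[OF dS dg]]]) (simp add: algebra_simps)
    show "\<bar>f x\<bar> \<le> 3 * (C * C)" for x
    proof -
      have r: "\<bar>rho x\<bar> \<le> 1" "\<bar>rho1 x\<bar> \<le> 1" using rho_pos[of x] rho_le_1[of x] abs_rho1_le[of x] by auto
      have "\<bar>rho1 x * (S x * g x)\<bar> \<le> 1 * (C * C)" "\<bar>(S' x * g x) * rho x\<bar> \<le> (C * C) * 1" "\<bar>(g' x * S x) * rho x\<bar> \<le> (C * C) * 1"
        using mult_mono[OF r(2) bb[OF b(1) b(3)]] mult_mono[OF bb[OF b(2) b(3)] r(1)] mult_mono[OF bb[OF b(4) b(1)] r(1)] C0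
        by (simp_all add: abs_mult)
      then show ?thesis unfolding f_def by linarith
    qed
    show "((\<lambda>x. rho x * (S x * g x)) \<longlongrightarrow> 0) at_top" "((\<lambda>x. rho x * (S x * g x)) \<longlongrightarrow> 0) at_bot"
      by (rule bounded_mult_rho_tendsto_0[where B="C * C"], rule bb, rule b, rule b)+
  qed
  moreover have "(\<integral>x. f x \<partial>lborel) = (\<integral>x. rho1 x * (S x * g x) \<partial>lborel)
     + ((\<integral>x. (S' x * g x) * rho x \<partial>lborel) + (\<integral>x. (g' x * S x) * rho x \<partial>lborel))"
    unfolding f_def using i1 i2 by simp
  moreover have "- (\<integral>x. rho1 x * (S x * g x) \<partial>lborel) \<le> (\<integral>x. (\<bar>S x\<bar> * \<bar>g x\<bar>) * rho x \<partial>lborel)"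
  proof -
    have "- (\<integral>x. rho1 x * (S x * g x) \<partial>lborel) = (\<integral>x. - (rho1 x * (S x * g x)) \<partial>lborel)" by simp
    also have "\<dots> \<le> (\<integral>x. (\<bar>S x\<bar> * \<bar>g x\<bar>) * rho x \<partial>lborel)"
    proof (rule integral_mono)
      fix x
      have "- (rho1 x * (S x * g x)) \<le> \<bar>rho1 x\<bar> * (\<bar>S x\<bar> * \<bar>g x\<bar>)"
        using abs_ge_minus_self[of "rho1 x * (S x * g x)"] by (simp add: abs_mult)
      also have "\<dots> \<le> rho x * (\<bar>S x\<bar> * \<bar>g x\<bar>)" by (intro mult_right_mono abs_rho1_le) simp
      finally show "- (rho1 x * (S x * g x)) \<le> (\<bar>S x\<bar> * \<bar>g x\<bar>) * rho x" by (simp add: mult.commute)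
    qed (use i1 i2 in auto)
    finally show ?thesis .
  qed
  ultimately have "(\<integral>x. (g' x * S x) * rho x \<partial>lborel) \<le> (\<integral>x. (\<bar>S x\<bar> * \<bar>g x\<bar>) * rho x \<partial>lborel) - (\<integral>x. (S' x * g x) * rho x \<partial>lborel)"
    by linarith
  then show ?thesis by (simp add: integral_Mx mult.commute)
qed

lemma cv_test2_deriv:
  assumes k: "test2 \<kappa> \<kappa>1 \<kappa>2" and g: "g \<in> borel_measurable borel" and B: "\<And>y. \<bar>g y\<bar> \<le> B"
  shows "(cv \<kappa> g has_real_derivative cv \<kappa>1 g x) (at x)" "(cv \<kappa>1 g has_real_derivative cv \<kappa>2 g x) (at x)"
proof -
  obtain R C where R: "\<And>x. \<bar>x\<bar> > R \<Longrightarrow> \<kappa> x = 0" "\<And>x. \<bar>x\<bar> > R \<Longrightarrow> \<kappa>1 x = 0"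
    "\<And>x. \<bar>\<kappa>1 x\<bar> \<le> C" "\<And>x. \<bar>\<kappa>2 x\<bar> \<le> C"
    by (rule test2E[OF k]) blast
  have d: "(\<kappa> has_real_derivative \<kappa>1 x) (at x)" "(\<kappa>1 has_real_derivative \<kappa>2 x) (at x)" for x
    using k unfolding test2_def by blast+
  show "(cv \<kappa> g has_real_derivative cv \<kappa>1 g x) (at x)"
    by (rule cv_deriv[OF g B d(1) R(1) R(3) test2_integrable(1)[OF k]])
  show "(cv \<kappa>1 g has_real_derivative cv \<kappa>2 g x) (at x)"
    by (rule cv_deriv[OF g B d(2) R(2) R(4) test2_integrable(2)[OF k]])
qed

text \<open>Here \<open>S\<close> is an antiderivative in \<open>x\<close> of the mollified \<open>z\<close>: the mollified initial datum is integrated with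
  a bounded antiderivative of the kernel, and \<open>S\<^sub>t = G\<^sub>x\<close>.  Differentiating \<open>\<integral> S\<^sup>2 \<rho>\<close> in time, one integration by parts yields
  \<open>- \<integral> z G \<rho>\<close> and an error from \<open>\<rho>'\<close>, which is controlled by \<open>\<bar>\<rho>'\<bar> \<le> \<rho>\<close>.\<close>

lemma energy_mollified:
  fixes z G :: "real \<times> real \<Rightarrow> real" and z0 :: "real \<Rightarrow> real"
  assumes z[measurable]: "z \<in> borel_measurable (borel \<Otimes>\<^sub>M borel)" and zB: "\<And>p. \<bar>z p\<bar> \<le> B"
    and G[measurable]: "G \<in> borel_measurable (borel \<Otimes>\<^sub>M borel)" and GB: "\<And>p. \<bar>G p\<bar> \<le> B"
    and z0: "integrable lborel z0" and z0B: "\<And>x. \<bar>z0 x\<bar> \<le> B" and z0i: "(\<integral>x. \<bar>z0 x\<bar> \<partial>lborel) \<le> \<zeta>"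
    and ev: "evol z z0 G (\<lambda>_. 0)"
    and k: "test2 \<kappa> \<kappa>1 \<kappa>2" "\<And>x. \<kappa> x \<ge> 0" "(\<integral>x. \<kappa> x \<partial>lborel) = 1"
    and T: "T > 0"
  obtains S C where "S \<in> borel_measurable (borel \<Otimes>\<^sub>M borel)" "\<And>p. \<bar>S p\<bar> \<le> C"
    "\<And>t. 0 \<le> t \<Longrightarrow> t \<le> T \<Longrightarrow> (\<integral>x. (S (x, t))\<^sup>2 \<partial>Mx) / 2 \<le> \<zeta>\<^sup>2 * measure Mx UNIV / 2
       - (\<integral>p. cv \<kappa> (\<lambda>y. z (y, snd p)) (fst p) * cv \<kappa> (\<lambda>y. G (y, snd p)) (fst p) \<partial>Q t)
       + (\<integral>p. \<bar>S p\<bar> * \<bar>cv \<kappa> (\<lambda>y. G (y, snd p)) (fst p)\<bar> \<partial>Q t)"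
proof -
  note km[measurable] = test2_borel[OF k(1)]
  note ki = test2_integrable[OF k(1)]
  have z0m[measurable]: "z0 \<in> borel_measurable borel" using z0 by auto
  have B0: "B \<ge> 0" using zB[of "(0,0)"] by linarith
  obtain N where N: "\<And>x. (N has_real_derivative \<kappa> x) (at x)" "\<And>x. \<bar>N x\<bar> \<le> 1" and Nm[measurable]: "N \<in> borel_measurable borel"
    using kernel_antiderivative[OF k] by blast
  define g0 where "g0 p = cv \<kappa> (\<lambda>y. G (y, snd p)) (fst p)" for p
  define g1 where "g1 p = cv \<kappa>1 (\<lambda>y. G (y, snd p)) (fst p)" for p
  define g2 where "g2 p = cv \<kappa>2 (\<lambda>y. G (y, snd p)) (fst p)" for p
  define zk where "zk p = cv \<kappa> (\<lambda>y. z (y, snd p)) (fst p)" for p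
  have m[measurable]: "g0 \<in> borel_measurable (borel \<Otimes>\<^sub>M borel)" "g1 \<in> borel_measurable (borel \<Otimes>\<^sub>M borel)"
    "g2 \<in> borel_measurable (borel \<Otimes>\<^sub>M borel)" "zk \<in> borel_measurable (borel \<Otimes>\<^sub>M borel)"
    unfolding g0_def g1_def g2_def zk_def by measurable
  have Gs: "(\<lambda>y. G (y, s)) \<in> borel_measurable borel" "(\<lambda>y. z (y, s)) \<in> borel_measurable borel" for s by measurable
  define D where "D = B * (\<integral>y. \<bar>\<kappa> y\<bar> \<partial>lborel) + B * (\<integral>y. \<bar>\<kappa>1 y\<bar> \<partial>lborel) + B * (\<integral>y. \<bar>\<kappa>2 y\<bar> \<partial>lborel)"
  have D0: "0 \<le> B * (\<integral>y. \<bar>\<kappa> y\<bar> \<partial>lborel)" "0 \<le> B * (\<integral>y. \<bar>\<kappa>1 y\<bar> \<partial>lborel)" "0 \<le> B * (\<integral>y. \<bar>\<kappa>2 y\<bar> \<partial>lborel)"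
    using B0 by auto
  have gb: "\<bar>g0 p\<bar> \<le> D" "\<bar>g1 p\<bar> \<le> D" "\<bar>g2 p\<bar> \<le> D" "\<bar>zk p\<bar> \<le> D" for p
    using cv_bound[of "\<lambda>y. G (y, snd p)" B, OF Gs(1) GB ki(1), of "fst p"] cv_bound[of "\<lambda>y. G (y, snd p)" B, OF Gs(1) GB ki(2), of "fst p"]
      cv_bound[of "\<lambda>y. G (y, snd p)" B, OF Gs(1) GB ki(3), of "fst p"] cv_bound[of "\<lambda>y. z (y, snd p)" B, OF Gs(2) zB ki(1), of "fst p"] D0
    unfolding D_def g0_def g1_def g2_def zk_def by linarith+
  have D00: "D \<ge> 0" using gb(1)[of "(0,0)"] by linarith
  have dg: "((\<lambda>x. g0 (x, s)) has_real_derivative g1 (x, s)) (at x)" "((\<lambda>x. g1 (x, s)) has_real_derivative g2 (x, s)) (at x)" for x s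
    unfolding g0_def g1_def g2_def using cv_test2_deriv[OF k(1) Gs(1) GB] by simp_all
  \<comment> \<open>The cap at T changes nothing on [0, T] and keeps the antiderivative in time
    bounded for every s.\<close>
  define I where "I w x s = (\<integral>r. w (x, r) \<partial>Mt (min s T))" for w :: "real \<times> real \<Rightarrow> real" and x s :: real
  have Ib: "\<bar>I w x s\<bar> \<le> D * T" if "w \<in> borel_measurable (borel \<Otimes>\<^sub>M borel)" "\<And>p. \<bar>w p\<bar> \<le> D" for w x s
  proof -
    have "\<bar>I w x s\<bar> \<le> D * measure (Mt (min s T)) UNIV"
      unfolding I_def using abs_integral_bounded[OF finite_Mt, of "\<lambda>r. w (x, r)" "min s T" D] that by simp
    also have "\<dots> \<le> D * T" using measure_Mt_le[of "min s T" T] T D00 by (intro mult_left_mono) auto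
    finally show ?thesis .
  qed
  have dI: "((\<lambda>x. I g1 x s) has_real_derivative I g2 x s) (at x)" for x s
    unfolding I_def
    by (rule deriv_under_integral[where e=1 and w="\<lambda>_. D"])
      (simp, rule dg, rule Mt.integrable_boundedI[where B=D], simp, rule gb, simp, rule gb)
  define S where "S p = cv N z0 (fst p) + I g1 (fst p) (snd p)" for p
  define zz where "zz p = cv \<kappa> z0 (fst p) + I g2 (fst p) (snd p)" for p
  obtain C\<kappa> where C\<kappa>: "\<And>x. \<bar>\<kappa> x\<bar> \<le> C\<kappa>" by (rule test2E[OF k(1)]) blast
  have cvN: "(cv N z0 has_real_derivative cv \<kappa> z0 x) (at x)" for x
    by (rule cv_deriv_integrable[OF z0 N(1) C\<kappa> N(2) Nm])
  have cvNm: "cv N z0 \<in> borel_measurable borel"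
    by (rule borel_measurable_continuous_onI, rule DERIV_imp_continuous_on, rule cvN)
  have cvkm: "cv \<kappa> z0 \<in> borel_measurable borel"
    unfolding cv_def by measurable
  note [measurable] = cvNm cvkm
  have Sm[measurable]: "S \<in> borel_measurable (borel \<Otimes>\<^sub>M borel)" "zz \<in> borel_measurable (borel \<Otimes>\<^sub>M borel)"
    unfolding S_def zz_def I_def by measurable
  have z00: "0 \<le> (\<integral>x. \<bar>z0 x\<bar> \<partial>lborel)" by simp
  have cvNb: "\<bar>cv N z0 x\<bar> \<le> \<zeta>" for x
  proof -
    have "\<bar>cv N z0 x\<bar> \<le> 1 * (\<integral>x. \<bar>z0 x\<bar> \<partial>lborel)"
      unfolding cv_def using abs_integral_mult_le[of lborel z0 "\<lambda>y. N (x - y)" 1, OF z0 _ N(2)] by (simp add: mult.commute)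
    then show ?thesis using z0i by simp
  qed
  have cvkb: "\<bar>cv \<kappa> z0 x\<bar> \<le> D" for x
    using cv_bound[OF z0m z0B ki(1), of x] D0 unfolding D_def by linarith
  define C where "C = \<zeta> + D + D * T"
  have \<zeta>0: "\<zeta> \<ge> 0" using z0i z00 by linarith
  have DT: "D * T \<ge> 0" using D00 T by simp
  have Sb: "\<bar>S p\<bar> \<le> C" "\<bar>zz p\<bar> \<le> C" for p
    using cvNb[of "fst p"] cvkb[of "fst p"] Ib[OF m(2) gb(2), of "fst p" "snd p"] Ib[OF m(3) gb(3), of "fst p" "snd p"] \<zeta>0 D00 DT
    unfolding S_def zz_def C_def by linarith+
  have gC: "\<bar>g0 p\<bar> \<le> C" "\<bar>g1 p\<bar> \<le> C" "\<bar>zk p\<bar> \<le> C" for p using gb[of p] \<zeta>0 D00 DT unfolding C_def by linarith+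
  have C0: "C \<ge> 0" using Sb(1)[of "(0,0)"] by linarith
  have CC: "\<bar>a * b\<bar> \<le> C * C" if "\<bar>a\<bar> \<le> C" "\<bar>b\<bar> \<le> C" for a b
    using that C0 by (auto simp: abs_mult intro!: mult_mono)
  have dS: "((\<lambda>x. S (x, s)) has_real_derivative zz (x, s)) (at x)" for x s
    unfolding S_def zz_def using DERIV_add[OF cvN dI] by simp
  \<comment> \<open>The x-derivative \<open>zz\<close> of S is built from the initial datum and G.
    Testing \<open>evol\<close> with the reflected kernel identifies it with the mollified z, but
    for each x only at almost every time; hence the replacement is made later, inside an integral
    whose inner variable is time.\<close>
  have zzk: "AE s in Mt t. zz (x, s) = zk (x, s)" if t: "0 \<le> t" "t \<le> T" for x t
  proof -
    have "AE s in lborel. 0 < s \<longrightarrow> zk (x, s) = cv \<kappa> z0 x + (\<integral>r. g2 (x, r) \<partial>Mt s)"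
      using ev[unfolded evol_def, rule_format, OF test2_reflect[OF k(1), of x]]
      by (simp add: zk_def cv_def g2_def)
    moreover have "AE s in lborel. s \<noteq> (0::real)" by (rule AE_lborel_singleton)
    ultimately show ?thesis unfolding AE_Mt
      by eventually_elim (use t in \<open>auto simp: zz_def I_def min_absorb1\<close>)
  qed
  have main: "(\<integral>x. (S (x, t))\<^sup>2 \<partial>Mx) / 2 \<le> \<zeta>\<^sup>2 * measure Mx UNIV / 2 - (\<integral>p. zk p * g0 p \<partial>Q t) + (\<integral>p. \<bar>S p\<bar> * \<bar>g0 p\<bar> \<partial>Q t)"
    if t: "0 \<le> t" "t \<le> T" for t
  proof -
    \<comment> \<open>Integrated form of (S^2)_t = 2 S S_t with S_t = \<open>g1\<close>: the cross
      term with the initial value is linear in the time integral, and the remaining square is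
      \<open>square_of_integral\<close>.\<close>
    have sq: "(S (x, t))\<^sup>2 = (cv N z0 x)\<^sup>2 + 2 * (\<integral>s. g1 (x, s) * S (x, s) \<partial>Mt t)" for x
    proof -
      let ?a = "\<lambda>s. g1 (x, s)" and ?c = "cv N z0 x"
      have I1: "integrable (Mt t) ?a" by (rule Mt.integrable_boundedI[where B=D]) (simp, rule gb)
      have I2: "integrable (Mt t) (\<lambda>s. ?a s * (\<integral>r. ?a r \<partial>Mt (min s T)))"
      proof (rule integrable_mult_bounded[where B=D])
        show "integrable (Mt t) (\<lambda>s. \<integral>r. ?a r \<partial>Mt (min s T))"
          by (rule Mt.integrable_boundedI[where B="D * T"])
            (measurable, rule Ib[OF m(2) gb(2), unfolded I_def])
        show "?a \<in> borel_measurable (Mt t)" by measurable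
      qed (rule gb)
      have "(\<integral>s. ?a s * (\<integral>r. ?a r \<partial>Mt s) \<partial>Mt t) = (\<integral>s. ?a s * (\<integral>r. ?a r \<partial>Mt (min s T)) \<partial>Mt t)"
        by (rule integral_cong_AE) (use t in \<open>auto simp: AE_Mt min_absorb1\<close>)
      then have "(\<integral>s. ?a s \<partial>Mt t)\<^sup>2 = 2 * (\<integral>s. ?a s * (\<integral>r. ?a r \<partial>Mt (min s T)) \<partial>Mt t)"
        using square_of_integral[of ?a D t] gb(2) by simp
      moreover have "(\<integral>s. g1 (x, s) * S (x, s) \<partial>Mt t) = (\<integral>s. ?a s * ?c + ?a s * (\<integral>r. ?a r \<partial>Mt (min s T)) \<partial>Mt t)"
        by (simp add: S_def I_def algebra_simps)
      moreover have "\<dots> = (\<integral>s. ?a s \<partial>Mt t) * ?c + (\<integral>s. ?a s * (\<integral>r. ?a r \<partial>Mt (min s T)) \<partial>Mt t)"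
        using I1 I2 by simp
      ultimately show ?thesis using t by (simp add: S_def I_def min_absorb1 power2_eq_square algebra_simps)
    qed
    have f1: "(\<lambda>p. g1 p * S p) \<in> borel_measurable (borel \<Otimes>\<^sub>M borel)" "\<And>p. \<bar>g1 p * S p\<bar> \<le> C * C"
      by (measurable, rule CC[OF gC(2) Sb(1)])
    have f2: "(\<lambda>p. \<bar>S p\<bar> * \<bar>g0 p\<bar>) \<in> borel_measurable (borel \<Otimes>\<^sub>M borel)" "\<And>p. \<bar>\<bar>S p\<bar> * \<bar>g0 p\<bar>\<bar> \<le> C * C"
      by (measurable, use CC[OF Sb(1) gC(1)] in \<open>simp add: abs_mult\<close>)
    have f3: "(\<lambda>p. zz p * g0 p) \<in> borel_measurable (borel \<Otimes>\<^sub>M borel)" "\<And>p. \<bar>zz p * g0 p\<bar> \<le> C * C"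
      by (measurable, rule CC[OF Sb(2) gC(1)])
    have f4: "(\<lambda>p. zk p * g0 p) \<in> borel_measurable (borel \<Otimes>\<^sub>M borel)" "\<And>p. \<bar>zk p * g0 p\<bar> \<le> C * C"
      by (measurable, rule CC[OF gC(3) gC(1)])
    have sqb: "(cv N z0 x)\<^sup>2 \<le> \<zeta>\<^sup>2" for x
      using abs_le_square_iff[of "cv N z0 x" \<zeta>] cvNb[of x] \<zeta>0 by simp
    have i1: "integrable Mx (\<lambda>x. (cv N z0 x)\<^sup>2)"
      by (rule Mx.integrable_boundedI[where B="\<zeta>\<^sup>2"]) (simp, simp add: sqb)
    have i2: "integrable Mx (\<lambda>x. \<integral>s. g1 (x, s) * S (x, s) \<partial>Mt t)"
      using Mxt.integrable_fst'[of t "\<lambda>p. g1 p * S p"] Q.integrable_boundedI[of "\<lambda>p. g1 p * S p" t "C * C"] f1 by (simp add: Q_def)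
    have "(\<integral>x. (S (x, t))\<^sup>2 \<partial>Mx) = (\<integral>x. (cv N z0 x)\<^sup>2 \<partial>Mx) + 2 * (\<integral>x. (\<integral>s. g1 (x, s) * S (x, s) \<partial>Mt t) \<partial>Mx)"
      unfolding sq using i1 i2 by simp
    also have "(\<integral>x. (\<integral>s. g1 (x, s) * S (x, s) \<partial>Mt t) \<partial>Mx) = (\<integral>s. (\<integral>x. g1 (x, s) * S (x, s) \<partial>Mx) \<partial>Mt t)"
      using Q_iterated[OF f1, of t] by simp
    also have "\<dots> \<le> (\<integral>s. (\<integral>x. \<bar>S (x, s)\<bar> * \<bar>g0 (x, s)\<bar> \<partial>Mx) - (\<integral>x. zz (x, s) * g0 (x, s) \<partial>Mx) \<partial>Mt t)"
    proof (rule integral_mono)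
      show "integrable (Mt t) (\<lambda>s. \<integral>x. g1 (x, s) * S (x, s) \<partial>Mx)"
        by (rule Mt.integrable_boundedI[where B="C * C * measure Mx UNIV"]) (simp add: Mx_marginal(1)[OF f1], rule Mx_marginal(2)[OF f1])
      show "integrable (Mt t) (\<lambda>s. (\<integral>x. \<bar>S (x, s)\<bar> * \<bar>g0 (x, s)\<bar> \<partial>Mx) - (\<integral>x. zz (x, s) * g0 (x, s) \<partial>Mx))"
        by (rule Bochner_Integration.integrable_diff; rule Mt.integrable_boundedI[where B="C * C * measure Mx UNIV"])
          (simp add: Mx_marginal(1)[OF f2], rule Mx_marginal(2)[OF f2], simp add: Mx_marginal(1)[OF f3], rule Mx_marginal(2)[OF f3])
      show "(\<integral>x. g1 (x, s) * S (x, s) \<partial>Mx) \<le> (\<integral>x. \<bar>S (x, s)\<bar> * \<bar>g0 (x, s)\<bar> \<partial>Mx) - (\<integral>x. zz (x, s) * g0 (x, s) \<partial>Mx)" for s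
        by (rule integral_parts_rho[where C=C, OF dS dg(1) Sb(1) Sb(2) gC(1) gC(2)]) measurable
    qed
    also have "\<dots> = (\<integral>p. \<bar>S p\<bar> * \<bar>g0 p\<bar> \<partial>Q t) - (\<integral>p. zz p * g0 p \<partial>Q t)"
    proof -
      have "integrable (Mt t) (\<lambda>s. \<integral>x. \<bar>S (x, s)\<bar> * \<bar>g0 (x, s)\<bar> \<partial>Mx)"
        by (rule Mt.integrable_boundedI[where B="C * C * measure Mx UNIV"]) (simp add: Mx_marginal(1)[OF f2], rule Mx_marginal(2)[OF f2])
      moreover have "integrable (Mt t) (\<lambda>s. \<integral>x. zz (x, s) * g0 (x, s) \<partial>Mx)"
        by (rule Mt.integrable_boundedI[where B="C * C * measure Mx UNIV"]) (simp add: Mx_marginal(1)[OF f3], rule Mx_marginal(2)[OF f3])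
      ultimately show ?thesis
        by (simp add: Q_iterated(1)[OF f2] Q_iterated(1)[OF f3])
    qed
    also have "(\<integral>p. zz p * g0 p \<partial>Q t) = (\<integral>p. zk p * g0 p \<partial>Q t)"
      unfolding Q_iterated(2)[OF f3] Q_iterated(2)[OF f4]
    proof (rule Bochner_Integration.integral_cong[OF refl])
      show "(\<integral>s. zz (x, s) * g0 (x, s) \<partial>Mt t) = (\<integral>s. zk (x, s) * g0 (x, s) \<partial>Mt t)" for x
        by (rule integral_cong_AE) (use zzk[OF t, of x] in auto)
    qed
    also have "(\<integral>x. (cv N z0 x)\<^sup>2 \<partial>Mx) \<le> \<zeta>\<^sup>2 * measure Mx UNIV"
    proof -
      have "(\<integral>x. (cv N z0 x)\<^sup>2 \<partial>Mx) \<le> (\<integral>x. \<zeta>\<^sup>2 \<partial>Mx)"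
        by (rule integral_mono[OF i1]) (simp_all add: sqb)
      then show ?thesis by (simp add: mult.commute)
    qed
    finally have "(\<integral>x. (S (x, t))\<^sup>2 \<partial>Mx) \<le> \<zeta>\<^sup>2 * measure Mx UNIV
        + 2 * ((\<integral>p. \<bar>S p\<bar> * \<bar>g0 p\<bar> \<partial>Q t) - (\<integral>p. zk p * g0 p \<partial>Q t))"
      by simp
    then show ?thesis by (simp add: field_simps)
  qed
  show ?thesis
    by (rule that[OF Sm(1) Sb(1)]) (use main in \<open>simp add: zk_def g0_def\<close>)
qed

text \<open>On a time interval as short as \<open>2 T \<le> c\<close> the weight error is absorbed by the supremum in time of the
  energy, so Gronwall's inequality is not needed.\<close>

lemma energy_estimate:
  fixes z G e :: "real \<times> real \<Rightarrow> real" and z0 :: "real \<Rightarrow> real"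
  assumes z[measurable]: "z \<in> borel_measurable (borel \<Otimes>\<^sub>M borel)" and zB: "\<And>p. \<bar>z p\<bar> \<le> B"
    and G[measurable]: "G \<in> borel_measurable (borel \<Otimes>\<^sub>M borel)" and GB: "\<And>p. \<bar>G p\<bar> \<le> B"
    and e[measurable]: "e \<in> borel_measurable (borel \<Otimes>\<^sub>M borel)" and eB: "\<And>p. \<bar>e p\<bar> \<le> E" and e0: "\<And>p. 0 \<le> e p"
    and z0: "integrable lborel z0" and z0B: "\<And>x. \<bar>z0 x\<bar> \<le> B" and z0i: "(\<integral>x. \<bar>z0 x\<bar> \<partial>lborel) \<le> \<zeta>"
    and ev: "evol z z0 G (\<lambda>_. 0)"
    and c: "c > 0" and mono: "\<And>p. c * (G p)\<^sup>2 - e p \<le> z p * G p"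
    and T: "T > 0" "2 * T \<le> c"
  shows "(\<integral>p. z p * G p \<partial>Q T) \<le> 2 * measure Mx UNIV * \<zeta>\<^sup>2 + 3 * (\<integral>p. e p \<partial>Q T)"
proof (rule field_le_epsilon)
  fix d :: real assume d: "d > 0"
  have B0: "B \<ge> 0" using zB[of "(0,0)"] by linarith
  \<comment> \<open>With r = (2 + c) B \<eta> the mollification error of the final bound is 4 r, and
    this choice makes it at most d. The summand 1 keeps the denominator positive if B = 0.\<close>
  define \<eta> where "\<eta> = d / (4 * (2 + c) * B + 1)"
  have \<eta>: "\<eta> > 0" "4 * (2 + c) * B * \<eta> \<le> d"
  proof -
    have p: "4 * (2 + c) * B \<ge> 0" using c B0 by simp
    then show "\<eta> > 0" unfolding \<eta>_def using d by simp
    then have "4 * (2 + c) * B * \<eta> \<le> (4 * (2 + c) * B + 1) * \<eta>" by (simp add: algebra_simps)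
    also have "\<dots> = d" unfolding \<eta>_def using p by simp
    finally show "4 * (2 + c) * B * \<eta> \<le> d" .
  qed
  obtain d1 where d1: "d1 > 0" "\<And>\<kappa> \<kappa>1 \<kappa>2. test2 \<kappa> \<kappa>1 \<kappa>2 \<Longrightarrow> (\<And>x. \<kappa> x \<ge> 0) \<Longrightarrow> (\<integral>x. \<kappa> x \<partial>lborel) = 1 \<Longrightarrow>
      (\<And>x. \<bar>x\<bar> > d1 \<Longrightarrow> \<kappa> x = 0) \<Longrightarrow> (\<integral>p. \<bar>cv \<kappa> (\<lambda>y. z (y, snd p)) (fst p) - z p\<bar> \<partial>Q T) \<le> \<eta>"
    using mollification_approx[OF z zB \<eta>(1), of T] by blast
  obtain d2 where d2: "d2 > 0" "\<And>\<kappa> \<kappa>1 \<kappa>2. test2 \<kappa> \<kappa>1 \<kappa>2 \<Longrightarrow> (\<And>x. \<kappa> x \<ge> 0) \<Longrightarrow> (\<integral>x. \<kappa> x \<partial>lborel) = 1 \<Longrightarrow>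
      (\<And>x. \<bar>x\<bar> > d2 \<Longrightarrow> \<kappa> x = 0) \<Longrightarrow> (\<integral>p. \<bar>cv \<kappa> (\<lambda>y. G (y, snd p)) (fst p) - G p\<bar> \<partial>Q T) \<le> \<eta>"
    using mollification_approx[OF G GB \<eta>(1), of T] by blast
  obtain \<kappa> \<kappa>1 \<kappa>2 where k: "test2 \<kappa> \<kappa>1 \<kappa>2" "\<And>x. \<kappa> x \<ge> 0" "(\<integral>x. \<kappa> x \<partial>lborel) = 1"
    "\<And>x. \<bar>x\<bar> > min d1 d2 \<Longrightarrow> \<kappa> x = 0"
    using mollifier_exists[of "min d1 d2"] d1(1) d2(1) by (metis min_less_iff_conj)
  note [measurable] = test2_borel[OF k(1)]
  define zk where "zk p = cv \<kappa> (\<lambda>y. z (y, snd p)) (fst p)" for p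
  define g where "g p = cv \<kappa> (\<lambda>y. G (y, snd p)) (fst p)" for p
  have [measurable]: "zk \<in> borel_measurable (borel \<Otimes>\<^sub>M borel)" "g \<in> borel_measurable (borel \<Otimes>\<^sub>M borel)"
    unfolding zk_def g_def by measurable
  have dz: "(\<integral>p. \<bar>zk p - z p\<bar> \<partial>Q T) \<le> \<eta>" unfolding zk_def by (rule d1(2)[OF k(1-3)]) (simp add: k(4))
  have dG: "(\<integral>p. \<bar>g p - G p\<bar> \<partial>Q T) \<le> \<eta>" unfolding g_def by (rule d2(2)[OF k(1-3)]) (simp add: k(4))
  have zkB: "\<bar>zk p\<bar> \<le> B" for p
    using cv_bound[of "\<lambda>y. z (y, snd p)" B \<kappa> "fst p", OF _ zB test2_integrable(1)[OF k(1)]]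
    by (simp add: zk_def abs_of_nonneg[OF k(2)] k(3))
  have gB: "\<bar>g p\<bar> \<le> B" for p
    using cv_bound[of "\<lambda>y. G (y, snd p)" B \<kappa> "fst p", OF _ GB test2_integrable(1)[OF k(1)]]
    by (simp add: g_def abs_of_nonneg[OF k(2)] k(3))
  obtain S C where S[measurable]: "S \<in> borel_measurable (borel \<Otimes>\<^sub>M borel)" and SC: "\<And>p. \<bar>S p\<bar> \<le> C"
    and SE: "\<And>t. 0 \<le> t \<Longrightarrow> t \<le> T \<Longrightarrow> (\<integral>x. (S (x, t))\<^sup>2 \<partial>Mx) / 2 \<le> \<zeta>\<^sup>2 * measure Mx UNIV / 2
       - (\<integral>p. zk p * g p \<partial>Q t) + (\<integral>p. \<bar>S p\<bar> * \<bar>g p\<bar> \<partial>Q t)"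
    using energy_mollified[OF z zB G GB z0 z0B z0i ev k(1-3) T(1)] unfolding zk_def g_def by blast
  define m where "m = measure Mx UNIV"
  have m0: "m \<ge> 0" unfolding m_def by simp
  have C0: "C \<ge> 0" using SC[of "(0,0)"] by linarith
  have E0: "E \<ge> 0" using eB[of "(0,0)"] by linarith
  define En where "En t = (\<integral>x. (S (x, t))\<^sup>2 \<partial>Mx)" for t
  have S2: "(\<lambda>p. (S p)\<^sup>2) \<in> borel_measurable (borel \<Otimes>\<^sub>M borel)" "\<And>p. \<bar>(S p)\<^sup>2\<bar> \<le> C\<^sup>2"
    using abs_le_square_iff[of _ C] SC C0 by simp_all
  have Em[measurable]: "En \<in> borel_measurable borel" unfolding En_def by (rule Mx_marginal(1)[OF S2])
  have Eb: "\<bar>En t\<bar> \<le> C\<^sup>2 * m" for t unfolding En_def m_def by (rule Mx_marginal(2)[OF S2])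
  have E0': "En t \<ge> 0" for t unfolding En_def by simp
  have BB: "\<bar>a * b\<bar> \<le> B * B" if "\<bar>a\<bar> \<le> B" "\<bar>b\<bar> \<le> B" for a b
    using that B0 by (auto simp: abs_mult intro!: mult_mono)
  have int: "integrable (Q t) f" if "f \<in> borel_measurable (borel \<Otimes>\<^sub>M borel)" "\<And>p. \<bar>f p\<bar> \<le> K" for f and K t :: real
    by (rule Q.integrable_boundedI[where B=K]) (use that in auto)
  have I: "integrable (Q t) (\<lambda>p. zk p * g p)" "integrable (Q t) (\<lambda>p. z p * G p)" "integrable (Q t) (\<lambda>p. (g p)\<^sup>2)"
    "integrable (Q t) (\<lambda>p. (G p)\<^sup>2)" for t
    by (rule int, measurable, (subst power2_eq_square)?, rule BB, (rule zB zkB gB GB)+)+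
  have I2: "integrable (Q t) e" "integrable (Q t) (\<lambda>p. (S p)\<^sup>2)" "integrable (Q t) (\<lambda>p. \<bar>zk p - z p\<bar>)" "integrable (Q t) (\<lambda>p. \<bar>g p - G p\<bar>)" for t
  proof -
    have 1: "\<bar>\<bar>zk p - z p\<bar>\<bar> \<le> 2 * B" "\<bar>\<bar>g p - G p\<bar>\<bar> \<le> 2 * B" for p
      using order_trans[OF abs_triangle_ineq4 add_mono[OF zkB zB]] order_trans[OF abs_triangle_ineq4 add_mono[OF gB GB]]
      by simp_all
    show "integrable (Q t) e" "integrable (Q t) (\<lambda>p. (S p)\<^sup>2)" by (rule int[OF e eB], rule int[OF S2])
    show "integrable (Q t) (\<lambda>p. \<bar>zk p - z p\<bar>)" by (rule int[OF _ 1(1)]) measurable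
    show "integrable (Q t) (\<lambda>p. \<bar>g p - G p\<bar>)" by (rule int[OF _ 1(2)]) measurable
  qed
  have I3: "integrable (Q t) (\<lambda>p. \<bar>S p\<bar> * \<bar>g p\<bar>)" for t
    by (rule int[where K="C * B"]) (use SC gB C0 in \<open>auto simp: abs_mult intro!: mult_mono\<close>)
  define r where "r = (2 + c) * B * \<eta>"
  define eT where "eT = (\<integral>p. e p \<partial>Q T)"
  \<comment> \<open>Young's inequality splits |S| |g| into c / 2 times G^2, up to mollification
    errors, and S^2 / (2 c). By the hypothesis \<open>mono\<close> the first part uses up just half
    of z G, so half of the dissipation survives on the left.\<close>
  have key: "En t / 2 + (\<integral>p. z p * G p \<partial>Q t) / 2 \<le> \<zeta>\<^sup>2 * m / 2 + eT / 2 + (\<integral>s. En s \<partial>Mt t) / (2 * c) + r"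
    if t: "0 \<le> t" "t \<le> T" for t
  proof -
    have arith: "E' / 2 + x3 / 2 \<le> A / 2 + e' / 2 + x5 / (2 * c) + (2 + c) * B * \<eta>"
      if "E' / 2 \<le> A / 2 - x1 + x2" "- x1 \<le> - x3 + (B * \<eta> + B * \<eta>)" "x2 \<le> c / 2 * x4 + c * B * \<eta> + 1 / (2 * c) * x5"
        "c / 2 * x4 \<le> 1 / 2 * x3 + 1 / 2 * x6" "x6 \<le> e'" for E' x1 x2 x3 x4 x5 x6 A e' :: real
      using that by (simp add: algebra_simps)
    have dz': "(\<integral>p. \<bar>zk p - z p\<bar> \<partial>Q t) \<le> \<eta>" "(\<integral>p. \<bar>g p - G p\<bar> \<partial>Q t) \<le> \<eta>"
      using Q_integral_mono[of "\<lambda>p. \<bar>zk p - z p\<bar>" "2 * B" t T] Q_integral_mono[of "\<lambda>p. \<bar>g p - G p\<bar>" "2 * B" t T] t dz dG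
        order_trans[OF abs_triangle_ineq4 add_mono[OF zkB zB]] order_trans[OF abs_triangle_ineq4 add_mono[OF gB GB]]
      by simp_all
    have pw1: "- (zk p * g p) \<le> - (z p * G p) + (B * \<bar>zk p - z p\<bar> + B * \<bar>g p - G p\<bar>)" for p
    proof -
      have "z p * G p - zk p * g p = (z p - zk p) * g p + z p * (G p - g p)" by (simp add: algebra_simps)
      also have "\<dots> \<le> \<bar>(z p - zk p) * g p\<bar> + \<bar>z p * (G p - g p)\<bar>" by linarith
      also have "\<dots> \<le> \<bar>zk p - z p\<bar> * B + B * \<bar>g p - G p\<bar>"
        unfolding abs_mult abs_minus_commute[of "z p"] abs_minus_commute[of "G p"]
        by (intro add_mono mult_left_mono mult_right_mono gB zB) auto
      finally show ?thesis by (simp add: mult.commute)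
    qed
    have pw2: "\<bar>S p\<bar> * \<bar>g p\<bar> \<le> c / 2 * (G p)\<^sup>2 + c * B * \<bar>g p - G p\<bar> + 1 / (2 * c) * (S p)\<^sup>2" for p
    proof -
      have "0 \<le> (c * \<bar>g p\<bar> - \<bar>S p\<bar>)\<^sup>2 / (2 * c)" using c by simp
      also have "\<dots> = c / 2 * (g p)\<^sup>2 + 1 / (2 * c) * (S p)\<^sup>2 - \<bar>S p\<bar> * \<bar>g p\<bar>"
        using c by (simp add: power2_diff field_simps power_mult_distrib) (simp add: power2_eq_square)
      finally have 1: "\<bar>S p\<bar> * \<bar>g p\<bar> \<le> c / 2 * (g p)\<^sup>2 + 1 / (2 * c) * (S p)\<^sup>2" by simp
      have "(g p)\<^sup>2 - (G p)\<^sup>2 = (g p - G p) * (g p + G p)" by (simp add: power2_eq_square algebra_simps)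
      also have "\<dots> \<le> \<bar>g p - G p\<bar> * \<bar>g p + G p\<bar>" by (metis abs_ge_self abs_mult)
      also have "\<dots> \<le> \<bar>g p - G p\<bar> * (2 * B)"
        using order_trans[OF abs_triangle_ineq add_mono[OF gB[of p] GB[of p]]] by (intro mult_left_mono) auto
      finally have "c / 2 * (g p)\<^sup>2 \<le> c / 2 * ((G p)\<^sup>2 + \<bar>g p - G p\<bar> * (2 * B))"
        using c by (intro mult_left_mono) auto
      with 1 show ?thesis by (simp add: algebra_simps)
    qed
    have pw3: "c / 2 * (G p)\<^sup>2 \<le> 1 / 2 * (z p * G p) + 1 / 2 * e p" for p using mono[of p] by linarith
    have a1: "- (\<integral>p. zk p * g p \<partial>Q t) \<le> - (\<integral>p. z p * G p \<partial>Q t) + (B * \<eta> + B * \<eta>)"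
    proof -
      have "- (\<integral>p. zk p * g p \<partial>Q t) = (\<integral>p. - (zk p * g p) \<partial>Q t)" by simp
      also have "\<dots> \<le> (\<integral>p. - (z p * G p) + (B * \<bar>zk p - z p\<bar> + B * \<bar>g p - G p\<bar>) \<partial>Q t)"
        by (rule integral_mono[OF _ _ pw1])
          (intro Bochner_Integration.integrable_add Bochner_Integration.integrable_minus integrable_mult_right I I2)+
      also have "\<dots> = - (\<integral>p. z p * G p \<partial>Q t) + (B * (\<integral>p. \<bar>zk p - z p\<bar> \<partial>Q t) + B * (\<integral>p. \<bar>g p - G p\<bar> \<partial>Q t))"
        using I[of t] I2[of t] by simp
      also have "\<dots> \<le> - (\<integral>p. z p * G p \<partial>Q t) + (B * \<eta> + B * \<eta>)"
        by (intro add_left_mono add_mono mult_left_mono dz' B0)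
      finally show ?thesis .
    qed
    have a2: "(\<integral>p. \<bar>S p\<bar> * \<bar>g p\<bar> \<partial>Q t) \<le> c / 2 * (\<integral>p. (G p)\<^sup>2 \<partial>Q t) + c * B * \<eta> + 1 / (2 * c) * (\<integral>p. (S p)\<^sup>2 \<partial>Q t)"
    proof -
      have "(\<integral>p. \<bar>S p\<bar> * \<bar>g p\<bar> \<partial>Q t) \<le> (\<integral>p. c / 2 * (G p)\<^sup>2 + c * B * \<bar>g p - G p\<bar> + 1 / (2 * c) * (S p)\<^sup>2 \<partial>Q t)"
        by (rule integral_mono[OF I3 _ pw2])
          (intro Bochner_Integration.integrable_add integrable_mult_right I I2)+
      also have "\<dots> = c / 2 * (\<integral>p. (G p)\<^sup>2 \<partial>Q t) + c * B * (\<integral>p. \<bar>g p - G p\<bar> \<partial>Q t) + 1 / (2 * c) * (\<integral>p. (S p)\<^sup>2 \<partial>Q t)"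
        using I[of t] I2[of t] by simp
      also have "\<dots> \<le> c / 2 * (\<integral>p. (G p)\<^sup>2 \<partial>Q t) + c * B * \<eta> + 1 / (2 * c) * (\<integral>p. (S p)\<^sup>2 \<partial>Q t)"
        using c B0 by (intro add_right_mono add_left_mono mult_left_mono dz') auto
      finally show ?thesis .
    qed
    have a3: "c / 2 * (\<integral>p. (G p)\<^sup>2 \<partial>Q t) \<le> 1 / 2 * (\<integral>p. z p * G p \<partial>Q t) + 1 / 2 * (\<integral>p. e p \<partial>Q t)"
    proof -
      have "(\<integral>p. c / 2 * (G p)\<^sup>2 \<partial>Q t) \<le> (\<integral>p. 1 / 2 * (z p * G p) + 1 / 2 * e p \<partial>Q t)"
        by (rule integral_mono[OF _ _ pw3]) (intro Bochner_Integration.integrable_add integrable_mult_right I I2)+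
      then show ?thesis using I[of t] I2[of t] by simp
    qed
    have a4: "(\<integral>p. (S p)\<^sup>2 \<partial>Q t) = (\<integral>s. En s \<partial>Mt t)"
      unfolding En_def by (rule Q_iterated(1)[OF S2])
    have a5: "(\<integral>p. e p \<partial>Q t) \<le> eT" unfolding eT_def by (rule Q_integral_mono[OF e eB e0 t(2)])
    show ?thesis
      unfolding r_def
      by (rule arith[OF SE[OF t, folded En_def m_def] a1 a2[unfolded a4] a3 a5])
  qed
  \<comment> \<open>Since z G >= -e pointwise, dropping the surviving half of the dissipation from
    \<open>key\<close> costs at most eT / 2.\<close>
  have low: "- eT \<le> (\<integral>p. z p * G p \<partial>Q t)" if t: "t \<le> T" for t
  proof -
    have "(\<integral>p. - e p \<partial>Q t) \<le> (\<integral>p. z p * G p \<partial>Q t)"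
    proof (rule integral_mono)
      show "- e p \<le> z p * G p" for p
        using mono[of p] c zero_le_power2[of "G p"] mult_nonneg_nonneg[of c "(G p)\<^sup>2"] by linarith
    qed (use I I2 in auto)
    moreover have "(\<integral>p. e p \<partial>Q t) \<le> eT" unfolding eT_def by (rule Q_integral_mono[OF e eB e0 t])
    ultimately show ?thesis by simp
  qed
  define A where "A = \<zeta>\<^sup>2 * m + 2 * eT + 2 * r"
  \<comment> \<open>Finite because S is bounded, so s / 2 may be subtracted from both sides of s <=
    A + s / 2. The time integral contributes at most s / 4 to \<open>key\<close>, as 2 T <=
    c.\<close>
  define s where "s = (SUP t\<in>{0..T}. En t)"
  have bdd: "bdd_above (En ` {0..T})"
    by (rule bdd_aboveI2[where M="C\<^sup>2 * m"]) (use Eb in \<open>auto intro: order_trans[OF abs_ge_self]\<close>)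
  have Es: "En t \<le> s" if "t \<in> {0..T}" for t unfolding s_def by (rule cSUP_upper[OF that bdd])
  have s0: "s \<ge> 0" using Es[of 0] E0'[of 0] T by simp
  have iE: "(\<integral>r. En r \<partial>Mt t) \<le> s * T" if "0 \<le> t" "t \<le> T" for t
  proof -
    have "(\<integral>r. En r \<partial>Mt t) \<le> (\<integral>r. s \<partial>Mt t)"
    proof (rule integral_mono_AE)
      show "integrable (Mt t) En" by (rule Mt.integrable_boundedI[where B="C\<^sup>2 * m"]) (simp, rule Eb)
      show "AE r in Mt t. En r \<le> s" unfolding AE_Mt using Es that by (intro AE_I2) auto
    qed simp
    also have "\<dots> \<le> s * T" using mult_left_mono[OF measure_Mt_le[OF that(2)] s0] T by (simp add: mult.commute)
    finally show ?thesis .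
  qed
  have q: "s * T / (2 * c) \<le> s / 4"
    using mult_left_mono[OF T(2) s0] c by (simp add: field_simps)
  have iE2: "(\<integral>r. En r \<partial>Mt t) / (2 * c) \<le> s / 4" if "0 \<le> t" "t \<le> T" for t
    using divide_right_mono[OF iE[OF that], of "2 * c"] q c by linarith
  have "s \<le> A + s / 2" unfolding s_def
  proof (rule cSUP_least)
    show "{0..T} \<noteq> {}" using T by simp
    fix t assume t: "t \<in> {0..T}"
    have "En t / 2 \<le> \<zeta>\<^sup>2 * m / 2 + eT + s / 4 + r"
      using key[of t] low[of t] iE2[of t] t by auto
    then have "En t \<le> A + s / 2" unfolding A_def by linarith
    then show "En t \<le> A + (SUP t\<in>{0..T}. En t) / 2" unfolding s_def .
  qed
  then have sA: "s \<le> 2 * A" by linarith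
  \<comment> \<open>Here s / 4 <= A / 2 is inserted; doubling produces the constants 2 and 3 of the
    claim and the 4 in front of r.\<close>
  have "(\<integral>p. z p * G p \<partial>Q T) / 2 \<le> \<zeta>\<^sup>2 * m / 2 + eT / 2 + A / 2 + r"
    using key[of T] iE2[of T] sA E0'[of T] T by linarith
  then have "(\<integral>p. z p * G p \<partial>Q T) \<le> 2 * (\<zeta>\<^sup>2 * m) + 3 * eT + 4 * r" unfolding A_def by (simp add: field_simps)
  also have "4 * r \<le> d" using \<eta>(2) unfolding r_def by (simp add: algebra_simps)
  finally show "(\<integral>p. z p * G p \<partial>Q T) \<le> 2 * measure Mx UNIV * \<zeta>\<^sup>2 + 3 * (\<integral>p. e p \<partial>Q T) + d"
    unfolding eT_def m_def by (simp add: mult.commute mult.left_commute)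
qed

section \<open>Stability of the integrated equation and its use with the weight\<close>

abbreviation bdd_borel2 :: "(real \<times> real \<Rightarrow> real) \<Rightarrow> real \<Rightarrow> bool" where
  "bdd_borel2 f B \<equiv> f \<in> borel_measurable (borel \<Otimes>\<^sub>M borel) \<and> (\<forall>p. \<bar>f p\<bar> \<le> B)"

abbreviation bdd_borel1 :: "(real \<Rightarrow> real) \<Rightarrow> real \<Rightarrow> bool" where
  "bdd_borel1 f B \<equiv> f \<in> borel_measurable borel \<and> (\<forall>x. \<bar>f x\<bar> \<le> B)"

lemma bdd_borel2_section: "bdd_borel2 f B \<Longrightarrow> (\<lambda>x. f (x, s)) \<in> borel_measurable borel"
  by (rule measurable_compose[of "\<lambda>x. (x, s)" _ "borel \<Otimes>\<^sub>M borel"]) auto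

lemma integrable_section_test:
  assumes f: "bdd_borel2 f B" and g: "integrable lborel g"
  shows "integrable lborel (\<lambda>x. f (x, s) * g x)"
  by (rule integrable_mult_bounded[OF g, where B=B]) (use bdd_borel2_section[OF f] f in auto)

lemma inner_integral_bound:
  assumes f: "bdd_borel2 f B" and h: "bdd_borel2 h B" and g: "integrable lborel g1" "integrable lborel g2"
  shows "(\<lambda>s. \<integral>x. f (x, s) * g1 x - h (x, s) * g2 x \<partial>lborel) \<in> borel_measurable borel"
    and "\<bar>\<integral>x. f (x, s) * g1 x - h (x, s) * g2 x \<partial>lborel\<bar>
       \<le> B * (\<integral>x. \<bar>g1 x\<bar> \<partial>lborel) + B * (\<integral>x. \<bar>g2 x\<bar> \<partial>lborel)"
proof -
  have [measurable]: "f \<in> borel_measurable (borel \<Otimes>\<^sub>M borel)" "h \<in> borel_measurable (borel \<Otimes>\<^sub>M borel)"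
    "g1 \<in> borel_measurable borel" "g2 \<in> borel_measurable borel" using f h g by auto
  show "(\<lambda>s. \<integral>x. f (x, s) * g1 x - h (x, s) * g2 x \<partial>lborel) \<in> borel_measurable borel" by measurable
  have "(\<integral>x. f (x, s) * g1 x - h (x, s) * g2 x \<partial>lborel) = (\<integral>x. f (x, s) * g1 x \<partial>lborel) - (\<integral>x. h (x, s) * g2 x \<partial>lborel)"
    by (intro Bochner_Integration.integral_diff integrable_section_test[OF f] integrable_section_test[OF h] g)
  moreover have "\<bar>\<integral>x. f (x, s) * g1 x \<partial>lborel\<bar> \<le> B * (\<integral>x. \<bar>g1 x\<bar> \<partial>lborel)"
    by (rule abs_integral_mult_le[OF g(1)]) (use f in auto)
  moreover have "\<bar>\<integral>x. h (x, s) * g2 x \<partial>lborel\<bar> \<le> B * (\<integral>x. \<bar>g2 x\<bar> \<partial>lborel)"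
    by (rule abs_integral_mult_le[OF g(2)]) (use h in auto)
  ultimately show "\<bar>\<integral>x. f (x, s) * g1 x - h (x, s) * g2 x \<partial>lborel\<bar>
       \<le> B * (\<integral>x. \<bar>g1 x\<bar> \<partial>lborel) + B * (\<integral>x. \<bar>g2 x\<bar> \<partial>lborel)" by linarith
qed

lemma inner_integrable:
  assumes f: "bdd_borel2 f B" and h: "bdd_borel2 h B" and g: "integrable lborel g1" "integrable lborel g2"
  shows "integrable (Mt t) (\<lambda>s. \<integral>x. f (x, s) * g1 x - h (x, s) * g2 x \<partial>lborel)"
  by (rule Mt.integrable_boundedI[where B="B * (\<integral>x. \<bar>g1 x\<bar> \<partial>lborel) + B * (\<integral>x. \<bar>g2 x\<bar> \<partial>lborel)"])
    (use inner_integral_bound[OF assms] in \<open>auto cong: measurable_cong_sets\<close>)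

lemma evol_diff:
  assumes e: "evol w w0 \<Phi> h" "evol w' w0' \<Phi>' h'"
    and b: "bdd_borel2 w B" "bdd_borel2 \<Phi> B" "bdd_borel2 h B" "bdd_borel2 w' B" "bdd_borel2 \<Phi>' B" "bdd_borel2 h' B"
    and b0: "bdd_borel1 w0 B" "bdd_borel1 w0' B"
  shows "evol (\<lambda>p. w p - w' p) (\<lambda>x. w0 x - w0' x) (\<lambda>p. \<Phi> p - \<Phi>' p) (\<lambda>p. h p - h' p)"
  unfolding evol_def
proof (intro allI impI)
  fix \<phi> \<phi>1 \<phi>2 assume t: "test2 \<phi> \<phi>1 \<phi>2"
  note i = test2_integrable[OF t]
  note s = integrable_section_test
  have i0: "integrable lborel (\<lambda>x. w0 x * \<phi> x)" "integrable lborel (\<lambda>x. w0' x * \<phi> x)"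
    by (rule integrable_mult_bounded[OF i(1), where B=B]; use b0 in auto)+
  show "AE t in lborel. 0 < t \<longrightarrow> (\<integral>x. (w (x, t) - w' (x, t)) * \<phi> x \<partial>lborel) = (\<integral>x. (w0 x - w0' x) * \<phi> x \<partial>lborel)
       + (\<integral>s. (\<integral>x. (\<Phi> (x, s) - \<Phi>' (x, s)) * \<phi>2 x - (h (x, s) - h' (x, s)) * \<phi> x \<partial>lborel) \<partial>Mt t)"
    using e(1)[unfolded evol_def, rule_format, OF t] e(2)[unfolded evol_def, rule_format, OF t]
  proof eventually_elim
    case (elim t)
    have 1: "(\<integral>x. (w (x, t) - w' (x, t)) * \<phi> x \<partial>lborel) = (\<integral>x. w (x, t) * \<phi> x \<partial>lborel) - (\<integral>x. w' (x, t) * \<phi> x \<partial>lborel)"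
      using s[OF b(1) i(1), of t] s[OF b(4) i(1), of t] by (simp add: left_diff_distrib)
    have 2: "(\<integral>x. (w0 x - w0' x) * \<phi> x \<partial>lborel) = (\<integral>x. w0 x * \<phi> x \<partial>lborel) - (\<integral>x. w0' x * \<phi> x \<partial>lborel)"
      using i0 by (simp add: left_diff_distrib)
    have "(\<integral>x. (\<Phi> (x, s) - \<Phi>' (x, s)) * \<phi>2 x - (h (x, s) - h' (x, s)) * \<phi> x \<partial>lborel)
        = (\<integral>x. (\<Phi> (x, s) * \<phi>2 x - h (x, s) * \<phi> x) - (\<Phi>' (x, s) * \<phi>2 x - h' (x, s) * \<phi> x) \<partial>lborel)" for s
      by (simp add: algebra_simps)
    then have 3: "(\<integral>x. (\<Phi> (x, s) - \<Phi>' (x, s)) * \<phi>2 x - (h (x, s) - h' (x, s)) * \<phi> x \<partial>lborel)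
        = (\<integral>x. \<Phi> (x, s) * \<phi>2 x - h (x, s) * \<phi> x \<partial>lborel) - (\<integral>x. \<Phi>' (x, s) * \<phi>2 x - h' (x, s) * \<phi> x \<partial>lborel)" for s
      using s[OF b(2) i(3), of s] s[OF b(3) i(1), of s] s[OF b(5) i(3), of s] s[OF b(6) i(1), of s] by simp
    show ?case
      using elim inner_integrable[OF b(2,3) i(3,1), of t] inner_integrable[OF b(5,6) i(3,1), of t]
      unfolding 1 2 3 by simp
  qed
qed

lemma AE_scale:
  fixes c :: real
  assumes c: "c > 0" and P: "AE t in lborel. P t"
  shows "AE t in lborel. P (c * t)"
proof -
  obtain N where N: "{t \<in> space lborel. \<not> P t} \<subseteq> N" "N \<in> null_sets lborel"
    using P by (rule AE_E) (blast intro: null_setsI)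
  have "AE x in density lborel (\<lambda>_. ennreal (inverse \<bar>c\<bar>)). x \<notin> N"
    by (subst AE_density) (use AE_not_in[OF N(2)] in auto)
  then have "AE x in distr lborel borel ((*) c). x \<notin> N"
    using c by (subst lborel_distr_mult) auto
  moreover have "N \<in> sets borel" using N(2) by auto
  ultimately have "AE x in lborel. c * x \<notin> N"
    by (subst (asm) AE_distr_iff) auto
  then show ?thesis by (rule AE_mp) (use N(1) in auto)
qed

lemma integral_Mt_scale:
  fixes H :: "real \<Rightarrow> real"
  assumes c: "c > 0" and H[measurable]: "H \<in> borel_measurable borel"
  shows "(\<integral>s. H s \<partial>Mt (c * t)) = c * (\<integral>r. H (c * r) \<partial>Mt t)"
proof -
  have "(\<integral>s. H s \<partial>Mt (c * t)) = (\<integral>s. indicator {0..c * t} s * H s \<partial>lborel)" by (simp add: integral_Mt)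
  also have "\<dots> = c * (\<integral>r. indicator {0..c * t} (c * r) * H (c * r) \<partial>lborel)"
    using lborel_integral_real_affine[of c "\<lambda>s. indicator {0..c * t} s * H s" 0] c by simp
  also have "(\<lambda>r. indicator {0..c * t} (c * r) * H (c * r)) = (\<lambda>r. indicator {0..t} r * H (c * r))"
    using c by (auto simp: indicator_def zero_le_mult_iff fun_eq_iff)
  finally show ?thesis by (simp add: integral_Mt)
qed

text \<open>Tested with phi(x / l), the second derivative carries 1 / l^2, which the substitution in
  time cancels; the reaction has no such factor and retains l^2. The factor l from the substitution
  in space is common to all terms.\<close>

lemma evol_scale:
  assumes e: "evol w w0 \<Phi> h" and l: "l > 0"
    and b: "bdd_borel2 \<Phi> B" "bdd_borel2 h B"
  shows "evol (\<lambda>p. w (l * fst p, l\<^sup>2 * snd p)) (\<lambda>x. w0 (l * x)) (\<lambda>p. \<Phi> (l * fst p, l\<^sup>2 * snd p))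
     (\<lambda>p. l\<^sup>2 * h (l * fst p, l\<^sup>2 * snd p))"
  unfolding evol_def
proof (intro allI impI)
  fix \<phi> \<phi>1 \<phi>2 assume t: "test2 \<phi> \<phi>1 \<phi>2"
  have sc: "(\<integral>x. f x \<partial>lborel) = l * (\<integral>y. f (l * y) \<partial>lborel)" for f :: "real \<Rightarrow> real"
    using lborel_integral_real_affine[of l f 0] l by simp
  have t': "test2 (\<lambda>x. \<phi> (x / l)) (\<lambda>x. \<phi>1 (x / l) / l) (\<lambda>x. \<phi>2 (x / l) / l\<^sup>2)"
    unfolding test2_def
  proof (intro conjI allI)
    note a = t[unfolded test2_def]
    have d: "((\<lambda>x. x / l) has_real_derivative 1 / l) (at x)" for x by (rule DERIV_cdivide[OF DERIV_ident])
    show "((\<lambda>x. \<phi> (x / l)) has_real_derivative \<phi>1 (x / l) / l) (at x)" for x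
      using DERIV_chain2[of \<phi> _ "\<lambda>x. x / l", OF _ d] a by fastforce
    have "((\<lambda>x. \<phi>1 (x / l)) has_real_derivative \<phi>2 (x / l) / l) (at x)" for x
      using DERIV_chain2[of \<phi>1 _ "\<lambda>x. x / l", OF _ d] a by fastforce
    from DERIV_cdivide[OF this, of l]
    show "((\<lambda>x. \<phi>1 (x / l) / l) has_real_derivative \<phi>2 (x / l) / l\<^sup>2) (at x)" for x
      by (simp add: power2_eq_square)
    show "continuous_on UNIV (\<lambda>x. \<phi>2 (x / l) / l\<^sup>2)"
      using a l by (auto intro!: continuous_intros continuous_on_compose2[of UNIV \<phi>2])
    from a obtain R where R: "\<forall>x. R < \<bar>x\<bar> \<longrightarrow> \<phi> x = 0" by blast
    show "\<exists>R. \<forall>x. R < \<bar>x\<bar> \<longrightarrow> \<phi> (x / l) = 0"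
      using R l by (intro exI[of _ "R * l"]) (auto simp: abs_divide less_divide_eq)
  qed
  have eq: "(\<integral>x. \<Phi> (x, s) * (\<phi>2 (x / l) / l\<^sup>2) - h (x, s) * \<phi> (x / l) \<partial>lborel)
     = l * (\<integral>x. \<Phi> (l * x, s) * \<phi>2 x - l\<^sup>2 * h (l * x, s) * \<phi> x \<partial>lborel) / l\<^sup>2" for s
  proof -
    have "(\<integral>x. \<Phi> (x, s) * (\<phi>2 (x / l) / l\<^sup>2) - h (x, s) * \<phi> (x / l) \<partial>lborel)
      = l * (\<integral>x. (\<Phi> (l * x, s) * \<phi>2 x - l\<^sup>2 * h (l * x, s) * \<phi> x) / l\<^sup>2 \<partial>lborel)"
    proof (subst sc, intro arg_cong2[where f="(*)"] refl Bochner_Integration.integral_cong)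
      have "l * x / l = x" for x using l by simp
      then show "\<Phi> (l * x, s) * (\<phi>2 (l * x / l) / l\<^sup>2) - h (l * x, s) * \<phi> (l * x / l)
          = (\<Phi> (l * x, s) * \<phi>2 x - l\<^sup>2 * h (l * x, s) * \<phi> x) / l\<^sup>2" for x
        using l by (simp add: diff_divide_distrib)
    qed
    then show ?thesis by simp
  qed
  have m: "(\<lambda>s. \<integral>x. \<Phi> (x, s) * (\<phi>2 (x / l) / l\<^sup>2) - h (x, s) * \<phi> (x / l) \<partial>lborel) \<in> borel_measurable borel"
    by (rule inner_integral_bound(1)[OF b test2_integrable(3,1)[OF t']])
  have "AE t in lborel. 0 < l\<^sup>2 * t \<longrightarrow> (\<integral>x. w (x, l\<^sup>2 * t) * \<phi> (x / l) \<partial>lborel) = (\<integral>x. w0 x * \<phi> (x / l) \<partial>lborel)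
       + (\<integral>s. (\<integral>x. \<Phi> (x, s) * (\<phi>2 (x / l) / l\<^sup>2) - h (x, s) * \<phi> (x / l) \<partial>lborel) \<partial>Mt (l\<^sup>2 * t))"
    by (rule AE_scale[OF _ e[unfolded evol_def, rule_format, OF t']]) (use l in simp)
  then show "AE t in lborel. 0 < t \<longrightarrow> (\<integral>x. w (l * fst (x, t), l\<^sup>2 * snd (x, t)) * \<phi> x \<partial>lborel) = (\<integral>x. w0 (l * x) * \<phi> x \<partial>lborel)
       + (\<integral>s. (\<integral>x. \<Phi> (l * fst (x, s), l\<^sup>2 * snd (x, s)) * \<phi>2 x - l\<^sup>2 * h (l * fst (x, s), l\<^sup>2 * snd (x, s)) * \<phi> x \<partial>lborel) \<partial>Mt t)"
  proof eventually_elim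
    case (elim t)
    show ?case
    proof
      have sI: "(\<integral>s. (\<integral>x. \<Phi> (x, s) * (\<phi>2 (x / l) / l\<^sup>2) - h (x, s) * \<phi> (x / l) \<partial>lborel) \<partial>Mt (l\<^sup>2 * t))
          = l * (\<integral>r. (\<integral>x. \<Phi> (l * x, l\<^sup>2 * r) * \<phi>2 x - l\<^sup>2 * h (l * x, l\<^sup>2 * r) * \<phi> x \<partial>lborel) \<partial>Mt t)"
        using integral_Mt_scale[OF _ m, of "l\<^sup>2" t] l unfolding eq by simp
      assume "0 < t"
      then have "(\<integral>x. w (x, l\<^sup>2 * t) * \<phi> (x / l) \<partial>lborel) = (\<integral>x. w0 x * \<phi> (x / l) \<partial>lborel)
       + (\<integral>s. (\<integral>x. \<Phi> (x, s) * (\<phi>2 (x / l) / l\<^sup>2) - h (x, s) * \<phi> (x / l) \<partial>lborel) \<partial>Mt (l\<^sup>2 * t))"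
        using elim l by simp
      then have "l * (\<integral>x. w (l * x, l\<^sup>2 * t) * \<phi> x \<partial>lborel) = l * (\<integral>x. w0 (l * x) * \<phi> x \<partial>lborel)
       + l * (\<integral>r. (\<integral>x. \<Phi> (l * x, l\<^sup>2 * r) * \<phi>2 x - l\<^sup>2 * h (l * x, l\<^sup>2 * r) * \<phi> x \<partial>lborel) \<partial>Mt t)"
        unfolding sc[of "\<lambda>x. w (x, l\<^sup>2 * t) * \<phi> (x / l)"] sc[of "\<lambda>x. w0 x * \<phi> (x / l)"]
        using sI l by simp
      then show "(\<integral>x. w (l * fst (x, t), l\<^sup>2 * snd (x, t)) * \<phi> x \<partial>lborel) = (\<integral>x. w0 (l * x) * \<phi> x \<partial>lborel)
       + (\<integral>s. (\<integral>x. \<Phi> (l * fst (x, s), l\<^sup>2 * snd (x, s)) * \<phi>2 x - l\<^sup>2 * h (l * fst (x, s), l\<^sup>2 * snd (x, s)) * \<phi> x \<partial>lborel) \<partial>Mt t)"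
        using l by (simp flip: distrib_left)
    qed
  qed
qed

text \<open>Turns integrals against rho'' into integrals for the weighted measure;
  \<open>abs_rho2_le\<close> makes the quotient bounded.\<close>

definition qrho :: "real \<Rightarrow> real" where "qrho x = rho2 x / rho x"

lemma borel_qrho[measurable]: "qrho \<in> borel_measurable borel"
  unfolding qrho_def[abs_def] by measurable

lemma abs_qrho_le: "\<bar>qrho x\<bar> \<le> 10"
  using abs_rho2_le[of x] rho_pos[of x] by (simp add: qrho_def abs_divide divide_le_eq)

text \<open>The second derivative is of order 1 / R^2; for R >= 1 the weaker order 1 / R lets both
  derivatives be treated alike, and decay as R grows is all that is used.\<close>

lemma bump_derivative_bounds:
  assumes "R \<ge> 1"
  shows "\<bar>bump1 R x\<bar> \<le> 6 / R" "\<bar>bump2 R x\<bar> \<le> 30 / R"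
proof -
  define p where "p = max 0 (1 - (x / R)\<^sup>2)"
  have p: "0 \<le> p" "p \<le> 1" unfolding p_def by auto
  have R0: "R > 0" using assms by simp
  show "\<bar>bump1 R x\<bar> \<le> 6 / R"
  proof (cases "\<bar>x\<bar> > R")
    case True then show ?thesis using bump_outside[OF R0 True] R0 by (simp add: bump1_def)
  next
    case False
    then have "\<bar>2 * x / R\<^sup>2\<bar> \<le> 2 / R" using R0 by (simp add: abs_mult abs_divide power2_eq_square field_simps)
    moreover have "p\<^sup>2 \<le> 1" using p by (simp add: power_le_one)
    ultimately have "p\<^sup>2 * \<bar>2 * x / R\<^sup>2\<bar> \<le> 1 * (2 / R)" by (intro mult_mono) auto
    then show ?thesis unfolding bump1_def p_def[symmetric] by (simp add: abs_mult)
  qed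
  show "\<bar>bump2 R x\<bar> \<le> 30 / R"
  proof (cases "\<bar>x\<bar> > R")
    case True then show ?thesis using bump_outside[OF R0 True] R0 by (simp add: bump2_def)
  next
    case False
    have RR: "1 / R\<^sup>2 \<le> 1 / R" using assms R0 by (simp add: power2_eq_square field_simps)
    have "\<bar>2 * x / R\<^sup>2\<bar> \<le> 2 / R" using False R0 by (simp add: abs_mult abs_divide power2_eq_square field_simps)
    then have "(2 * x / R\<^sup>2)\<^sup>2 \<le> (2 / R)\<^sup>2" by (metis abs_ge_zero power2_abs power_mono)
    then have "(- 2 * x / R\<^sup>2)\<^sup>2 \<le> 4 * (1 / R\<^sup>2)" by (simp add: power_divide)
    then have "(- 2 * x / R\<^sup>2)\<^sup>2 \<le> 4 * (1 / R)" using RR by linarith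
    then have 1: "p * (- 2 * x / R\<^sup>2)\<^sup>2 \<le> 1 * (4 * (1 / R))" using p by (intro mult_mono) auto
    have "p\<^sup>2 \<le> 1" using p by (simp add: power_le_one)
    then have 2: "p\<^sup>2 * (2 / R\<^sup>2) \<le> 1 * (2 * (1 / R))" using RR by (intro mult_mono) auto
    have 0: "0 \<le> p * (- 2 * x / R\<^sup>2)\<^sup>2" "0 \<le> p\<^sup>2 * (2 / R\<^sup>2)" using p by auto
    have "bump2 R x = 6 * (p * (- 2 * x / R\<^sup>2)\<^sup>2) - 3 * (p\<^sup>2 * (2 / R\<^sup>2))"
      unfolding bump2_def p_def by simp
    moreover have "30 / R = 30 * (1 / R)" by simp
    moreover have "0 \<le> 1 / R" using R0 by simp
    ultimately show ?thesis using 0 1 2 by linarith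
  qed
qed

lemma bump_tendsto:
  "(\<lambda>n. bump (real (Suc n)) x) \<longlonglongrightarrow> 1" "(\<lambda>n. bump1 (real (Suc n)) x) \<longlonglongrightarrow> 0" "(\<lambda>n. bump2 (real (Suc n)) x) \<longlonglongrightarrow> 0"
proof -
  have "(\<lambda>n. x / real (Suc n)) \<longlonglongrightarrow> 0"
    using LIMSEQ_Suc[OF lim_const_over_n[of x]] by simp
  then have "(\<lambda>n. (max 0 (1 - (x / real (Suc n))\<^sup>2)) ^ 3) \<longlonglongrightarrow> (max 0 (1 - 0\<^sup>2)) ^ 3"
    by (intro tendsto_power tendsto_max tendsto_diff tendsto_const)
  then show "(\<lambda>n. bump (real (Suc n)) x) \<longlonglongrightarrow> 1" by (simp add: bump_def)
  have c: "(\<lambda>n. c / real (Suc n)) \<longlonglongrightarrow> 0" for c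
    using LIMSEQ_Suc[OF lim_const_over_n[of c]] by simp
  show "(\<lambda>n. bump1 (real (Suc n)) x) \<longlonglongrightarrow> 0"
    by (rule Lim_null_comparison[OF always_eventually c[of 6]]) (use bump_derivative_bounds(1)[of "real (Suc _)"] in auto)
  show "(\<lambda>n. bump2 (real (Suc n)) x) \<longlonglongrightarrow> 0"
    by (rule Lim_null_comparison[OF always_eventually c[of 30]]) (use bump_derivative_bounds(2)[of "real (Suc _)"] in auto)
qed

text \<open>The weight \<open>rho\<close> is not an admissible test function; it is the limit of \<open>rho\<close> times cut-offs.\<close>

lemma evol_rho:
  assumes e: "evol w w0 \<Phi> h" and b: "bdd_borel2 w B" "bdd_borel2 \<Phi> B" "bdd_borel2 h B" "bdd_borel1 w0 B"
  shows "AE t in lborel. 0 < t \<longrightarrow> (\<integral>x. w (x, t) \<partial>Mx) = (\<integral>x. w0 x \<partial>Mx) + (\<integral>p. \<Phi> p * qrho (fst p) - h p \<partial>Q t)"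
proof -
  have [measurable]: "w \<in> borel_measurable (borel \<Otimes>\<^sub>M borel)" "\<Phi> \<in> borel_measurable (borel \<Otimes>\<^sub>M borel)"
    "h \<in> borel_measurable (borel \<Otimes>\<^sub>M borel)" "w0 \<in> borel_measurable borel" using b by auto
  have B: "\<bar>w p\<bar> \<le> B" "\<bar>\<Phi> p\<bar> \<le> B" "\<bar>h p\<bar> \<le> B" "\<bar>w0 x\<bar> \<le> B" for p x using b by blast+
  have B0: "B \<ge> 0" using B(4)[of 0] by linarith
  define f where "f n x = rho x * bump (real (Suc n)) x" for n x
  define f1 where "f1 n x = rho1 x * bump (real (Suc n)) x + rho x * bump1 (real (Suc n)) x" for n x
  define f2 where "f2 n x = rho2 x * bump (real (Suc n)) x + 2 * rho1 x * bump1 (real (Suc n)) x + rho x * bump2 (real (Suc n)) x" for n x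
  have t2: "test2 (f n) (f1 n) (f2 n)" for n
    unfolding test2_def
  proof (intro conjI allI)
    note a = test2_bump[of "real (Suc n)", unfolded test2_def]
    have db: "(bump (real (Suc n)) has_real_derivative bump1 (real (Suc n)) x) (at x)"
      "(bump1 (real (Suc n)) has_real_derivative bump2 (real (Suc n)) x) (at x)" for x using a by auto
    show "(f n has_real_derivative f1 n x) (at x)" for x
      unfolding f_def[abs_def] f1_def
      by (rule DERIV_cong[OF DERIV_mult[OF DERIV_rho db(1)]]) (simp add: algebra_simps)
    show "(f1 n has_real_derivative f2 n x) (at x)" for x
      unfolding f1_def[abs_def] f2_def
      by (rule DERIV_cong[OF DERIV_add[OF DERIV_mult[OF DERIV_rho1 db(1)] DERIV_mult[OF DERIV_rho db(2)]]]) (simp add: algebra_simps)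
    have "continuous_on UNIV rho" "continuous_on UNIV rho1" "continuous_on UNIV (bump (real (Suc n)))"
      "continuous_on UNIV (bump1 (real (Suc n)))" "continuous_on UNIV (bump2 (real (Suc n)))"
      using DERIV_imp_continuous_on[OF DERIV_rho] DERIV_imp_continuous_on[OF DERIV_rho1] DERIV_imp_continuous_on[OF db(1)]
        DERIV_imp_continuous_on[OF db(2)] a by auto
    moreover have "continuous_on UNIV rho2"
      unfolding rho2_def[abs_def] by (intro continuous_intros calculation(1))
    ultimately show "continuous_on UNIV (f2 n)" unfolding f2_def[abs_def] by (intro continuous_intros)
    show "\<exists>R. \<forall>x. R < \<bar>x\<bar> \<longrightarrow> f n x = 0"
      using a unfolding f_def by auto
  qed
  note fm[measurable] = test2_borel[OF t2]
  have bb: "\<bar>bump R x\<bar> \<le> 1" for R x using bump_nonneg[of R x] bump_le_1[of R x] by simp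
  have fb: "\<bar>f n x\<bar> \<le> rho x" for n x
    unfolding f_def using mult_left_mono[OF bb, of "rho x"] rho_pos[of x] by (simp add: abs_mult)
  \<comment> \<open>From |\<open>rho2\<close>| <= 10 \<open>rho\<close>, |\<open>rho1\<close>| <=
    \<open>rho\<close> and the bounds 6 and 30 for the derivatives of the cut-off; 10 + 2 * 6 + 30
    is below 60.\<close>
  have f2b: "\<bar>f2 n x\<bar> \<le> 60 * rho x" for n x
  proof -
    let ?R = "real (Suc n)"
    have b1: "\<bar>bump1 ?R x\<bar> \<le> 6" "\<bar>bump2 ?R x\<bar> \<le> 30"
      using bump_derivative_bounds[of ?R x] by (auto intro: order_trans simp: divide_le_eq)
    have "\<bar>rho2 x * bump ?R x\<bar> \<le> (10 * rho x) * 1" "\<bar>rho1 x * bump1 ?R x\<bar> \<le> rho x * 6" "\<bar>rho x * bump2 ?R x\<bar> \<le> rho x * 30"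
      unfolding abs_mult using rho_pos[of x] by (intro mult_mono abs_rho2_le abs_rho1_le bb b1; simp)+
    then show ?thesis unfolding f2_def using rho_pos[of x] by linarith
  qed
  have fl: "(\<lambda>n. f n x) \<longlonglongrightarrow> rho x" for x
    unfolding f_def using tendsto_mult_left[OF bump_tendsto(1), of "rho x" x] by simp
  have f2l: "(\<lambda>n. f2 n x) \<longlonglongrightarrow> rho2 x" for x
  proof -
    have "(\<lambda>n. f2 n x) \<longlonglongrightarrow> rho2 x * 1 + 2 * rho1 x * 0 + rho x * 0"
      unfolding f2_def by (intro tendsto_add tendsto_mult_left bump_tendsto)
    then show ?thesis by simp
  qed
  have L: "(\<lambda>n. \<integral>x. g x * f n x \<partial>lborel) \<longlonglongrightarrow> (\<integral>x. g x \<partial>Mx)" if g: "g \<in> borel_measurable borel" "\<And>x. \<bar>g x\<bar> \<le> B" for g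
  proof -
    have [measurable]: "g \<in> borel_measurable borel" by (rule g)
    have "(\<lambda>n. \<integral>x. g x * f n x \<partial>lborel) \<longlonglongrightarrow> (\<integral>x. g x * rho x \<partial>lborel)"
    proof (rule integral_dominated_convergence[where w="\<lambda>x. B * rho x"])
      show "AE x in lborel. (\<lambda>n. g x * f n x) \<longlonglongrightarrow> g x * rho x" by (intro AE_I2 tendsto_mult_left fl)
      show "AE x in lborel. norm (g x * f n x) \<le> B * rho x" for n
        by (intro AE_I2) (use mult_mono[OF g(2) fb] B0 in \<open>simp add: abs_mult\<close>)
    qed (use integrable_rho in auto)
    then show ?thesis by (simp add: integral_Mx mult.commute)
  qed
  define H where "H n s = (\<integral>x. \<Phi> (x, s) * f2 n x - h (x, s) * f n x \<partial>lborel)" for n s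
  define H0 where "H0 s = (\<integral>x. \<Phi> (x, s) * qrho x - h (x, s) \<partial>Mx)" for s
  have Hm[measurable]: "H n \<in> borel_measurable borel" for n unfolding H_def by measurable
  have H0m[measurable]: "H0 \<in> borel_measurable borel" unfolding H0_def by measurable
  have pw: "\<bar>\<Phi> p * f2 n x - h p * f n x\<bar> \<le> 61 * B * rho x" for p n x
  proof -
    have "\<bar>\<Phi> p * f2 n x\<bar> \<le> B * (60 * rho x)" "\<bar>h p * f n x\<bar> \<le> B * rho x"
      unfolding abs_mult by (intro mult_mono B f2b fb; simp add: B0)+
    then show ?thesis by (simp add: abs_le_iff)
  qed
  have HL: "(\<lambda>n. H n s) \<longlonglongrightarrow> H0 s" for s
  proof -
    have "(\<lambda>n. H n s) \<longlonglongrightarrow> (\<integral>x. \<Phi> (x, s) * rho2 x - h (x, s) * rho x \<partial>lborel)"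
      unfolding H_def
    proof (rule integral_dominated_convergence[where w="\<lambda>x. 61 * B * rho x"])
      show "AE x in lborel. (\<lambda>n. \<Phi> (x, s) * f2 n x - h (x, s) * f n x) \<longlonglongrightarrow> \<Phi> (x, s) * rho2 x - h (x, s) * rho x"
        by (intro AE_I2 tendsto_diff tendsto_mult_left fl f2l)
      show "AE x in lborel. norm (\<Phi> (x, s) * f2 n x - h (x, s) * f n x) \<le> 61 * B * rho x" for n
        unfolding real_norm_def by (intro AE_I2 pw)
    qed (use integrable_rho in auto)
    moreover have "(\<integral>x. \<Phi> (x, s) * rho2 x - h (x, s) * rho x \<partial>lborel) = H0 s"
      unfolding H0_def by (subst integral_Mx, measurable, rule Bochner_Integration.integral_cong)
        (use less_imp_neq[OF rho_pos] in \<open>auto simp: qrho_def field_simps\<close>)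
    ultimately show ?thesis by simp
  qed
  have HB: "\<bar>H n s\<bar> \<le> 61 * B * (\<integral>x. rho x \<partial>lborel)" for n s
  proof -
    have "\<bar>H n s\<bar> \<le> (\<integral>x. \<bar>\<Phi> (x, s) * f2 n x - h (x, s) * f n x\<bar> \<partial>lborel)" unfolding H_def by (rule integral_abs_bound)
    also have "\<dots> \<le> (\<integral>x. 61 * B * rho x \<partial>lborel)"
    proof (rule integral_mono)
      show "integrable lborel (\<lambda>x. 61 * B * rho x)" using integrable_rho by simp
      then show "integrable lborel (\<lambda>x. \<bar>\<Phi> (x, s) * f2 n x - h (x, s) * f n x\<bar>)"
        by (rule Bochner_Integration.integrable_bound) (measurable, simp, intro AE_I2 order_trans[OF pw abs_ge_self])
    qed (rule pw)
    finally show ?thesis by simp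
  qed
  have TL: "(\<lambda>n. \<integral>s. H n s \<partial>Mt t) \<longlonglongrightarrow> (\<integral>s. H0 s \<partial>Mt t)" for t
    by (rule integral_dominated_convergence[where w="\<lambda>_. 61 * B * (\<integral>x. rho x \<partial>lborel)"])
      (use HL HB in auto)
  \<comment> \<open>The null set of times in \<open>evol\<close> depends on the test function; for
    countably many cut-offs a single one suffices.\<close>
  have "AE t in lborel. \<forall>n. 0 < t \<longrightarrow> (\<integral>x. w (x, t) * f n x \<partial>lborel) = (\<integral>x. w0 x * f n x \<partial>lborel) + (\<integral>s. H n s \<partial>Mt t)"
    unfolding AE_all_countable H_def using e[unfolded evol_def] t2 by blast
  then show ?thesis
  proof eventually_elim
    case (elim t)
    show ?case
    proof
      assume "0 < t"
      then have "(\<lambda>n. \<integral>x. w (x, t) * f n x \<partial>lborel) = (\<lambda>n. (\<integral>x. w0 x * f n x \<partial>lborel) + (\<integral>s. H n s \<partial>Mt t))"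
        using elim by auto
      moreover have "(\<lambda>n. \<integral>x. w (x, t) * f n x \<partial>lborel) \<longlonglongrightarrow> (\<integral>x. w (x, t) \<partial>Mx)"
        by (rule L) (measurable, rule B)
      moreover have "(\<lambda>n. (\<integral>x. w0 x * f n x \<partial>lborel) + (\<integral>s. H n s \<partial>Mt t)) \<longlonglongrightarrow> (\<integral>x. w0 x \<partial>Mx) + (\<integral>s. H0 s \<partial>Mt t)"
        by (intro tendsto_add TL L) (measurable, rule B)
      moreover have "(\<integral>s. H0 s \<partial>Mt t) = (\<integral>p. \<Phi> p * qrho (fst p) - h p \<partial>Q t)"
      proof -
        have "\<bar>\<Phi> p * qrho (fst p) - h p\<bar> \<le> B * 10 + B" for p
        proof -
          have "\<bar>\<Phi> p * qrho (fst p)\<bar> \<le> B * 10" unfolding abs_mult by (intro mult_mono B abs_qrho_le) (use B0 in auto)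
          then show ?thesis using B(3)[of p] by linarith
        qed
        then show ?thesis unfolding H0_def by (subst Q_iterated(1)) auto
      qed
      ultimately show "(\<integral>x. w (x, t) \<partial>Mx) = (\<integral>x. w0 x \<partial>Mx) + (\<integral>p. \<Phi> p * qrho (fst p) - h p \<partial>Q t)"
        using LIMSEQ_unique by force
    qed
  qed
qed

section \<open>The interface equation\<close>

text \<open>Up to normalisation \<open>gk d\<close> is the heat kernel of diffusivity d at time 1,
  and \<open>GA d\<close> is its distribution function. Both diffusive branches of the profile are
  affine in \<open>GA\<close>.\<close>

definition gk :: "real \<Rightarrow> real \<Rightarrow> real" where "gk d s = exp (- s\<^sup>2 / (4 * d))"
definition GA :: "real \<Rightarrow> real \<Rightarrow> real" where "GA d x = (\<integral>s. indicator {..x} s * gk d s \<partial>lborel)"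

lemma gk_pos: "0 < gk d s" unfolding gk_def by simp

lemma borel_gk[measurable]: "gk d \<in> borel_measurable borel" unfolding gk_def[abs_def] by measurable

lemma DERIV_gk: assumes "d > 0" shows "(gk d has_real_derivative - (s / (2 * d)) * gk d s) (at s)"
  unfolding gk_def[abs_def] using assms by (auto intro!: derivative_eq_intros)

lemma continuous_gk: "d > 0 \<Longrightarrow> continuous_on S (gk d)"
  by (rule DERIV_imp_continuous_on[OF DERIV_gk])

lemma integrable_gk: assumes "d > 0" shows "integrable lborel (gk d)"
proof -
  have "integrable lborel (\<lambda>x. sqrt (2 * pi * (sqrt (2 * d))\<^sup>2) * normal_density 0 (sqrt (2 * d)) x)"
    using assms by (intro integrable_mult_right integrable_normal_density) simp
  moreover have "sqrt (2 * pi * (sqrt (2 * d))\<^sup>2) * normal_density 0 (sqrt (2 * d)) x = gk d x" for x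
    using assms by (simp add: normal_density_def gk_def)
  ultimately show ?thesis by simp
qed

lemma integrable_gk_ind:
  assumes "d > 0" "A \<in> sets borel" shows "integrable lborel (\<lambda>s. indicator A s * gk d s)"
  by (rule integrable_mult_bounded[OF integrable_gk[OF assms(1)], where B=1]) (use assms in \<open>auto simp: indicator_def\<close>)

lemma FTC_continuous:
  fixes A f :: "real \<Rightarrow> real"
  assumes d: "\<And>x. (A has_real_derivative f x) (at x)" and c: "continuous_on UNIV f" and ab: "a \<le> b"
  shows "(\<integral>x. indicator {a..b} x * f x \<partial>lborel) = A b - A a"
proof -
  have "bounded (f ` {a..b})"
    by (intro compact_imp_bounded compact_continuous_image continuous_on_subset[OF c]) auto
  then obtain B where B: "\<And>x. x \<in> {a..b} \<Longrightarrow> \<bar>f x\<bar> \<le> B" unfolding bounded_iff by (metis image_eqI real_norm_def)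
  show ?thesis
    by (rule FTC_bounded[OF ab DERIV_imp_continuous_on[OF d] d borel_measurable_continuous_onI[OF c] B]) auto
qed

lemma GA_diff:
  assumes d: "d > 0" and ab: "a \<le> b"
  shows "GA d b - GA d a = (\<integral>s. indicator {a..b} s * gk d s \<partial>lborel)"
proof -
  have "GA d b = (\<integral>s. indicator {..a} s * gk d s + indicator {a<..b} s * gk d s \<partial>lborel)"
    unfolding GA_def by (rule Bochner_Integration.integral_cong) (use ab in \<open>auto simp: indicator_def\<close>)
  also have "\<dots> = GA d a + (\<integral>s. indicator {a<..b} s * gk d s \<partial>lborel)"
    unfolding GA_def by (intro Bochner_Integration.integral_add integrable_gk_ind d) auto
  also have "(\<integral>s. indicator {a<..b} s * gk d s \<partial>lborel) = (\<integral>s. indicator {a..b} s * gk d s \<partial>lborel)"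
  proof (rule integral_cong_AE)
    show "AE s in lborel. indicator {a<..b} s * gk d s = indicator {a..b} s * gk d s"
      using AE_lborel_singleton[of a] by eventually_elim (auto simp: indicator_def)
  qed auto
  finally show ?thesis by simp
qed

text \<open>Near x the half-line integral differs by a constant from an antiderivative of the
  continuous integrand on a bounded interval.\<close>

lemma DERIV_GA:
  assumes d: "d > 0" shows "(GA d has_real_derivative gk d x) (at x)"
proof -
  obtain P where P: "\<And>y. y \<in> {x - 1..x + 1} \<Longrightarrow> (P has_vector_derivative gk d y) (at y within {x - 1..x + 1})"
    using antiderivative_continuous[OF continuous_gk[OF d]] by metis
  have dP: "(P has_real_derivative gk d y) (at y)" if "y \<in> {x - 1<..<x + 1}" for y
    using P[of y] that by (simp add: has_real_derivative_iff_has_vector_derivative at_within_Icc_at)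
  have "GA d y = GA d (x - 1) + P y - P (x - 1)" if "y \<in> {x - 1<..<x + 1}" for y
  proof -
    have "(\<integral>s. indicator {x - 1..y} s * gk d s \<partial>lborel) = P y - P (x - 1)"
    proof (rule FTC_bounded[where B=1])
      show "continuous_on {x - 1..y} P"
        by (rule continuous_on_subset[of "{x - 1..x + 1}"])
          (use P that in \<open>auto intro!: continuous_on_vector_derivative[of _ _ "gk d"]\<close>)
      show "\<bar>gk d s\<bar> \<le> 1" for s using d by (simp add: gk_def divide_nonneg_nonneg)
    qed (use that dP in auto)
    then show ?thesis using GA_diff[OF d, of "x - 1" y] that by simp
  qed
  then have ev: "GA d y = GA d (x - 1) + P y - P (x - 1)" if "y \<in> {x - 1<..<x + 1}" for y using that by blast
  have "((\<lambda>y. GA d (x - 1) + P y - P (x - 1)) has_real_derivative gk d x) (at x)"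
    using dP[of x] by (auto intro!: derivative_eq_intros)
  then show ?thesis
    by (rule has_field_derivative_transform_within_open[of _ _ _ "{x - 1<..<x + 1}"]) (use ev in auto)
qed

lemma lborel_integral_neg:
  fixes f :: "real \<Rightarrow> real" shows "(\<integral>s. f s \<partial>lborel) = (\<integral>s. f (- s) \<partial>lborel)"
  using lborel_integral_reflect[of f 0] by simp

lemma GA_reflect: "(\<integral>s. indicator {x..} s * gk d s \<partial>lborel) = GA d (- x)"
  unfolding GA_def
  by (subst lborel_integral_neg, rule Bochner_Integration.integral_cong) (auto simp: gk_def indicator_def)

lemma GA_strict_mono: assumes "d > 0" "x < y" shows "GA d x < GA d y"
  by (rule DERIV_pos_imp_increasing[OF assms(2)]) (use DERIV_GA[OF assms(1)] gk_pos in blast)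

lemma GA_nonneg: "GA d x \<ge> 0"
  unfolding GA_def using gk_pos[of d] by (intro Bochner_Integration.integral_nonneg) (auto simp: less_imp_le)

lemma GA_pos: assumes "d > 0" shows "GA d x > 0"
  using GA_strict_mono[OF assms, of "x - 1" x] GA_nonneg[of d "x - 1"] by linarith

lemma GA_tendsto_0: assumes "d > 0" shows "(GA d \<longlongrightarrow> 0) at_bot"
  unfolding filterlim_at_bot_mirror
proof (rule tendsto_at_topI_sequentially)
  fix X :: "nat \<Rightarrow> real" assume X: "filterlim X at_top sequentially"
  have "(\<lambda>n. \<integral>s. indicator {..- X n} s * gk d s \<partial>lborel) \<longlonglongrightarrow> (\<integral>s. 0 \<partial>(lborel :: real measure))"
  proof (rule integral_dominated_convergence[where w="gk d"])
    show "AE s in lborel. (\<lambda>n. indicator {..- X n} s * gk d s) \<longlonglongrightarrow> 0"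
    proof (rule AE_I2)
      fix s :: real
      have "\<forall>\<^sub>F n in sequentially. X n > - s" using X by (simp add: filterlim_at_top_dense)
      then have "\<forall>\<^sub>F n in sequentially. indicator {..- X n} s * gk d s = 0" by eventually_elim (auto simp: indicator_def)
      then show "(\<lambda>n. indicator {..- X n} s * gk d s) \<longlonglongrightarrow> 0" by (rule tendsto_eventually)
    qed
  qed (use integrable_gk[OF assms] gk_pos[of d] in \<open>auto simp: indicator_def less_imp_le\<close>)
  then show "(\<lambda>n. GA d (- X n)) \<longlonglongrightarrow> 0" unfolding GA_def by simp
qed

text \<open>With the Mills ratio \<open>mills\<close> the interface equation compares an increasing and a decreasing function of \<open>a\<close>.\<close>

definition mills :: "real \<Rightarrow> real \<Rightarrow> real" where "mills d a = exp (a\<^sup>2 / (4 * d)) * GA d a"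

text \<open>After the substitution s = a - r the domain is free of a, and for each r > 0 the
  integrand increases with a. Monotonicity and the limit at minus infinity can be read off.\<close>

lemma mills_eq: "mills d a = (\<integral>r. indicator {0..} r * exp ((2 * a * r - r\<^sup>2) / (4 * d)) \<partial>lborel)"
proof -
  have "mills d a = (\<integral>s. indicator {..a} s * exp ((a\<^sup>2 - s\<^sup>2) / (4 * d)) \<partial>lborel)"
    unfolding mills_def GA_def gk_def
    by (subst integral_mult_right_zero[symmetric], rule Bochner_Integration.integral_cong)
      (auto simp: diff_divide_distrib exp_add[symmetric] mult.left_commute)
  also have "\<dots> = (\<integral>r. indicator {..a} (a - r) * exp ((a\<^sup>2 - (a - r)\<^sup>2) / (4 * d)) \<partial>lborel)"
    by (rule lborel_integral_reflect[symmetric])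
  also have "\<dots> = (\<integral>r. indicator {0..} r * exp ((2 * a * r - r\<^sup>2) / (4 * d)) \<partial>lborel)"
    by (rule Bochner_Integration.integral_cong) (auto simp: indicator_def power2_eq_square algebra_simps)
  finally show ?thesis .
qed

lemma integral_less_lborel:
  fixes f g :: "real \<Rightarrow> real"
  assumes i: "integrable lborel f" "integrable lborel g"
    and le: "\<And>x. f x \<le> g x" and lt: "\<And>x. x \<in> {a..b} \<Longrightarrow> f x < g x" and ab: "a < b"
  shows "(\<integral>x. f x \<partial>lborel) < (\<integral>x. g x \<partial>lborel)"
proof -
  have ii: "integrable lborel (\<lambda>x. g x - f x)" using i by simp
  have "\<not> (AE x in lborel. g x - f x = 0)"
  proof
    assume "AE x in lborel. g x - f x = 0"
    then have "AE x in lborel. x \<notin> {a..b}" by (rule AE_mp) (use lt in force)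
    then have "emeasure lborel {a..b} = 0" by (subst (asm) AE_iff_measurable[of "{a..b}"]) auto
    then show False using ab by (simp add: emeasure_lborel_Icc_eq)
  qed
  then have "(\<integral>x. g x - f x \<partial>lborel) \<noteq> 0"
    using integral_nonneg_eq_0_iff_AE[OF ii] le by auto
  moreover have "(\<integral>x. g x - f x \<partial>lborel) \<ge> 0" using le by simp
  ultimately show ?thesis using i by simp
qed

lemma mills_integrable:
  fixes a d :: real
  assumes "d > 0" shows "integrable lborel (\<lambda>r. indicator {0..} r * exp ((2 * a * r - r\<^sup>2) / (4 * d)))"
proof -
  have "integrable lborel (\<lambda>s. exp (a\<^sup>2 / (4 * d)) * (indicator {..a} s * gk d s))"
    by (intro integrable_mult_right integrable_gk_ind assms) auto
  from lborel_integrable_reflect[OF this, of a]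
  have "integrable lborel (\<lambda>r. exp (a\<^sup>2 / (4 * d)) * (indicator {..a} (a - r) * gk d (a - r)))" .
  moreover have "exp (a\<^sup>2 / (4 * d)) * (indicator {..a} (a - r) * gk d (a - r)) = indicator {0..} r * exp ((2 * a * r - r\<^sup>2) / (4 * d))" for r
    by (auto simp: indicator_def gk_def exp_add[symmetric] add_divide_distrib[symmetric] power2_eq_square algebra_simps)
  ultimately show ?thesis by simp
qed

lemma mills_strict_mono:
  assumes d: "d > 0" and ab: "a < b" shows "mills d a < mills d b"
proof -
  have lt: "exp ((2 * a * r - r\<^sup>2) / (4 * d)) < exp ((2 * b * r - r\<^sup>2) / (4 * d))" if "r > 0" for r
    using that ab d by (simp add: divide_strict_right_mono)
  show ?thesis
    unfolding mills_eq
  proof (rule integral_less_lborel[OF mills_integrable[OF d] mills_integrable[OF d], where a=1 and b=2])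
    show "indicator {0..} r * exp ((2 * a * r - r\<^sup>2) / (4 * d)) \<le> indicator {0..} r * exp ((2 * b * r - r\<^sup>2) / (4 * d))" for r
      using lt[of r] by (cases "r > 0"; cases "r = 0") (auto simp: indicator_def)
  qed (use lt in auto)
qed

lemma mills_pos: "d > 0 \<Longrightarrow> mills d a > 0"
  unfolding mills_def using GA_pos by simp

lemma continuous_mills: "d > 0 \<Longrightarrow> continuous_on S (mills d)"
  unfolding mills_def[abs_def]
  by (intro continuous_intros DERIV_imp_continuous_on[OF DERIV_GA]) auto

lemma mills_tendsto_0: assumes d: "d > 0" shows "(\<lambda>n. mills d (- real n)) \<longlonglongrightarrow> 0"
proof -
  have "(\<lambda>n. \<integral>r. indicator {0..} r * exp ((2 * (- real n) * r - r\<^sup>2) / (4 * d)) \<partial>lborel) \<longlonglongrightarrow> (\<integral>r. 0 \<partial>(lborel :: real measure))"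
  proof (rule integral_dominated_convergence[where w="\<lambda>r. indicator {0..} r * exp ((2 * 0 * r - r\<^sup>2) / (4 * d))"])
    show "AE r in lborel. (\<lambda>n. indicator {0..} r * exp ((2 * (- real n) * r - r\<^sup>2) / (4 * d))) \<longlonglongrightarrow> 0"
      using AE_lborel_singleton[of 0]
    proof eventually_elim
      fix r :: real assume r: "r \<noteq> 0"
      show "(\<lambda>n. indicator {0..} r * exp ((2 * (- real n) * r - r\<^sup>2) / (4 * d))) \<longlonglongrightarrow> 0"
      proof (cases "r > 0")
        case True
        then have "(\<lambda>n. exp ((2 * (- real n) * r - r\<^sup>2) / (4 * d))) \<longlonglongrightarrow> 0" using d by real_asymp
        then show ?thesis using True by simp
      qed (use r in auto)
    qed
    show "AE r in lborel. norm (indicator {0..} r * exp ((2 * (- real n) * r - r\<^sup>2) / (4 * d))) \<le> indicator {0..} r * exp ((2 * 0 * r - r\<^sup>2) / (4 * d))" for n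
    proof (rule AE_I2)
      fix r :: real
      have "(2 * (- real n) * r - r\<^sup>2) / (4 * d) \<le> (2 * 0 * r - r\<^sup>2) / (4 * d)" if "r \<ge> 0"
        using that d by (intro divide_right_mono) auto
      then show "norm (indicator {0..} r * exp ((2 * (- real n) * r - r\<^sup>2) / (4 * d))) \<le> indicator {0..} r * exp ((2 * 0 * r - r\<^sup>2) / (4 * d))"
        unfolding indicator_def by simp
    qed
    show "integrable lborel (\<lambda>r. indicator {0..} r * exp ((2 * 0 * r - r\<^sup>2) / (4 * d)))" by (rule mills_integrable[OF d])
  qed auto
  then show ?thesis unfolding mills_eq by simp
qed

lemma interface_eq_mills:
  assumes "du > 0" "dv \<ge> 0"
  shows "interface_eq du dv U0 V0 a \<longleftrightarrow> (if dv > 0 then du * U0 * mills dv (- a) = dv * V0 * mills du a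
     else a > 0 \<and> U0 = V0 * a / (2 * du) * mills du a)"
proof -
  have 1: "(\<integral>s\<in>{..a}. exp ((a\<^sup>2 - s\<^sup>2) / (4 * d)) \<partial>lborel) = mills d a" for d
    unfolding mills_def GA_def gk_def set_lebesgue_integral_def
    by (subst integral_mult_right_zero[symmetric], rule Bochner_Integration.integral_cong)
      (auto simp: diff_divide_distrib exp_add[symmetric] mult.left_commute)
  have 2: "(\<integral>s\<in>{a..}. exp ((a\<^sup>2 - s\<^sup>2) / (4 * d)) \<partial>lborel) = mills d (- a)" for d
  proof -
    have "(\<integral>s\<in>{a..}. exp ((a\<^sup>2 - s\<^sup>2) / (4 * d)) \<partial>lborel) = exp (a\<^sup>2 / (4 * d)) * (\<integral>s. indicator {a..} s * gk d s \<partial>lborel)"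
      unfolding gk_def set_lebesgue_integral_def
      by (subst integral_mult_right_zero[symmetric], rule Bochner_Integration.integral_cong)
        (auto simp: diff_divide_distrib exp_add[symmetric] mult.left_commute)
    then show ?thesis unfolding GA_reflect mills_def by simp
  qed
  show ?thesis unfolding interface_eq_def 1 2 ..
qed

lemma interface_root:
  assumes du: "du > 0" and dv: "dv \<ge> 0" and U: "U0 > 0" and V: "V0 > 0"
  shows "\<exists>!a. interface_eq du dv U0 V0 a"
proof (cases "dv > 0")
  case True
  define F where "F a = dv * V0 * mills du a - du * U0 * mills dv (- a)" for a
  have p: "0 < dv * V0" "0 < du * U0" using True du U V by simp_all
  have sm: "F a < F b" if "a < b" for a b
  proof -
    have "dv * V0 * mills du a < dv * V0 * mills du b"
      by (rule mult_strict_left_mono[OF mills_strict_mono[OF du that] p(1)])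
    moreover have "du * U0 * mills dv (- b) < du * U0 * mills dv (- a)"
      by (rule mult_strict_left_mono[OF mills_strict_mono[OF True] p(2)]) (use that in simp)
    ultimately show ?thesis unfolding F_def by linarith
  qed
  have "continuous_on S (\<lambda>a. mills dv (- a))" for S
    by (rule continuous_on_compose2[OF continuous_mills[OF True, of UNIV]]) (auto intro!: continuous_intros)
  then have cF: "continuous_on S F" for S
    unfolding F_def[abs_def] by (intro continuous_on_diff continuous_on_mult_left continuous_mills[OF du])
  have small: "\<exists>n. c * mills d (- real n) < e" if "d > 0" "e > 0" for c d e :: real
  proof -
    have "(\<lambda>n. c * mills d (- real n)) \<longlonglongrightarrow> c * 0" by (intro tendsto_mult_left mills_tendsto_0 that)
    then have "\<forall>\<^sub>F n in sequentially. c * mills d (- real n) < e"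
      by (rule order_tendstoD) (use that in simp)
    then show ?thesis by (meson eventually_happens trivial_limit_sequentially)
  qed
  \<comment> \<open>The side that tends to 0 is made smaller than the value of the other side at 0,
    which by monotonicity is a lower bound for that side at n; similarly at -n'.\<close>
  obtain n where n: "du * U0 * mills dv (- real n) < dv * V0 * mills du 0"
    using small[OF True mult_pos_pos[OF p(1) mills_pos[OF du]]] by blast
  obtain n' where n': "dv * V0 * mills du (- real n') < du * U0 * mills dv 0"
    using small[OF du mult_pos_pos[OF p(2) mills_pos[OF True]]] by blast
  have mono: "mills d 0 \<le> mills d (real n)" if "d > 0" for d n
    using mills_strict_mono[OF that, of 0 "real n"] by (cases "n = 0") (simp_all add: less_imp_le)
  have "dv * V0 * mills du 0 \<le> dv * V0 * mills du (real n)" "du * U0 * mills dv 0 \<le> du * U0 * mills dv (real n')"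
    using p by (simp_all add: mult_left_mono[OF mono[OF du]] mult_left_mono[OF mono[OF True]])
  then have "F (real n) > 0" "F (- real n') < 0" unfolding F_def using n n' by simp_all
  then have "\<exists>a. - real n' \<le> a \<and> a \<le> real n \<and> F a = 0"
    by (intro IVT' cF) simp_all
  then obtain a where a: "F a = 0" by blast
  have u: "b = a" if "F b = 0" for b
    using sm[of a b] sm[of b a] a that by (cases a b rule: linorder_cases) simp_all
  have "interface_eq du dv U0 V0 b \<longleftrightarrow> F b = 0" for b
    unfolding interface_eq_mills[OF du dv] F_def if_P[OF True] by linarith
  note iff = this
  show ?thesis
    by (rule ex1I[of _ a]; unfold iff) (rule a, erule u)
next
  case False
  define F where "F a = V0 * a / (2 * du) * mills du a" for a
  have sm: "F a < F b" if "0 < a" "a < b" for a b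
  proof -
    have "V0 * a / (2 * du) < V0 * b / (2 * du)" using that du V by (simp add: divide_strict_right_mono)
    moreover have "0 < V0 * b / (2 * du)" using that du V by simp
    ultimately show ?thesis
      unfolding F_def using mills_strict_mono[OF du that(2)] mills_pos[OF du, of a] by (intro mult_strict_mono) auto
  qed
  have cF: "continuous_on S F" for S
    unfolding F_def[abs_def] using continuous_mills[OF du] du by (intro continuous_intros) auto
  \<comment> \<open>With \<open>mills du 0\<close> in place of \<open>mills du b\<close> the
    right-hand side equals U0 at this b. Hence F b >= U0, while F 0 = 0.\<close>
  define b where "b = 2 * du * U0 / (V0 * mills du 0)"
  have b0: "b > 0" unfolding b_def using du U V mills_pos[OF du] by simp
  have "V0 * b / (2 * du) * mills du 0 = U0"
    unfolding b_def using du V mills_pos[OF du, of 0] by (simp add: field_simps)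
  moreover have "V0 * b / (2 * du) * mills du 0 \<le> F b"
    unfolding F_def using mills_strict_mono[OF du b0] du V b0 by (intro mult_left_mono) auto
  ultimately have "U0 \<le> F b" by simp
  moreover have "F 0 \<le> U0" unfolding F_def using U by simp
  ultimately have "\<exists>a. 0 \<le> a \<and> a \<le> b \<and> F a = U0"
    using b0 by (intro IVT' cF) simp_all
  then obtain a where a: "0 \<le> a" "F a = U0" by blast
  have a0: "a > 0" using a U by (cases "a = 0") (simp_all add: F_def)
  have u: "b = a" if "F b = U0" "b > 0" for b
    using sm[of a b] sm[of b a] a a0 that by (cases a b rule: linorder_cases) simp_all
  have "interface_eq du dv U0 V0 b \<longleftrightarrow> 0 < b \<and> F b = U0" for b
    unfolding interface_eq_mills[OF du dv] F_def if_not_P[OF False] by metis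
  note iff = this
  show ?thesis
    by (rule ex1I[of _ a]; unfold iff) (intro conjI a0 a, elim conjE, rule u)
qed

section \<open>The self-similar solution\<close>

text \<open>The profile is the self-similar solution of the limit problem \<open>w\<^sub>t = (Dfun w)\<^sub>x\<^sub>x\<close>, a free boundary problem in
  which \<open>u = max w 0\<close> and \<open>v = - min w 0\<close>; the interface equation is its flux balance at \<open>a\<close>.\<close>

definition Dfun :: "real \<Rightarrow> real \<Rightarrow> real \<Rightarrow> real" where
  "Dfun du dv s = du * max s 0 + dv * min s 0"

text \<open>The branches are defined on the whole line, so that their derivatives at the interface a
  are ordinary two-sided ones.\<close>

definition fL :: "real \<Rightarrow> real \<Rightarrow> real \<Rightarrow> real \<Rightarrow> real" where
  "fL du U0 a \<eta> = U0 * (1 - GA du \<eta> / GA du a)"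

definition fR :: "real \<Rightarrow> real \<Rightarrow> real \<Rightarrow> real \<Rightarrow> real" where
  "fR dv V0 a \<eta> = (if dv > 0 then - V0 * (1 - GA dv (- \<eta>) / GA dv (- a)) else - V0)"

lemma profile_eq: "profile du dv U0 V0 a \<eta> = (if \<eta> \<le> a then fL du U0 a \<eta> else fR dv V0 a \<eta>)"
proof -
  have 1: "(\<integral>s\<in>{..x}. exp (- s\<^sup>2 / (4 * d)) \<partial>lborel) = GA d x" for d x
    unfolding GA_def gk_def set_lebesgue_integral_def by simp
  have 2: "(\<integral>s\<in>{x..}. exp (- s\<^sup>2 / (4 * d)) \<partial>lborel) = GA d (- x)" for d x
    unfolding GA_reflect[symmetric] gk_def set_lebesgue_integral_def by simp
  show ?thesis unfolding profile_def 1 2 fL_def fR_def by simp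
qed

lemma DERIV_fL:
  assumes "du > 0"
  shows "(fL du U0 a has_real_derivative (- U0 / GA du a) * gk du \<eta>) (at \<eta>)"
    "((\<lambda>\<eta>. (- U0 / GA du a) * gk du \<eta>) has_real_derivative (- U0 / GA du a) * (- (\<eta> / (2 * du)) * gk du \<eta>)) (at \<eta>)"
proof -
  have "((\<lambda>\<eta>. U0 + (- U0 / GA du a) * GA du \<eta>) has_real_derivative 0 + (- U0 / GA du a) * gk du \<eta>) (at \<eta>)"
    by (intro DERIV_add DERIV_const DERIV_cmult DERIV_GA assms)
  then show "(fL du U0 a has_real_derivative (- U0 / GA du a) * gk du \<eta>) (at \<eta>)"
    unfolding fL_def[abs_def] by (simp add: right_diff_distrib)
  show "((\<lambda>\<eta>. (- U0 / GA du a) * gk du \<eta>) has_real_derivative (- U0 / GA du a) * (- (\<eta> / (2 * du)) * gk du \<eta>)) (at \<eta>)"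
    by (intro DERIV_cmult DERIV_gk assms)
qed

definition fR1 :: "real \<Rightarrow> real \<Rightarrow> real \<Rightarrow> real \<Rightarrow> real" where
  "fR1 dv V0 a \<eta> = (if dv > 0 then (- V0 / GA dv (- a)) * gk dv \<eta> else 0)"

definition fR2 :: "real \<Rightarrow> real \<Rightarrow> real \<Rightarrow> real \<Rightarrow> real" where
  "fR2 dv V0 a \<eta> = (if dv > 0 then (- V0 / GA dv (- a)) * (- (\<eta> / (2 * dv)) * gk dv \<eta>) else 0)"

lemma DERIV_fR:
  shows "(fR dv V0 a has_real_derivative fR1 dv V0 a \<eta>) (at \<eta>)"
    "(fR1 dv V0 a has_real_derivative fR2 dv V0 a \<eta>) (at \<eta>)"
proof -
  have g: "((\<lambda>\<eta>. GA dv (- \<eta>)) has_real_derivative - gk dv \<eta>) (at \<eta>)" if "dv > 0"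
    using DERIV_reflect[of "GA dv" "gk dv" 0, OF DERIV_GA[OF that]] by (simp add: gk_def)
  have "((\<lambda>\<eta>. - V0 + (V0 / GA dv (- a)) * GA dv (- \<eta>)) has_real_derivative 0 + (V0 / GA dv (- a)) * (- gk dv \<eta>)) (at \<eta>)" if "dv > 0"
    by (intro DERIV_add DERIV_const DERIV_cmult g that)
  then show "(fR dv V0 a has_real_derivative fR1 dv V0 a \<eta>) (at \<eta>)"
    unfolding fR_def[abs_def] fR1_def by (auto simp: algebra_simps)
  have "((\<lambda>\<eta>. (- V0 / GA dv (- a)) * gk dv \<eta>) has_real_derivative (- V0 / GA dv (- a)) * (- (\<eta> / (2 * dv)) * gk dv \<eta>)) (at \<eta>)" if "dv > 0"
    by (intro DERIV_cmult DERIV_gk that)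
  then show "(fR1 dv V0 a has_real_derivative fR2 dv V0 a \<eta>) (at \<eta>)"
    unfolding fR1_def[abs_def] fR2_def by auto
qed

lemma fL_bounds:
  assumes "du > 0" "U0 > 0"
  shows "\<eta> \<le> a \<Longrightarrow> 0 \<le> fL du U0 a \<eta>" "\<eta> < a \<Longrightarrow> 0 < fL du U0 a \<eta>" "fL du U0 a \<eta> \<le> U0" "fL du U0 a a = 0"
proof -
  note p = GA_pos[OF assms(1)]
  show lt: "0 < fL du U0 a \<eta>" if "\<eta> < a"
    using GA_strict_mono[OF assms(1) that] p[of a] assms(2) by (simp add: fL_def)
  show z: "fL du U0 a a = 0" using p[of a] by (simp add: fL_def)
  show "0 \<le> fL du U0 a \<eta>" if "\<eta> \<le> a" using lt z that by (cases "\<eta> = a") (simp_all add: less_imp_le)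
  show "fL du U0 a \<eta> \<le> U0" using p[of a] p[of \<eta>] assms(2) by (simp add: fL_def mult_le_cancel_left1)
qed

lemma fR_bounds:
  assumes "V0 > 0"
  shows "\<eta> \<ge> a \<Longrightarrow> fR dv V0 a \<eta> \<le> 0" "- V0 \<le> fR dv V0 a \<eta>"
proof -
  show "fR dv V0 a \<eta> \<le> 0" if "\<eta> \<ge> a"
  proof (cases "dv > 0")
    case True
    have "GA dv (- \<eta>) \<le> GA dv (- a)"
      using GA_strict_mono[OF True, of "- \<eta>" "- a"] that by (cases "\<eta> = a") simp_all
    then show ?thesis using True GA_pos[OF True, of "- a"] assms by (simp add: fR_def)
  qed (use assms in \<open>simp add: fR_def\<close>)
  show "- V0 \<le> fR dv V0 a \<eta>"
  proof (cases "dv > 0")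
    case True
    have "0 \<le> V0 * (GA dv (- \<eta>) / GA dv (- a))" using GA_pos[OF True] assms by (simp add: less_imp_le)
    then show ?thesis using True by (simp add: fR_def right_diff_distrib)
  qed (use assms in \<open>simp add: fR_def\<close>)
qed

text \<open>The Rankine-Hugoniot condition on the curve x = a sqrt t. For dv > 0 the profile is
  continuous at a and the two fluxes agree; for dv = 0 it jumps from 0 to -V0, and the jump times a
  / 2 balances the flux of u.\<close>

lemma profile_junction:
  assumes du: "du > 0" and dv: "dv \<ge> 0" and ie: "interface_eq du dv U0 V0 a"
  shows "du * ((- U0 / GA du a) * gk du a) = dv * fR1 dv V0 a a + a * fR dv V0 a a / 2"
proof -
  define E1 where "E1 = exp (a\<^sup>2 / (4 * du))"
  define E2 where "E2 = exp (a\<^sup>2 / (4 * dv))"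
  have E: "E1 > 0" "E2 > 0" unfolding E1_def E2_def by auto
  have g: "gk du a = 1 / E1" "gk dv a = 1 / E2" unfolding gk_def E1_def E2_def by (simp_all add: exp_minus inverse_eq_divide)
  note A = GA_pos[OF du, of a]
  show ?thesis
  proof (cases "dv > 0")
    case True
    note B = GA_pos[OF True, of "- a"]
    have "du * U0 * (E2 * GA dv (- a)) = dv * V0 * (E1 * GA du a)"
      using ie True unfolding interface_eq_mills[OF du dv] mills_def E1_def E2_def by simp
    then show ?thesis using True A B E by (simp add: fR_def fR1_def g field_simps)
  next
    case False
    have "U0 = V0 * a / (2 * du) * (E1 * GA du a)"
      using ie False unfolding interface_eq_mills[OF du dv] mills_def E1_def by simp
    then show ?thesis using False A E du by (simp add: fR_def fR1_def g field_simps)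
  qed
qed

text \<open>By the equation c F'' = -x F' / 2 of self-similar solutions the integrand is an exact
  derivative, that of the expression evaluated at p and q.\<close>

lemma selfsimilar_piece:
  fixes F F1 F2 :: "real \<Rightarrow> real"
  assumes F: "\<And>x. (F has_real_derivative F1 x) (at x)" "\<And>x. (F1 has_real_derivative F2 x) (at x)"
    and ode: "\<And>x. c * F2 x = - (x * F1 x / 2)"
    and t: "test2 \<phi> \<phi>1 \<phi>2" and pq: "p \<le> q"
  shows "(\<integral>x. indicator {p..q} x * (c * F x * \<phi>2 x - F x * (\<phi> x + x * \<phi>1 x) / 2) \<partial>lborel)
     = (c * F q * \<phi>1 q - c * F1 q * \<phi> q - q * F q * \<phi> q / 2) - (c * F p * \<phi>1 p - c * F1 p * \<phi> p - p * F p * \<phi> p / 2)"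
proof (rule FTC_continuous[where A="\<lambda>q. c * F q * \<phi>1 q - c * F1 q * \<phi> q - q * F q * \<phi> q / 2", OF _ _ pq])
  have d: "\<And>x. (\<phi> has_real_derivative \<phi>1 x) (at x)" "\<And>x. (\<phi>1 has_real_derivative \<phi>2 x) (at x)" "continuous_on UNIV \<phi>2"
    using t unfolding test2_def by auto
  show "((\<lambda>q. c * F q * \<phi>1 q - c * F1 q * \<phi> q - q * F q * \<phi> q / 2) has_real_derivative
      c * F x * \<phi>2 x - F x * (\<phi> x + x * \<phi>1 x) / 2) (at x)" for x
  proof (rule DERIV_cong)
    show "((\<lambda>q. c * F q * \<phi>1 q - c * F1 q * \<phi> q - q * F q * \<phi> q / 2) has_real_derivative
      ((c * F1 x * \<phi>1 x + \<phi>2 x * (c * F x)) - (c * F2 x * \<phi> x + \<phi>1 x * (c * F1 x)))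
        - ((1 * F x + F1 x * x) * \<phi> x + \<phi>1 x * (x * F x)) / 2) (at x)"
      by (intro DERIV_diff DERIV_mult DERIV_cmult DERIV_cdivide DERIV_ident F d)
    have "c * F2 x * \<phi> x = - (x * F1 x / 2) * \<phi> x" using ode[of x] by simp
    then show "((c * F1 x * \<phi>1 x + \<phi>2 x * (c * F x)) - (c * F2 x * \<phi> x + \<phi>1 x * (c * F1 x)))
        - ((1 * F x + F1 x * x) * \<phi> x + \<phi>1 x * (x * F x)) / 2 = c * F x * \<phi>2 x - F x * (\<phi> x + x * \<phi>1 x) / 2"
      by (simp add: field_simps)
  qed
  have "continuous_on UNIV F" "continuous_on UNIV \<phi>" "continuous_on UNIV \<phi>1"
    using DERIV_imp_continuous_on[OF F(1)] DERIV_imp_continuous_on[OF d(1)] DERIV_imp_continuous_on[OF d(2)] by auto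
  then show "continuous_on UNIV (\<lambda>x. c * F x * \<phi>2 x - F x * (\<phi> x + x * \<phi>1 x) / 2)"
    by (intro continuous_intros d(3)) auto
qed

lemma borel_fL: "du > 0 \<Longrightarrow> fL du U0 a \<in> borel_measurable borel"
  by (rule borel_measurable_continuous_onI, rule DERIV_imp_continuous_on, rule DERIV_fL(1))

lemma borel_fR: "fR dv V0 a \<in> borel_measurable borel"
  by (rule borel_measurable_continuous_onI, rule DERIV_imp_continuous_on, rule DERIV_fR(1))

lemma borel_profile: assumes "du > 0" shows "profile du dv U0 V0 a \<in> borel_measurable borel"
proof -
  have "profile du dv U0 V0 a = (\<lambda>\<eta>. if \<eta> \<le> a then fL du U0 a \<eta> else fR dv V0 a \<eta>)"
    using profile_eq by blast
  then show ?thesis using borel_fL[OF assms] borel_fR by simp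
qed

lemma borel_Dfun[measurable]: "Dfun du dv \<in> borel_measurable borel"
  unfolding Dfun_def[abs_def] by measurable

lemma profile_bounds:
  assumes "du > 0" "U0 > 0" "V0 > 0"
  shows "- V0 \<le> profile du dv U0 V0 a \<eta>" "profile du dv U0 V0 a \<eta> \<le> U0"
    "\<eta> < a \<Longrightarrow> 0 < profile du dv U0 V0 a \<eta>" "\<eta> \<ge> a \<Longrightarrow> profile du dv U0 V0 a \<eta> \<le> 0"
proof -
  note l = fL_bounds(1)[OF assms(1,2), where \<eta>=\<eta> and a=a] fL_bounds(2)[OF assms(1,2), where \<eta>=\<eta> and a=a]
    fL_bounds(3)[OF assms(1,2), where \<eta>=\<eta> and a=a] and l' = fL_bounds(4)[OF assms(1,2), of a]
  note r = fR_bounds(1)[OF assms(3), where \<eta>=\<eta> and a=a and dv=dv] fR_bounds(2)[OF assms(3), where \<eta>=\<eta> and a=a and dv=dv]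
  show "- V0 \<le> profile du dv U0 V0 a \<eta>" using l(1) r assms unfolding profile_eq by (cases "\<eta> \<le> a") simp_all
  show "profile du dv U0 V0 a \<eta> \<le> U0" using l r assms unfolding profile_eq by (cases "\<eta> \<le> a") simp_all
  show "0 < profile du dv U0 V0 a \<eta>" if "\<eta> < a" using l(2)[OF that] that unfolding profile_eq by simp
  show "profile du dv U0 V0 a \<eta> \<le> 0" if "\<eta> \<ge> a"
    using l' r(1)[OF that] that unfolding profile_eq by (cases "\<eta> = a") simp_all
qed

lemma profile_limits:
  assumes "du > 0" "dv \<ge> 0"
  shows "(profile du dv U0 V0 a \<longlongrightarrow> U0) at_bot" "(profile du dv U0 V0 a \<longlongrightarrow> - V0) at_top"
proof -
  have "((\<lambda>\<eta>. U0 * (1 - GA du \<eta> / GA du a)) \<longlongrightarrow> U0 * (1 - 0 / GA du a)) at_bot"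
    using GA_pos[OF assms(1), of a] by (intro tendsto_intros GA_tendsto_0 assms) simp
  then have "(fL du U0 a \<longlongrightarrow> U0) at_bot" unfolding fL_def[abs_def] by simp
  then show "(profile du dv U0 V0 a \<longlongrightarrow> U0) at_bot"
    by (rule Lim_transform_eventually) (auto simp: profile_eq intro: eventually_at_bot_linorderI[of a])
  have "(fR dv V0 a \<longlongrightarrow> - V0) at_top"
  proof (cases "dv > 0")
    case True
    have "((\<lambda>\<eta>. GA dv (- \<eta>)) \<longlongrightarrow> 0) at_top"
      using GA_tendsto_0[OF True] by (simp add: filterlim_at_bot_mirror)
    then have "((\<lambda>\<eta>. - V0 * (1 - GA dv (- \<eta>) / GA dv (- a))) \<longlongrightarrow> - V0 * (1 - 0 / GA dv (- a))) at_top"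
      using GA_pos[OF True, of "- a"] by (intro tendsto_intros) simp_all
    then show ?thesis using True unfolding fR_def[abs_def] by simp
  qed (simp add: fR_def[abs_def])
  then show "(profile du dv U0 V0 a \<longlongrightarrow> - V0) at_top"
    by (rule Lim_transform_eventually) (auto simp: profile_eq intro: eventually_at_top_linorderI[of "a + 1"])
qed

text \<open>The distributional form of (D f)'' + \<eta> f' / 2 = 0 across the interface. Each branch
  is integrated separately; the boundary terms vanish outside the support of the test function and
  cancel at a by the flux balance.\<close>

lemma profile_stationary:
  assumes du: "du > 0" and dv: "dv \<ge> 0" and U: "U0 > 0" and V: "V0 > 0"
    and ie: "interface_eq du dv U0 V0 a" and t: "test2 \<phi> \<phi>1 \<phi>2"
  shows "(\<integral>\<eta>. Dfun du dv (profile du dv U0 V0 a \<eta>) * \<phi>2 \<eta> - profile du dv U0 V0 a \<eta> * (\<phi> \<eta> + \<eta> * \<phi>1 \<eta>) / 2 \<partial>lborel) = 0"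
proof -
  let ?f = "profile du dv U0 V0 a"
  obtain R where R: "\<And>x. \<bar>x\<bar> > R \<Longrightarrow> \<phi> x = 0" "\<And>x. \<bar>x\<bar> > R \<Longrightarrow> \<phi>1 x = 0" "\<And>x. \<bar>x\<bar> > R \<Longrightarrow> \<phi>2 x = 0"
    by (rule test2E[OF t]) blast
  define L where "L = max R \<bar>a\<bar> + 1"
  have L: "- L \<le> a" "a \<le> L" "\<bar>L\<bar> > R" "\<bar>- L\<bar> > R" unfolding L_def by auto
  have z: "\<phi> L = 0" "\<phi>1 L = 0" "\<phi> (- L) = 0" "\<phi>1 (- L) = 0" using R L by auto
  note [measurable] = test2_borel[OF t] borel_profile[OF du] borel_fL[OF du] borel_fR
  define l where "l x = indicator {-L..a} x * (du * fL du U0 a x * \<phi>2 x - fL du U0 a x * (\<phi> x + x * \<phi>1 x) / 2)" for x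
  define r where "r x = indicator {a..L} x * (dv * fR dv V0 a x * \<phi>2 x - fR dv V0 a x * (\<phi> x + x * \<phi>1 x) / 2)" for x
  have dt: "continuous_on UNIV \<phi>" "continuous_on UNIV \<phi>1" "continuous_on UNIV \<phi>2"
    using t unfolding test2_def by (auto intro: DERIV_imp_continuous_on)
  have ib: "integrable lborel (\<lambda>x. indicator {p..q} x * h x)" if "continuous_on UNIV h" for h :: "real \<Rightarrow> real" and p q :: real
  proof -
    have "bounded (h ` {p..q})" by (intro compact_imp_bounded compact_continuous_image continuous_on_subset[OF that]) auto
    then obtain B where "\<And>x. x \<in> {p..q} \<Longrightarrow> \<bar>h x\<bar> \<le> B" unfolding bounded_iff by (metis image_eqI real_norm_def)
    then show ?thesis by (intro integrable_bounded_Icc[where B=B] borel_measurable_continuous_onI that) auto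
  qed
  have il: "integrable lborel l" unfolding l_def
    by (rule ib, intro continuous_intros dt DERIV_imp_continuous_on[OF DERIV_fL(1)[OF du]]) auto
  have ir: "integrable lborel r" unfolding r_def
    by (rule ib, intro continuous_intros dt DERIV_imp_continuous_on[OF DERIV_fR(1)]) auto
  have "(\<integral>\<eta>. Dfun du dv (?f \<eta>) * \<phi>2 \<eta> - ?f \<eta> * (\<phi> \<eta> + \<eta> * \<phi>1 \<eta>) / 2 \<partial>lborel) = (\<integral>x. l x + r x \<partial>lborel)"
  proof (rule integral_cong_AE)
    show "AE x in lborel. Dfun du dv (?f x) * \<phi>2 x - ?f x * (\<phi> x + x * \<phi>1 x) / 2 = l x + r x"
      using AE_lborel_singleton[of a]
    proof eventually_elim
      fix x :: real assume xa: "x \<noteq> a"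
      consider "\<bar>x\<bar> > L" | "\<bar>x\<bar> \<le> L" "x < a" | "\<bar>x\<bar> \<le> L" "x > a" using xa by linarith
      then show "Dfun du dv (?f x) * \<phi>2 x - ?f x * (\<phi> x + x * \<phi>1 x) / 2 = l x + r x"
      proof cases
        case 1
        then have "\<bar>x\<bar> > R" unfolding L_def by linarith
        then show ?thesis by (simp add: R l_def r_def)
      next
        case 2
        then have f: "?f x = fL du U0 a x" by (simp add: profile_eq)
        have "Dfun du dv (?f x) = du * fL du U0 a x"
          unfolding f Dfun_def using fL_bounds(2)[OF du U 2(2)] by simp
        moreover have "- L \<le> x" using 2 by linarith
        ultimately show ?thesis using 2 unfolding l_def r_def f by (simp add: indicator_def)
      next
        case 3
        then have f: "?f x = fR dv V0 a x" by (simp add: profile_eq)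
        have "Dfun du dv (?f x) = dv * fR dv V0 a x"
          unfolding f Dfun_def using fR_bounds(1)[OF V, of a x dv] 3 by simp
        moreover have "x \<le> L" using 3 by linarith
        ultimately show ?thesis using 3 unfolding l_def r_def f by (simp add: indicator_def)
      qed
    qed
  qed (use il ir in auto)
  also have "\<dots> = (\<integral>x. l x \<partial>lborel) + (\<integral>x. r x \<partial>lborel)" using il ir by simp
  also have "(\<integral>x. l x \<partial>lborel) = - (du * ((- U0 / GA du a) * gk du a) * \<phi> a)"
    unfolding l_def
    by (subst selfsimilar_piece[OF DERIV_fL[OF du] _ t L(1)]) (use z fL_bounds(4)[OF du U] du in \<open>simp_all add: field_simps\<close>)
  also have "(\<integral>x. r x \<partial>lborel) = (dv * fR1 dv V0 a a + a * fR dv V0 a a / 2) * \<phi> a"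
  proof -
    \<comment> \<open>D of the profile is continuous at a even where the profile jumps, so the
      boundary term with \<open>\<phi>1\<close> vanishes on this side as well.\<close>
    have dvR: "dv * fR dv V0 a a = 0" using dv GA_pos[of dv "- a"] by (cases "dv > 0") (simp_all add: fR_def)
    have ode: "dv * fR2 dv V0 a x = - (x * fR1 dv V0 a x / 2)" for x
      using dv by (cases "dv > 0") (simp_all add: fR1_def fR2_def field_simps)
    show ?thesis unfolding r_def
      by (subst selfsimilar_piece[OF DERIV_fR ode t L(2)]) (simp add: z dvR algebra_simps)
  qed
  finally show ?thesis unfolding profile_junction[OF du dv ie] by simp
qed

text \<open>At time 0 the division returns f 0. This is a single instant, invisible to integrals in
  time; at all times the function inherits bounds and measurability from f.\<close>

definition selfsim :: "(real \<Rightarrow> real) \<Rightarrow> real \<times> real \<Rightarrow> real" where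
  "selfsim f p = f (fst p / sqrt (snd p))"

text \<open>With \<open>\<sigma>\<close> = sqrt t the pairing with phi becomes the integral of f
  against \<open>\<sigma>\<close> phi(\<open>\<sigma>\<close> eta). Its derivative in
  \<open>\<sigma>\<close> is computed by the stationary identity, and the limits of f at infinity
  give the initial value.\<close>

lemma selfsim_evol:
  assumes f: "bdd_borel1 f B" and g: "bdd_borel1 g B"
    and lim: "(f \<longlongrightarrow> fm) at_bot" "(f \<longlongrightarrow> fp) at_top"
    and st: "\<And>\<phi> \<phi>1 \<phi>2. test2 \<phi> \<phi>1 \<phi>2 \<Longrightarrow> (\<integral>\<eta>. g \<eta> * \<phi>2 \<eta> - f \<eta> * (\<phi> \<eta> + \<eta> * \<phi>1 \<eta>) / 2 \<partial>lborel) = 0"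
    and w0: "\<And>x. x < 0 \<Longrightarrow> w0 x = fm" "\<And>x. x > 0 \<Longrightarrow> w0 x = fp" and w0m[measurable]: "w0 \<in> borel_measurable borel"
  shows "evol (selfsim f) w0 (selfsim g) (\<lambda>_. 0)"
  unfolding evol_def
proof (intro allI impI)
  fix \<phi> \<phi>1 \<phi>2 assume t: "test2 \<phi> \<phi>1 \<phi>2"
  note [measurable] = test2_borel[OF t]
  note ti = test2_integrable[OF t]
  have fm'[measurable]: "f \<in> borel_measurable borel" and gm'[measurable]: "g \<in> borel_measurable borel" using f g by auto
  have fB: "\<bar>f x\<bar> \<le> B" and gB: "\<bar>g x\<bar> \<le> B" for x using f g by auto
  have B0: "B \<ge> 0" using fB[of 0] by linarith
  have dt: "\<And>x. (\<phi> has_real_derivative \<phi>1 x) (at x)" "\<And>x. (\<phi>1 has_real_derivative \<phi>2 x) (at x)" "continuous_on UNIV \<phi>2"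
    using t unfolding test2_def by auto
  obtain R C where R: "R > 0" "C > 0" "\<And>x. \<bar>x\<bar> > R \<Longrightarrow> \<phi> x = 0" "\<And>x. \<bar>x\<bar> > R \<Longrightarrow> \<phi>1 x = 0"
     "\<And>x. \<bar>\<phi> x\<bar> \<le> C" "\<And>x. \<bar>\<phi>1 x\<bar> \<le> C" "\<And>x. \<bar>\<phi>2 x\<bar> \<le> C"
    by (rule test2E[OF t]) blast
  have sc: "(\<integral>x. h x \<partial>lborel) = \<sigma> * (\<integral>y. h (\<sigma> * y) \<partial>lborel)" if "\<sigma> > 0" for h :: "real \<Rightarrow> real" and \<sigma>
    using lborel_integral_real_affine[of \<sigma> h 0] that by simp
  \<comment> \<open>The change of variables moves the time dependence from f, which may jump, to the
    smooth test function.\<close>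
  define n where "n \<sigma> = (\<integral>\<eta>. f \<eta> * (\<sigma> * \<phi> (\<sigma> * \<eta>)) \<partial>lborel)" for \<sigma>
  define b where "b \<tau> = (\<integral>x. g (x / sqrt \<tau>) * \<phi>2 x \<partial>lborel)" for \<tau>
  have n_eq: "n \<sigma> = (\<integral>x. f (x / \<sigma>) * \<phi> x \<partial>lborel)" if "\<sigma> > 0" for \<sigma>
  proof -
    have "(\<integral>x. f (x / \<sigma>) * \<phi> x \<partial>lborel) = \<sigma> * (\<integral>y. f y * \<phi> (\<sigma> * y) \<partial>lborel)"
      using sc[OF that, of "\<lambda>x. f (x / \<sigma>) * \<phi> x"] that by simp
    also have "\<dots> = (\<integral>y. \<sigma> * (f y * \<phi> (\<sigma> * y)) \<partial>lborel)" by simp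
    finally show ?thesis unfolding n_def by (simp add: mult.left_commute)
  qed
  have t\<sigma>: "test2 (\<lambda>\<eta>. \<phi> (\<sigma> * \<eta>)) (\<lambda>\<eta>. \<sigma> * \<phi>1 (\<sigma> * \<eta>)) (\<lambda>\<eta>. \<sigma>\<^sup>2 * \<phi>2 (\<sigma> * \<eta>))" if "\<sigma> > 0" for \<sigma>
    unfolding test2_def
  proof (intro conjI allI)
    have i: "((\<lambda>\<eta>. \<sigma> * \<eta>) has_real_derivative \<sigma>) (at \<eta>)" for \<eta> using DERIV_cmult_Id by simp
    show "((\<lambda>\<eta>. \<phi> (\<sigma> * \<eta>)) has_real_derivative \<sigma> * \<phi>1 (\<sigma> * \<eta>)) (at \<eta>)" for \<eta>
      using DERIV_chain2[OF dt(1) i] by (simp add: mult.commute)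
    show "((\<lambda>\<eta>. \<sigma> * \<phi>1 (\<sigma> * \<eta>)) has_real_derivative \<sigma>\<^sup>2 * \<phi>2 (\<sigma> * \<eta>)) (at \<eta>)" for \<eta>
      by (rule DERIV_cong[OF DERIV_cmult[OF DERIV_chain2[OF dt(2) i]]]) (simp add: power2_eq_square)
    show "continuous_on UNIV (\<lambda>\<eta>. \<sigma>\<^sup>2 * \<phi>2 (\<sigma> * \<eta>))"
      by (intro continuous_on_mult_left continuous_on_compose2[OF dt(3)] continuous_intros) auto
    show "\<exists>R. \<forall>\<eta>. R < \<bar>\<eta>\<bar> \<longrightarrow> \<phi> (\<sigma> * \<eta>) = 0"
    proof (intro exI[of _ "R / \<sigma>"] allI impI)
      fix \<eta> assume "R / \<sigma> < \<bar>\<eta>\<bar>"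
      then have "R < \<bar>\<sigma> * \<eta>\<bar>" using that by (simp add: abs_mult divide_less_eq mult.commute)
      then show "\<phi> (\<sigma> * \<eta>) = 0" by (rule R(3))
    qed
  qed
  have dn: "(n has_real_derivative 2 * \<sigma> * b (\<sigma>\<^sup>2)) (at \<sigma>)" if s: "\<sigma> > 0" for \<sigma>
  proof -
    have "(n has_real_derivative (\<integral>\<eta>. f \<eta> * (\<phi> (\<sigma> * \<eta>) + \<sigma> * (\<eta> * \<phi>1 (\<sigma> * \<eta>))) \<partial>lborel)) (at \<sigma>)"
      unfolding n_def[abs_def]
    proof (rule deriv_under_integral[where e="\<sigma> / 2" and w="\<lambda>\<eta>. indicator {- (2 * R / \<sigma>)..2 * R / \<sigma>} \<eta> * (B * (C + R * C))"])
      show "((\<lambda>\<sigma>. f \<eta> * (\<sigma> * \<phi> (\<sigma> * \<eta>))) has_real_derivative f \<eta> * (\<phi> (x * \<eta>) + x * (\<eta> * \<phi>1 (x * \<eta>)))) (at x)" for x \<eta>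
      proof -
        have i: "((\<lambda>\<sigma>. \<sigma> * \<eta>) has_real_derivative \<eta>) (at x)" using DERIV_cmult_right[OF DERIV_ident] by simp
        show ?thesis
          by (rule DERIV_cmult, rule DERIV_cong[OF DERIV_mult[OF DERIV_ident DERIV_chain2[OF dt(1) i]]]) (simp add: mult.commute)
      qed
      show "integrable lborel (\<lambda>\<eta>. f \<eta> * (x * \<phi> (x * \<eta>)))" if "\<bar>x - \<sigma>\<bar> < \<sigma> / 2" for x
      proof -
        have "x > 0" using that s by linarith
        then have "integrable lborel (\<lambda>\<eta>. x * \<phi> (x * \<eta>))" using test2_integrable(1)[OF t\<sigma>] by simp
        then show ?thesis by (rule integrable_mult_bounded[where B=B]) (simp, rule fB)
      qed
      show "integrable lborel (\<lambda>\<eta>. indicator {- (2 * R / \<sigma>)..2 * R / \<sigma>} \<eta> * (B * (C + R * C)))"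
        by (rule integrable_bounded_Icc[where B="\<bar>B * (C + R * C)\<bar>"]) simp_all
      show "\<bar>f \<eta> * (\<phi> (x * \<eta>) + x * (\<eta> * \<phi>1 (x * \<eta>)))\<bar> \<le> indicator {- (2 * R / \<sigma>)..2 * R / \<sigma>} \<eta> * (B * (C + R * C))"
        if x: "\<bar>x - \<sigma>\<bar> < \<sigma> / 2" for x \<eta>
      proof (cases "\<bar>x * \<eta>\<bar> > R")
        case True
        have "0 \<le> B * (C + R * C)" using B0 R by simp
        then show ?thesis using R(3,4)[OF True] by (simp add: indicator_def)
      next
        case False
        have x2: "\<bar>x\<bar> \<ge> \<sigma> / 2" using x by linarith
        have "\<sigma> / 2 * \<bar>\<eta>\<bar> \<le> R" using mult_right_mono[OF x2, of "\<bar>\<eta>\<bar>"] False by (simp add: abs_mult)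
        then have "\<bar>\<eta>\<bar> \<le> 2 * R / \<sigma>" using s by (simp add: field_simps)
        then have ind: "indicator {- (2 * R / \<sigma>)..2 * R / \<sigma>} \<eta> = (1 :: real)" by (simp add: indicator_def abs_le_iff)
        have "\<bar>x * (\<eta> * \<phi>1 (x * \<eta>))\<bar> \<le> R * C"
          using mult_mono[of "\<bar>x * \<eta>\<bar>" R "\<bar>\<phi>1 (x * \<eta>)\<bar>" C] False R by (simp add: abs_mult mult.assoc)
        then have "\<bar>\<phi> (x * \<eta>) + x * (\<eta> * \<phi>1 (x * \<eta>))\<bar> \<le> C + R * C" using R(5)[of "x * \<eta>"] by linarith
        then show ?thesis unfolding ind using mult_mono[OF fB[of \<eta>]] B0 by (simp add: abs_mult)
      qed
    qed (use s in simp)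
    \<comment> \<open>The stationary identity for the test function phi(\<open>\<sigma>\<close>
      eta): its second derivative carries \<open>\<sigma>\<^sup>2\<close>, and the substitution in b
      uses up one factor \<open>\<sigma>\<close>. The 2 \<open>\<sigma>\<close> that results is the
      inner derivative of \<open>\<tau>\<close> = \<open>\<sigma>\<^sup>2\<close>.\<close>
    moreover have "(\<integral>\<eta>. f \<eta> * (\<phi> (\<sigma> * \<eta>) + \<sigma> * (\<eta> * \<phi>1 (\<sigma> * \<eta>))) \<partial>lborel) = 2 * \<sigma> * b (\<sigma>\<^sup>2)"
    proof -
      note T = t\<sigma>[OF s]
      have i1: "integrable lborel (\<lambda>\<eta>. g \<eta> * (\<sigma>\<^sup>2 * \<phi>2 (\<sigma> * \<eta>)))"
        by (rule integrable_mult_bounded[OF test2_integrable(3)[OF T], where B=B]) (simp, rule gB)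
      have i2: "integrable lborel (\<lambda>\<eta>. f \<eta> * (\<phi> (\<sigma> * \<eta>) + \<eta> * (\<sigma> * \<phi>1 (\<sigma> * \<eta>))))"
      proof (rule integrable_mult_bounded[where B=B])
        show "integrable lborel (\<lambda>\<eta>. \<phi> (\<sigma> * \<eta>) + \<eta> * (\<sigma> * \<phi>1 (\<sigma> * \<eta>)))"
        proof (rule integrable_bounded_support[where R="R / \<sigma>" and B="C + R * C"])
          show "\<bar>\<phi> (\<sigma> * \<eta>) + \<eta> * (\<sigma> * \<phi>1 (\<sigma> * \<eta>))\<bar> \<le> C + R * C" for \<eta>
          proof (cases "\<bar>\<sigma> * \<eta>\<bar> > R")
            case True then show ?thesis using R(3,4)[OF True] R(1,2) by simp
          next
            case False
            have "\<bar>\<eta> * (\<sigma> * \<phi>1 (\<sigma> * \<eta>))\<bar> \<le> R * C"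
              using mult_mono[of "\<bar>\<sigma> * \<eta>\<bar>" R "\<bar>\<phi>1 (\<sigma> * \<eta>)\<bar>" C] False R by (simp add: abs_mult mult.assoc mult.left_commute)
            then show ?thesis using R(5)[of "\<sigma> * \<eta>"] by linarith
          qed
          show "\<phi> (\<sigma> * \<eta>) + \<eta> * (\<sigma> * \<phi>1 (\<sigma> * \<eta>)) = 0" if "R / \<sigma> < \<bar>\<eta>\<bar>" for \<eta>
          proof -
            have "R < \<bar>\<sigma> * \<eta>\<bar>" using that s by (simp add: abs_mult divide_less_eq mult.commute)
            then show ?thesis by (simp add: R(3,4))
          qed
        qed measurable
      qed (simp, rule fB)
      have "(\<integral>\<eta>. g \<eta> * (\<sigma>\<^sup>2 * \<phi>2 (\<sigma> * \<eta>)) \<partial>lborel) - (\<integral>\<eta>. f \<eta> * (\<phi> (\<sigma> * \<eta>) + \<eta> * (\<sigma> * \<phi>1 (\<sigma> * \<eta>))) \<partial>lborel) / 2 = 0"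
        using st[OF T] i1 i2 by simp
      moreover have "(\<integral>\<eta>. g \<eta> * (\<sigma>\<^sup>2 * \<phi>2 (\<sigma> * \<eta>)) \<partial>lborel) = \<sigma> * b (\<sigma>\<^sup>2)"
      proof -
        have "b (\<sigma>\<^sup>2) = \<sigma> * (\<integral>y. g y * \<phi>2 (\<sigma> * y) \<partial>lborel)"
          unfolding b_def using sc[OF s, of "\<lambda>x. g (x / \<sigma>) * \<phi>2 x"] s by simp
        moreover have "(\<integral>\<eta>. g \<eta> * (\<sigma>\<^sup>2 * \<phi>2 (\<sigma> * \<eta>)) \<partial>lborel) = \<sigma>\<^sup>2 * (\<integral>\<eta>. g \<eta> * \<phi>2 (\<sigma> * \<eta>) \<partial>lborel)"
          by (subst integral_mult_right_zero[symmetric]) (simp add: mult.left_commute)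
        ultimately show ?thesis by (simp add: power2_eq_square)
      qed
      ultimately show ?thesis by (simp add: mult.left_commute)
    qed
    ultimately show ?thesis by simp
  qed
  \<comment> \<open>Back in the time variable, with the initial pairing as the value at 0;
    \<open>m0\<close> shows that this choice makes m continuous there, so the fundamental theorem
    applies on [0, \<open>\<tau>\<close>].\<close>
  define m where "m \<tau> = (if \<tau> > 0 then n (sqrt \<tau>) else (\<integral>x. w0 x * \<phi> x \<partial>lborel))" for \<tau>
  have dm: "(m has_real_derivative b \<tau>) (at \<tau>)" if s: "\<tau> > 0" for \<tau>
  proof -
    have "((\<lambda>\<tau>. n (sqrt \<tau>)) has_real_derivative (2 * sqrt \<tau> * b ((sqrt \<tau>)\<^sup>2)) * (inverse (sqrt \<tau>) / 2)) (at \<tau>)"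
      by (rule DERIV_chain2[OF dn DERIV_real_sqrt]) (use s in auto)
    then have "((\<lambda>\<tau>. n (sqrt \<tau>)) has_real_derivative b \<tau>) (at \<tau>)" using s by (simp add: field_simps)
    then show ?thesis
      by (rule has_field_derivative_transform_within_open[of _ _ _ "{0<..}"]) (use s in \<open>auto simp: m_def\<close>)
  qed
  have m0: "(m \<longlongrightarrow> m 0) (at 0 within {0..})"
    unfolding tendsto_at_iff_sequentially comp_def
  proof (intro allI impI)
    fix X :: "nat \<Rightarrow> real" assume Xs: "\<forall>i. X i \<in> {0..} - {0}" and X: "X \<longlonglongrightarrow> 0"
    have Xp: "X i > 0" for i using Xs[rule_format, of i] by auto
    have inf: "filterlim (\<lambda>i. inverse (sqrt (X i))) at_top sequentially"
    proof (rule filterlim_compose[OF filterlim_inverse_at_top_right])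
      have "(\<lambda>i. sqrt (X i)) \<longlonglongrightarrow> sqrt 0" by (intro tendsto_real_sqrt X)
      then show "filterlim (\<lambda>i. sqrt (X i)) (at_right 0) sequentially"
        by (simp add: filterlim_at Xp less_imp_neq[OF Xp, symmetric])
    qed
    have "(\<lambda>i. \<integral>x. f (x / sqrt (X i)) * \<phi> x \<partial>lborel) \<longlonglongrightarrow> (\<integral>x. w0 x * \<phi> x \<partial>lborel)"
    proof (rule integral_dominated_convergence[where w="\<lambda>x. B * \<bar>\<phi> x\<bar>"])
      show "AE x in lborel. (\<lambda>i. f (x / sqrt (X i)) * \<phi> x) \<longlonglongrightarrow> w0 x * \<phi> x"
        using AE_lborel_singleton[of 0]
      proof eventually_elim
        fix x :: real assume x: "x \<noteq> 0"
        have "(\<lambda>i. f (x * inverse (sqrt (X i)))) \<longlonglongrightarrow> w0 x"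
        proof (cases "x > 0")
          case True
          have "filterlim (\<lambda>i. x * inverse (sqrt (X i))) at_top sequentially"
            by (rule filterlim_tendsto_pos_mult_at_top[OF tendsto_const True inf])
          then show ?thesis using filterlim_compose[OF lim(2)] w0(2)[OF True] by simp
        next
          case False
          then have x0: "x < 0" using x by simp
          have "filterlim (\<lambda>i. x * inverse (sqrt (X i))) at_bot sequentially"
            by (rule filterlim_tendsto_neg_mult_at_bot[OF tendsto_const x0 inf])
          then show ?thesis using filterlim_compose[OF lim(1)] w0(1)[OF x0] by simp
        qed
        then show "(\<lambda>i. f (x / sqrt (X i)) * \<phi> x) \<longlonglongrightarrow> w0 x * \<phi> x"
          by (intro tendsto_mult_right) (simp add: divide_inverse)
      qed
      show "AE x in lborel. norm (f (x / sqrt (X i)) * \<phi> x) \<le> B * \<bar>\<phi> x\<bar>" for i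
        by (intro AE_I2) (simp add: abs_mult mult_right_mono fB)
    qed (use ti in auto)
    moreover have "m (X i) = (\<integral>x. f (x / sqrt (X i)) * \<phi> x \<partial>lborel)" for i
      unfolding m_def using Xp[of i] n_eq[of "sqrt (X i)"] by simp
    ultimately show "(\<lambda>i. m (X i)) \<longlonglongrightarrow> m 0" by (simp add: m_def)
  qed
  have cm: "continuous_on {0..T} m" for T
    unfolding continuous_on_eq_continuous_within
  proof
    fix x assume x: "x \<in> {0..T}"
    show "continuous (at x within {0..T}) m"
    proof (cases "x = 0")
      case True
      have "(m \<longlongrightarrow> m 0) (at 0 within {0..T})" by (rule tendsto_within_subset[OF m0]) auto
      then show ?thesis using True by (simp add: continuous_within)
    next
      case False
      then have "isCont m x" using dm[of x] x by (intro DERIV_isCont) auto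
      then show ?thesis by (rule continuous_at_imp_continuous_within)
    qed
  qed
  have bm[measurable]: "b \<in> borel_measurable borel" unfolding b_def[abs_def] by measurable
  have bB: "\<bar>b \<tau>\<bar> \<le> B * (\<integral>x. \<bar>\<phi>2 x\<bar> \<partial>lborel)" for \<tau>
    unfolding b_def by (rule abs_integral_mult_le[OF ti(3)]) (simp, rule gB)
  have "(\<integral>s. indicator {0..\<tau>} s * b s \<partial>lborel) = m \<tau> - m 0" if "\<tau> > 0" for \<tau>
    by (rule FTC_bounded[OF _ cm dm bm bB]) (use that in auto)
  then have "m \<tau> = m 0 + (\<integral>s. b s \<partial>Mt \<tau>)" if "\<tau> > 0" for \<tau>
    using that by (simp add: integral_Mt)
  then show "AE t in lborel. 0 < t \<longrightarrow> (\<integral>x. selfsim f (x, t) * \<phi> x \<partial>lborel) = (\<integral>x. w0 x * \<phi> x \<partial>lborel)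
       + (\<integral>s. (\<integral>x. selfsim g (x, s) * \<phi>2 x - 0 * \<phi> x \<partial>lborel) \<partial>Mt t)"
    by (intro AE_I2) (auto simp: m_def n_eq selfsim_def b_def)
qed

section \<open>Solutions satisfy the integrated evolution equations\<close>

lemma reaction_rateD:
  assumes "reaction_rate F"
  shows "\<exists>\<alpha>>0. Hoelder_on \<alpha> ({0..} \<times> {0..}) F"
    "\<And>u v. 0 \<le> u \<Longrightarrow> 0 \<le> v \<Longrightarrow> 0 \<le> F u v"
    "\<And>u v. 0 < u \<Longrightarrow> 0 < v \<Longrightarrow> 0 < F u v"
    "\<And>v. v \<ge> 0 \<Longrightarrow> mono_on {0..} (\<lambda>u. F u v)"
    "\<And>u. u \<ge> 0 \<Longrightarrow> mono_on {0..} (\<lambda>v. F u v)"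
  using assms unfolding reaction_rate_def by (elim conjE; simp)+

lemma reaction_rate_continuous:
  assumes F: "reaction_rate F" and M: "M \<ge> 0"
  shows "continuous_on ({0..M} \<times> {0..M}) (\<lambda>(u, v). F u v)"
proof -
  obtain \<alpha> where \<alpha>: "\<alpha> > 0" "Hoelder_on \<alpha> ({0..} \<times> {0..}) F"
    using reaction_rateD(1)[OF F] by (elim exE conjE)
  have K: "compact ({0..M} \<times> {0..M})" "{0..M} \<times> {0..M} \<subseteq> {0..} \<times> {0..}"
    by (auto intro: compact_Times)
  obtain C where C0: "\<forall>(u, v)\<in>{0..M} \<times> {0..M}. \<forall>(u', v')\<in>{0..M} \<times> {0..M}. \<bar>F u v - F u' v'\<bar> \<le> C * dist (u, v) (u', v') powr \<alpha>"
    using \<alpha>(2)[unfolded Hoelder_on_def, rule_format, OF conjI[OF K]] by blast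
  have C: "\<bar>F (fst p) (snd p) - F (fst q) (snd q)\<bar> \<le> C * dist p q powr \<alpha>"
    if pq: "p \<in> {0..M} \<times> {0..M}" "q \<in> {0..M} \<times> {0..M}" for p q
  proof -
    obtain u v where p: "p = (u, v)" by (rule prod.exhaust)
    obtain u' v' where q: "q = (u', v')" by (rule prod.exhaust)
    have "\<forall>(u', v')\<in>{0..M} \<times> {0..M}. \<bar>F u v - F u' v'\<bar> \<le> C * dist (u, v) (u', v') powr \<alpha>"
      using bspec[OF C0 pq(1)[unfolded p]] by (simp only: prod.case)
    from bspec[OF this pq(2)[unfolded q]] show ?thesis unfolding p q by (simp only: prod.case fst_conv snd_conv)
  qed
  show ?thesis
    unfolding continuous_on_def
  proof
    fix q assume q: "q \<in> {0..M} \<times> {0..M}"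
    have "((\<lambda>p. F (fst p) (snd p) - F (fst q) (snd q)) \<longlongrightarrow> 0) (at q within {0..M} \<times> {0..M})"
    proof (rule Lim_null_comparison[where g="\<lambda>p. C * dist p q powr \<alpha>"])
      show "\<forall>\<^sub>F p in at q within {0..M} \<times> {0..M}. norm (F (fst p) (snd p) - F (fst q) (snd q)) \<le> C * dist p q powr \<alpha>"
        unfolding eventually_at_filter real_norm_def by (intro always_eventually allI impI C q)
      have "((\<lambda>p. dist p q) \<longlongrightarrow> dist q q) (at q within {0..M} \<times> {0..M})"
        by (intro tendsto_dist tendsto_ident_at tendsto_const)
      then have "((\<lambda>p. dist p q) \<longlongrightarrow> 0) (at q within {0..M} \<times> {0..M})" by simp
      then have "((\<lambda>p. dist p q powr \<alpha>) \<longlongrightarrow> 0 powr \<alpha>) (at q within {0..M} \<times> {0..M})"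
        by (rule tendsto_powr2[OF _ tendsto_const]) (use \<alpha>(1) in auto)
      then have "((\<lambda>p. dist p q powr \<alpha>) \<longlongrightarrow> 0) (at q within {0..M} \<times> {0..M})" by simp
      then show "((\<lambda>p. C * dist p q powr \<alpha>) \<longlongrightarrow> 0) (at q within {0..M} \<times> {0..M})"
        by (rule tendsto_mult_right_zero)
    qed
    then show "((\<lambda>(u, v). F u v) \<longlongrightarrow> (case q of (u, v) \<Rightarrow> F u v)) (at q within {0..M} \<times> {0..M})"
      unfolding split_beta' by (rule LIM_zero_cancel)
  qed
qed

text \<open>F is constrained on the closed quadrant only. Composing it with the clamping of both
  arguments to [0, M] gives a continuous function on the plane that agrees with F at all values of a
  and b.\<close>

lemma reaction_rate_borel:
  assumes F: "reaction_rate F" and M: "M \<ge> 0"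
    and a: "a \<in> borel_measurable N" "\<And>p. 0 \<le> a p \<and> a p \<le> M" and b: "b \<in> borel_measurable N" "\<And>p. 0 \<le> b p \<and> b p \<le> M"
  shows "(\<lambda>p. F (a p) (b p)) \<in> borel_measurable N"
proof -
  have "continuous_on UNIV (\<lambda>p :: real \<times> real. (max 0 (min M (fst p)), max 0 (min M (snd p))))"
    by (intro continuous_intros)
  moreover have "range (\<lambda>p :: real \<times> real. (max 0 (min M (fst p)), max 0 (min M (snd p)))) \<subseteq> {0..M} \<times> {0..M}"
    using M by auto
  ultimately have c: "continuous_on UNIV (\<lambda>p :: real \<times> real. (\<lambda>(u, v). F u v) (max 0 (min M (fst p)), max 0 (min M (snd p))))"
    by (rule continuous_on_compose2[OF reaction_rate_continuous[OF F M]])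
  have "(\<lambda>p. (a p, b p)) \<in> borel_measurable N" using a b by measurable
  from borel_measurable_continuous_on[OF c this]
  have "(\<lambda>p. F (max 0 (min M (a p))) (max 0 (min M (b p)))) \<in> borel_measurable N" by simp
  moreover have "max 0 (min M (a p)) = a p" "max 0 (min M (b p)) = b p" for p using a(2)[of p] b(2)[of p] by auto
  ultimately show ?thesis by simp
qed

lemma reaction_rate_bounds:
  assumes F: "reaction_rate F" and a: "0 \<le> a" "a \<le> M" and b: "0 \<le> b" "b \<le> M"
  shows "0 \<le> F a b" "F a b \<le> F M M"
proof -
  show "0 \<le> F a b" by (rule reaction_rateD(2)[OF F a(1) b(1)])
  have M: "M \<ge> 0" using a by linarith
  have m: "\<And>v. v \<ge> 0 \<Longrightarrow> mono_on {0..} (\<lambda>u. F u v)" "\<And>u. u \<ge> 0 \<Longrightarrow> mono_on {0..} (\<lambda>v. F u v)"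
    by (rule reaction_rateD[OF F], assumption)+
  have "F a b \<le> F M b" using mono_onD[OF m(1)[OF b(1)], of a M] a M by simp
  also have "F M b \<le> F M M" using mono_onD[OF m(2)[OF M], of b M] b M by simp
  finally show "F a b \<le> F M M" .
qed

text \<open>A quantitative form of segregation: either min a b is below d, or monotonicity gives F a
  b >= F d d > 0, and then the second summand alone is at least M.\<close>

lemma reaction_rate_min:
  assumes F: "reaction_rate F" and a: "0 \<le> a" "a \<le> M" and b: "0 \<le> b" "b \<le> M" and d: "d > 0"
  shows "min a b \<le> d + M / F d d * F a b"
proof (cases "min a b \<ge> d")
  case False
  have "F d d > 0" by (rule reaction_rateD(3)[OF F d d])
  then have "0 \<le> M / F d d * F a b" using reaction_rate_bounds(1)[OF assms(1-5)] a by (simp add: divide_nonneg_pos)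
  then show ?thesis using False by linarith
next
  case True
  have p: "F d d > 0" by (rule reaction_rateD(3)[OF F d d])
  have "F d d \<le> F a b"
  proof -
    have m: "\<And>v. v \<ge> 0 \<Longrightarrow> mono_on {0..} (\<lambda>u. F u v)" "\<And>u. u \<ge> 0 \<Longrightarrow> mono_on {0..} (\<lambda>v. F u v)"
      by (rule reaction_rateD[OF F], assumption)+
    have "F d d \<le> F a d" using mono_onD[OF m(1)[of d], of d a] True d a by simp
    also have "F a d \<le> F a b" using mono_onD[OF m(2)[OF a(1)], of d b] True d b by simp
    finally show ?thesis .
  qed
  then have "1 \<le> F a b / F d d" using p by simp
  then have "M * 1 \<le> M * (F a b / F d d)" using a by (intro mult_left_mono) auto
  then show ?thesis using a b d by simp
qed

section \<open>Classical solutions\<close>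

lemma integral_parts_test2:
  assumes t: "test2 \<phi> \<phi>1 \<phi>2"
    and w: "\<And>x. (w has_real_derivative w1 x) (at x)" "\<And>x. (w1 has_real_derivative w2 x) (at x)" and c: "continuous_on UNIV w2"
  shows "(\<integral>x. w2 x * \<phi> x \<partial>lborel) = (\<integral>x. w x * \<phi>2 x \<partial>lborel)"
proof -
  have d: "\<And>x. (\<phi> has_real_derivative \<phi>1 x) (at x)" "\<And>x. (\<phi>1 has_real_derivative \<phi>2 x) (at x)" "continuous_on UNIV \<phi>2"
    using t unfolding test2_def by auto
  obtain R where R: "\<And>x. \<bar>x\<bar> > R \<Longrightarrow> \<phi> x = 0" "\<And>x. \<bar>x\<bar> > R \<Longrightarrow> \<phi>1 x = 0" "\<And>x. \<bar>x\<bar> > R \<Longrightarrow> \<phi>2 x = 0"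
    by (rule test2E[OF t]) blast
  note cw = DERIV_imp_continuous_on[OF w(1), of UNIV] and cp = DERIV_imp_continuous_on[OF d(1), of UNIV]
  have c1: "continuous_on UNIV (\<lambda>x. w2 x * \<phi> x)" "continuous_on UNIV (\<lambda>x. w x * \<phi>2 x)"
    by (intro continuous_intros c cw cp d)+
  have i: "integrable lborel f" if f: "continuous_on UNIV f" "\<And>x. \<bar>x\<bar> > R \<Longrightarrow> f x = 0" for f :: "real \<Rightarrow> real"
  proof -
    obtain B where "\<And>x. \<bar>f x\<bar> \<le> B" using continuous_compact_bounded[OF f] by blast
    then show ?thesis
      using integrable_bounded_support[OF borel_measurable_continuous_onI[OF f(1)], of B R] f(2) by blast
  qed
  have i1: "integrable lborel (\<lambda>x. w2 x * \<phi> x)" "integrable lborel (\<lambda>x. w x * \<phi>2 x)"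
    by (rule i[OF c1(1)], simp add: R, rule i[OF c1(2)], simp add: R)
  have cd: "continuous_on UNIV (\<lambda>x. w2 x * \<phi> x - w x * \<phi>2 x)" by (intro continuous_intros c1)
  have z: "w2 x * \<phi> x - w x * \<phi>2 x = 0" if "\<bar>x\<bar> > R" for x using that by (simp add: R)
  obtain B where B: "\<And>x. \<bar>w2 x * \<phi> x - w x * \<phi>2 x\<bar> \<le> B"
    using continuous_compact_bounded[OF cd z] by blast
  have "(\<integral>x. w2 x * \<phi> x - w x * \<phi>2 x \<partial>lborel) = 0"
  proof (rule integral_deriv_compact_eq_0[where A="\<lambda>x. w1 x * \<phi> x - w x * \<phi>1 x" and R=R and B=B])
    show "((\<lambda>x. w1 x * \<phi> x - w x * \<phi>1 x) has_real_derivative w2 x * \<phi> x - w x * \<phi>2 x) (at x)" for x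
      by (rule DERIV_cong[OF DERIV_diff[OF DERIV_mult[OF w(2) d(1)] DERIV_mult[OF w(1) d(2)]]]) (simp add: algebra_simps)
    show "(\<lambda>x. w2 x * \<phi> x - w x * \<phi>2 x) \<in> borel_measurable borel" by (rule borel_measurable_continuous_onI[OF cd])
    show "\<bar>w2 x * \<phi> x - w x * \<phi>2 x\<bar> \<le> B" for x by (rule B)
  qed (simp_all add: R)
  then show ?thesis using i1 by simp
qed

lemma continuous_on_section:
  assumes "continuous_on (UNIV \<times> I) (\<lambda>(x, t). f x t)" "t \<in> I"
  shows "continuous_on UNIV (\<lambda>x. f x t)"
proof -
  have "continuous_on UNIV (\<lambda>x. (\<lambda>(x, t). f x t) (x, t))"
    by (rule continuous_on_compose2[OF assms(1)]) (use assms(2) in \<open>auto intro!: continuous_intros\<close>)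
  then show ?thesis by simp
qed

lemma continuous_on_section2:
  assumes "continuous_on (UNIV \<times> I) (\<lambda>(x, t). f x t)"
  shows "continuous_on I (\<lambda>t. f x t)"
proof -
  have "continuous_on I (\<lambda>t. (\<lambda>(x, t). f x t) (x, t))"
    by (rule continuous_on_compose2[OF assms(1)]) (auto intro!: continuous_intros)
  then show ?thesis by simp
qed

text \<open>Extension by 0 from positive times, not the positive part of the values. At negative
  times a solution is an arbitrary function, so it must be cut off before it can be Borel measurable
  on the plane.\<close>

definition pos_part_time :: "(real \<Rightarrow> real \<Rightarrow> real) \<Rightarrow> real \<times> real \<Rightarrow> real" where
  "pos_part_time w p = (if snd p > 0 then w (fst p) (snd p) else 0)"

lemma borel_pos_part_time:
  assumes c: "\<And>T. T > 0 \<Longrightarrow> continuous_on (UNIV \<times> {0..T}) (\<lambda>(x, t). w x t)"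
  shows "pos_part_time w \<in> borel_measurable (borel \<Otimes>\<^sub>M borel)"
proof -
  have o: "open ((UNIV :: real set) \<times> {0<..<T::real})" for T by (intro open_Times) auto
  have "isCont (\<lambda>(x, t). w x t) p" if "p \<in> UNIV \<times> {0<..}" for p
  proof -
    have "continuous_on (UNIV \<times> {0<..<snd p + 1}) (\<lambda>(x, t). w x t)"
      by (rule continuous_on_subset[OF c[of "snd p + 1"]]) (use that in auto)
    then have "\<forall>q\<in>UNIV \<times> {0<..<snd p + 1}. isCont (\<lambda>(x, t). w x t) q"
      by (rule continuous_on_eq_continuous_at[OF o, THEN iffD1])
    moreover have "p \<in> UNIV \<times> {0<..<snd p + 1}" using that by (cases p) simp
    ultimately show ?thesis by (rule bspec)
  qed
  then have "continuous_on (UNIV \<times> {0<..}) (\<lambda>(x, t). w x t)"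
    by (simp add: continuous_at_imp_continuous_on)
  then have "(\<lambda>p. if p \<in> UNIV \<times> {0<..} then (\<lambda>(x, t). w x t) p else 0) \<in> borel_measurable borel"
    by (intro borel_measurable_continuous_on_if continuous_intros) (auto intro!: borel_open open_Times)
  moreover have "(\<lambda>p. if p \<in> UNIV \<times> {0<..} then (\<lambda>(x, t). w x t) p else 0) = pos_part_time w"
    unfolding pos_part_time_def by (auto simp: fun_eq_iff split_beta')
  ultimately show ?thesis by (simp add: borel_prod)
qed

text \<open>For s > 0 the pairing A with phi is differentiable under the integral, and two
  integrations by parts put the space derivatives on phi. At time 0 only continuity of A is
  available; together with the boundedness of b this suffices for the fundamental theorem.\<close>

lemma classical_component_evol:
  fixes w :: "real \<Rightarrow> real \<Rightarrow> real"
  assumes b: "\<And>x t. 0 \<le> t \<Longrightarrow> 0 \<le> w x t \<and> w x t \<le> M"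
    and c: "\<And>T. T > 0 \<Longrightarrow> continuous_on (UNIV \<times> {0..T}) (\<lambda>(x, t). w x t)"
    and pde: "\<And>T \<delta>. 0 < \<delta> \<Longrightarrow> \<delta> < T \<Longrightarrow> \<exists>wx wxx wt. C21_on {\<delta>..T} w wx wxx wt \<and>
          (\<forall>x. \<forall>t\<in>{\<delta><..<T}. wt x t = d * wxx x t - h (x, t))"
    and h: "bdd_borel2 h B"
  shows "evol (pos_part_time w) (\<lambda>x. w x 0) (\<lambda>p. d * pos_part_time w p) h"
  unfolding evol_def
proof (intro allI impI)
  fix \<phi> \<phi>1 \<phi>2 assume t: "test2 \<phi> \<phi>1 \<phi>2"
  note [measurable] = test2_borel[OF t] borel_pos_part_time[of w, OF c]
  have hm[measurable]: "h \<in> borel_measurable (borel \<Otimes>\<^sub>M borel)" and hB: "\<And>p. \<bar>h p\<bar> \<le> B" using h by auto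
  note ti = test2_integrable[OF t]
  have M0: "M \<ge> 0" using b[of 0 0] by linarith
  have wM: "\<bar>w x s\<bar> \<le> M" if "s \<ge> 0" for x s using b[OF that, of x] by simp
  obtain R C where R: "\<And>x. \<bar>x\<bar> > R \<Longrightarrow> \<phi> x = 0" "\<And>x. \<bar>\<phi> x\<bar> \<le> C"
    by (rule test2E[OF t]) blast
  have C0: "C \<ge> 0" using R(2)[of 0] by linarith
  have wc: "continuous_on UNIV (\<lambda>x. w x s)" if "s \<ge> 0" for s
    by (rule continuous_on_section[OF c[of "s + 1"]]) (use that in auto)
  have wm: "(\<lambda>x. w x s) \<in> borel_measurable borel" if "s \<ge> 0" for s
    by (rule borel_measurable_continuous_onI[OF wc[OF that]])
  define A where "A s = (\<integral>x. w x s * \<phi> x \<partial>lborel)" for s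
  define b where "b s = (\<integral>x. d * pos_part_time w (x, s) * \<phi>2 x - h (x, s) * \<phi> x \<partial>lborel)" for s
  have wi: "integrable lborel (\<lambda>x. w x s * g x)" if "s \<ge> 0" "integrable lborel g" for s g
    by (rule integrable_mult_bounded[OF that(2), where B=M]) (use wm wM that in auto)
  have pB: "\<bar>d * pos_part_time w p\<bar> \<le> \<bar>d\<bar> * M + B" for p
    using mult_left_mono[OF wM, of "snd p" "\<bar>d\<bar>" "fst p"] M0 hB[of p] by (auto simp: pos_part_time_def abs_mult)
  have pB': "bdd_borel2 (\<lambda>p. d * pos_part_time w p) (\<bar>d\<bar> * M + B)" using pB by auto
  have hB': "bdd_borel2 h (\<bar>d\<bar> * M + B)"
    using h M0 by (auto intro: order_trans[of _ B])
  have bm: "b \<in> borel_measurable borel" and bb: "\<And>s. \<bar>b s\<bar> \<le> (\<bar>d\<bar> * M + B) * (\<integral>x. \<bar>\<phi>2 x\<bar> \<partial>lborel) + (\<bar>d\<bar> * M + B) * (\<integral>x. \<bar>\<phi> x\<bar> \<partial>lborel)"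
    unfolding b_def using inner_integral_bound[OF pB' hB' ti(3,1)] by auto
  have dA: "(A has_real_derivative b s) (at s)" if s: "s > 0" for s
  proof -
    \<comment> \<open>The interval from s / 2 to 2 s contains all times within s / 2 of s in its
      interior, where the one-sided time derivatives of \<open>C21_on\<close> are two-sided.\<close>
    define \<delta> where "\<delta> = s / 2"
    define T where "T = 2 * s"
    have dT: "0 < \<delta>" "\<delta> < T" "\<delta> < s" "s < T" unfolding \<delta>_def T_def using s by auto
    obtain wx wxx wt where W: "C21_on {\<delta>..T} w wx wxx wt" "\<forall>x. \<forall>t\<in>{\<delta><..<T}. wt x t = d * wxx x t - h (x, t)"
      using pde[OF dT(1,2)] by blast
    note W1 = W(1)[unfolded C21_on_def]
    have "bounded ((\<lambda>(x, t). wt x t) ` ({-R..R} \<times> {\<delta>..T}))"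
      by (intro compact_imp_bounded compact_continuous_image compact_Times)
        (use W1 in \<open>auto intro: continuous_on_subset\<close>)
    then obtain K where K: "\<And>x r. x \<in> {-R..R} \<Longrightarrow> r \<in> {\<delta>..T} \<Longrightarrow> \<bar>wt x r\<bar> \<le> K"
      unfolding bounded_iff by (metis (no_types, lifting) SigmaI case_prod_conv image_eqI real_norm_def)
    have "(A has_real_derivative (\<integral>x. wt x s * \<phi> x \<partial>lborel)) (at s)"
      unfolding A_def[abs_def]
    proof (rule deriv_under_integral[where e="s / 2" and w="\<lambda>x. \<bar>K\<bar> * \<bar>\<phi> x\<bar>"])
      fix r x assume r: "\<bar>r - s\<bar> < s / 2"
      then have "s / 2 < r" "r < 2 * s" using s by linarith+
      then have rI: "r \<in> {\<delta><..<T}" unfolding \<delta>_def T_def by simp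
      then have "((\<lambda>s. w x s) has_real_derivative wt x r) (at r within {\<delta>..T})" using W1 by auto
      then have "((\<lambda>s. w x s) has_real_derivative wt x r) (at r)"
        using rI by (simp add: at_within_Icc_at)
      then show "((\<lambda>s. w x s * \<phi> x) has_real_derivative wt x r * \<phi> x) (at r)" by (rule DERIV_cmult_right)
      show "integrable lborel (\<lambda>x. w x r * \<phi> x)" by (rule wi[OF _ ti(1)]) (use rI dT in auto)
      show "\<bar>wt x r * \<phi> x\<bar> \<le> \<bar>K\<bar> * \<bar>\<phi> x\<bar>"
      proof (cases "\<bar>x\<bar> > R")
        case False
        then have "\<bar>wt x r\<bar> \<le> K" using rI by (intro K) auto
        then show ?thesis unfolding abs_mult by (intro mult_right_mono) auto
      qed (simp add: R)
    qed (use s ti in auto)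
    also have "(\<integral>x. wt x s * \<phi> x \<partial>lborel) = (\<integral>x. d * (wxx x s * \<phi> x) - h (x, s) * \<phi> x \<partial>lborel)"
    proof (rule Bochner_Integration.integral_cong[OF refl])
      have "wt x s = d * wxx x s - h (x, s)" for x using W(2) dT by simp
      then show "wt x s * \<phi> x = d * (wxx x s * \<phi> x) - h (x, s) * \<phi> x" for x by (simp only: left_diff_distrib mult.assoc)
    qed
    also have "\<dots> = d * (\<integral>x. wxx x s * \<phi> x \<partial>lborel) - (\<integral>x. h (x, s) * \<phi> x \<partial>lborel)"
    proof -
      have cxx: "continuous_on UNIV (\<lambda>x. wxx x s)" 
        by (rule continuous_on_section[of "{\<delta>..T}"]) (use W1 dT in auto)
      have cp: "continuous_on UNIV \<phi>" using t unfolding test2_def by (auto intro: DERIV_imp_continuous_on)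
      have "continuous_on UNIV (\<lambda>x. wxx x s * \<phi> x)" by (intro continuous_intros cxx cp)
      moreover have "wxx x s * \<phi> x = 0" if "\<bar>x\<bar> > R" for x using that by (simp add: R)
      ultimately obtain K' where "\<And>x. \<bar>wxx x s * \<phi> x\<bar> \<le> K'"
        using continuous_compact_bounded[of "\<lambda>x. wxx x s * \<phi> x" R] by blast
      then have "integrable lborel (\<lambda>x. wxx x s * \<phi> x)"
        by (rule integrable_bounded_support[where R=R, rotated]) (simp add: R, rule borel_measurable_continuous_onI, intro continuous_intros cxx cp)
      then show ?thesis using integrable_section_test[OF h ti(1), of s] by simp
    qed
    also have "(\<integral>x. wxx x s * \<phi> x \<partial>lborel) = (\<integral>x. w x s * \<phi>2 x \<partial>lborel)"
    proof (rule integral_parts_test2[OF t])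
      show "((\<lambda>x. w x s) has_real_derivative wx x s) (at x)" "((\<lambda>x. wx x s) has_real_derivative wxx x s) (at x)" for x
        using W1 dT by auto
      show "continuous_on UNIV (\<lambda>x. wxx x s)"
        by (rule continuous_on_section[of "{\<delta>..T}"]) (use W1 dT in auto)
    qed
    also have "d * (\<integral>x. w x s * \<phi>2 x \<partial>lborel) - (\<integral>x. h (x, s) * \<phi> x \<partial>lborel) = b s"
      unfolding b_def using wi[of s \<phi>2] ti s integrable_section_test[OF h ti(1), of s]
      by (simp add: pos_part_time_def mult.assoc)
    finally show ?thesis .
  qed
  have cA: "continuous_on {0..T} A" if T: "T > 0" for T
    unfolding continuous_on_sequentially
  proof (intro allI ballI impI)
    fix X and s assume s: "s \<in> {0..T}" and X: "(\<forall>n. X n \<in> {0..T}) \<and> X \<longlonglongrightarrow> s"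
    show "(A \<circ> X) \<longlonglongrightarrow> A s"
      unfolding A_def comp_def
    proof (rule integral_dominated_convergence[where w="\<lambda>x. M * \<bar>\<phi> x\<bar>"])
      have "(\<lambda>n. w x (X n)) \<longlonglongrightarrow> w x s" for x
        using continuous_on_section2[OF c[OF T], of x] X s unfolding continuous_on_sequentially comp_def by blast
      then show "AE x in lborel. (\<lambda>n. w x (X n) * \<phi> x) \<longlonglongrightarrow> w x s * \<phi> x" by (intro AE_I2 tendsto_mult_right)
      show "AE x in lborel. norm (w x (X n) * \<phi> x) \<le> M * \<bar>\<phi> x\<bar>" for n
        using X wM[of "X n"] by (intro AE_I2) (auto simp: abs_mult intro!: mult_right_mono)
    qed (use wm X s ti in auto)
  qed
  have "A \<tau> = A 0 + (\<integral>s. b s \<partial>Mt \<tau>)" if "\<tau> > 0" for \<tau>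
  proof -
    have "(\<integral>s. indicator {0..\<tau>} s * b s \<partial>lborel) = A \<tau> - A 0"
      by (rule FTC_bounded[OF _ cA[OF that] dA bm bb]) (use that in auto)
    then show ?thesis using bm by (simp add: integral_Mt)
  qed
  then show "AE \<tau> in lborel. 0 < \<tau> \<longrightarrow> (\<integral>x. pos_part_time w (x, \<tau>) * \<phi> x \<partial>lborel) = (\<integral>x. w x 0 * \<phi> x \<partial>lborel)
       + (\<integral>s. (\<integral>x. d * pos_part_time w (x, s) * \<phi>2 x - h (x, s) * \<phi> x \<partial>lborel) \<partial>Mt \<tau>)"
    by (intro AE_I2) (simp add: A_def b_def pos_part_time_def)
qed

text \<open>An argument of du Bois-Reymond type. The hypothesis \<open>H\<close> is the weak
  formulation for products phi(x) theta(t) with theta' = g and theta T = 0. Choosing theta as the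
  antiderivative from T of an arbitrary continuous g and exchanging integrals shows that a - c0 - I
  is orthogonal to all continuous g on [0, T].\<close>

lemma weak_component_evol:
  assumes w: "bdd_borel2 w B" and \<Phi>: "bdd_borel2 \<Phi> B" and h: "bdd_borel2 h B" and w0: "bdd_borel1 w0 B"
    and H: "\<And>T \<phi> \<phi>1 \<phi>2 \<theta> g. 0 < T \<Longrightarrow> test2 \<phi> \<phi>1 \<phi>2 \<Longrightarrow> continuous_on UNIV g \<Longrightarrow> \<theta> \<in> borel_measurable borel \<Longrightarrow>
      (\<And>t. t \<in> {0..T} \<Longrightarrow> (\<theta> has_real_derivative g t) (at t within {0..T})) \<Longrightarrow> \<theta> T = 0 \<Longrightarrow>
      (\<integral>s. (\<integral>x. w (x, s) * \<phi> x \<partial>lborel) * g s \<partial>Mt T)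
       + (\<integral>s. (\<integral>x. \<Phi> (x, s) * \<phi>2 x - h (x, s) * \<phi> x \<partial>lborel) * \<theta> s \<partial>Mt T) = - \<theta> 0 * (\<integral>x. w0 x * \<phi> x \<partial>lborel)"
  shows "evol w w0 \<Phi> h"
  unfolding evol_def
proof (intro allI impI)
  fix \<phi> \<phi>1 \<phi>2 assume t: "test2 \<phi> \<phi>1 \<phi>2"
  note ti = test2_integrable[OF t]
  have z2: "bdd_borel2 (\<lambda>_. 0) B" using w by (auto intro: order_trans[OF abs_ge_zero])
  define a where "a s = (\<integral>x. w (x, s) * \<phi> x \<partial>lborel)" for s
  define b where "b s = (\<integral>x. \<Phi> (x, s) * \<phi>2 x - h (x, s) * \<phi> x \<partial>lborel)" for s
  define c0 where "c0 = (\<integral>x. w0 x * \<phi> x \<partial>lborel)"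
  define Ka where "Ka = B * (\<integral>x. \<bar>\<phi> x\<bar> \<partial>lborel) + B * (\<integral>x. \<bar>\<phi> x\<bar> \<partial>lborel)"
  define Kb where "Kb = B * (\<integral>x. \<bar>\<phi>2 x\<bar> \<partial>lborel) + B * (\<integral>x. \<bar>\<phi> x\<bar> \<partial>lborel)"
  have am[measurable]: "a \<in> borel_measurable borel" and aB: "\<bar>a s\<bar> \<le> Ka" for s
    using inner_integral_bound[OF w z2 ti(1,1)] unfolding a_def Ka_def by simp_all
  have bm[measurable]: "b \<in> borel_measurable borel" and bB: "\<bar>b s\<bar> \<le> Kb" for s
    using inner_integral_bound[OF \<Phi> h ti(3,1)] unfolding b_def Kb_def by simp_all
  have Kb0: "Kb \<ge> 0" using bB[of 0] by linarith
  define I where "I r = (\<integral>s. b s \<partial>Mt r)" for r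
  have Im[measurable]: "I \<in> borel_measurable borel"
  proof -
    have "(\<lambda>r. \<integral>s. (\<lambda>p. b (snd p)) (0 :: real, s) \<partial>Mt r) \<in> borel_measurable borel"
      by (rule tint_measurable[where w="\<lambda>p. b (snd p)" and f="\<lambda>_. 0" and g="\<lambda>r. r"]) measurable
    then show ?thesis unfolding I_def[abs_def] by simp
  qed
  have key: "AE r in lborel. r \<in> {0..T} \<longrightarrow> a r = c0 + I r" if T: "T > 0" for T
  proof -
    define hh where "hh r = indicator {0..T} r * (a r - c0 - I r)" for r
    have Ib: "\<bar>I r\<bar> \<le> Kb * T" if "r \<le> T" for r
    proof -
      have "\<bar>I r\<bar> \<le> Kb * measure (Mt r) UNIV"
        unfolding I_def using abs_integral_bounded[OF finite_Mt, of b r Kb, OF _ bB] by simp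
      also have "\<dots> \<le> Kb * T" by (intro mult_left_mono measure_Mt_le[OF that] Kb0) (use T in simp)
      finally show ?thesis .
    qed
    have KT: "Kb * T \<ge> 0" using Kb0 T by simp
    have hB: "\<bar>hh r\<bar> \<le> Ka + \<bar>c0\<bar> + Kb * T" for r
    proof (cases "r \<in> {0..T}")
      case True
      then show ?thesis unfolding hh_def using aB[of r] Ib[of r] by simp
    next
      case False
      then show ?thesis unfolding hh_def using aB[of r] KT by simp
    qed
    have hm: "hh \<in> borel_measurable borel" unfolding hh_def by measurable
    have "AE r in lborel. r \<in> {0..T} \<longrightarrow> hh r = 0"
    proof (rule AE_zero_if_orthogonal_continuous[OF hm hB])
      fix g :: "real \<Rightarrow> real" assume g: "continuous_on UNIV g"
      have gm[measurable]: "g \<in> borel_measurable borel" by (rule borel_measurable_continuous_onI[OF g])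
      have "bounded (g ` {0..T})" by (intro compact_imp_bounded compact_continuous_image continuous_on_subset[OF g]) auto
      then obtain K where K: "\<And>r. r \<in> {0..T} \<Longrightarrow> \<bar>g r\<bar> \<le> K" unfolding bounded_iff by (metis image_eqI real_norm_def)
      have K0: "K \<ge> 0" using K[of 0] T by simp
      obtain P where P: "\<And>t. t \<in> {0..T} \<Longrightarrow> (P has_vector_derivative g t) (at t within {0..T})"
        using antiderivative_continuous[OF continuous_on_subset[OF g, of "{0..T}"]] by auto
      \<comment> \<open>The integral formula, rather than P t - P T, defines a Borel function on the
        whole line; on [0, T] the two agree.\<close>
      define \<theta> where "\<theta> t = - (\<integral>r. indicator {t..T} r * g r \<partial>lborel)" for t
      have "\<theta> = (\<lambda>t. - (\<integral>r. (if t \<le> r \<and> r \<le> T then g r else 0) \<partial>lborel))"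
        unfolding \<theta>_def by (auto simp: indicator_def fun_eq_iff intro!: Bochner_Integration.integral_cong)
      then have \<theta>m: "\<theta> \<in> borel_measurable borel" by simp
      have \<theta>P: "\<theta> t = P t - P T" if t: "t \<in> {0..T}" for t
      proof -
        have "(\<integral>r. indicator {t..T} r * g r \<partial>lborel) = P T - P t"
        proof (rule FTC_bounded[where B=K])
          show "continuous_on {t..T} P"
            by (rule continuous_on_subset[OF continuous_on_vector_derivative[OF P]]) (use t in auto)
          show "(P has_real_derivative g x) (at x)" if "t < x" "x < T" for x
            using P[of x] that t by (simp add: has_real_derivative_iff_has_vector_derivative at_within_Icc_at)
        qed (use t K in auto)
        then show ?thesis unfolding \<theta>_def by simp
      qed
      have d\<theta>: "(\<theta> has_real_derivative g t) (at t within {0..T})" if t: "t \<in> {0..T}" for t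
      proof -
        have "((\<lambda>t. P t - P T) has_real_derivative g t - 0) (at t within {0..T})"
          by (rule DERIV_diff) (use P[OF t] in \<open>simp_all add: has_real_derivative_iff_has_vector_derivative\<close>)
        then have "((\<lambda>t. P t - P T) has_real_derivative g t) (at t within {0..T})" by simp
        then show ?thesis
          by (rule has_field_derivative_transform_within[where d=1]) (use t \<theta>P in auto)
      qed
      have \<theta>T: "\<theta> T = 0" using \<theta>P[of T] T by simp
      have \<theta>0: "\<theta> 0 = - (\<integral>r. g r \<partial>Mt T)" unfolding \<theta>_def by (simp add: integral_Mt)
      have eq: "(\<integral>s. a s * g s \<partial>Mt T) + (\<integral>s. b s * \<theta> s \<partial>Mt T) = - \<theta> 0 * c0"
        using H[OF T t g \<theta>m d\<theta> \<theta>T] unfolding a_def b_def c0_def .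
      interpret P: pair_sigma_finite "Mt T" "Mt T" ..
      have fP: "finite_measure (Mt T \<Otimes>\<^sub>M Mt T)" by (rule finite_measure_pair_measure) (rule finite_Mt)+
      \<comment> \<open>The triangular kernel whose two iterated integrals are those of -b
        \<open>\<theta>\<close> and of g I. The indicator keeps it bounded, since g is bounded on
        [0, T] but possibly not elsewhere.\<close>
      define kk where "kk p = (if fst p \<le> snd p then b (fst p) * (indicator {0..T} (snd p) * g (snd p)) else 0)" for p :: "real \<times> real"
      have km: "kk \<in> borel_measurable (Mt T \<Otimes>\<^sub>M Mt T)" unfolding kk_def by measurable
      have gK: "\<bar>indicator {0..T} r * g r\<bar> \<le> K" for r using K[of r] K0 by (cases "r \<in> {0..T}") auto
      have kb: "\<bar>kk p\<bar> \<le> Kb * K" for p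
        using mult_mono[OF bB gK Kb0] Kb0 K0 unfolding kk_def by (auto simp: abs_mult)
      have ki: "integrable (Mt T \<Otimes>\<^sub>M Mt T) kk"
        by (rule finite_measure.integrable_boundedI[OF fP km, where B="Kb * K"]) (rule kb)
      have sw: "(\<integral>s. (\<integral>r. kk (s, r) \<partial>Mt T) \<partial>Mt T) = (\<integral>r. (\<integral>s. kk (s, r) \<partial>Mt T) \<partial>Mt T)"
        using P.integral_fst'[OF ki] P.integral_snd[of "\<lambda>x y. kk (x, y)"] ki by simp
      have e1: "(\<integral>r. kk (s, r) \<partial>Mt T) = - (b s * \<theta> s)" if s: "0 \<le> s" for s
      proof -
        have "(\<integral>r. kk (s, r) \<partial>Mt T) = (\<integral>r. indicator {0..T} r * kk (s, r) \<partial>lborel)"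
          by (rule integral_Mt) (simp add: kk_def cong: if_cong)
        also have "\<dots> = (\<integral>r. b s * (indicator {s..T} r * g r) \<partial>lborel)"
          by (rule Bochner_Integration.integral_cong) (use s in \<open>auto simp: kk_def indicator_def\<close>)
        finally show ?thesis unfolding \<theta>_def by simp
      qed
      have e2: "(\<integral>s. kk (s, r) \<partial>Mt T) = g r * I r" if r: "0 \<le> r" "r \<le> T" for r
      proof -
        have "(\<integral>s. kk (s, r) \<partial>Mt T) = (\<integral>s. indicator {0..T} s * kk (s, r) \<partial>lborel)"
          by (rule integral_Mt) (simp add: kk_def cong: if_cong)
        also have "\<dots> = (\<integral>s. g r * (indicator {0..r} s * b s) \<partial>lborel)"
          by (rule Bochner_Integration.integral_cong) (use r in \<open>auto simp: kk_def indicator_def\<close>)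
        finally show ?thesis unfolding I_def by (simp add: integral_Mt)
      qed
      have "(\<integral>s. b s * \<theta> s \<partial>Mt T) = (\<integral>s. - (\<integral>r. kk (s, r) \<partial>Mt T) \<partial>Mt T)"
      proof (rule integral_cong_AE)
        show "AE s in Mt T. b s * \<theta> s = - (\<integral>r. kk (s, r) \<partial>Mt T)" unfolding AE_Mt using e1 by simp
        show "(\<lambda>s. - (\<integral>r. kk (s, r) \<partial>Mt T)) \<in> borel_measurable (Mt T)" using km by measurable
      qed (use \<theta>m in simp)
      also have "\<dots> = - (\<integral>r. (\<integral>s. kk (s, r) \<partial>Mt T) \<partial>Mt T)" using sw by simp
      also have "(\<integral>r. (\<integral>s. kk (s, r) \<partial>Mt T) \<partial>Mt T) = (\<integral>r. g r * I r \<partial>Mt T)"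
      proof (rule integral_cong_AE)
        show "AE r in Mt T. (\<integral>s. kk (s, r) \<partial>Mt T) = g r * I r" unfolding AE_Mt using e2 by simp
        show "(\<lambda>r. (\<integral>s. kk (s, r) \<partial>Mt T)) \<in> borel_measurable (Mt T)" using km by measurable
      qed simp
      finally have eq2: "(\<integral>s. a s * g s \<partial>Mt T) - (\<integral>r. g r * I r \<partial>Mt T) - (\<integral>r. g r \<partial>Mt T) * c0 = 0"
        using eq unfolding \<theta>0 by simp
      have i: "integrable lborel (\<lambda>s. indicator {0..T} s * (a s * g s))" "integrable lborel (\<lambda>s. indicator {0..T} s * (g s * I s))"
        "integrable lborel (\<lambda>s. indicator {0..T} s * g s)"
      proof -
        show "integrable lborel (\<lambda>s. indicator {0..T} s * (a s * g s))"
          by (rule integrable_bounded_Icc[where B="Ka * K"]) (measurable, use aB K K0 in \<open>auto simp: abs_mult intro!: mult_mono order_trans[OF abs_ge_zero aB]\<close>)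
        show "integrable lborel (\<lambda>s. indicator {0..T} s * (g s * I s))"
          by (rule integrable_bounded_Icc[where B="K * (Kb * T)"]) (measurable, use Ib K K0 in \<open>auto simp: abs_mult intro!: mult_mono\<close>)
        show "integrable lborel (\<lambda>s. indicator {0..T} s * g s)"
          by (rule integrable_bounded_Icc[where B=K]) (use K in auto)
      qed
      have "(\<integral>x. indicator {0..T} x * (hh x * g x) \<partial>lborel)
          = (\<integral>s. indicator {0..T} s * (a s * g s) - indicator {0..T} s * (g s * I s) - (indicator {0..T} s * g s) * c0 \<partial>lborel)"
        by (rule Bochner_Integration.integral_cong) (auto simp: hh_def indicator_def algebra_simps)
      also have "\<dots> = (\<integral>s. indicator {0..T} s * (a s * g s) \<partial>lborel) - (\<integral>s. indicator {0..T} s * (g s * I s) \<partial>lborel)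
          - (\<integral>s. indicator {0..T} s * g s \<partial>lborel) * c0"
        using i by simp
      also have "\<dots> = 0" using eq2 by (simp add: integral_Mt)
      finally show "(\<integral>x. indicator {0..T} x * (hh x * g x) \<partial>lborel) = 0" .
    qed
    then show ?thesis by eventually_elim (auto simp: hh_def)
  qed
  \<comment> \<open>The null set in \<open>key\<close> depends on T; countably many values of T
    exhaust the positive times.\<close>
  have "AE r in lborel. \<forall>n. r \<in> {0..real (Suc n)} \<longrightarrow> a r = c0 + I r"
    unfolding AE_all_countable using key by simp
  then show "AE t in lborel. 0 < t \<longrightarrow> (\<integral>x. w (x, t) * \<phi> x \<partial>lborel) = (\<integral>x. w0 x * \<phi> x \<partial>lborel)
       + (\<integral>s. (\<integral>x. \<Phi> (x, s) * \<phi>2 x - h (x, s) * \<phi> x \<partial>lborel) \<partial>Mt t)"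
  proof eventually_elim
    case (elim r)
    show ?case
    proof
      assume "0 < r"
      moreover obtain n where "r \<le> real n" using real_arch_simple by blast
      ultimately have "r \<in> {0..real (Suc n)}" by simp
      then show "(\<integral>x. w (x, r) * \<phi> x \<partial>lborel) = (\<integral>x. w0 x * \<phi> x \<partial>lborel)
       + (\<integral>s. (\<integral>x. \<Phi> (x, s) * \<phi>2 x - h (x, s) * \<phi> x \<partial>lborel) \<partial>Mt r)"
        using elim unfolding a_def b_def c0_def I_def by blast
    qed
  qed
qed

section \<open>Borel representatives of weak solutions\<close>

lemma lebesgue_integral_AE_eq:
  fixes f g :: "'a::euclidean_space \<Rightarrow> real"
  assumes g: "g \<in> borel_measurable borel" and ae: "AE x in lebesgue. f x = g x"
  shows "f \<in> borel_measurable lebesgue" "(\<integral>x. f x \<partial>lebesgue) = (\<integral>x. g x \<partial>lborel)"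
    "integrable lborel g \<Longrightarrow> integrable lebesgue f"
proof -
  have gl: "g \<in> borel_measurable lebesgue" using g by (simp add: measurable_completion)
  have ae': "AE x in lebesgue. g x = f x" using ae by eventually_elim simp
  show fm: "f \<in> borel_measurable lebesgue" by (rule borel_measurable_AE[OF gl ae'])
  have "(\<integral>x. f x \<partial>lebesgue) = (\<integral>x. g x \<partial>lebesgue)" by (rule integral_cong_AE[OF fm gl ae])
  then show "(\<integral>x. f x \<partial>lebesgue) = (\<integral>x. g x \<partial>lborel)" using g by (simp add: integral_completion)
  assume "integrable lborel g"
  then have "integrable lebesgue g" using g by (simp add: integrable_completion)
  then show "integrable lebesgue f" using integrable_cong_AE[OF fm gl ae] by simp
qed

text \<open>Passes from the Lebesgue integrals of the weak formulation to iterated Borel integrals.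
  The function r supplies the integrability in x that Fubini requires on an unbounded slab.\<close>

lemma slab_integral:
  fixes f G :: "real \<times> real \<Rightarrow> real"
  assumes G[measurable]: "G \<in> borel_measurable (borel \<Otimes>\<^sub>M borel)" and T: "T > 0"
    and ae: "AE p in lebesgue. 0 < snd p \<and> snd p < T \<longrightarrow> f p = G p"
    and r: "integrable lborel r" and b: "\<And>x s. 0 \<le> s \<Longrightarrow> s \<le> T \<Longrightarrow> \<bar>G (x, s)\<bar> \<le> \<bar>r x\<bar>"
  shows "(\<integral>p. f p \<partial>lebesgue_on (UNIV \<times> {0<..<T})) = (\<integral>s. (\<integral>x. G (x, s) \<partial>lborel) \<partial>Mt T)"
proof -
  let ?S = "(UNIV :: real set) \<times> {0<..<T}"
  have oS: "open ?S" by (intro open_Times) auto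
  then have Sb: "?S \<in> sets borel" by simp
  have Sb2: "?S \<in> sets (borel \<Otimes>\<^sub>M borel)" using Sb by (simp add: borel_prod)
  have G1: "(\<lambda>p. indicator ?S p * G p) \<in> borel_measurable (borel \<Otimes>\<^sub>M borel)"
    using Sb2 by measurable
  have [measurable]: "r \<in> borel_measurable borel" using r by auto
  have i: "integrable (lborel \<Otimes>\<^sub>M lborel) (\<lambda>p. indicator ?S p * G p)"
  proof (rule Bochner_Integration.integrable_bound[where f="\<lambda>p. \<bar>r (fst p)\<bar> * indicator {0..T} (snd p)"])
    show "integrable (lborel \<Otimes>\<^sub>M lborel) (\<lambda>p. \<bar>r (fst p)\<bar> * indicator {0..T} (snd p))"
    proof (rule lborel_pair.Fubini_integrable)
      show "integrable lborel (\<lambda>x. \<integral>y. norm (\<bar>r (fst (x, y))\<bar> * indicator {0..T} (snd (x, y))) \<partial>lborel)"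
        using r by (simp add: abs_mult)
      show "AE x in lborel. integrable lborel (\<lambda>y. \<bar>r (fst (x, y))\<bar> * indicator {0..T} (snd (x, y)))"
        by (intro AE_I2) (simp add: emeasure_lborel_Icc_eq)
    qed measurable
    show "AE p in lborel \<Otimes>\<^sub>M lborel. norm (indicator ?S p * G p) \<le> norm (\<bar>r (fst p)\<bar> * indicator {0..T} (snd p))"
    proof (rule AE_I2)
      fix p :: "real \<times> real"
      show "norm (indicator ?S p * G p) \<le> norm (\<bar>r (fst p)\<bar> * indicator {0..T} (snd p))"
        using b[of "snd p" "fst p"] by (cases "p \<in> ?S") (auto simp: indicator_def)
    qed
  qed (use G1 in simp)
  have "(\<integral>p. f p \<partial>lebesgue_on ?S) = (\<integral>p. indicator ?S p * f p \<partial>lebesgue)"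
    using Sb by (subst integral_restrict_space) auto
  also have "\<dots> = (\<integral>p. indicator ?S p * G p \<partial>lborel)"
  proof (rule lebesgue_integral_AE_eq(2))
    show "(\<lambda>p. indicator ?S p * G p) \<in> borel_measurable borel" using G1 by (simp add: borel_prod)
    show "AE p in lebesgue. indicator ?S p * f p = indicator ?S p * G p"
      using ae by eventually_elim (auto simp: indicator_def)
  qed
  also have "\<dots> = (\<integral>p. indicator ?S p * G p \<partial>(lborel \<Otimes>\<^sub>M lborel))" by (simp only: lborel_prod)
  also have "\<dots> = (\<integral>s. (\<integral>x. indicator ?S (x, s) * G (x, s) \<partial>lborel) \<partial>lborel)"
    using lborel_pair.integral_snd[of "\<lambda>x s. indicator ?S (x, s) * G (x, s)"] i by (simp add: split_beta')
  also have "\<dots> = (\<integral>s. indicator {0..T} s * (\<integral>x. G (x, s) \<partial>lborel) \<partial>lborel)"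
  proof (rule integral_cong_AE)
    show "AE s in lborel. (\<integral>x. indicator ?S (x, s) * G (x, s) \<partial>lborel) = indicator {0..T} s * (\<integral>x. G (x, s) \<partial>lborel)"
      using AE_lborel_singleton[of 0] AE_lborel_singleton[of T]
      by eventually_elim (auto simp: indicator_def)
    show "(\<lambda>s. \<integral>x. indicator ?S (x, s) * G (x, s) \<partial>lborel) \<in> borel_measurable lborel"
      using G1 by measurable
  qed measurable
  also have "\<dots> = (\<integral>s. (\<integral>x. G (x, s) \<partial>lborel) \<partial>Mt T)" by (rule integral_Mt[symmetric]) measurable
  finally show ?thesis .
qed

text \<open>Fubini for null sets. The exceptional set is first enlarged to a Borel null set, for
  which the order of the quantifiers over x and t may be exchanged.\<close>

lemma AE_lebesgue_slices:
  fixes P :: "real \<times> real \<Rightarrow> bool"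
  assumes "AE p in lebesgue. P p"
  shows "AE t in lborel. AE x in lborel. P (x, t)"
proof -
  have "AE p in lborel. P p" using assms by (simp add: AE_completion_iff)
  then have ae: "AE p in lborel \<Otimes>\<^sub>M lborel. P p" by (simp only: lborel_prod)
  then obtain N where N: "{p \<in> space (lborel \<Otimes>\<^sub>M lborel). \<not> P p} \<subseteq> N" "N \<in> null_sets (lborel \<Otimes>\<^sub>M lborel)"
    by (rule AE_E) (blast intro: null_setsI)
  have "AE p in lborel \<Otimes>\<^sub>M lborel. p \<notin> N" by (rule AE_not_in[OF N(2)])
  then have "AE x in lborel. AE t in lborel. (x, t) \<notin> N" by (rule lborel_pair.AE_pair)
  moreover have Ns: "N \<in> sets (lborel \<Otimes>\<^sub>M lborel)" using N(2) by auto
  moreover have "{p \<in> space (lborel \<Otimes>\<^sub>M lborel). (fst p, snd p) \<notin> N} \<in> sets (lborel \<Otimes>\<^sub>M lborel)"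
    using Ns by measurable
  ultimately have "AE t in lborel. AE x in lborel. (x, t) \<notin> N"
    using lborel_pair.AE_commute[of "\<lambda>x t. (x, t) \<notin> N"] by simp
  then show ?thesis
  proof eventually_elim
    case (elim t)
    then show ?case by eventually_elim (use N(1) in \<open>auto simp: space_pair_measure\<close>)
  qed
qed

text \<open>Measurability is known on bounded boxes only, so w at positive times is the limit of its
  restrictions to growing boxes. The Borel version is clamped to [0, M], so the bounds hold at every
  point and F can be applied there.\<close>

lemma borel_representative:
  fixes w :: "real \<Rightarrow> real \<Rightarrow> real"
  assumes m: "\<And>J T. J > 0 \<Longrightarrow> T > 0 \<Longrightarrow> (\<lambda>(x, t). w x t) \<in> borel_measurable (lebesgue_on ({-J<..<J} \<times> {0<..<T}))"
    and b: "\<And>T. T > 0 \<Longrightarrow> AE (x, t) in lebesgue_on (UNIV \<times> {0<..<T}). 0 \<le> w x t \<and> w x t \<le> M" and M: "M \<ge> 0"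
  obtains W where "W \<in> borel_measurable (borel \<Otimes>\<^sub>M borel)" "\<And>p. 0 \<le> W p \<and> W p \<le> M"
    "AE p in lebesgue. 0 < snd p \<longrightarrow> w (fst p) (snd p) = W p"
proof -
  have op: "open ({-J<..<J} \<times> {0<..<T})" "open ((UNIV :: real set) \<times> {0<..<T})" for J T :: real
    by (intro open_Times; auto)+
  have lim: "(\<lambda>n. if p \<in> {-real (Suc n)<..<real (Suc n)} \<times> {0<..<real (Suc n)} then (\<lambda>(x, t). w x t) p else 0)
      \<longlonglongrightarrow> pos_part_time w p" for p
  proof (rule tendsto_eventually)
    obtain N :: nat where N: "max \<bar>fst p\<bar> \<bar>snd p\<bar> \<le> real N" using real_arch_simple by blast
    show "\<forall>\<^sub>F n in sequentially. (if p \<in> {-real (Suc n)<..<real (Suc n)} \<times> {0<..<real (Suc n)} then (\<lambda>(x, t). w x t) p else 0) = pos_part_time w p"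
    proof (rule eventually_sequentiallyI[of N])
      fix n assume "N \<le> n"
      then have "\<bar>fst p\<bar> < real (Suc n)" "\<bar>snd p\<bar> < real (Suc n)" using N by linarith+
      then have "p \<in> {-real (Suc n)<..<real (Suc n)} \<times> {0<..<real (Suc n)} \<longleftrightarrow> snd p > 0"
        by (cases p) (auto simp: abs_less_iff)
      then show "(if p \<in> {-real (Suc n)<..<real (Suc n)} \<times> {0<..<real (Suc n)} then (\<lambda>(x, t). w x t) p else 0) = pos_part_time w p"
        by (simp add: pos_part_time_def split_beta')
    qed
  qed
  have "pos_part_time w \<in> borel_measurable lebesgue"
  proof (rule borel_measurable_LIMSEQ_real[OF lim])
    show "(\<lambda>p. if p \<in> {-real (Suc n)<..<real (Suc n)} \<times> {0<..<real (Suc n)} then (\<lambda>(x, t). w x t) p else 0) \<in> borel_measurable lebesgue" for n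
      by (subst borel_measurable_if) (use op(1)[of "real (Suc n)" "real (Suc n)"] m[of "real (Suc n)" "real (Suc n)"] in auto)
  qed
  then obtain g where g: "g \<in> borel_measurable lborel" "AE p in lborel. pos_part_time w p = g p"
    using completion_ex_borel_measurable_real by blast
  define W where "W p = max 0 (min M (g p))" for p
  have "AE p in lebesgue. \<forall>n. snd p \<in> {0<..<real (Suc n)} \<longrightarrow> 0 \<le> w (fst p) (snd p) \<and> w (fst p) (snd p) \<le> M"
    unfolding AE_all_countable
  proof
    fix n
    have "AE p in lebesgue. p \<in> UNIV \<times> {0<..<real (Suc n)} \<longrightarrow> (case p of (x, t) \<Rightarrow> 0 \<le> w x t \<and> w x t \<le> M)"
      by (rule AE_restrict_space_iff[THEN iffD1, OF _ b]) (use op(2)[of "real (Suc n)"] in auto)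
    then show "AE p in lebesgue. snd p \<in> {0<..<real (Suc n)} \<longrightarrow> 0 \<le> w (fst p) (snd p) \<and> w (fst p) (snd p) \<le> M"
      by eventually_elim (auto simp: mem_Times_iff split_beta')
  qed
  moreover have "AE p in lebesgue. pos_part_time w p = g p" using g(2) by (simp add: AE_completion_iff)
  ultimately have ae: "AE p in lebesgue. 0 < snd p \<longrightarrow> w (fst p) (snd p) = W p"
  proof eventually_elim
    case (elim p)
    show ?case
    proof
      assume p: "0 < snd p"
      obtain n :: nat where "snd p \<le> real n" using real_arch_simple by blast
      then have "snd p \<in> {0<..<real (Suc n)}" using p by simp
      then have "0 \<le> w (fst p) (snd p) \<and> w (fst p) (snd p) \<le> M" using elim(1) by blast
      moreover have "w (fst p) (snd p) = g p" using elim(2) p by (simp add: pos_part_time_def)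
      ultimately show "w (fst p) (snd p) = W p" unfolding W_def by simp
    qed
  qed
  show ?thesis
    by (rule that[of W, OF _ _ ae]) (use g(1) M in \<open>auto simp: W_def[abs_def] borel_prod\<close>)
qed

text \<open>Separates the variables of the test function: class C^{2,1} requires one continuous time
  derivative only, so every C^1 function theta is admissible in time.\<close>

lemma weak_solution_test:
  assumes ws: "weak_solution du k F u0 v0 M T u v" and T: "T > 0" and t: "test2 \<phi> \<phi>1 \<phi>2"
    and g: "continuous_on UNIV g" and d: "\<And>t. t \<in> {0..T} \<Longrightarrow> (\<theta> has_real_derivative g t) (at t within {0..T})"
    and \<theta>T: "\<theta> T = 0"
  shows "(\<integral>(x, t). u x t * (\<phi> x * g t) \<partial>lebesgue_on (UNIV \<times> {0<..<T})) +
        (\<integral>(x, t). du * u x t * (\<phi>2 x * \<theta> t) - k * F (u x t) (v x t) * (\<phi> x * \<theta> t)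
            \<partial>lebesgue_on (UNIV \<times> {0<..<T})) = - (\<integral>x. u0 x * (\<phi> x * \<theta> 0) \<partial>lebesgue)"
    "(\<integral>(x, t). v x t * (\<phi> x * g t) \<partial>lebesgue_on (UNIV \<times> {0<..<T})) -
        (\<integral>(x, t). k * F (u x t) (v x t) * (\<phi> x * \<theta> t)
            \<partial>lebesgue_on (UNIV \<times> {0<..<T})) = - (\<integral>x. v0 x * (\<phi> x * \<theta> 0) \<partial>lebesgue)"
proof -
  have d2: "\<And>x. (\<phi> has_real_derivative \<phi>1 x) (at x)" "\<And>x. (\<phi>1 has_real_derivative \<phi>2 x) (at x)" "continuous_on UNIV \<phi>2"
    using t unfolding test2_def by auto
  have c: "continuous_on UNIV \<phi>" "continuous_on UNIV \<phi>1" "continuous_on {0..T} \<theta>" "continuous_on {0..T} g"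
    using DERIV_imp_continuous_on[OF d2(1)] DERIV_imp_continuous_on[OF d2(2)] DERIV_continuous_on[OF d] continuous_on_subset[OF g]
    by auto
  have joint: "continuous_on (UNIV \<times> {0..T}) (\<lambda>(x, t). a x * b t)"
    if "continuous_on UNIV a" "continuous_on {0..T} b" for a b :: "real \<Rightarrow> real"
  proof -
    have "continuous_on (UNIV \<times> {0..T}) (\<lambda>p. a (fst p) * b (snd p))"
      by (intro continuous_on_mult continuous_on_compose2[OF that(1)] continuous_on_compose2[OF that(2)])
        (auto intro!: continuous_intros)
    then show ?thesis by (simp add: split_beta')
  qed
  have C: "C21_on {0..T} (\<lambda>x t. \<phi> x * \<theta> t) (\<lambda>x t. \<phi>1 x * \<theta> t) (\<lambda>x t. \<phi>2 x * \<theta> t) (\<lambda>x t. \<phi> x * g t)"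
    unfolding C21_on_def by (intro conjI allI ballI joint c d2 DERIV_cmult_right DERIV_cmult d)
  obtain R where R: "R > 0" "\<And>x. \<bar>x\<bar> > R \<Longrightarrow> \<phi> x = 0" by (rule test2E[OF t]) blast
  have z: "\<forall>x. \<phi> x * \<theta> T = 0" using \<theta>T by simp
  have s: "\<exists>J>0. \<forall>x. \<forall>t\<in>{0..T}. \<bar>x\<bar> > J \<longrightarrow> \<phi> x * \<theta> t = 0" using R by auto
  note W = ws[unfolded weak_solution_def, THEN conjunct2, THEN conjunct2, THEN conjunct2, rule_format, OF conjI[OF C conjI[OF z s]]]
  show "(\<integral>(x, t). u x t * (\<phi> x * g t) \<partial>lebesgue_on (UNIV \<times> {0<..<T})) +
        (\<integral>(x, t). du * u x t * (\<phi>2 x * \<theta> t) - k * F (u x t) (v x t) * (\<phi> x * \<theta> t)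
            \<partial>lebesgue_on (UNIV \<times> {0<..<T})) = - (\<integral>x. u0 x * (\<phi> x * \<theta> 0) \<partial>lebesgue)"
    by (rule W[THEN conjunct1])
  show "(\<integral>(x, t). v x t * (\<phi> x * g t) \<partial>lebesgue_on (UNIV \<times> {0<..<T})) -
        (\<integral>(x, t). k * F (u x t) (v x t) * (\<phi> x * \<theta> t)
            \<partial>lebesgue_on (UNIV \<times> {0<..<T})) = - (\<integral>x. v0 x * (\<phi> x * \<theta> 0) \<partial>lebesgue)"
    by (rule W[THEN conjunct2])
qed

lemma continuous_on_Icc_bound:
  fixes f :: "real \<Rightarrow> real"
  assumes "continuous_on {a..b} f"
  obtains K where "K \<ge> 0" "\<And>x. x \<in> {a..b} \<Longrightarrow> \<bar>f x\<bar> \<le> K"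
proof -
  have "bounded (f ` {a..b})" by (intro compact_imp_bounded compact_continuous_image assms) auto
  then obtain K where "\<And>x. x \<in> {a..b} \<Longrightarrow> \<bar>f x\<bar> \<le> K" unfolding bounded_iff by (metis image_eqI real_norm_def)
  then show ?thesis using that[of "\<bar>K\<bar>"] by (metis abs_ge_self abs_ge_zero order_trans)
qed

text \<open>The vanishing flux of v is written \<open>0 * V p\<close>, so that the conclusion has
  the shape of the diffusive case with dv = 0 and both kinds of solutions continue in the same
  way.\<close>

lemma weak_solution_evol:
  assumes F: "reaction_rate F" and M: "M \<ge> 0" and k: "k > 0" and du: "du > 0"
    and u0: "u0 \<in> borel_measurable borel" "\<And>x. 0 \<le> u0 x \<and> u0 x \<le> M" and v0: "v0 \<in> borel_measurable borel" "\<And>x. 0 \<le> v0 x \<and> v0 x \<le> M"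
    and ws: "\<And>T. T > 0 \<Longrightarrow> weak_solution du k F u0 v0 M T u v"
  obtains U V where "U \<in> borel_measurable (borel \<Otimes>\<^sub>M borel)" "\<And>p. 0 \<le> U p \<and> U p \<le> M"
    "V \<in> borel_measurable (borel \<Otimes>\<^sub>M borel)" "\<And>p. 0 \<le> V p \<and> V p \<le> M"
    "AE p in lebesgue. 0 < snd p \<longrightarrow> u (fst p) (snd p) = U p" "AE p in lebesgue. 0 < snd p \<longrightarrow> v (fst p) (snd p) = V p"
    "evol U u0 (\<lambda>p. du * U p) (\<lambda>p. k * F (U p) (V p))" "evol V v0 (\<lambda>p. 0 * V p) (\<lambda>p. k * F (U p) (V p))"
proof -
  have mu: "(\<lambda>(x, t). u x t) \<in> borel_measurable (lebesgue_on ({-J<..<J} \<times> {0<..<T}))" if "J > 0" "T > 0" for J T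
  proof -
    have "W21p 1 ({-J<..<J} \<times> {0<..<T}) u"
      using ws[OF that(2), unfolded weak_solution_def, THEN conjunct2, THEN conjunct1] that(1) by simp
    then show ?thesis unfolding W21p_def Lp2_def by blast
  qed
  have mv: "(\<lambda>(x, t). v x t) \<in> borel_measurable (lebesgue_on ({-J<..<J} \<times> {0<..<T}))" if "J > 0" "T > 0" for J T
  proof -
    have "W1inf_Linf T {-J<..<J} v"
      using ws[OF that(2), unfolded weak_solution_def, THEN conjunct2, THEN conjunct2, THEN conjunct1] that(1) by simp
    then show ?thesis unfolding W1inf_Linf_def Linf_Linf_def by blast
  qed
  have bnd: "AE (x, t) in lebesgue_on (UNIV \<times> {0<..<T}). 0 \<le> u x t \<and> u x t \<le> M \<and> 0 \<le> v x t \<and> v x t \<le> M" if "T > 0" for T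
    using ws[OF that, unfolded weak_solution_def, THEN conjunct1] .
  have bu: "AE (x, t) in lebesgue_on (UNIV \<times> {0<..<T}). 0 \<le> u x t \<and> u x t \<le> M" if "T > 0" for T
    using bnd[OF that] by eventually_elim auto
  have bv: "AE (x, t) in lebesgue_on (UNIV \<times> {0<..<T}). 0 \<le> v x t \<and> v x t \<le> M" if "T > 0" for T
    using bnd[OF that] by eventually_elim auto
  obtain U where U[measurable]: "U \<in> borel_measurable (borel \<Otimes>\<^sub>M borel)" and Ub: "\<And>p. 0 \<le> U p \<and> U p \<le> M"
    and Uae: "AE p in lebesgue. 0 < snd p \<longrightarrow> u (fst p) (snd p) = U p"
    using borel_representative[of u M, OF mu bu M] by blast
  obtain V where V[measurable]: "V \<in> borel_measurable (borel \<Otimes>\<^sub>M borel)" and Vb: "\<And>p. 0 \<le> V p \<and> V p \<le> M"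
    and Vae: "AE p in lebesgue. 0 < snd p \<longrightarrow> v (fst p) (snd p) = V p"
    using borel_representative[of v M, OF mv bv M] by blast
  define h where "h p = k * F (U p) (V p)" for p
  have hm[measurable]: "h \<in> borel_measurable (borel \<Otimes>\<^sub>M borel)"
    unfolding h_def by (intro borel_measurable_times borel_measurable_const reaction_rate_borel[OF F M U Ub V Vb])
  have hb: "0 \<le> h p" "h p \<le> k * F M M" for p
    using reaction_rate_bounds[OF F, of "U p" M "V p"] Ub[of p] Vb[of p] k unfolding h_def by simp_all
  define B where "B = M + du * M + k * F M M"
  have FM: "0 \<le> k * F M M" using hb[of "(0,0)"] by linarith
  have duM: "0 \<le> du * M" using du M by simp
  have UB: "bdd_borel2 U B" "bdd_borel2 V B" "bdd_borel2 (\<lambda>p. du * U p) B" "bdd_borel2 h B" "bdd_borel2 (\<lambda>p. 0 * V p) B"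
  proof -
    have "\<bar>U p\<bar> \<le> B" "\<bar>V p\<bar> \<le> B" "\<bar>h p\<bar> \<le> B" "\<bar>du * U p\<bar> \<le> B" for p
    proof -
      have "0 \<le> du * U p" "du * U p \<le> du * M" using Ub[of p] du by simp_all
      then show "\<bar>U p\<bar> \<le> B" "\<bar>V p\<bar> \<le> B" "\<bar>h p\<bar> \<le> B" "\<bar>du * U p\<bar> \<le> B"
        using Ub[of p] Vb[of p] hb[of p] FM duM M unfolding B_def by linarith+
    qed
    moreover have "B \<ge> 0" using FM duM M unfolding B_def by simp
    ultimately show "bdd_borel2 U B" "bdd_borel2 V B" "bdd_borel2 (\<lambda>p. du * U p) B" "bdd_borel2 h B" "bdd_borel2 (\<lambda>p. 0 * V p) B"
      by simp_all
  qed
  have u0B: "bdd_borel1 u0 B" "bdd_borel1 v0 B"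
  proof -
    have "\<bar>u0 x\<bar> \<le> B" "\<bar>v0 x\<bar> \<le> B" for x
      using u0(2)[of x] v0(2)[of x] FM duM unfolding B_def by linarith+
    then show "bdd_borel1 u0 B" "bdd_borel1 v0 B" using u0 v0 by simp_all
  qed
  have ae: "AE p in lebesgue. 0 < snd p \<longrightarrow> u (fst p) (snd p) = U p \<and> k * F (u (fst p) (snd p)) (v (fst p) (snd p)) = h p \<and> v (fst p) (snd p) = V p"
    using Uae Vae by eventually_elim (simp add: h_def)
  have B0: "B \<ge> 0" using FM duM M unfolding B_def by simp
  have init: "(\<integral>x. w0 x * (\<phi> x * c) \<partial>lebesgue) = c * (\<integral>x. w0 x * \<phi> x \<partial>lborel)"
    if [measurable]: "w0 \<in> borel_measurable borel" "\<phi> \<in> borel_measurable borel" for w0 \<phi> :: "real \<Rightarrow> real" and c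
  proof -
    have "(\<integral>x. w0 x * (\<phi> x * c) \<partial>lebesgue) = (\<integral>x. w0 x * (\<phi> x * c) \<partial>lborel)" by (rule integral_completion) simp
    also have "\<dots> = (\<integral>x. c * (w0 x * \<phi> x) \<partial>lborel)" by (simp add: mult_ac)
    finally show ?thesis by simp
  qed
  have slab1: "(\<integral>(x, t). w x t * (\<phi> x * g t) \<partial>lebesgue_on (UNIV \<times> {0<..<T})) = (\<integral>s. (\<integral>x. W (x, s) * \<phi> x \<partial>lborel) * g s \<partial>Mt T)"
    if T: "T > 0" and t: "test2 \<phi> \<phi>1 \<phi>2" and g: "g \<in> borel_measurable borel" "\<And>s. s \<in> {0..T} \<Longrightarrow> \<bar>g s\<bar> \<le> K" "K \<ge> 0" and W: "bdd_borel2 W B"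
      and wW: "AE p in lebesgue. 0 < snd p \<longrightarrow> w (fst p) (snd p) = W p" for T \<phi> \<phi>1 \<phi>2 g K w W
  proof -
    note [measurable] = test2_borel[OF t] g(1)
    have [measurable]: "W \<in> borel_measurable (borel \<Otimes>\<^sub>M borel)" using W by simp
    have "(\<integral>p. (case p of (x, t) \<Rightarrow> w x t * (\<phi> x * g t)) \<partial>lebesgue_on (UNIV \<times> {0<..<T}))
        = (\<integral>s. (\<integral>x. (\<lambda>p. W p * (\<phi> (fst p) * g (snd p))) (x, s) \<partial>lborel) \<partial>Mt T)"
    proof (rule slab_integral[OF _ T, where r="\<lambda>x. B * K * \<phi> x"])
      show "AE p in lebesgue. 0 < snd p \<and> snd p < T \<longrightarrow> (case p of (x, t) \<Rightarrow> w x t * (\<phi> x * g t)) = W p * (\<phi> (fst p) * g (snd p))"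
        using wW by eventually_elim (simp add: split_beta')
      show "\<bar>(\<lambda>p. W p * (\<phi> (fst p) * g (snd p))) (x, s)\<bar> \<le> \<bar>B * K * \<phi> x\<bar>" if "0 \<le> s" "s \<le> T" for x s
      proof -
        have "\<bar>W (x, s)\<bar> * (\<bar>\<phi> x\<bar> * \<bar>g s\<bar>) \<le> B * (\<bar>\<phi> x\<bar> * K)"
          using W g that B0 by (intro mult_mono) auto
        then show ?thesis using B0 g(3) by (simp add: abs_mult mult_ac)
      qed
      show "integrable lborel (\<lambda>x. B * K * \<phi> x)" using test2_integrable(1)[OF t] by simp
    qed measurable
    moreover have "(\<integral>x. W (x, s) * (\<phi> x * g s) \<partial>lborel) = (\<integral>x. W (x, s) * \<phi> x \<partial>lborel) * g s" for s
      by (simp flip: mult.assoc)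
    ultimately show ?thesis by simp
  qed
  have slab2: "(\<integral>(x, t). c * w x t * (\<phi>2 x * \<theta> t) - k * F (u x t) (v x t) * (\<phi> x * \<theta> t) \<partial>lebesgue_on (UNIV \<times> {0<..<T}))
      = (\<integral>s. (\<integral>x. c * W (x, s) * \<phi>2 x - h (x, s) * \<phi> x \<partial>lborel) * \<theta> s \<partial>Mt T)"
    if T: "T > 0" and t: "test2 \<phi> \<phi>1 \<phi>2" and g: "\<theta> \<in> borel_measurable borel" "\<And>s. s \<in> {0..T} \<Longrightarrow> \<bar>\<theta> s\<bar> \<le> K" "K \<ge> 0" and W: "bdd_borel2 (\<lambda>p. c * W p) B"
      and Wm: "W \<in> borel_measurable (borel \<Otimes>\<^sub>M borel)"
      and wW: "AE p in lebesgue. 0 < snd p \<longrightarrow> w (fst p) (snd p) = W p" for T \<phi> \<phi>1 \<phi>2 \<theta> K w W c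
  proof -
    note [measurable] = test2_borel[OF t] g(1) Wm
    have "(\<integral>p. (case p of (x, t) \<Rightarrow> c * w x t * (\<phi>2 x * \<theta> t) - k * F (u x t) (v x t) * (\<phi> x * \<theta> t)) \<partial>lebesgue_on (UNIV \<times> {0<..<T}))
        = (\<integral>s. (\<integral>x. (\<lambda>p. c * W p * (\<phi>2 (fst p) * \<theta> (snd p)) - h p * (\<phi> (fst p) * \<theta> (snd p))) (x, s) \<partial>lborel) \<partial>Mt T)"
    proof (rule slab_integral[OF _ T, where r="\<lambda>x. B * K * (\<bar>\<phi>2 x\<bar> + \<bar>\<phi> x\<bar>)"])
      show "AE p in lebesgue. 0 < snd p \<and> snd p < T \<longrightarrow> (case p of (x, t) \<Rightarrow> c * w x t * (\<phi>2 x * \<theta> t) - k * F (u x t) (v x t) * (\<phi> x * \<theta> t))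
          = c * W p * (\<phi>2 (fst p) * \<theta> (snd p)) - h p * (\<phi> (fst p) * \<theta> (snd p))"
        using wW ae by eventually_elim (simp add: split_beta' h_def)
      show "\<bar>(\<lambda>p. c * W p * (\<phi>2 (fst p) * \<theta> (snd p)) - h p * (\<phi> (fst p) * \<theta> (snd p))) (x, s)\<bar> \<le> \<bar>B * K * (\<bar>\<phi>2 x\<bar> + \<bar>\<phi> x\<bar>)\<bar>" if "0 \<le> s" "s \<le> T" for x s
      proof -
        have "\<bar>c * W (x, s)\<bar> * (\<bar>\<phi>2 x\<bar> * \<bar>\<theta> s\<bar>) \<le> B * (\<bar>\<phi>2 x\<bar> * K)" "\<bar>h (x, s)\<bar> * (\<bar>\<phi> x\<bar> * \<bar>\<theta> s\<bar>) \<le> B * (\<bar>\<phi> x\<bar> * K)"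
          using W UB(4) g that B0 by (intro mult_mono; simp)+
        then have "\<bar>c * W (x, s) * (\<phi>2 x * \<theta> s) - h (x, s) * (\<phi> x * \<theta> s)\<bar> \<le> B * (\<bar>\<phi>2 x\<bar> * K) + B * (\<bar>\<phi> x\<bar> * K)"
          unfolding abs_mult[symmetric] by linarith
        also have "\<dots> = \<bar>B * K * (\<bar>\<phi>2 x\<bar> + \<bar>\<phi> x\<bar>)\<bar>" using B0 g(3) by (simp add: algebra_simps abs_mult)
        finally show ?thesis by simp
      qed
      show "integrable lborel (\<lambda>x. B * K * (\<bar>\<phi>2 x\<bar> + \<bar>\<phi> x\<bar>))" using test2_integrable(1,3)[OF t] by simp
    qed measurable
    moreover have "(\<integral>x. c * W (x, s) * (\<phi>2 x * \<theta> s) - h (x, s) * (\<phi> x * \<theta> s) \<partial>lborel)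
        = (\<integral>x. c * W (x, s) * \<phi>2 x - h (x, s) * \<phi> x \<partial>lborel) * \<theta> s" for s
      by (subst integral_mult_left_zero[symmetric]) (simp add: algebra_simps)
    ultimately show ?thesis by simp
  qed
  have eU: "evol U u0 (\<lambda>p. du * U p) h"
  proof (rule weak_component_evol[OF UB(1) UB(3) UB(4) u0B(1)])
    fix T \<phi> \<phi>1 \<phi>2 \<theta> g
    assume a: "0 < T" "test2 \<phi> \<phi>1 \<phi>2" "continuous_on UNIV g" "\<theta> \<in> borel_measurable borel"
      "\<And>t. t \<in> {0..T} \<Longrightarrow> (\<theta> has_real_derivative g t) (at t within {0..T})" "\<theta> T = 0"
    note gm = borel_measurable_continuous_onI[OF a(3)]
    obtain K1 where K1: "K1 \<ge> 0" "\<And>s. s \<in> {0..T} \<Longrightarrow> \<bar>g s\<bar> \<le> K1"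
      using continuous_on_Icc_bound[OF continuous_on_subset[OF a(3) subset_UNIV], of 0 T] by blast
    obtain K2 where K2: "K2 \<ge> 0" "\<And>s. s \<in> {0..T} \<Longrightarrow> \<bar>\<theta> s\<bar> \<le> K2"
      using continuous_on_Icc_bound[OF DERIV_continuous_on[OF a(5)]] by blast
    have s1: "(\<integral>(x, t). u x t * (\<phi> x * g t) \<partial>lebesgue_on (UNIV \<times> {0<..<T})) = (\<integral>s. (\<integral>x. U (x, s) * \<phi> x \<partial>lborel) * g s \<partial>Mt T)"
      by (rule slab1[OF a(1,2) gm K1(2) K1(1) UB(1) Uae])
    have s2: "(\<integral>(x, t). du * u x t * (\<phi>2 x * \<theta> t) - k * F (u x t) (v x t) * (\<phi> x * \<theta> t) \<partial>lebesgue_on (UNIV \<times> {0<..<T}))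
      = (\<integral>s. (\<integral>x. du * U (x, s) * \<phi>2 x - h (x, s) * \<phi> x \<partial>lborel) * \<theta> s \<partial>Mt T)"
      by (rule slab2[OF a(1,2,4) K2(2) K2(1) UB(3) U Uae])
    show "(\<integral>s. (\<integral>x. U (x, s) * \<phi> x \<partial>lborel) * g s \<partial>Mt T)
       + (\<integral>s. (\<integral>x. du * U (x, s) * \<phi>2 x - h (x, s) * \<phi> x \<partial>lborel) * \<theta> s \<partial>Mt T) = - \<theta> 0 * (\<integral>x. u0 x * \<phi> x \<partial>lborel)"
      using weak_solution_test(1)[OF ws[OF a(1)] a(1,2,3,5,6)]
      unfolding s1 s2 init[OF u0(1) test2_borel(1)[OF a(2)]]
      by simp
  qed
  have eV: "evol V v0 (\<lambda>p. 0 * V p) h"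
  proof (rule weak_component_evol[OF UB(2) UB(5) UB(4) u0B(2)])
    fix T \<phi> \<phi>1 \<phi>2 \<theta> g
    assume a: "0 < T" "test2 \<phi> \<phi>1 \<phi>2" "continuous_on UNIV g" "\<theta> \<in> borel_measurable borel"
      "\<And>t. t \<in> {0..T} \<Longrightarrow> (\<theta> has_real_derivative g t) (at t within {0..T})" "\<theta> T = 0"
    note gm = borel_measurable_continuous_onI[OF a(3)]
    obtain K1 where K1: "K1 \<ge> 0" "\<And>s. s \<in> {0..T} \<Longrightarrow> \<bar>g s\<bar> \<le> K1"
      using continuous_on_Icc_bound[OF continuous_on_subset[OF a(3) subset_UNIV], of 0 T] by blast
    obtain K2 where K2: "K2 \<ge> 0" "\<And>s. s \<in> {0..T} \<Longrightarrow> \<bar>\<theta> s\<bar> \<le> K2"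
      using continuous_on_Icc_bound[OF DERIV_continuous_on[OF a(5)]] by blast
    \<comment> \<open>Seen as an equation with diffusion coefficient 0, the equation for v is
      covered by \<open>slab2\<close>, which was proved for an arbitrary coefficient.\<close>
    have neg: "(\<integral>(x, t). 0 * v x t * (\<phi>2 x * \<theta> t) - k * F (u x t) (v x t) * (\<phi> x * \<theta> t) \<partial>lebesgue_on (UNIV \<times> {0<..<T}))
        = - (\<integral>(x, t). k * F (u x t) (v x t) * (\<phi> x * \<theta> t) \<partial>lebesgue_on (UNIV \<times> {0<..<T}))"
      unfolding integral_minus[symmetric] by (intro Bochner_Integration.integral_cong) auto
    have s1: "(\<integral>(x, t). v x t * (\<phi> x * g t) \<partial>lebesgue_on (UNIV \<times> {0<..<T})) = (\<integral>s. (\<integral>x. V (x, s) * \<phi> x \<partial>lborel) * g s \<partial>Mt T)"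
      by (rule slab1[OF a(1,2) gm K1(2) K1(1) UB(2) Vae])
    have s2: "(\<integral>(x, t). 0 * v x t * (\<phi>2 x * \<theta> t) - k * F (u x t) (v x t) * (\<phi> x * \<theta> t) \<partial>lebesgue_on (UNIV \<times> {0<..<T}))
      = (\<integral>s. (\<integral>x. 0 * V (x, s) * \<phi>2 x - h (x, s) * \<phi> x \<partial>lborel) * \<theta> s \<partial>Mt T)"
      by (rule slab2[OF a(1,2,4) K2(2) K2(1) UB(5) V Vae])
    show "(\<integral>s. (\<integral>x. V (x, s) * \<phi> x \<partial>lborel) * g s \<partial>Mt T)
       + (\<integral>s. (\<integral>x. 0 * V (x, s) * \<phi>2 x - h (x, s) * \<phi> x \<partial>lborel) * \<theta> s \<partial>Mt T) = - \<theta> 0 * (\<integral>x. v0 x * \<phi> x \<partial>lborel)"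
      using weak_solution_test(2)[OF ws[OF a(1)] a(1,2,3,5,6)] neg
      unfolding s1 s2 init[OF v0(1) test2_borel(1)[OF a(2)]]
      by linarith
  qed
  show ?thesis
    by (rule that[OF U Ub V Vb Uae Vae]) (use eU eV in \<open>simp_all only: h_def[abs_def]\<close>)
qed

lemma classical_solution_evol:
  assumes F: "reaction_rate F" and M: "M \<ge> 0" and k: "k > 0"
    and cs: "\<And>T. T > 0 \<Longrightarrow> classical_solution du dv k F u0 v0 M T u v"
  obtains U V where "U \<in> borel_measurable (borel \<Otimes>\<^sub>M borel)" "\<And>p. 0 \<le> U p \<and> U p \<le> M"
    "V \<in> borel_measurable (borel \<Otimes>\<^sub>M borel)" "\<And>p. 0 \<le> V p \<and> V p \<le> M"
    "AE p in lebesgue. 0 < snd p \<longrightarrow> u (fst p) (snd p) = U p" "AE p in lebesgue. 0 < snd p \<longrightarrow> v (fst p) (snd p) = V p"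
    "evol U u0 (\<lambda>p. du * U p) (\<lambda>p. k * F (U p) (V p))" "evol V v0 (\<lambda>p. dv * V p) (\<lambda>p. k * F (U p) (V p))"
proof -
  note cs' = cs[unfolded classical_solution_def]
  have b: "0 \<le> u x t \<and> u x t \<le> M \<and> 0 \<le> v x t \<and> v x t \<le> M" if "0 \<le> t" for x t
    using cs'[of "t + 1", THEN conjunct1] that by auto
  have cu: "continuous_on (UNIV \<times> {0..T}) (\<lambda>(x, t). u x t)" if "T > 0" for T
    by (rule cs'[OF that, THEN conjunct2, THEN conjunct1])
  have cv: "continuous_on (UNIV \<times> {0..T}) (\<lambda>(x, t). v x t)" if "T > 0" for T
    by (rule cs'[OF that, THEN conjunct2, THEN conjunct2, THEN conjunct1])
  have init: "u x 0 = u0 x" "v x 0 = v0 x" for x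
    using cs'[of 1, THEN conjunct2, THEN conjunct2, THEN conjunct2, THEN conjunct2, THEN conjunct2] by simp_all
  have pde: "\<exists>ux uxx ut vx vxx vt.
          C21_on {\<delta>..T} u ux uxx ut \<and> C21_on {\<delta>..T} v vx vxx vt \<and>
          (\<forall>x. \<forall>t\<in>{\<delta><..<T}. ut x t = du * uxx x t - k * F (u x t) (v x t) \<and>
                              vt x t = dv * vxx x t - k * F (u x t) (v x t))" if "0 < \<delta>" "\<delta> < T" for \<delta> T
    using cs'[of T, THEN conjunct2, THEN conjunct2, THEN conjunct2, THEN conjunct2, THEN conjunct1] that by simp
  define U where "U = pos_part_time u"
  define V where "V = pos_part_time v"
  have U[measurable]: "U \<in> borel_measurable (borel \<Otimes>\<^sub>M borel)" unfolding U_def by (rule borel_pos_part_time[OF cu])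
  have V[measurable]: "V \<in> borel_measurable (borel \<Otimes>\<^sub>M borel)" unfolding V_def by (rule borel_pos_part_time[OF cv])
  have Ub: "0 \<le> U p \<and> U p \<le> M" and Vb: "0 \<le> V p \<and> V p \<le> M" for p
    using b[of "snd p" "fst p"] M unfolding U_def V_def pos_part_time_def by auto
  define h where "h p = k * F (U p) (V p)" for p
  have hm[measurable]: "h \<in> borel_measurable (borel \<Otimes>\<^sub>M borel)"
    unfolding h_def by (intro borel_measurable_times borel_measurable_const reaction_rate_borel[OF F M U Ub V Vb])
  have hb: "0 \<le> h p" "h p \<le> k * F M M" for p
    using reaction_rate_bounds[OF F, of "U p" M "V p"] Ub[of p] Vb[of p] k unfolding h_def by simp_all
  have hB: "bdd_borel2 h (k * F M M)" using hb by simp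
  have heq: "h (x, t) = k * F (u x t) (v x t)" if "t > 0" for x t
    using that unfolding h_def U_def V_def pos_part_time_def by simp
  have "evol (pos_part_time u) (\<lambda>x. u x 0) (\<lambda>p. du * pos_part_time u p) h"
  proof (rule classical_component_evol[OF _ cu _ hB])
    show "0 \<le> u x t \<and> u x t \<le> M" if "0 \<le> t" for x t using b[OF that, of x] by blast
    fix T \<delta> :: real assume d: "0 < \<delta>" "\<delta> < T"
    obtain ux uxx ut vx vxx vt where P: "C21_on {\<delta>..T} u ux uxx ut" 
      "\<forall>x. \<forall>t\<in>{\<delta><..<T}. ut x t = du * uxx x t - k * F (u x t) (v x t) \<and> vt x t = dv * vxx x t - k * F (u x t) (v x t)"
      using pde[OF d] by blast
    show "\<exists>wx wxx wt. C21_on {\<delta>..T} u wx wxx wt \<and> (\<forall>x. \<forall>t\<in>{\<delta><..<T}. wt x t = du * wxx x t - h (x, t))"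
      by (intro exI conjI, rule P(1)) (use P(2) heq d in simp)
  qed
  then have eU: "evol U u0 (\<lambda>p. du * U p) h" unfolding U_def[symmetric] init by simp
  have "evol (pos_part_time v) (\<lambda>x. v x 0) (\<lambda>p. dv * pos_part_time v p) h"
  proof (rule classical_component_evol[OF _ cv _ hB])
    show "0 \<le> v x t \<and> v x t \<le> M" if "0 \<le> t" for x t using b[OF that, of x] by blast
    fix T \<delta> :: real assume d: "0 < \<delta>" "\<delta> < T"
    obtain ux uxx ut vx vxx vt where P: "C21_on {\<delta>..T} v vx vxx vt" 
      "\<forall>x. \<forall>t\<in>{\<delta><..<T}. ut x t = du * uxx x t - k * F (u x t) (v x t) \<and> vt x t = dv * vxx x t - k * F (u x t) (v x t)"
      using pde[OF d] by blast
    show "\<exists>wx wxx wt. C21_on {\<delta>..T} v wx wxx wt \<and> (\<forall>x. \<forall>t\<in>{\<delta><..<T}. wt x t = dv * wxx x t - h (x, t))"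
      by (intro exI conjI, rule P(1)) (use P(2) heq d in simp)
  qed
  then have eV: "evol V v0 (\<lambda>p. dv * V p) h" unfolding V_def[symmetric] init by simp
  have ae: "AE p in lebesgue. 0 < snd p \<longrightarrow> u (fst p) (snd p) = U p" "AE p in lebesgue. 0 < snd p \<longrightarrow> v (fst p) (snd p) = V p"
    unfolding U_def V_def pos_part_time_def by simp_all
  show ?thesis
    by (rule that[OF U Ub V Vb ae]) (use eU eV in \<open>simp_all only: h_def[abs_def]\<close>)
qed

text \<open>Testing with nonnegative kernels shows that, for each x and almost every time, the
  mollification of w lies below that of w0. The mollification errors of both are then removed in the
  mean over \<open>Q T\<close>.\<close>

lemma evol_decreasing:
  assumes e: "evol w w0 \<Phi> h" and w: "bdd_borel2 w B" and h: "bdd_borel2 h B" and h0: "\<And>p. 0 \<le> h p" and \<Phi>: "\<And>p. \<Phi> p = 0"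
    and w0: "bdd_borel1 w0 B"
  shows "AE p in Q T. w p \<le> w0 (fst p)"
proof -
  have wm[measurable]: "w \<in> borel_measurable (borel \<Otimes>\<^sub>M borel)" and [measurable]: "w0 \<in> borel_measurable borel"
    using w w0 by auto
  have wB: "\<bar>w p\<bar> \<le> B" and w0B: "\<bar>w0 x\<bar> \<le> B" for p x using w w0 by blast+
  define d where "d p = max 0 (w p - w0 (fst p))" for p
  have dm[measurable]: "d \<in> borel_measurable (borel \<Otimes>\<^sub>M borel)" unfolding d_def by measurable
  have dB: "\<bar>d p\<bar> \<le> 2 * B" for p unfolding d_def using wB[of p] w0B[of "fst p"] by (auto simp: abs_le_iff max_def)
  have di: "integrable (Q T) d" by (rule Q.integrable_boundedI[where B="2 * B"]) (simp, rule dB)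
  have "(\<integral>p. d p \<partial>Q T) \<le> 0"
  proof (rule field_le_epsilon)
    fix \<eta> :: real assume \<eta>: "\<eta> > 0"
    obtain d1 where d1: "d1 > 0" "\<And>\<kappa> \<kappa>1 \<kappa>2. test2 \<kappa> \<kappa>1 \<kappa>2 \<Longrightarrow> (\<And>x. \<kappa> x \<ge> 0) \<Longrightarrow> (\<integral>x. \<kappa> x \<partial>lborel) = 1 \<Longrightarrow>
        (\<And>x. \<bar>x\<bar> > d1 \<Longrightarrow> \<kappa> x = 0) \<Longrightarrow> (\<integral>p. \<bar>cv \<kappa> (\<lambda>y. w (y, snd p)) (fst p) - w p\<bar> \<partial>Q T) \<le> \<eta> / 2"
      using mollification_approx[OF wm wB half_gt_zero[OF \<eta>], of T] by blast
    have w0m: "(\<lambda>p. w0 (fst p)) \<in> borel_measurable (borel \<Otimes>\<^sub>M (borel :: real measure))" by measurable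
    obtain d2 where d2: "d2 > 0" "\<And>\<kappa> \<kappa>1 \<kappa>2. test2 \<kappa> \<kappa>1 \<kappa>2 \<Longrightarrow> (\<And>x. \<kappa> x \<ge> 0) \<Longrightarrow> (\<integral>x. \<kappa> x \<partial>lborel) = 1 \<Longrightarrow>
        (\<And>x. \<bar>x\<bar> > d2 \<Longrightarrow> \<kappa> x = 0) \<Longrightarrow> (\<integral>p. \<bar>cv \<kappa> (\<lambda>y. w0 (fst (y, snd p))) (fst p) - w0 (fst p)\<bar> \<partial>Q T) \<le> \<eta> / 2"
      using mollification_approx[where z="\<lambda>p. w0 (fst p)", OF w0m w0B half_gt_zero[OF \<eta>], of T] by blast
    obtain \<kappa> \<kappa>1 \<kappa>2 where k: "test2 \<kappa> \<kappa>1 \<kappa>2" "\<And>x. \<kappa> x \<ge> 0" "(\<integral>x. \<kappa> x \<partial>lborel) = 1"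
      "\<And>x. \<bar>x\<bar> > min d1 d2 \<Longrightarrow> \<kappa> x = 0"
      using mollifier_exists[of "min d1 d2"] d1(1) d2(1) by (metis min_less_iff_conj)
    note [measurable] = test2_borel[OF k(1)]
    define wk where "wk p = cv \<kappa> (\<lambda>y. w (y, snd p)) (fst p)" for p
    define w0k where "w0k p = cv \<kappa> w0 (fst p)" for p :: "real \<times> real"
    have wkm[measurable]: "wk \<in> borel_measurable (borel \<Otimes>\<^sub>M borel)" unfolding wk_def by measurable
    have w0km[measurable]: "w0k \<in> borel_measurable (borel \<Otimes>\<^sub>M borel)" unfolding w0k_def cv_def by measurable
    have i1: "(\<integral>p. \<bar>wk p - w p\<bar> \<partial>Q T) \<le> \<eta> / 2" unfolding wk_def by (rule d1(2)[OF k(1-3)]) (simp add: k(4))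
    have i2: "(\<integral>p. \<bar>w0k p - w0 (fst p)\<bar> \<partial>Q T) \<le> \<eta> / 2"
      using d2(2)[OF k(1-3)] k(4) unfolding w0k_def by simp
    have wkB: "\<bar>wk p\<bar> \<le> B" for p
      using cv_bound[of "\<lambda>y. w (y, snd p)" B \<kappa> "fst p", OF _ wB test2_integrable(1)[OF k(1)]]
      by (simp add: wk_def abs_of_nonneg[OF k(2)] k(3))
    have w0kB: "\<bar>w0k p\<bar> \<le> B" for p
      using cv_bound[of w0 B \<kappa> "fst p", OF _ w0B test2_integrable(1)[OF k(1)]]
      by (simp add: w0k_def abs_of_nonneg[OF k(2)] k(3))
    have le: "AE s in lborel. 0 < s \<longrightarrow> wk (x, s) \<le> w0k (x, s)" for x
      using e[unfolded evol_def, rule_format, OF test2_reflect[OF k(1), of x]]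
    proof eventually_elim
      case (elim s)
      show ?case
      proof
        assume "0 < s"
        then have "wk (x, s) = w0k (x, s) + (\<integral>r. (\<integral>y. - (h (y, r) * \<kappa> (x - y)) \<partial>lborel) \<partial>Mt s)"
          using elim by (simp add: wk_def w0k_def cv_def \<Phi>)
        moreover have "(\<integral>r. (\<integral>y. h (y, r) * \<kappa> (x - y) \<partial>lborel) \<partial>Mt s) \<ge> 0"
          by (intro Bochner_Integration.integral_nonneg mult_nonneg_nonneg h0 k(2))
        ultimately show "wk (x, s) \<le> w0k (x, s)" by simp
      qed
    qed
    have mz: "(\<integral>p. max 0 (wk p - w0k p) \<partial>Q T) = 0"
    proof -
      have bb: "\<bar>max 0 (wk p - w0k p)\<bar> \<le> 2 * B" for p using wkB[of p] w0kB[of p] by (auto simp: abs_le_iff max_def)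
      have "(\<integral>s. max 0 (wk (x, s) - w0k (x, s)) \<partial>Mt T) = (\<integral>s. 0 \<partial>Mt T)" for x
      proof (rule integral_cong_AE)
        show "AE s in Mt T. max 0 (wk (x, s) - w0k (x, s)) = 0"
          unfolding AE_Mt using le[of x] AE_lborel_singleton[of 0] by eventually_elim auto
      qed measurable
      then show ?thesis by (subst Q_iterated(2)[where B="2 * B"]) (measurable, rule bb, simp)
    qed
    have int: "integrable (Q T) f" if "f \<in> borel_measurable (borel \<Otimes>\<^sub>M borel)" "\<And>p. \<bar>f p\<bar> \<le> 2 * B" for f
      by (rule Q.integrable_boundedI[where B="2 * B"]) (use that in auto)
    have I: "integrable (Q T) (\<lambda>p. \<bar>wk p - w p\<bar>)" "integrable (Q T) (\<lambda>p. \<bar>w0k p - w0 (fst p)\<bar>)" "integrable (Q T) (\<lambda>p. max 0 (wk p - w0k p))"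
    proof -
      have "\<bar>\<bar>wk p - w p\<bar>\<bar> \<le> 2 * B" "\<bar>\<bar>w0k p - w0 (fst p)\<bar>\<bar> \<le> 2 * B" "\<bar>max 0 (wk p - w0k p)\<bar> \<le> 2 * B" for p
        using wkB[of p] w0kB[of p] wB[of p] w0B[of "fst p"] by (auto simp: abs_le_iff max_def)
      note b = this
      show "integrable (Q T) (\<lambda>p. \<bar>wk p - w p\<bar>)" by (rule int[OF _ b(1)]) measurable
      show "integrable (Q T) (\<lambda>p. \<bar>w0k p - w0 (fst p)\<bar>)" by (rule int[OF _ b(2)]) measurable
      show "integrable (Q T) (\<lambda>p. max 0 (wk p - w0k p))" by (rule int[OF _ b(3)]) measurable
    qed
    have "(\<integral>p. d p \<partial>Q T) \<le> (\<integral>p. \<bar>wk p - w p\<bar> + (\<bar>w0k p - w0 (fst p)\<bar> + max 0 (wk p - w0k p)) \<partial>Q T)"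
      by (rule integral_mono[OF di]) (use I in \<open>auto simp: d_def\<close>)
    also have "\<dots> \<le> \<eta>" using I i1 i2 mz by simp
    finally show "(\<integral>p. d p \<partial>Q T) \<le> 0 + \<eta>" by simp
  qed
  moreover have "(\<integral>p. d p \<partial>Q T) \<ge> 0" by (simp add: d_def)
  ultimately have "(\<integral>p. d p \<partial>Q T) = 0" by linarith
  moreover have "AE p in Q T. 0 \<le> d p" by (simp add: d_def)
  ultimately have "AE p in Q T. d p = 0" using integral_nonneg_eq_0_iff_AE[OF di] by simp
  then show ?thesis by eventually_elim (simp add: d_def max_def split: if_splits)
qed

section \<open>Convergence after rescaling\<close>

text \<open>For \<open>m = 0\<close> one has \<open>G = q\<close>, and all estimates express the monotonicity of \<open>Dfun\<close>; the terms with \<open>m\<close>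
  account for the coexistence of the two components.\<close>

lemma monotone_flux_estimates:
  fixes u v w M du dv :: real
  assumes du: "du > 0" and dv: "dv \<ge> 0" and u: "0 \<le> u" "u \<le> M" and v: "0 \<le> v" "v \<le> M" and w: "\<bar>w\<bar> \<le> M"
  defines "z \<equiv> u - v - w" and "G \<equiv> du * u - dv * v - Dfun du dv w" and "q \<equiv> Dfun du dv (u - v) - Dfun du dv w" and "m \<equiv> min u v" and "L \<equiv> du + dv"
  shows "du * (max (u - v) 0 - max w 0)\<^sup>2 \<le> z * q" "dv * (min (u - v) 0 - min w 0)\<^sup>2 \<le> z * q"
    "du * ((v - m) * max w 0) \<le> z * q" "z * q \<le> z * G + 2 * M * L * m"
    "1 / (2 * L) * G\<^sup>2 - 3 * M * L * m \<le> z * G"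
proof -
  define P where "P = max (u - v) 0 - max w 0"
  define N where "N = min (u - v) 0 - min w 0"
  \<comment> \<open>Positive and negative part are both nondecreasing functions, so P and N have the
    sign of u - v - w.\<close>
  have PN: "0 \<le> P * N"
  proof (cases "u - v \<ge> w")
    case True then show ?thesis unfolding P_def N_def by (intro mult_nonneg_nonneg) (auto simp: max_def min_def)
  next
    case False then show ?thesis unfolding P_def N_def by (intro mult_nonpos_nonpos) (auto simp: max_def min_def)
  qed
  have z: "z = P + N" unfolding z_def P_def N_def by (auto simp: max_def min_def)
  have q: "q = du * P + dv * N" unfolding q_def P_def N_def Dfun_def by (simp add: algebra_simps)
  have L0: "L > 0" unfolding L_def using du dv by simp
  have zq: "z * q = du * P\<^sup>2 + L * (P * N) + dv * N\<^sup>2"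
    unfolding z q L_def by (simp add: power2_eq_square algebra_simps)
  have LPN: "0 \<le> L * (P * N)" "0 \<le> du * P\<^sup>2" "0 \<le> dv * N\<^sup>2" using PN L0 du dv by simp_all
  show 1: "du * (max (u - v) 0 - max w 0)\<^sup>2 \<le> z * q" unfolding P_def[symmetric] using zq LPN by linarith
  show 2: "dv * (min (u - v) 0 - min w 0)\<^sup>2 \<le> z * q" unfolding N_def[symmetric] using zq LPN by linarith
  show "du * ((v - m) * max w 0) \<le> z * q"
  proof (cases "u < v \<and> 0 < w")
    case True
    \<comment> \<open>In this case m = u, P = -w and N = u - v.\<close>
    then have "(v - m) * max w 0 = P * N" unfolding P_def N_def m_def by (simp add: max_def min_def algebra_simps)
    moreover have "du * (P * N) \<le> L * (P * N)" unfolding L_def using PN dv by (intro mult_right_mono) simp_all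
    ultimately have "du * ((v - m) * max w 0) \<le> L * (P * N)" by simp
    then show ?thesis using zq LPN by linarith
  next
    case False
    then have "(v - m) * max w 0 = 0" unfolding m_def by (auto simp: max_def min_def)
    then have "du * ((v - m) * max w 0) = 0" by simp
    then show ?thesis using zq LPN by linarith
  qed
  have m0: "0 \<le> m" "m \<le> M" unfolding m_def using u v by auto
  have M0: "M \<ge> 0" using u by linarith
  \<comment> \<open>Because max (u - v) 0 = u - m and min (u - v) 0 = m - v.\<close>
  have Guv: "du * u - dv * v = Dfun du dv (u - v) + (du - dv) * m"
    unfolding Dfun_def m_def by (auto simp: max_def min_def algebra_simps)
  then have G: "G = q + (du - dv) * m" unfolding G_def q_def by simp
  have zM: "\<bar>z\<bar> \<le> 2 * M" unfolding z_def using u v w by linarith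
  have dL: "\<bar>du - dv\<bar> \<le> L" unfolding L_def using du dv by simp
  have "\<bar>z * ((du - dv) * m)\<bar> \<le> 2 * M * (L * m)"
    unfolding abs_mult using m0 M0 by (intro mult_mono zM mult_mono dL) (use L0 in auto)
  then show 4: "z * q \<le> z * G + 2 * M * L * m"
    unfolding G by (simp add: algebra_simps abs_le_iff)
  \<comment> \<open>Cocoercivity of the nondecreasing function D, for which L is a Lipschitz
    constant; the expansion exhibits the defect as a sum of nonnegative terms.\<close>
  have "L * (z * q) - q\<^sup>2 = du * dv * P\<^sup>2 + (du\<^sup>2 + dv\<^sup>2) * (P * N) + du * dv * N\<^sup>2"
    unfolding z q L_def by (simp add: power2_eq_square algebra_simps)
  moreover have "0 \<le> du * dv * P\<^sup>2 + (du\<^sup>2 + dv\<^sup>2) * (P * N) + du * dv * N\<^sup>2" using PN du dv by simp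
  ultimately have q2: "q\<^sup>2 \<le> L * (z * q)" by linarith
  have "((du - dv) * m)\<^sup>2 \<le> L\<^sup>2 * (M * m)"
  proof -
    have "(du - dv)\<^sup>2 \<le> L\<^sup>2" using dL L0 by (metis abs_le_square_iff abs_of_pos)
    moreover have "m\<^sup>2 \<le> M * m" unfolding power2_eq_square using m0 by (intro mult_right_mono) auto
    ultimately show ?thesis unfolding power_mult_distrib by (intro mult_mono) auto
  qed
  moreover have "G\<^sup>2 \<le> 2 * q\<^sup>2 + 2 * ((du - dv) * m)\<^sup>2"
    unfolding G using zero_le_power2[of "q - (du - dv) * m"] by (simp add: power2_eq_square algebra_simps)
  ultimately have "G\<^sup>2 \<le> 2 * L * (z * q) + 2 * (L\<^sup>2 * (M * m))" using q2 by linarith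
  then have "1 / (2 * L) * G\<^sup>2 \<le> 1 / (2 * L) * (2 * L * (z * q) + 2 * (L\<^sup>2 * (M * m)))"
    using L0 by (intro mult_left_mono) auto
  also have "\<dots> = z * q + M * L * m" using L0 by (simp add: field_simps power2_eq_square)
  finally show "1 / (2 * L) * G\<^sup>2 - 3 * M * L * m \<le> z * G" using 4 by linarith
qed

lemma tendsto_0I:
  fixes x :: "nat \<Rightarrow> real"
  assumes nn: "\<And>n. 0 \<le> x n" and le: "\<And>e. e > 0 \<Longrightarrow> \<exists>b. b \<longlonglongrightarrow> 0 \<and> (\<forall>n. x n \<le> e + b n)"
  shows "x \<longlonglongrightarrow> 0"
proof (rule LIMSEQ_I)
  fix r :: real assume r: "r > 0"
  obtain b where b: "b \<longlonglongrightarrow> 0" "\<And>n. x n \<le> r / 2 + b n" using le[of "r / 2"] r by auto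
  obtain N where "\<And>n. n \<ge> N \<Longrightarrow> norm (b n - 0) < r / 2" using LIMSEQ_D[OF b(1), of "r / 2"] r by auto
  then have "norm (x n - 0) < r" if "n \<ge> N" for n using b(2)[of n] nn[of n] that by (fastforce simp: abs_less_iff)
  then show "\<exists>no. \<forall>n\<ge>no. norm (x n - 0) < r" by blast
qed

text \<open>Instead of the Cauchy-Schwarz inequality, |f| <= d + f^2 / d pointwise, with d a small
  multiple of e, so that the constant term integrates to at most e.\<close>

lemma L1_of_L2:
  assumes f: "\<And>n. bdd_borel2 (f n) B" and l: "(\<lambda>n. \<integral>p. (f n p)\<^sup>2 \<partial>Q T) \<longlonglongrightarrow> 0"
  shows "(\<lambda>n. \<integral>p. \<bar>f n p\<bar> \<partial>Q T) \<longlonglongrightarrow> 0"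
proof (rule tendsto_0I)
  have B0: "B \<ge> 0" using f[of 0] by (meson abs_ge_zero order_trans)
  fix e :: real assume e: "e > 0"
  define \<mu> where "\<mu> = measure (Q T) UNIV + 1"
  define d where "d = e / \<mu>"
  have \<mu>: "\<mu> > 0" unfolding \<mu>_def by (simp add: add_nonneg_pos)
  then have d: "d > 0" unfolding d_def using e by simp
  have "(\<integral>p. \<bar>f n p\<bar> \<partial>Q T) \<le> e + 1 / d * (\<integral>p. (f n p)\<^sup>2 \<partial>Q T)" for n
  proof -
    have fm: "f n \<in> borel_measurable (borel \<Otimes>\<^sub>M borel)" "\<And>p. \<bar>f n p\<bar> \<le> B" using f[of n] by auto
    have i: "integrable (Q T) (\<lambda>p. \<bar>f n p\<bar>)" "integrable (Q T) (\<lambda>p. (f n p)\<^sup>2)"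
    proof -
      show "integrable (Q T) (\<lambda>p. \<bar>f n p\<bar>)" by (rule Q.integrable_boundedI[where B=B]) (use fm in auto)
      have "\<bar>(f n p)\<^sup>2\<bar> \<le> B\<^sup>2" for p using abs_le_square_iff[of "f n p" B] fm(2)[of p] B0 by simp
      then show "integrable (Q T) (\<lambda>p. (f n p)\<^sup>2)" by (intro Q.integrable_boundedI[where B="B\<^sup>2"]) (use fm(1) in auto)
    qed
    have pw: "\<bar>f n p\<bar> \<le> d + 1 / d * (f n p)\<^sup>2" for p
    proof -
      have "0 \<le> (\<bar>f n p\<bar> - d)\<^sup>2 / d" using d by simp
      also have "\<dots> = 1 / d * (f n p)\<^sup>2 - 2 * \<bar>f n p\<bar> + d" using d by (simp add: power2_diff field_simps power2_eq_square[of d])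
      finally show ?thesis using abs_ge_zero[of "f n p"] by linarith
    qed
    have "(\<integral>p. \<bar>f n p\<bar> \<partial>Q T) \<le> (\<integral>p. d + 1 / d * (f n p)\<^sup>2 \<partial>Q T)"
      by (rule integral_mono[OF i(1) _ pw]) (use i in simp)
    also have "\<dots> = d * measure (Q T) UNIV + 1 / d * (\<integral>p. (f n p)\<^sup>2 \<partial>Q T)" using i by (simp add: mult.commute)
    also have "d * measure (Q T) UNIV \<le> d * \<mu>" unfolding \<mu>_def using d by (intro mult_left_mono) auto
    also have "d * \<mu> = e" unfolding d_def using \<mu> by simp
    finally show ?thesis by simp
  qed
  moreover have "(\<lambda>n. 1 / d * (\<integral>p. (f n p)\<^sup>2 \<partial>Q T)) \<longlonglongrightarrow> 0" by (rule tendsto_mult_right_zero[OF l])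
  ultimately show "\<exists>b. b \<longlonglongrightarrow> 0 \<and> (\<forall>n. (\<integral>p. \<bar>f n p\<bar> \<partial>Q T) \<le> e + b n)" by blast
qed simp

lemma AE_Q_sliceI:
  assumes m: "{p. \<not> P p} \<in> sets (borel \<Otimes>\<^sub>M borel)"
    and s: "(\<forall>x. AE s in Mt T. P (x, s)) \<or> (\<forall>s. AE x in Mx. P (x, s))"
  shows "AE p in Q T. P p"
proof -
  have im[measurable]: "(\<lambda>p. indicator {p. \<not> P p} p :: real) \<in> borel_measurable (borel \<Otimes>\<^sub>M borel)" using m by simp
  have ib: "\<bar>indicator {p. \<not> P p} p :: real\<bar> \<le> 1" for p by (simp add: indicator_def)
  have ii: "integrable (Q T) (\<lambda>p. indicator {p. \<not> P p} p :: real)" by (rule Q.integrable_boundedI[where B=1]) (simp, rule ib)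
  have "(\<integral>p. (indicator {p. \<not> P p} p :: real) \<partial>Q T) = 0"
    using s
  proof
    assume s: "\<forall>x. AE s in Mt T. P (x, s)"
    have "(\<integral>s. (indicator {p. \<not> P p} (x, s) :: real) \<partial>Mt T) = (\<integral>s. 0 \<partial>Mt T)" for x
    proof (rule integral_cong_AE)
      show "(\<lambda>s. indicator {p. \<not> P p} (x, s) :: real) \<in> borel_measurable (Mt T)" by measurable
      show "AE s in Mt T. (indicator {p. \<not> P p} (x, s) :: real) = 0"
        using s[rule_format, of x] by eventually_elim (simp add: indicator_def)
    qed simp
    note this
    then show ?thesis unfolding Q_iterated(2)[OF im ib] by (simp only:) simp
  next
    assume s: "\<forall>s. AE x in Mx. P (x, s)"
    have "(\<integral>x. (indicator {p. \<not> P p} (x, s) :: real) \<partial>Mx) = (\<integral>x. 0 \<partial>Mx)" for s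
    proof (rule integral_cong_AE)
      show "(\<lambda>x. indicator {p. \<not> P p} (x, s) :: real) \<in> borel_measurable Mx" by measurable
      show "AE x in Mx. (indicator {p. \<not> P p} (x, s) :: real) = 0"
        using s[rule_format, of s] by eventually_elim (simp add: indicator_def)
    qed simp
    note this
    then show ?thesis unfolding Q_iterated(1)[OF im ib] by (simp only:) simp
  qed
  then have "AE p in Q T. (indicator {p. \<not> P p} p :: real) = 0"
    using integral_nonneg_eq_0_iff_AE[OF ii] by simp
  then show ?thesis by eventually_elim (simp add: indicator_def split: if_splits)
qed

lemma AE_exists_between:
  fixes a b :: real
  assumes "AE t in lborel. P t" "a < b"
  obtains t where "a < t" "t < b" "P t"
proof -
  have "\<exists>t. a < t \<and> t < b \<and> P t"
  proof (rule ccontr)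
    assume n: "\<not> ?thesis"
    have "AE t in lborel. t \<notin> {a<..<b}" using assms(1) by eventually_elim (use n in auto)
    then have "emeasure lborel {a<..<b} = 0" by (subst (asm) AE_iff_measurable[of "{a<..<b}"]) auto
    then show False using assms(2) by simp
  qed
  then show ?thesis using that by blast
qed

text \<open>U and V stand for Borel representatives of u and v, bounded at every point. Nothing but
  the integrated equations is kept of the two notions of solution, so classical and weak solutions
  are treated together.\<close>

locale selfsimilar_setup =
  fixes du dv k U0 V0 M a :: real and F :: "real \<Rightarrow> real \<Rightarrow> real" and u0 v0 :: "real \<Rightarrow> real" and U V :: "real \<times> real \<Rightarrow> real"
  assumes k: "k > 0" and du: "du > 0" and dv: "dv \<ge> 0" and U0: "U0 > 0" and V0: "V0 > 0" and UM: "U0 \<le> M" and VM: "V0 \<le> M"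
    and F: "reaction_rate F"
    and u0m[measurable]: "u0 \<in> borel_measurable borel" and u0b: "\<And>x. 0 \<le> u0 x \<and> u0 x \<le> M"
    and v0m[measurable]: "v0 \<in> borel_measurable borel" and v0b: "\<And>x. 0 \<le> v0 x \<and> v0 x \<le> M"
    and u0i: "integrable lborel (\<lambda>x. u0 x - u0_inf U0 x)" and v0i: "integrable lborel (\<lambda>x. v0 x - v0_inf V0 x)"
    and ie: "interface_eq du dv U0 V0 a"
    and Um[measurable]: "U \<in> borel_measurable (borel \<Otimes>\<^sub>M borel)" and Ub: "\<And>p. 0 \<le> U p \<and> U p \<le> M"
    and Vm[measurable]: "V \<in> borel_measurable (borel \<Otimes>\<^sub>M borel)" and Vb: "\<And>p. 0 \<le> V p \<and> V p \<le> M"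
    and eU: "evol U u0 (\<lambda>p. du * U p) (\<lambda>p. k * F (U p) (V p))"
    and eV: "evol V v0 (\<lambda>p. dv * V p) (\<lambda>p. k * F (U p) (V p))"
begin

text \<open>\<open>Us l\<close> and \<open>Vs l\<close> are the parabolic rescalings, \<open>wb\<close> the self-similar solution, and \<open>zn l\<close> the difference with
  \<open>(zn l)\<^sub>t = (Gn l)\<^sub>x\<^sub>x\<close>.  The time \<open>T\<close> is the largest admitted by the energy estimate with \<open>c = 1 / (2 * L)\<close>.\<close>

definition "L = du + dv"
definition "T = 1 / (4 * L)"
definition "\<mu> = measure Mx UNIV"
definition "f = profile du dv U0 V0 a"
definition "wb = selfsim f"
definition "gb = selfsim (\<lambda>\<eta>. Dfun du dv (f \<eta>))"
definition "Us l p = U (l * fst p, l\<^sup>2 * snd p)" for l :: real and p :: "real \<times> real"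
definition "Vs l p = V (l * fst p, l\<^sup>2 * snd p)" for l :: real and p :: "real \<times> real"
definition "mn l p = min (Us l p) (Vs l p)" for l :: real and p :: "real \<times> real"
definition "zn l p = Us l p - Vs l p - wb p" for l :: real and p :: "real \<times> real"
definition "Gn l p = du * Us l p - dv * Vs l p - gb p" for l :: real and p :: "real \<times> real"
definition "qn l p = Dfun du dv (Us l p - Vs l p) - gb p" for l :: real and p :: "real \<times> real"
definition "K = 2 * M + 2 * L * M"
definition "Z = (\<integral>x. \<bar>u0 x - u0_inf U0 x\<bar> \<partial>lborel) + (\<integral>x. \<bar>v0 x - v0_inf V0 x\<bar> \<partial>lborel)"

lemma L_pos: "L > 0" unfolding L_def using du dv by simp
lemma T_pos: "T > 0" unfolding T_def using L_pos by simp
lemma M_pos: "M > 0" using U0 UM by linarith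
lemma mu_nonneg: "\<mu> \<ge> 0" unfolding \<mu>_def by simp
lemma K_nonneg: "K \<ge> 0" unfolding K_def using M_pos L_pos by simp

lemma f_measurable[measurable]: "f \<in> borel_measurable borel" unfolding f_def by (rule borel_profile[OF du])

lemma f_bound: "\<bar>f \<eta>\<bar> \<le> M"
  using profile_bounds(1,2)[OF du U0 V0, of dv a \<eta>] UM VM unfolding f_def by (simp add: abs_le_iff)

lemma wb_measurable[measurable]: "wb \<in> borel_measurable (borel \<Otimes>\<^sub>M borel)"
  unfolding wb_def selfsim_def[abs_def] by measurable

lemma wb_bound: "\<bar>wb p\<bar> \<le> M" unfolding wb_def selfsim_def by (rule f_bound)

lemma gb_eq: "gb p = Dfun du dv (wb p)" unfolding gb_def wb_def selfsim_def ..

lemma gb_measurable[measurable]: "gb \<in> borel_measurable (borel \<Otimes>\<^sub>M borel)"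
  unfolding gb_eq[abs_def] by measurable

lemma Dfun_bound:
  assumes s: "\<bar>s\<bar> \<le> M"
  shows "\<bar>Dfun du dv s\<bar> \<le> L * M"
proof -
  have 1: "\<bar>max s 0\<bar> \<le> M" "\<bar>min s 0\<bar> \<le> M" using s by auto
  have 2: "\<bar>du * max s 0\<bar> \<le> du * M" "\<bar>dv * min s 0\<bar> \<le> dv * M"
    using mult_left_mono[OF 1(1), of du] mult_left_mono[OF 1(2), of dv] du dv by (simp_all add: abs_mult)
  have "\<bar>du * max s 0 + dv * min s 0\<bar> \<le> du * M + dv * M"
    using 2 by linarith
  thus ?thesis unfolding Dfun_def L_def distrib_right .
qed

lemma Us_measurable[measurable]: "Us l \<in> borel_measurable (borel \<Otimes>\<^sub>M borel)"
  and Vs_measurable[measurable]: "Vs l \<in> borel_measurable (borel \<Otimes>\<^sub>M borel)"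
  unfolding Us_def[abs_def] Vs_def[abs_def] by measurable

lemma UVs_bound: "0 \<le> Us l p" "Us l p \<le> M" "0 \<le> Vs l p" "Vs l p \<le> M"
  using Ub Vb unfolding Us_def Vs_def by auto

lemma mn_bound: "0 \<le> mn l p" "mn l p \<le> M" unfolding mn_def using UVs_bound[of l p] by auto

lemma mn_measurable[measurable]: "mn l \<in> borel_measurable (borel \<Otimes>\<^sub>M borel)"
  and zn_measurable[measurable]: "zn l \<in> borel_measurable (borel \<Otimes>\<^sub>M borel)"
  and Gn_measurable[measurable]: "Gn l \<in> borel_measurable (borel \<Otimes>\<^sub>M borel)"
  and qn_measurable[measurable]: "qn l \<in> borel_measurable (borel \<Otimes>\<^sub>M borel)"
  unfolding mn_def[abs_def] zn_def[abs_def] Gn_def[abs_def] qn_def[abs_def] by measurable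

lemma zn_bound: "\<bar>zn l p\<bar> \<le> K" and Gn_bound: "\<bar>Gn l p\<bar> \<le> K" and qn_bound: "\<bar>qn l p\<bar> \<le> K"
proof -
  note b = UVs_bound[of l p] wb_bound[of p] Dfun_bound[OF wb_bound[of p]]
  have LM: "0 \<le> L * M" using L_pos M_pos by simp
  show "\<bar>zn l p\<bar> \<le> K" unfolding zn_def K_def using b LM by linarith
  have "0 \<le> du * Us l p" "du * Us l p \<le> du * M" "0 \<le> dv * Vs l p" "dv * Vs l p \<le> dv * M"
    using b du dv by (simp_all add: mult_left_mono)
  moreover have "L * M = du * M + dv * M" unfolding L_def by (simp add: distrib_right)
  ultimately show "\<bar>Gn l p\<bar> \<le> K" unfolding Gn_def gb_eq K_def using b LM M_pos by linarith
  have "\<bar>Us l p - Vs l p\<bar> \<le> M" using b by linarith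
  from Dfun_bound[OF this] show "\<bar>qn l p\<bar> \<le> K" unfolding qn_def gb_eq K_def using b LM M_pos by linarith
qed

lemma flux:
  "du * (max (Us l p - Vs l p) 0 - max (wb p) 0)\<^sup>2 \<le> zn l p * qn l p"
  "dv * (min (Us l p - Vs l p) 0 - min (wb p) 0)\<^sup>2 \<le> zn l p * qn l p"
  "du * ((Vs l p - mn l p) * max (wb p) 0) \<le> zn l p * qn l p"
  "zn l p * qn l p \<le> zn l p * Gn l p + 2 * M * L * mn l p"
  "1 / (2 * L) * (Gn l p)\<^sup>2 - 3 * M * L * mn l p \<le> zn l p * Gn l p"
  unfolding zn_def Gn_def qn_def mn_def gb_eq L_def
  by (rule monotone_flux_estimates[OF du dv UVs_bound wb_bound])+

lemma prod_bound: "\<bar>x\<bar> \<le> K \<Longrightarrow> \<bar>y\<bar> \<le> K \<Longrightarrow> \<bar>x * y\<bar> \<le> K * K"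
  unfolding abs_mult using K_nonneg by (intro mult_mono) auto

lemma int_zG: "integrable (Q t) (\<lambda>p. zn l p * Gn l p)"
  by (rule Q.integrable_boundedI[where B="K * K"]) (measurable, intro prod_bound zn_bound Gn_bound)

lemma int_zq: "integrable (Q t) (\<lambda>p. zn l p * qn l p)"
  by (rule Q.integrable_boundedI[where B="K * K"]) (measurable, intro prod_bound zn_bound qn_bound)

lemma int_m: "integrable (Q t) (mn l)"
  by (rule Q.integrable_boundedI[where B=M]) (measurable, use mn_bound in simp)

lemma zq_nonneg: "0 \<le> zn l p * qn l p"
  by (rule order_trans[OF _ flux(1)]) (use du in simp)

definition "FM = F M M"

lemma F_measurable[measurable]: "(\<lambda>p. F (U p) (V p)) \<in> borel_measurable (borel \<Otimes>\<^sub>M borel)"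
  by (rule reaction_rate_borel[OF F less_imp_le[OF M_pos] Um Ub Vm Vb])

lemma Fn_measurable[measurable]: "(\<lambda>p. F (Us l p) (Vs l p)) \<in> borel_measurable (borel \<Otimes>\<^sub>M borel)"
  by (rule reaction_rate_borel[OF F less_imp_le[OF M_pos] Us_measurable _ Vs_measurable]) (simp_all add: UVs_bound)

lemma F_bound: "0 \<le> F (U p) (V p)" "F (U p) (V p) \<le> FM"
  using reaction_rate_bounds[OF F, of "U p" M "V p"] Ub Vb unfolding FM_def by simp_all

lemma Fn_bound: "0 \<le> F (Us l p) (Vs l p)" "F (Us l p) (Vs l p) \<le> FM"
  using reaction_rate_bounds[OF F UVs_bound] unfolding FM_def by simp_all

text \<open>A crude common bound, growing with l, which ensures that all integrals are finite. It
  enters hypotheses of boundedness only; no estimate carries it into the limit.\<close>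

definition "CB l = K + M + L * M + k * FM + l\<^sup>2 * (k * FM)" for l :: real

lemma CB_bounds: "K \<le> CB l" "M \<le> CB l" "L * M \<le> CB l" "k * FM \<le> CB l" "l\<^sup>2 * (k * FM) \<le> CB l" "0 \<le> CB l"
proof -
  have "0 \<le> FM" using F_bound[of "(0, 0)"] by linarith
  then have "0 \<le> k * FM" "0 \<le> l\<^sup>2 * (k * FM)" "0 \<le> L * M" using k L_pos M_pos by simp_all
  then show "K \<le> CB l" "M \<le> CB l" "L * M \<le> CB l" "k * FM \<le> CB l" "l\<^sup>2 * (k * FM) \<le> CB l" "0 \<le> CB l"
    unfolding CB_def using K_nonneg M_pos by linarith+
qed

lemma flux_bounds:
  assumes "0 \<le> s" "s \<le> M" shows "\<bar>du * s\<bar> \<le> L * M" "\<bar>dv * s\<bar> \<le> L * M"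
  unfolding abs_mult L_def using assms du dv by (intro mult_mono; simp)+

lemma bdd_CB:
  "bdd_borel2 (Us l) (CB l)" "bdd_borel2 (Vs l) (CB l)" "bdd_borel2 (\<lambda>p. du * Us l p) (CB l)" "bdd_borel2 (\<lambda>p. dv * Vs l p) (CB l)"
  "bdd_borel2 (\<lambda>p. l\<^sup>2 * (k * F (Us l p) (Vs l p))) (CB l)" "bdd_borel2 wb (CB l)" "bdd_borel2 gb (CB l)"
  "bdd_borel2 (zn l) (CB l)" "bdd_borel2 (Gn l) (CB l)" "bdd_borel2 (\<lambda>_. 0) (CB l)"
proof -
  note b = CB_bounds[of l]
  have "\<bar>Us l p\<bar> \<le> CB l" "\<bar>Vs l p\<bar> \<le> CB l" for p using UVs_bound[of l p] b by linarith+
  then show "bdd_borel2 (Us l) (CB l)" "bdd_borel2 (Vs l) (CB l)" by simp_all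
  have "\<bar>du * Us l p\<bar> \<le> CB l" "\<bar>dv * Vs l p\<bar> \<le> CB l" for p
    using flux_bounds(1)[OF UVs_bound(1,2)[of l p]] flux_bounds(2)[OF UVs_bound(3,4)[of l p]] b by linarith+
  then show "bdd_borel2 (\<lambda>p. du * Us l p) (CB l)" "bdd_borel2 (\<lambda>p. dv * Vs l p) (CB l)" by simp_all
  have "\<bar>l\<^sup>2 * (k * F (Us l p) (Vs l p))\<bar> \<le> CB l" for p
  proof -
    have kF: "k * F (Us l p) (Vs l p) \<le> k * FM" "0 \<le> k * F (Us l p) (Vs l p)" using Fn_bound[of l p] k by simp_all
    have "l\<^sup>2 * (k * F (Us l p) (Vs l p)) \<le> l\<^sup>2 * (k * FM)" "0 \<le> l\<^sup>2 * (k * F (Us l p) (Vs l p))"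
      by (rule mult_left_mono[OF kF(1) zero_le_power2], rule mult_nonneg_nonneg[OF zero_le_power2 kF(2)])
    then show ?thesis using b by linarith
  qed
  then show "bdd_borel2 (\<lambda>p. l\<^sup>2 * (k * F (Us l p) (Vs l p))) (CB l)" by simp
  have "\<bar>wb p\<bar> \<le> CB l" "\<bar>gb p\<bar> \<le> CB l" "\<bar>zn l p\<bar> \<le> CB l" "\<bar>Gn l p\<bar> \<le> CB l" for p
    using wb_bound[of p] Dfun_bound[OF wb_bound[of p]] zn_bound[of l p] Gn_bound[of l p] b unfolding gb_eq by linarith+
  then show "bdd_borel2 wb (CB l)" "bdd_borel2 gb (CB l)" "bdd_borel2 (zn l) (CB l)" "bdd_borel2 (Gn l) (CB l)" "bdd_borel2 (\<lambda>_. 0) (CB l)"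
    using b by simp_all
qed

lemma evol_Us: "l > 0 \<Longrightarrow> evol (Us l) (\<lambda>x. u0 (l * x)) (\<lambda>p. du * Us l p) (\<lambda>p. l\<^sup>2 * (k * F (Us l p) (Vs l p)))"
  and evol_Vs: "l > 0 \<Longrightarrow> evol (Vs l) (\<lambda>x. v0 (l * x)) (\<lambda>p. dv * Vs l p) (\<lambda>p. l\<^sup>2 * (k * F (Us l p) (Vs l p)))"
proof -
  assume l: "l > 0"
  note b = CB_bounds[of 1]
  have "\<bar>du * U p\<bar> \<le> CB 1" "\<bar>dv * V p\<bar> \<le> CB 1" "\<bar>k * F (U p) (V p)\<bar> \<le> CB 1" for p
  proof -
    have "k * F (U p) (V p) \<le> k * FM" "0 \<le> k * F (U p) (V p)" using F_bound[of p] k by simp_all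
    then show "\<bar>du * U p\<bar> \<le> CB 1" "\<bar>dv * V p\<bar> \<le> CB 1" "\<bar>k * F (U p) (V p)\<bar> \<le> CB 1"
      using flux_bounds(1)[of "U p"] flux_bounds(2)[of "V p"] Ub[of p] Vb[of p] b by linarith+
  qed
  then have B: "bdd_borel2 (\<lambda>p. du * U p) (CB 1)" "bdd_borel2 (\<lambda>p. dv * V p) (CB 1)" "bdd_borel2 (\<lambda>p. k * F (U p) (V p)) (CB 1)"
    by simp_all
  show "evol (Us l) (\<lambda>x. u0 (l * x)) (\<lambda>p. du * Us l p) (\<lambda>p. l\<^sup>2 * (k * F (Us l p) (Vs l p)))"
    using evol_scale[OF eU l B(1,3)] unfolding Us_def[abs_def] Vs_def[abs_def] .
  show "evol (Vs l) (\<lambda>x. v0 (l * x)) (\<lambda>p. dv * Vs l p) (\<lambda>p. l\<^sup>2 * (k * F (Us l p) (Vs l p)))"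
    using evol_scale[OF eV l B(2,3)] unfolding Us_def[abs_def] Vs_def[abs_def] .
qed

definition "z0 l x = u0 (l * x) - v0 (l * x) - (u0_inf U0 x - v0_inf V0 x)" for l x :: real

lemma inf_measurable[measurable]: "u0_inf U0 \<in> borel_measurable borel" "v0_inf V0 \<in> borel_measurable borel"
  unfolding u0_inf_def[abs_def] v0_inf_def[abs_def] by measurable

lemma evol_wb: "evol wb (\<lambda>x. u0_inf U0 x - v0_inf V0 x) gb (\<lambda>_. 0)"
  unfolding wb_def gb_def
proof (rule selfsim_evol[where B="M + L * M" and fm=U0 and fp="- V0"])
  have LM: "0 \<le> L * M" using L_pos M_pos by simp
  have "\<bar>f \<eta>\<bar> \<le> M + L * M" "\<bar>Dfun du dv (f \<eta>)\<bar> \<le> M + L * M" for \<eta>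
    using f_bound[of \<eta>] Dfun_bound[OF f_bound[of \<eta>]] LM M_pos by linarith+
  then show "bdd_borel1 f (M + L * M)" "bdd_borel1 (\<lambda>\<eta>. Dfun du dv (f \<eta>)) (M + L * M)" by simp_all
  show "(f \<longlongrightarrow> U0) at_bot" "(f \<longlongrightarrow> - V0) at_top" unfolding f_def by (rule profile_limits[OF du dv])+
  show "(\<integral>\<eta>. Dfun du dv (f \<eta>) * \<phi>2 \<eta> - f \<eta> * (\<phi> \<eta> + \<eta> * \<phi>1 \<eta>) / 2 \<partial>lborel) = 0" if "test2 \<phi> \<phi>1 \<phi>2" for \<phi> \<phi>1 \<phi>2
    unfolding f_def by (rule profile_stationary[OF du dv U0 V0 ie that])
qed (simp_all add: u0_inf_def v0_inf_def)

lemma evol_zn: assumes l: "l > 0" shows "evol (zn l) (z0 l) (Gn l) (\<lambda>_. 0)"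
proof -
  have b1: "bdd_borel1 (\<lambda>x. u0 (l * x)) (2 * CB l)" "bdd_borel1 (\<lambda>x. v0 (l * x)) (2 * CB l)"
    "bdd_borel1 (\<lambda>x. u0 (l * x) - v0 (l * x)) (2 * CB l)" "bdd_borel1 (\<lambda>x. u0_inf U0 x - v0_inf V0 x) (2 * CB l)"
  proof -
    have "\<bar>u0 (l * x)\<bar> \<le> 2 * CB l" "\<bar>v0 (l * x)\<bar> \<le> 2 * CB l" "\<bar>u0 (l * x) - v0 (l * x)\<bar> \<le> 2 * CB l"
      "\<bar>u0_inf U0 x - v0_inf V0 x\<bar> \<le> 2 * CB l" for x
      using u0b[of "l * x"] v0b[of "l * x"] CB_bounds[of l] U0 V0 UM VM unfolding u0_inf_def v0_inf_def by auto
    then show "bdd_borel1 (\<lambda>x. u0 (l * x)) (2 * CB l)" "bdd_borel1 (\<lambda>x. v0 (l * x)) (2 * CB l)"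
      "bdd_borel1 (\<lambda>x. u0 (l * x) - v0 (l * x)) (2 * CB l)" "bdd_borel1 (\<lambda>x. u0_inf U0 x - v0_inf V0 x) (2 * CB l)" by simp_all
  qed
  have w2: "bdd_borel2 h (2 * CB l)" if "bdd_borel2 h (CB l)" for h
  proof -
    have "\<bar>h p\<bar> \<le> 2 * CB l" for p using that[THEN conjunct2, rule_format, of p] CB_bounds(6)[of l] by linarith
    then show ?thesis using that by simp
  qed
  have d2: "bdd_borel2 (\<lambda>p. h p - h' p) (2 * CB l)" if "bdd_borel2 h (CB l)" "bdd_borel2 h' (CB l)" for h h'
  proof -
    have "\<bar>h p - h' p\<bar> \<le> 2 * CB l" for p
      using that(1)[THEN conjunct2, rule_format, of p] that(2)[THEN conjunct2, rule_format, of p] by linarith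
    moreover have "h \<in> borel_measurable (borel \<Otimes>\<^sub>M borel)" "h' \<in> borel_measurable (borel \<Otimes>\<^sub>M borel)" using that by blast+
    ultimately show ?thesis by simp
  qed
  have e1: "evol (\<lambda>p. Us l p - Vs l p) (\<lambda>x. u0 (l * x) - v0 (l * x)) (\<lambda>p. du * Us l p - dv * Vs l p)
      (\<lambda>p. l\<^sup>2 * (k * F (Us l p) (Vs l p)) - l\<^sup>2 * (k * F (Us l p) (Vs l p)))"
    by (rule evol_diff[OF evol_Us[OF l] evol_Vs[OF l], where B="2 * CB l"]) (intro w2 bdd_CB b1)+
  have "evol (\<lambda>p. Us l p - Vs l p - wb p) (\<lambda>x. u0 (l * x) - v0 (l * x) - (u0_inf U0 x - v0_inf V0 x))
      (\<lambda>p. du * Us l p - dv * Vs l p - gb p) (\<lambda>p. (l\<^sup>2 * (k * F (Us l p) (Vs l p)) - l\<^sup>2 * (k * F (Us l p) (Vs l p))) - 0)"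
    by (rule evol_diff[OF e1 evol_wb, where B="2 * CB l"]) (intro w2 d2 bdd_CB b1)+
  then show ?thesis unfolding zn_def[abs_def] Gn_def[abs_def] z0_def[abs_def] by simp
qed

text \<open>The limiting data depend on the sign of x only and are invariant under scaling, so the
  substitution y = l x leaves the factor 1 / l.\<close>

lemma scaled_initial:
  assumes l: "l > 0"
  shows "integrable lborel (\<lambda>x. u0 (l * x) - u0_inf U0 x)" "integrable lborel (\<lambda>x. v0 (l * x) - v0_inf V0 x)"
    "(\<integral>x. \<bar>u0 (l * x) - u0_inf U0 x\<bar> \<partial>lborel) = (\<integral>x. \<bar>u0 x - u0_inf U0 x\<bar> \<partial>lborel) / l"
    "(\<integral>x. \<bar>v0 (l * x) - v0_inf V0 x\<bar> \<partial>lborel) = (\<integral>x. \<bar>v0 x - v0_inf V0 x\<bar> \<partial>lborel) / l"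
proof -
  have s: "u0_inf U0 (l * x) = u0_inf U0 x" "v0_inf V0 (l * x) = v0_inf V0 x" for x
    using l by (simp_all add: u0_inf_def v0_inf_def mult_less_0_iff zero_less_mult_iff)
  show "integrable lborel (\<lambda>x. u0 (l * x) - u0_inf U0 x)" "integrable lborel (\<lambda>x. v0 (l * x) - v0_inf V0 x)"
    using lborel_integrable_real_affine[OF u0i, of l 0] lborel_integrable_real_affine[OF v0i, of l 0] l by (simp_all add: s)
  show "(\<integral>x. \<bar>u0 (l * x) - u0_inf U0 x\<bar> \<partial>lborel) = (\<integral>x. \<bar>u0 x - u0_inf U0 x\<bar> \<partial>lborel) / l"
    using lborel_integral_real_affine[of l "\<lambda>x. \<bar>u0 x - u0_inf U0 x\<bar>" 0] l by (simp add: s)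
  show "(\<integral>x. \<bar>v0 (l * x) - v0_inf V0 x\<bar> \<partial>lborel) = (\<integral>x. \<bar>v0 x - v0_inf V0 x\<bar> \<partial>lborel) / l"
    using lborel_integral_real_affine[of l "\<lambda>x. \<bar>v0 x - v0_inf V0 x\<bar>" 0] l by (simp add: s)
qed

lemma z0_facts:
  assumes l: "l > 0"
  shows "integrable lborel (z0 l)" "(\<integral>x. \<bar>z0 l x\<bar> \<partial>lborel) \<le> Z / l" "\<bar>z0 l x\<bar> \<le> CB l"
proof -
  have eq: "z0 l = (\<lambda>x. (u0 (l * x) - u0_inf U0 x) - (v0 (l * x) - v0_inf V0 x))" unfolding z0_def by auto
  note s = scaled_initial[OF l]
  show i: "integrable lborel (z0 l)" unfolding eq using s by simp
  have "(\<integral>x. \<bar>z0 l x\<bar> \<partial>lborel) \<le> (\<integral>x. \<bar>u0 (l * x) - u0_inf U0 x\<bar> + \<bar>v0 (l * x) - v0_inf V0 x\<bar> \<partial>lborel)"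
    by (rule integral_mono) (use i s in \<open>auto simp: eq\<close>)
  also have "\<dots> = Z / l" using s by (simp add: Z_def add_divide_distrib)
  finally show "(\<integral>x. \<bar>z0 l x\<bar> \<partial>lborel) \<le> Z / l" .
  show "\<bar>z0 l x\<bar> \<le> CB l"
    using u0b[of "l * x"] v0b[of "l * x"] U0 V0 UM VM CB_bounds(1)[of l] M_pos mult_pos_pos[OF L_pos M_pos]
    unfolding z0_def u0_inf_def v0_inf_def K_def by auto
qed

text \<open>Initial mass plus flux: |\<open>qrho\<close>| <= 10, and the slab on which the flux is
  integrated has measure at most 2 * \<mu> * T, whence the 20.\<close>

definition "C1 = \<mu> * M + 20 * du * M * \<mu> * T"

text \<open>The rescaled reaction term carries the factor \<open>l\<^sup>2\<close> while \<open>Us l\<close> stays bounded; this forces segregation.\<close>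

lemma reaction_integral_bound:
  assumes l: "l > 0" shows "l\<^sup>2 * k * (\<integral>p. F (Us l p) (Vs l p) \<partial>Q T) \<le> C1"
proof -
  let ?h = "\<lambda>p. l\<^sup>2 * (k * F (Us l p) (Vs l p))"
  have b0: "bdd_borel1 (\<lambda>x. u0 (l * x)) (CB l)"
  proof -
    have "\<bar>u0 (l * x)\<bar> \<le> CB l" for x using u0b[of "l * x"] CB_bounds(2)[of l] by linarith
    then show ?thesis by simp
  qed
  \<comment> \<open>The weighted identity holds for almost every time and may fail at T; a good time
    below 2 T is taken and the nonnegative reaction is restricted to \<open>Q T\<close>
    afterwards.\<close>
  obtain t where t: "T < t" "t < 2 * T" and eq: "0 < t \<longrightarrow> (\<integral>x. Us l (x, t) \<partial>Mx) = (\<integral>x. u0 (l * x) \<partial>Mx) + (\<integral>p. du * Us l p * qrho (fst p) - ?h p \<partial>Q t)"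
    using AE_exists_between[OF evol_rho[OF evol_Us[OF l] bdd_CB(1,3,5) b0], of T "2 * T"] T_pos by auto
  have t0: "0 < t" using t T_pos by linarith
  have B: "\<bar>du * Us l p * qrho (fst p)\<bar> \<le> du * M * 10" for p
    unfolding abs_mult[of "du * Us l p"] using UVs_bound[of l p] du M_pos abs_qrho_le by (intro mult_mono) (simp_all add: abs_mult)
  have hB: "\<bar>?h p\<bar> \<le> CB l" for p using bdd_CB(5)[of l] by blast
  have h0: "0 \<le> ?h p" for p using Fn_bound k by simp
  have hm: "?h \<in> borel_measurable (borel \<Otimes>\<^sub>M borel)" by measurable
  have i: "integrable (Q t) (\<lambda>p. du * Us l p * qrho (fst p))" "integrable (Q t) ?h"
    by (rule Q.integrable_boundedI[where B="du * M * 10"], measurable, rule B) (rule Q.integrable_boundedI[where B="CB l"], measurable, rule hB)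
  have "(\<integral>p. ?h p \<partial>Q T) \<le> (\<integral>p. ?h p \<partial>Q t)" by (rule Q_integral_mono[OF hm hB h0]) (use t in simp)
  also have "\<dots> = (\<integral>x. u0 (l * x) \<partial>Mx) - (\<integral>x. Us l (x, t) \<partial>Mx) + (\<integral>p. du * Us l p * qrho (fst p) \<partial>Q t)"
    using eq t0 i by simp
  also have "\<dots> \<le> M * \<mu> - 0 + du * M * 10 * (\<mu> * (2 * T))"
  proof (intro add_mono diff_mono)
    have "\<bar>\<integral>x. u0 (l * x) \<partial>Mx\<bar> \<le> M * measure Mx (space Mx)"
      by (rule abs_integral_bounded[OF finite_Mx]) (measurable, use u0b in simp)
    then show "(\<integral>x. u0 (l * x) \<partial>Mx) \<le> M * \<mu>" unfolding \<mu>_def by simp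
    show "0 \<le> (\<integral>x. Us l (x, t) \<partial>Mx)" by (simp add: UVs_bound)
    have "\<bar>\<integral>p. du * Us l p * qrho (fst p) \<partial>Q t\<bar> \<le> du * M * 10 * measure (Q t) (space (Q t))"
      by (rule abs_integral_bounded[OF finite_Q]) (measurable, rule B)
    also have "\<dots> = du * M * 10 * (\<mu> * t)" using measure_Q[of t] t0 by (simp add: \<mu>_def)
    also have "\<dots> \<le> du * M * 10 * (\<mu> * (2 * T))" using t mu_nonneg du M_pos by (intro mult_left_mono) auto
    finally show "(\<integral>p. du * Us l p * qrho (fst p) \<partial>Q t) \<le> du * M * 10 * (\<mu> * (2 * T))" by simp
  qed
  finally show ?thesis unfolding C1_def by (simp add: algebra_simps)
qed

abbreviation "sc n \<equiv> real (Suc n)"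

lemma one_over_sc: "(\<lambda>n. c / sc n) \<longlonglongrightarrow> 0" for c :: real
  using LIMSEQ_Suc[OF lim_const_over_n[of c]] by simp

lemma one_over_sc2: "(\<lambda>n. c / (sc n)\<^sup>2) \<longlonglongrightarrow> 0" for c :: real
  using tendsto_mult[OF one_over_sc[of c] one_over_sc[of 1]] by (simp add: power2_eq_square)

text \<open>For fixed d the second summand of \<open>reaction_rate_min\<close> has integral of order
  1 / l^2 by the reaction bound, while the first one is kept below e by the choice of d.\<close>

lemma m_tendsto: "(\<lambda>n. \<integral>p. mn (sc n) p \<partial>Q T) \<longlonglongrightarrow> 0"
proof (rule tendsto_0I)
  show "0 \<le> (\<integral>p. mn (sc n) p \<partial>Q T)" for n by (simp add: mn_bound)
  fix e :: real assume e: "e > 0"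
  define d where "d = e / (\<mu> * T + 1)"
  have p: "\<mu> * T + 1 > 0" using mu_nonneg T_pos by (simp add: add_nonneg_pos)
  have d: "d > 0" unfolding d_def using e p by simp
  have "(\<integral>p. mn (sc n) p \<partial>Q T) \<le> e + (M / F d d * (C1 / k)) / (sc n)\<^sup>2" for n
  proof -
    let ?l = "sc n"
    have i: "integrable (Q T) (\<lambda>p. F (Us ?l p) (Vs ?l p))"
      by (rule Q.integrable_boundedI[where B=FM]) (measurable, use Fn_bound in simp)
    have "(\<integral>p. mn ?l p \<partial>Q T) \<le> (\<integral>p. d + M / F d d * F (Us ?l p) (Vs ?l p) \<partial>Q T)"
      by (rule integral_mono[OF int_m]) (use i reaction_rate_min[OF F UVs_bound d] in \<open>auto simp: mn_def\<close>)
    also have "\<dots> = d * (\<mu> * T) + M / F d d * (\<integral>p. F (Us ?l p) (Vs ?l p) \<partial>Q T)"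
      using i measure_Q[of T] T_pos by (simp add: \<mu>_def mult.commute)
    also have "d * (\<mu> * T) \<le> d * (\<mu> * T + 1)" using d by (intro mult_left_mono) auto
    also have "d * (\<mu> * T + 1) = e" unfolding d_def using p by simp
    finally have "(\<integral>p. mn ?l p \<partial>Q T) \<le> e + M / F d d * (\<integral>p. F (Us ?l p) (Vs ?l p) \<partial>Q T)" by simp
    moreover have "(\<integral>p. F (Us ?l p) (Vs ?l p) \<partial>Q T) \<le> C1 / k / ?l\<^sup>2"
    proof -
      have "?l\<^sup>2 * k > 0" using k by simp
      then have "(\<integral>p. F (Us ?l p) (Vs ?l p) \<partial>Q T) \<le> C1 / (?l\<^sup>2 * k)"
        using reaction_integral_bound[of ?l] by (simp add: pos_le_divide_eq mult.commute)
      then show ?thesis by (simp only: divide_divide_eq_left mult.commute)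
    qed
    then have "M / F d d * (\<integral>p. F (Us ?l p) (Vs ?l p) \<partial>Q T) \<le> M / F d d * (C1 / k / ?l\<^sup>2)"
      using reaction_rateD(3)[OF F d d] M_pos by (intro mult_left_mono) simp_all
    moreover have "M / F d d * (C1 / k / ?l\<^sup>2) = (M / F d d * (C1 / k)) / ?l\<^sup>2" by simp
    ultimately show ?thesis by linarith
  qed
  then show "\<exists>b. b \<longlonglongrightarrow> 0 \<and> (\<forall>n. (\<integral>p. mn (sc n) p \<partial>Q T) \<le> e + b n)"
    using one_over_sc2 by blast
qed

text \<open>The energy estimate with error function 3 M L m and c = 1 / (2 L), both taken from the
  last flux estimate; the 9 is 3 times the 3 of the error function.\<close>

lemma energy_bound:
  assumes l: "l > 0"
  shows "(\<integral>p. zn l p * Gn l p \<partial>Q T) \<le> 2 * \<mu> * (Z / l)\<^sup>2 + 9 * M * L * (\<integral>p. mn l p \<partial>Q T)"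
proof -
  define e where "e p = 3 * M * L * mn l p" for p
  have e0: "0 \<le> e p" "e p \<le> 3 * M * L * M" for p
    unfolding e_def using mn_bound[of l p] M_pos L_pos by (simp_all add: mult_left_mono)
  have em: "e \<in> borel_measurable (borel \<Otimes>\<^sub>M borel)" unfolding e_def[abs_def] by measurable
  have eB: "\<bar>e p\<bar> \<le> 3 * M * L * M" for p using e0[of p] by linarith
  have zB: "\<bar>zn l p\<bar> \<le> CB l" and GB: "\<bar>Gn l p\<bar> \<le> CB l" for p
    using zn_bound[of l p] Gn_bound[of l p] CB_bounds(1)[of l] by linarith+
  have fl: "1 / (2 * L) * (Gn l p)\<^sup>2 - e p \<le> zn l p * Gn l p" for p unfolding e_def by (rule flux(5))
  have L2: "0 < 1 / (2 * L)" "2 * T \<le> 1 / (2 * L)" unfolding T_def using L_pos by simp_all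
  have "(\<integral>p. zn l p * Gn l p \<partial>Q T) \<le> 2 * measure Mx UNIV * (Z / l)\<^sup>2 + 3 * (\<integral>p. e p \<partial>Q T)"
    by (rule energy_estimate[OF zn_measurable zB Gn_measurable GB em eB e0(1) z0_facts(1)[OF l] z0_facts(3)[OF l] z0_facts(2)[OF l]
          evol_zn[OF l] L2(1) fl T_pos L2(2)])
  moreover have "(\<integral>p. e p \<partial>Q T) = 3 * M * L * (\<integral>p. mn l p \<partial>Q T)" unfolding e_def by simp
  ultimately show ?thesis unfolding \<mu>_def by simp
qed

lemma zq_le: "(\<integral>p. zn l p * qn l p \<partial>Q T) \<le> (\<integral>p. zn l p * Gn l p \<partial>Q T) + 2 * M * L * (\<integral>p. mn l p \<partial>Q T)"
proof -
  have "(\<integral>p. zn l p * qn l p \<partial>Q T) \<le> (\<integral>p. zn l p * Gn l p + 2 * M * L * mn l p \<partial>Q T)"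
    by (rule integral_mono[OF int_zq _ flux(4)]) (use int_zG int_m in simp)
  then show ?thesis using int_zG int_m by simp
qed

lemma zq_tendsto: "(\<lambda>n. \<integral>p. zn (sc n) p * qn (sc n) p \<partial>Q T) \<longlonglongrightarrow> 0"
proof (rule tendsto_sandwich[OF _ _ tendsto_const])
  show "\<forall>\<^sub>F n in sequentially. 0 \<le> (\<integral>p. zn (sc n) p * qn (sc n) p \<partial>Q T)" by (simp add: zq_nonneg)
  show "\<forall>\<^sub>F n in sequentially. (\<integral>p. zn (sc n) p * qn (sc n) p \<partial>Q T)
      \<le> 2 * \<mu> * (Z / sc n)\<^sup>2 + 11 * M * L * (\<integral>p. mn (sc n) p \<partial>Q T)"
  proof (intro always_eventually allI)
    fix n
    show "(\<integral>p. zn (sc n) p * qn (sc n) p \<partial>Q T) \<le> 2 * \<mu> * (Z / sc n)\<^sup>2 + 11 * M * L * (\<integral>p. mn (sc n) p \<partial>Q T)"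
      using order_trans[OF zq_le add_right_mono[OF energy_bound[of "sc n"]]] by (simp add: algebra_simps)
  qed
  have "(\<lambda>n. 2 * \<mu> * (Z / sc n)\<^sup>2 + 11 * M * L * (\<integral>p. mn (sc n) p \<partial>Q T)) \<longlonglongrightarrow> 2 * \<mu> * 0\<^sup>2 + 11 * M * L * 0"
    by (intro tendsto_add tendsto_mult_left tendsto_power one_over_sc m_tendsto)
  then show "(\<lambda>n. 2 * \<mu> * (Z / sc n)\<^sup>2 + 11 * M * L * (\<integral>p. mn (sc n) p \<partial>Q T)) \<longlonglongrightarrow> 0" by simp
qed

lemma integral_le_zq_m:
  assumes g: "g \<in> borel_measurable (borel \<Otimes>\<^sub>M borel)" and le: "\<And>p. \<bar>g p\<bar> \<le> c * (zn l p * qn l p) + c' * mn l p"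
  shows "(\<integral>p. g p \<partial>Q T) \<le> c * (\<integral>p. zn l p * qn l p \<partial>Q T) + c' * (\<integral>p. mn l p \<partial>Q T)"
proof -
  have ii: "integrable (Q T) (\<lambda>p. c * (zn l p * qn l p) + c' * mn l p)" using int_zq int_m by simp
  have ig: "integrable (Q T) g"
    by (rule Bochner_Integration.integrable_bound[OF ii]) (use g le in \<open>auto intro!: AE_I2 intro: order_trans[OF le]\<close>)
  have "(\<integral>p. g p \<partial>Q T) \<le> (\<integral>p. c * (zn l p * qn l p) + c' * mn l p \<partial>Q T)"
    by (rule integral_mono[OF ig ii]) (use le in \<open>auto intro: order_trans[OF abs_ge_self]\<close>)
  then show ?thesis using int_zq int_m by simp
qed

lemma tendsto_of_zq_m:
  assumes g: "\<And>n. g n \<in> borel_measurable (borel \<Otimes>\<^sub>M borel)" and nn: "\<And>n p. 0 \<le> g n p"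
    and le: "\<And>n p. g n p \<le> c * (zn (sc n) p * qn (sc n) p) + c' * mn (sc n) p"
  shows "(\<lambda>n. \<integral>p. g n p \<partial>Q T) \<longlonglongrightarrow> 0"
proof (rule tendsto_sandwich[OF _ _ tendsto_const])
  show "\<forall>\<^sub>F n in sequentially. 0 \<le> (\<integral>p. g n p \<partial>Q T)" by (simp add: nn)
  show "\<forall>\<^sub>F n in sequentially. (\<integral>p. g n p \<partial>Q T) \<le> c * (\<integral>p. zn (sc n) p * qn (sc n) p \<partial>Q T) + c' * (\<integral>p. mn (sc n) p \<partial>Q T)"
    by (intro always_eventually allI integral_le_zq_m g) (simp only: abs_of_nonneg[OF nn] le)
  have "(\<lambda>n. c * (\<integral>p. zn (sc n) p * qn (sc n) p \<partial>Q T) + c' * (\<integral>p. mn (sc n) p \<partial>Q T)) \<longlonglongrightarrow> c * 0 + c' * 0"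
    by (intro tendsto_add tendsto_mult_left zq_tendsto m_tendsto)
  then show "(\<lambda>n. c * (\<integral>p. zn (sc n) p * qn (sc n) p \<partial>Q T) + c' * (\<integral>p. mn (sc n) p \<partial>Q T)) \<longlonglongrightarrow> 0" by simp
qed

definition "errU l p = Us l p - max (wb p) 0" for l :: real and p :: "real \<times> real"
definition "errV l p = Vs l p + min (wb p) 0" for l :: real and p :: "real \<times> real"

lemma euv_measurable[measurable]: "errU l \<in> borel_measurable (borel \<Otimes>\<^sub>M borel)" "errV l \<in> borel_measurable (borel \<Otimes>\<^sub>M borel)"
  unfolding errU_def[abs_def] errV_def[abs_def] by measurable

lemma euv_bound: "\<bar>errU l p\<bar> \<le> M" "\<bar>errV l p\<bar> \<le> M"
  using UVs_bound[of l p] wb_bound[of p] unfolding errU_def errV_def by auto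

lemma square_add_le: "0 \<le> m \<Longrightarrow> m \<le> M \<Longrightarrow> (y + m)\<^sup>2 \<le> 2 * y\<^sup>2 + 2 * M * m" for y m :: real
proof -
  assume m: "0 \<le> m" "m \<le> M"
  have "(y + m)\<^sup>2 \<le> 2 * y\<^sup>2 + 2 * m\<^sup>2" using zero_le_power2[of "y - m"] by (simp add: power2_eq_square algebra_simps)
  moreover have "m\<^sup>2 \<le> M * m" unfolding power2_eq_square using m by (intro mult_right_mono) auto
  ultimately show ?thesis by simp
qed

text \<open>Since u is m plus the positive part of u - v, its error splits into a difference of
  positive parts, controlled by z q and du > 0, and the coexistence term m.\<close>

lemma eu_tendsto: "(\<lambda>n. \<integral>p. (errU (sc n) p)\<^sup>2 \<partial>Q T) \<longlonglongrightarrow> 0"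
proof (rule tendsto_of_zq_m[where c="2 / du" and c'="2 * M"])
  fix n p
  have "errU (sc n) p = (max (Us (sc n) p - Vs (sc n) p) 0 - max (wb p) 0) + mn (sc n) p"
    unfolding errU_def mn_def by (auto simp: max_def min_def)
  then have "(errU (sc n) p)\<^sup>2 \<le> 2 * (max (Us (sc n) p - Vs (sc n) p) 0 - max (wb p) 0)\<^sup>2 + 2 * M * mn (sc n) p"
    using square_add_le[OF mn_bound] by simp
  moreover have "(max (Us (sc n) p - Vs (sc n) p) 0 - max (wb p) 0)\<^sup>2 \<le> 1 / du * (zn (sc n) p * qn (sc n) p)"
    using flux(1)[of "sc n" p] du by (simp add: field_simps)
  ultimately show "(errU (sc n) p)\<^sup>2 \<le> 2 / du * (zn (sc n) p * qn (sc n) p) + 2 * M * mn (sc n) p" by simp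
qed simp_all

lemma ev_tendsto_pos: assumes "dv > 0" shows "(\<lambda>n. \<integral>p. (errV (sc n) p)\<^sup>2 \<partial>Q T) \<longlonglongrightarrow> 0"
proof (rule tendsto_of_zq_m[where c="2 / dv" and c'="2 * M"])
  fix n p
  have "errV (sc n) p = (min (wb p) 0 - min (Us (sc n) p - Vs (sc n) p) 0) + mn (sc n) p"
    unfolding errV_def mn_def by (auto simp: max_def min_def)
  then have "(errV (sc n) p)\<^sup>2 \<le> 2 * (min (wb p) 0 - min (Us (sc n) p - Vs (sc n) p) 0)\<^sup>2 + 2 * M * mn (sc n) p"
    using square_add_le[OF mn_bound] by simp
  moreover have "(min (wb p) 0 - min (Us (sc n) p - Vs (sc n) p) 0)\<^sup>2 \<le> 1 / dv * (zn (sc n) p * qn (sc n) p)"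
    using flux(2)[of "sc n" p] assms by (simp add: field_simps power2_commute[of "min (wb p) 0"])
  ultimately show "(errV (sc n) p)\<^sup>2 \<le> 2 / dv * (zn (sc n) p * qn (sc n) p) + 2 * M * mn (sc n) p" by simp
qed simp_all

end

section \<open>The component v in the absence of its diffusion\<close>

context selfsimilar_setup
begin

text \<open>The last flux estimate read backwards: the energy controls G in L2. This smallness is
  what drives the weighted mean of z to 0.\<close>

lemma G_tendsto: "(\<lambda>n. \<integral>p. \<bar>Gn (sc n) p\<bar> \<partial>Q T) \<longlonglongrightarrow> 0"
proof (rule L1_of_L2)
  show "bdd_borel2 (Gn (sc n)) K" for n using Gn_bound by simp
  show "(\<lambda>n. \<integral>p. (Gn (sc n) p)\<^sup>2 \<partial>Q T) \<longlonglongrightarrow> 0"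
  proof (rule tendsto_sandwich[OF _ _ tendsto_const])
    show "\<forall>\<^sub>F n in sequentially. 0 \<le> (\<integral>p. (Gn (sc n) p)\<^sup>2 \<partial>Q T)" by simp
    let ?b = "\<lambda>n. 2 * L * (2 * \<mu> * (Z / sc n)\<^sup>2) + 24 * M * L\<^sup>2 * (\<integral>p. mn (sc n) p \<partial>Q T)"
    have "(\<integral>p. (Gn (sc n) p)\<^sup>2 \<partial>Q T) \<le> ?b n" for n
    proof -
      have i: "integrable (Q T) (\<lambda>p. (Gn (sc n) p)\<^sup>2)"
        unfolding power2_eq_square by (rule Q.integrable_boundedI[where B="K * K"]) (measurable, intro prod_bound Gn_bound)
      have "(Gn (sc n) p)\<^sup>2 \<le> 2 * L * (zn (sc n) p * Gn (sc n) p) + 6 * M * L\<^sup>2 * mn (sc n) p" for p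
      proof -
        have "2 * L * (1 / (2 * L) * (Gn (sc n) p)\<^sup>2 - 3 * M * L * mn (sc n) p) \<le> 2 * L * (zn (sc n) p * Gn (sc n) p)"
          using L_pos by (intro mult_left_mono flux(5)) simp
        moreover have "2 * L * (1 / (2 * L) * (Gn (sc n) p)\<^sup>2 - 3 * M * L * mn (sc n) p) = (Gn (sc n) p)\<^sup>2 - 6 * M * L\<^sup>2 * mn (sc n) p"
          using L_pos by (simp add: right_diff_distrib power2_eq_square)
        ultimately show ?thesis by linarith
      qed
      then have "(\<integral>p. (Gn (sc n) p)\<^sup>2 \<partial>Q T) \<le> (\<integral>p. 2 * L * (zn (sc n) p * Gn (sc n) p) + 6 * M * L\<^sup>2 * mn (sc n) p \<partial>Q T)"
        by (intro integral_mono[OF i]) (use int_zG int_m in simp)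
      also have "\<dots> = 2 * L * (\<integral>p. zn (sc n) p * Gn (sc n) p \<partial>Q T) + 6 * M * L\<^sup>2 * (\<integral>p. mn (sc n) p \<partial>Q T)"
        using int_zG int_m by simp
      also have "2 * L * (\<integral>p. zn (sc n) p * Gn (sc n) p \<partial>Q T) \<le> 2 * L * (2 * \<mu> * (Z / sc n)\<^sup>2 + 9 * M * L * (\<integral>p. mn (sc n) p \<partial>Q T))"
        using L_pos by (intro mult_left_mono energy_bound) simp_all
      finally show ?thesis by (simp add: algebra_simps power2_eq_square)
    qed
    then show "\<forall>\<^sub>F n in sequentially. (\<integral>p. (Gn (sc n) p)\<^sup>2 \<partial>Q T) \<le> ?b n" by simp
    have "?b \<longlonglongrightarrow> 2 * L * (2 * \<mu> * 0\<^sup>2) + 24 * M * L\<^sup>2 * 0"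
      by (intro tendsto_add tendsto_mult_left tendsto_power one_over_sc m_tendsto)
    then show "?b \<longlonglongrightarrow> 0" by simp
  qed
qed

text \<open>Tested with the weight, the equation of z expresses its weighted mean at time s by the
  initial mean, at most Z / l, and an integral of G rho'', where |rho''| <= 10 rho. The absolute
  value stands outside the integral of z, so cancellations in z are kept.\<close>

lemma z_integral_bound:
  assumes l: "l > 0"
  shows "\<bar>\<integral>p. zn l p \<partial>Q T\<bar> \<le> T * (Z / l + 10 * (\<integral>p. \<bar>Gn l p\<bar> \<partial>Q T))"
proof -
  define c where "c = Z / l + 10 * (\<integral>p. \<bar>Gn l p\<bar> \<partial>Q T)"
  have b0: "bdd_borel1 (z0 l) (CB l)" using z0_facts[OF l] by auto
  have iG: "integrable (Q s) (\<lambda>p. \<bar>Gn l p\<bar>)" for s by (rule Q.integrable_boundedI[where B=K]) (use Gn_bound in auto)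
  have ae: "AE s in Mt T. \<bar>\<integral>x. zn l (x, s) \<partial>Mx\<bar> \<le> c"
    unfolding AE_Mt using evol_rho[OF evol_zn[OF l] bdd_CB(8,9,10) b0] AE_lborel_singleton[of 0]
  proof eventually_elim
    case (elim s)
    show ?case
    proof
      assume s: "0 \<le> s \<and> s \<le> T"
      then have "(\<integral>x. zn l (x, s) \<partial>Mx) = (\<integral>x. z0 l x \<partial>Mx) + (\<integral>p. Gn l p * qrho (fst p) \<partial>Q s)" using elim by simp
      moreover have "\<bar>\<integral>x. z0 l x \<partial>Mx\<bar> \<le> Z / l"
      proof -
        have [measurable]: "z0 l \<in> borel_measurable borel" using b0 by simp
        have "\<bar>\<integral>x. z0 l x \<partial>Mx\<bar> = \<bar>\<integral>x. rho x * z0 l x \<partial>lborel\<bar>" by (simp add: integral_Mx)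
        also have "\<dots> \<le> 1 * (\<integral>x. \<bar>z0 l x\<bar> \<partial>lborel)"
          by (rule abs_integral_mult_le[OF z0_facts(1)[OF l]]) (use rho_pos rho_le_1 in \<open>simp_all add: less_imp_le\<close>)
        finally show ?thesis using z0_facts(2)[OF l] by simp
      qed
      moreover have "\<bar>\<integral>p. Gn l p * qrho (fst p) \<partial>Q s\<bar> \<le> 10 * (\<integral>p. \<bar>Gn l p\<bar> \<partial>Q T)"
      proof -
        have "\<bar>\<integral>p. qrho (fst p) * Gn l p \<partial>Q s\<bar> \<le> 10 * (\<integral>p. \<bar>Gn l p\<bar> \<partial>Q s)"
        proof (rule abs_integral_mult_le)
          show "integrable (Q s) (Gn l)" by (rule Q.integrable_boundedI[where B=K]) (use Gn_bound in auto)
        qed (measurable, rule abs_qrho_le)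
        also have "(\<integral>p. \<bar>Gn l p\<bar> \<partial>Q s) \<le> (\<integral>p. \<bar>Gn l p\<bar> \<partial>Q T)"
          by (rule Q_integral_mono[where B=K]) (use Gn_bound s in auto)
        finally show ?thesis by (simp add: mult.commute)
      qed
      ultimately show "\<bar>\<integral>x. zn l (x, s) \<partial>Mx\<bar> \<le> c" unfolding c_def by linarith
    qed
  qed
  have "\<bar>\<integral>p. zn l p \<partial>Q T\<bar> = \<bar>\<integral>s. (\<integral>x. zn l (x, s) \<partial>Mx) \<partial>Mt T\<bar>"
    by (subst Q_iterated(1)[OF zn_measurable zn_bound]) simp
  also have "\<dots> \<le> (\<integral>s. \<bar>\<integral>x. zn l (x, s) \<partial>Mx\<bar> \<partial>Mt T)" by (rule integral_abs_bound)
  also have "\<dots> \<le> (\<integral>s. c \<partial>Mt T)"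
  proof (rule integral_mono_AE[OF _ _ ae])
    show "integrable (Mt T) (\<lambda>s. \<bar>\<integral>x. zn l (x, s) \<partial>Mx\<bar>)"
      by (rule Mt.integrable_boundedI[where B="K * measure Mx UNIV"])
        (measurable, use Mx_marginal(2)[OF zn_measurable zn_bound] in simp)
  qed simp
  also have "\<dots> = T * c" using measure_Mt[of T] T_pos by simp
  finally show ?thesis unfolding c_def .
qed

lemma AE_Q_time: "AE p in Q T. 0 < snd p \<and> snd p \<le> T"
proof (rule AE_Q_sliceI)
  have "Measurable.pred (borel \<Otimes>\<^sub>M borel) (\<lambda>p :: real \<times> real. \<not> (0 < snd p \<and> snd p \<le> T))" by measurable
  then show "{p :: real \<times> real. \<not> (0 < snd p \<and> snd p \<le> T)} \<in> sets (borel \<Otimes>\<^sub>M (borel :: real measure))"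
    by (simp add: pred_def space_pair_measure)
  have "AE s in Mt T. 0 < snd (x, s) \<and> snd (x, s) \<le> T" for x :: real
    unfolding AE_Mt using AE_lborel_singleton[of 0] by eventually_elim auto
  then show "(\<forall>x :: real. AE s in Mt T. 0 < snd (x, s) \<and> snd (x, s) \<le> T) \<or> (\<forall>s. AE x in Mx. 0 < snd (x, s) \<and> snd (x, s) \<le> T)"
    by blast
qed

lemma AE_Q_interface: "AE p in Q T. fst p \<noteq> a * sqrt (snd p)"
proof (rule AE_Q_sliceI)
  have "Measurable.pred (borel \<Otimes>\<^sub>M borel) (\<lambda>p :: real \<times> real. \<not> fst p \<noteq> a * sqrt (snd p))" by measurable
  then show "{p. \<not> fst p \<noteq> a * sqrt (snd p)} \<in> sets (borel \<Otimes>\<^sub>M borel)"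
    by (simp add: pred_def space_pair_measure)
  have "AE x in Mx. fst (x, s) \<noteq> a * sqrt (snd (x, s))" for s
    unfolding AE_Mx using AE_lborel_singleton[of "a * sqrt s"] by simp
  then show "(\<forall>x. AE s in Mt T. fst (x, s) \<noteq> a * sqrt (snd (x, s))) \<or> (\<forall>s. AE x in Mx. fst (x, s) \<noteq> a * sqrt (snd (x, s)))"
    by blast
qed

text \<open>Indicator of the strip on the u-side of the interface where the profile is at most
  \<open>\<delta>\<close>. There z q gives too little control of v; the strip shrinks to a null set
  with \<open>\<delta>\<close> because the profile is positive on that side.\<close>

definition "thin \<delta> p = (if fst p / sqrt (snd p) < a \<and> wb p \<le> \<delta> then 1 else 0 :: real)" for \<delta> :: real and p :: "real \<times> real"

lemma thin_measurable[measurable]: "thin \<delta> \<in> borel_measurable (borel \<Otimes>\<^sub>M borel)"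
  unfolding thin_def[abs_def] by measurable

lemma thin_bound: "0 \<le> thin \<delta> p" "thin \<delta> p \<le> 1" unfolding thin_def by auto

lemma thin_integrable: "integrable (Q T) (thin \<delta>)"
  by (rule Q.integrable_boundedI[where B=1]) (use thin_bound in simp_all)

lemma thin_tendsto: "(\<lambda>j. \<integral>p. thin (1 / sc j) p \<partial>Q T) \<longlonglongrightarrow> 0"
proof -
  have "(\<lambda>j. \<integral>p. thin (1 / sc j) p \<partial>Q T) \<longlonglongrightarrow> (\<integral>p. 0 \<partial>Q T)"
  proof (rule integral_dominated_convergence[where w="\<lambda>_. 1"])
    have "(\<lambda>j. thin (1 / sc j) p) \<longlonglongrightarrow> 0" for p
    proof (cases "fst p / sqrt (snd p) < a")
      case True
      then have "wb p > 0" unfolding wb_def selfsim_def f_def by (rule profile_bounds(3)[OF du U0 V0])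
      then have "\<forall>\<^sub>F j in sequentially. 1 / sc j < wb p" by (rule order_tendstoD(2)[OF one_over_sc])
      then have "\<forall>\<^sub>F j in sequentially. thin (1 / sc j) p = 0" by eventually_elim (simp add: thin_def)
      then show ?thesis by (rule tendsto_eventually)
    qed (simp add: thin_def)
    then show "AE p in Q T. (\<lambda>j. thin (1 / sc j) p) \<longlonglongrightarrow> 0" by simp
  qed (use thin_bound in simp_all)
  then show ?thesis by simp
qed

lemma v0_integral_bound:
  assumes l: "l > 0"
  shows "integrable (Q T) (\<lambda>p. \<bar>v0 (l * fst p) - v0_inf V0 (fst p)\<bar>)"
    "(\<integral>p. \<bar>v0 (l * fst p) - v0_inf V0 (fst p)\<bar> \<partial>Q T) \<le> T * (Z / l)"
proof -
  have vb: "\<bar>\<bar>v0 (l * x) - v0_inf V0 x\<bar>\<bar> \<le> M" for x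
    using v0b[of "l * x"] V0 VM unfolding v0_inf_def by auto
  have m: "(\<lambda>p. \<bar>v0 (l * fst p) - v0_inf V0 (fst p)\<bar>) \<in> borel_measurable (borel \<Otimes>\<^sub>M (borel :: real measure))" by measurable
  show "integrable (Q T) (\<lambda>p. \<bar>v0 (l * fst p) - v0_inf V0 (fst p)\<bar>)"
    by (rule Q.integrable_boundedI[where B=M]) (measurable, rule vb)
  have "(\<integral>x. \<bar>v0 (l * x) - v0_inf V0 x\<bar> \<partial>Mx) \<le> Z / l"
  proof -
    have i: "integrable lborel (\<lambda>x. \<bar>v0 (l * x) - v0_inf V0 x\<bar>)" using scaled_initial(2)[OF l] by simp
    have "(\<integral>x. \<bar>v0 (l * x) - v0_inf V0 x\<bar> \<partial>Mx) = (\<integral>x. rho x * \<bar>v0 (l * x) - v0_inf V0 x\<bar> \<partial>lborel)"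
      by (rule integral_Mx) measurable
    also have "\<dots> \<le> (\<integral>x. \<bar>v0 (l * x) - v0_inf V0 x\<bar> \<partial>lborel)"
    proof (rule integral_mono[OF _ i])
      show "integrable lborel (\<lambda>x. rho x * \<bar>v0 (l * x) - v0_inf V0 x\<bar>)"
        by (rule integrable_mult_bounded[OF i, where B=1]) (use rho_pos rho_le_1 in \<open>simp_all add: less_imp_le\<close>)
      show "rho x * \<bar>v0 (l * x) - v0_inf V0 x\<bar> \<le> \<bar>v0 (l * x) - v0_inf V0 x\<bar>" for x
        using mult_right_mono[OF rho_le_1[of x], of "\<bar>v0 (l * x) - v0_inf V0 x\<bar>"] by simp
    qed
    also have "\<dots> \<le> Z / l"
      unfolding scaled_initial(4)[OF l] Z_def using l by (intro divide_right_mono) auto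
    finally show ?thesis .
  qed
  then have "(\<integral>s. (\<integral>x. \<bar>v0 (l * x) - v0_inf V0 x\<bar> \<partial>Mx) \<partial>Mt T) \<le> (\<integral>s. Z / l \<partial>Mt T)"
    by (intro integral_mono) simp_all
  also have "\<dots> = T * (Z / l)" using measure_Mt[of T] T_pos by simp
  finally show "(\<integral>p. \<bar>v0 (l * fst p) - v0_inf V0 (fst p)\<bar> \<partial>Q T) \<le> T * (Z / l)"
    by (subst Q_iterated(1)[where B=M]) (measurable, rule vb, simp)
qed

text \<open>Without diffusion of \<open>v\<close> the flux controls \<open>v\<close> only where the profile is bounded away from \<open>0\<close> on the \<open>u\<close>-side;
  on the \<open>v\<close>-side it decreases in time from its initial value.  This bounds the excess of \<open>v\<close>; the
  deficit then follows from the smallness of the mean of \<open>zn\<close>.\<close>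

lemma errV_excess_pointwise:
  assumes dv0: "dv = 0" and l: "l > 0" and \<delta>: "\<delta> > 0"
  shows "AE p in Q T. max 0 (errV l p)
     \<le> \<bar>v0 (l * fst p) - v0_inf V0 (fst p)\<bar> + (mn l p + (1 / (\<delta> * du) * (zn l p * qn l p) + M * thin \<delta> p))"
proof -
  have b0: "bdd_borel1 (\<lambda>x. v0 (l * x)) (CB l)"
  proof -
    have "\<bar>v0 (l * x)\<bar> \<le> CB l" for x using v0b[of "l * x"] CB_bounds(2)[of l] by linarith
    then show ?thesis by simp
  qed
  have a0: "a > 0" using ie dv0 unfolding interface_eq_def by simp
  have "AE p in Q T. Vs l p \<le> v0 (l * fst p)"
    by (rule evol_decreasing[OF evol_Vs[OF l] bdd_CB(2) bdd_CB(5) _ _ b0]) (use Fn_bound k dv0 in simp_all)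
  then show ?thesis using AE_Q_time AE_Q_interface
  proof eventually_elim
    case (elim p)
    let ?x = "fst p" and ?\<eta> = "fst p / sqrt (snd p)"
    have sp: "sqrt (snd p) > 0" using elim by simp
    have wb: "wb p = f ?\<eta>" unfolding wb_def selfsim_def ..
    have zq0: "0 \<le> 1 / (\<delta> * du) * (zn l p * qn l p)" using \<delta> du zq_nonneg[of l p] by simp
    have th0: "0 \<le> M * thin \<delta> p" using thin_bound[of \<delta> p] M_pos by simp
    note m0 = mn_bound[of l p]
    show ?case
    proof (cases "?x > a * sqrt (snd p)")
      case True
      then have "?\<eta> > a" using sp by (simp add: less_divide_eq)
      then have "f ?\<eta> = - V0" unfolding f_def profile_eq using dv0 by (simp add: fR_def)
      then have e: "errV l p = Vs l p - V0" unfolding errV_def wb using V0 by simp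
      \<comment> \<open>A positive a puts this region inside x > 0, where the limiting datum is V0;
        so v - V0 is at most the initial error.\<close>
      have "?x > 0" using True a0 sp by (smt (verit) mult_pos_pos)
      then have "v0_inf V0 ?x = V0" unfolding v0_inf_def by simp
      then show ?thesis using e elim zq0 th0 m0 by auto
    next
      case False
      then have lt: "?\<eta> < a" using sp elim by (simp add: divide_less_eq)
      then have wp: "wb p > 0" unfolding wb f_def by (rule profile_bounds(3)[OF du U0 V0])
      then have e: "errV l p = Vs l p" unfolding errV_def by simp
      show ?thesis
      proof (cases "wb p \<le> \<delta>")
        case True
        then have "thin \<delta> p = 1" unfolding thin_def using lt by simp
        then show ?thesis using e UVs_bound[of l p] zq0 m0 by simp
      next
        case d: False
        have vm: "0 \<le> Vs l p - mn l p" unfolding mn_def by simp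
        \<comment> \<open>Where the profile exceeds \<open>\<delta>\<close>, the mixed flux estimate
          controls v - m at the price of the factor 1 / (\<open>\<delta>\<close> du).\<close>
        have "\<delta> * du * (Vs l p - mn l p) \<le> du * ((Vs l p - mn l p) * max (wb p) 0)"
        proof -
          have "(Vs l p - mn l p) * \<delta> \<le> (Vs l p - mn l p) * max (wb p) 0" using vm d by (intro mult_left_mono) simp_all
          then have "du * ((Vs l p - mn l p) * \<delta>) \<le> du * ((Vs l p - mn l p) * max (wb p) 0)"
            by (rule mult_left_mono) (use du in simp)
          then show ?thesis by (simp only: mult_ac)
        qed
        then have "\<delta> * du * (Vs l p - mn l p) \<le> zn l p * qn l p" using flux(3)[of l p] by linarith
        then have "Vs l p - mn l p \<le> 1 / (\<delta> * du) * (zn l p * qn l p)"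
          using mult_pos_pos[OF \<delta> du] by (simp add: pos_le_divide_eq mult.commute)
        moreover have "max 0 (errV l p) = Vs l p" using e UVs_bound(3)[of l p] by simp
        ultimately show ?thesis using th0 by linarith
      qed
    qed
  qed
qed

text \<open>The order of the limits matters: \<open>\<delta>\<close> is fixed first, so that the
  strip costs less than e, and only then does n grow with 1 / (\<open>\<delta>\<close> du) held
  constant.\<close>

lemma errV_excess_tendsto:
  assumes dv0: "dv = 0"
  shows "(\<lambda>n. \<integral>p. max 0 (errV (sc n) p) \<partial>Q T) \<longlonglongrightarrow> 0"
proof (rule tendsto_0I)
  show "0 \<le> (\<integral>p. max 0 (errV (sc n) p) \<partial>Q T)" for n by simp
  fix e :: real assume e: "e > 0"
  have "\<forall>\<^sub>F j in sequentially. M * (\<integral>p. thin (1 / sc j) p \<partial>Q T) < e"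
    by (rule order_tendstoD(2)[OF tendsto_mult_right_zero[OF thin_tendsto] e])
  then obtain j where j: "M * (\<integral>p. thin (1 / sc j) p \<partial>Q T) < e" by (meson eventually_happens trivial_limit_sequentially)
  define \<delta> where "\<delta> = 1 / sc j"
  have \<delta>: "\<delta> > 0" unfolding \<delta>_def by simp
  define b where "b n = T * (Z / sc n) + ((\<integral>p. mn (sc n) p \<partial>Q T) + 1 / (\<delta> * du) * (\<integral>p. zn (sc n) p * qn (sc n) p \<partial>Q T))" for n
  have "(\<integral>p. max 0 (errV (sc n) p) \<partial>Q T) \<le> e + b n" for n
  proof -
    have l: "sc n > 0" by simp
    have i: "integrable (Q T) (\<lambda>p. max 0 (errV (sc n) p))"
      by (rule Q.integrable_boundedI[where B=M]) (measurable, use euv_bound(2)[of "sc n"] M_pos in \<open>auto simp: abs_le_iff max_def\<close>)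
    note ii = v0_integral_bound(1)[OF l] int_m[of T "sc n"] int_zq[of T "sc n"] thin_integrable[of \<delta>]
    have "(\<integral>p. max 0 (errV (sc n) p) \<partial>Q T) \<le> (\<integral>p. \<bar>v0 (sc n * fst p) - v0_inf V0 (fst p)\<bar> + (mn (sc n) p
        + (1 / (\<delta> * du) * (zn (sc n) p * qn (sc n) p) + M * thin \<delta> p)) \<partial>Q T)"
      by (rule integral_mono_AE[OF i _ errV_excess_pointwise[OF dv0 l \<delta>]])
        (intro Bochner_Integration.integrable_add integrable_mult_right ii)
    also have "\<dots> = (\<integral>p. \<bar>v0 (sc n * fst p) - v0_inf V0 (fst p)\<bar> \<partial>Q T) + ((\<integral>p. mn (sc n) p \<partial>Q T)
        + (1 / (\<delta> * du) * (\<integral>p. zn (sc n) p * qn (sc n) p \<partial>Q T) + M * (\<integral>p. thin \<delta> p \<partial>Q T)))"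
      using ii by (simp only: Bochner_Integration.integral_add Bochner_Integration.integrable_add integrable_mult_right integral_mult_right_zero)
    also have "\<dots> \<le> e + b n" using v0_integral_bound(2)[OF l] j unfolding b_def \<delta>_def by linarith
    finally show ?thesis .
  qed
  moreover have "b \<longlonglongrightarrow> T * 0 + (0 + 1 / (\<delta> * du) * 0)"
    unfolding b_def by (intro tendsto_add tendsto_mult_left one_over_sc m_tendsto zq_tendsto)
  ultimately show "\<exists>b. b \<longlonglongrightarrow> 0 \<and> (\<forall>n. (\<integral>p. max 0 (errV (sc n) p) \<partial>Q T) \<le> e + b n)" by auto
qed

text \<open>With y = \<open>errV\<close> one has |y| = 2 max 0 y - y, and -\<open>errV\<close> =
  \<open>zn\<close> - \<open>errU\<close>. The excess and \<open>errU\<close> tend to 0 in the mean,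
  and \<open>zn\<close> enters linearly, so its mean without absolute values is enough. Boundedness
  by M then passes from |y| to y^2.\<close>

lemma ev_tendsto_zero:
  assumes dv0: "dv = 0"
  shows "(\<lambda>n. \<integral>p. (errV (sc n) p)\<^sup>2 \<partial>Q T) \<longlonglongrightarrow> 0"
proof (rule tendsto_sandwich[OF _ _ tendsto_const])
  show "\<forall>\<^sub>F n in sequentially. 0 \<le> (\<integral>p. (errV (sc n) p)\<^sup>2 \<partial>Q T)" by simp
  let ?b = "\<lambda>n. M * (2 * (\<integral>p. max 0 (errV (sc n) p) \<partial>Q T) + ((\<integral>p. \<bar>errU (sc n) p\<bar> \<partial>Q T) + T * (Z / sc n + 10 * (\<integral>p. \<bar>Gn (sc n) p\<bar> \<partial>Q T))))"
  have "(\<integral>p. (errV (sc n) p)\<^sup>2 \<partial>Q T) \<le> ?b n" for n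
  proof -
    let ?l = "sc n"
    have sqb: "(errV ?l p)\<^sup>2 \<le> M * \<bar>errV ?l p\<bar>" for p
      using mult_right_mono[OF euv_bound(2)[of ?l p], of "\<bar>errV ?l p\<bar>"] by (simp add: power2_eq_square)
    have pw: "(errV ?l p)\<^sup>2 \<le> M * (2 * max 0 (errV ?l p) + (\<bar>errU ?l p\<bar> + zn ?l p))" for p
    proof -
      have "errU ?l p - errV ?l p = zn ?l p" unfolding errU_def errV_def zn_def by (auto simp: max_def min_def)
      then have "\<bar>errV ?l p\<bar> \<le> 2 * max 0 (errV ?l p) + (\<bar>errU ?l p\<bar> + zn ?l p)" by (auto simp: max_def)
      then have "M * \<bar>errV ?l p\<bar> \<le> M * (2 * max 0 (errV ?l p) + (\<bar>errU ?l p\<bar> + zn ?l p))" using M_pos by (intro mult_left_mono) simp_all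
      then show ?thesis using sqb[of p] by linarith
    qed
    have i: "integrable (Q T) (\<lambda>p. (errV ?l p)\<^sup>2)" "integrable (Q T) (\<lambda>p. max 0 (errV ?l p))" "integrable (Q T) (\<lambda>p. \<bar>errU ?l p\<bar>)" "integrable (Q T) (zn ?l)"
    proof -
      have "\<bar>(errV ?l p)\<^sup>2\<bar> \<le> M\<^sup>2" for p using abs_le_square_iff[of "errV ?l p" M] euv_bound(2)[of ?l p] M_pos by simp
      then show "integrable (Q T) (\<lambda>p. (errV ?l p)\<^sup>2)" by (intro Q.integrable_boundedI[where B="M\<^sup>2"]) simp_all
      show "integrable (Q T) (\<lambda>p. max 0 (errV ?l p))"
        by (rule Q.integrable_boundedI[where B=M]) (measurable, use euv_bound(2)[of ?l] M_pos in \<open>auto simp: abs_le_iff max_def\<close>)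
      show "integrable (Q T) (\<lambda>p. \<bar>errU ?l p\<bar>)" by (rule Q.integrable_boundedI[where B=M]) (measurable, use euv_bound(1) in simp)
      show "integrable (Q T) (zn ?l)" by (rule Q.integrable_boundedI[where B=K]) (measurable, rule zn_bound)
    qed
    have "(\<integral>p. (errV ?l p)\<^sup>2 \<partial>Q T) \<le> (\<integral>p. M * (2 * max 0 (errV ?l p) + (\<bar>errU ?l p\<bar> + zn ?l p)) \<partial>Q T)"
      by (rule integral_mono[OF i(1) _ pw]) (intro Bochner_Integration.integrable_add integrable_mult_right i)
    also have "\<dots> = M * (2 * (\<integral>p. max 0 (errV ?l p) \<partial>Q T) + ((\<integral>p. \<bar>errU ?l p\<bar> \<partial>Q T) + (\<integral>p. zn ?l p \<partial>Q T)))"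
      using i by (simp only: Bochner_Integration.integral_add Bochner_Integration.integrable_add integrable_mult_right integral_mult_right_zero)
    also have "\<dots> \<le> ?b n"
    proof (intro mult_left_mono add_left_mono)
      show "(\<integral>p. zn ?l p \<partial>Q T) \<le> T * (Z / ?l + 10 * (\<integral>p. \<bar>Gn ?l p\<bar> \<partial>Q T))"
        using z_integral_bound[of ?l] by (simp add: abs_le_iff)
    qed (use M_pos in simp)
    finally show ?thesis .
  qed
  then show "\<forall>\<^sub>F n in sequentially. (\<integral>p. (errV (sc n) p)\<^sup>2 \<partial>Q T) \<le> ?b n" by simp
  have "bdd_borel2 (errU (sc n)) M" for n using euv_bound(1) by simp
  then have "?b \<longlonglongrightarrow> M * (2 * 0 + (0 + T * (0 + 10 * 0)))"
    by (intro tendsto_add tendsto_mult_left one_over_sc G_tendsto errV_excess_tendsto[OF dv0] L1_of_L2[OF _ eu_tendsto])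
  then show "?b \<longlonglongrightarrow> 0" by simp
qed

section \<open>Choice of times and return to the original variables\<close>

definition "D n s = (\<integral>x. (errU (sc n) (x, s))\<^sup>2 \<partial>Mx) + (\<integral>x. (errV (sc n) (x, s))\<^sup>2 \<partial>Mx)" for n :: nat and s :: real

lemma sq_facts:
  "(\<lambda>p. (errU l p)\<^sup>2) \<in> borel_measurable (borel \<Otimes>\<^sub>M borel)" "\<bar>(errU l p)\<^sup>2\<bar> \<le> M\<^sup>2"
  "(\<lambda>p. (errV l p)\<^sup>2) \<in> borel_measurable (borel \<Otimes>\<^sub>M borel)" "\<bar>(errV l p)\<^sup>2\<bar> \<le> M\<^sup>2"
  using abs_le_square_iff[of "errU l p" M] abs_le_square_iff[of "errV l p" M] euv_bound[of l p] M_pos by simp_all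

lemma D_measurable[measurable]: "D n \<in> borel_measurable borel"
  unfolding D_def[abs_def] by measurable

lemma D_integral: "integrable (Mt T) (D n)" "(\<integral>s. D n s \<partial>Mt T) = (\<integral>p. (errU (sc n) p)\<^sup>2 \<partial>Q T) + (\<integral>p. (errV (sc n) p)\<^sup>2 \<partial>Q T)"
proof -
  have i: "integrable (Mt T) (\<lambda>s. \<integral>x. (errU (sc n) (x, s))\<^sup>2 \<partial>Mx)" "integrable (Mt T) (\<lambda>s. \<integral>x. (errV (sc n) (x, s))\<^sup>2 \<partial>Mx)"
    by (rule Mt.integrable_boundedI[where B="M\<^sup>2 * measure Mx UNIV"], measurable, rule Mx_marginal(2)[OF sq_facts(1,2)])
      (rule Mt.integrable_boundedI[where B="M\<^sup>2 * measure Mx UNIV"], measurable, rule Mx_marginal(2)[OF sq_facts(3,4)])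
  show "integrable (Mt T) (D n)" unfolding D_def[abs_def] using i by simp
  show "(\<integral>s. D n s \<partial>Mt T) = (\<integral>p. (errU (sc n) p)\<^sup>2 \<partial>Q T) + (\<integral>p. (errV (sc n) p)\<^sup>2 \<partial>Q T)"
    unfolding D_def Q_iterated(1)[OF sq_facts(1,2)] Q_iterated(1)[OF sq_facts(3,4)] using i by simp
qed

lemma D_tendsto: "(\<lambda>n. \<integral>s. D n s \<partial>Mt T) \<longlonglongrightarrow> 0"
proof -
  have "(\<lambda>n. \<integral>p. (errV (sc n) p)\<^sup>2 \<partial>Q T) \<longlonglongrightarrow> 0"
    using ev_tendsto_zero ev_tendsto_pos dv by (cases "dv = 0") simp_all
  from tendsto_add[OF eu_tendsto this] show ?thesis unfolding D_integral by simp
qed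

text \<open>As \<open>\<integral> D n\<close> tends to \<open>0\<close>, some time avoiding any given null set has \<open>D n\<close> at most twice its average over
  \<open>(T/2, T)\<close>, up to a vanishing term.\<close>

lemma time_selection:
  assumes P: "AE t in lborel. 0 < t \<longrightarrow> P t"
  obtains \<tau> where "\<And>n. T / 2 < \<tau> n" "\<And>n. \<tau> n < T" "\<And>n. P ((sc n)\<^sup>2 * \<tau> n)" "(\<lambda>n. D n (\<tau> n)) \<longlonglongrightarrow> 0"
proof -
  \<comment> \<open>If D n exceeded c n almost everywhere on an interval of length T / 2, its
    integral would be at least twice itself plus a positive term. The summand 1 /
    \<open>sc n\<close> yields a contradiction also when the integral is 0.\<close>
  define c where "c n = 4 / T * (\<integral>s. D n s \<partial>Mt T) + 1 / sc n" for n
  have D0: "0 \<le> D n s" for n s unfolding D_def by simp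
  have "\<exists>\<tau>. T / 2 < \<tau> \<and> \<tau> < T \<and> P ((sc n)\<^sup>2 * \<tau>) \<and> D n \<tau> \<le> c n" for n
  proof (rule ccontr)
    assume neg: "\<not> ?thesis"
    have "AE \<tau> in lborel. 0 < (sc n)\<^sup>2 * \<tau> \<longrightarrow> P ((sc n)\<^sup>2 * \<tau>)" by (rule AE_scale[OF _ P]) simp
    then have ae: "AE \<tau> in Mt T. c n * indicator {T / 2<..<T} \<tau> \<le> D n \<tau>"
      unfolding AE_Mt
    proof eventually_elim
      case (elim \<tau>)
      show ?case
      proof
        assume "0 \<le> \<tau> \<and> \<tau> \<le> T"
        show "c n * indicator {T / 2<..<T} \<tau> \<le> D n \<tau>"
        proof (cases "\<tau> \<in> {T / 2<..<T}")
          case True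
          then have "0 < (sc n)\<^sup>2 * \<tau>" using T_pos by simp
          then have "P ((sc n)\<^sup>2 * \<tau>)" using elim by blast
          then have "\<not> D n \<tau> \<le> c n" using neg True by auto
          then show ?thesis using True by simp
        qed (simp add: D0)
      qed
    qed
    have "(\<integral>\<tau>. c n * indicator {T / 2<..<T} \<tau> \<partial>Mt T) \<le> (\<integral>s. D n s \<partial>Mt T)"
      by (rule integral_mono_AE[OF _ D_integral(1) ae]) (rule Mt.integrable_boundedI[where B="\<bar>c n\<bar>"], measurable, simp add: indicator_def)
    moreover have "(\<integral>\<tau>. c n * indicator {T / 2<..<T} \<tau> \<partial>Mt T) = c n * (T / 2)"
    proof -
      have "(\<integral>\<tau>. c n * indicator {T / 2<..<T} \<tau> \<partial>Mt T) = (\<integral>\<tau>. indicator {0..T} \<tau> * (c n * indicator {T / 2<..<T} \<tau>) \<partial>lborel)"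
        by (rule integral_Mt) measurable
      also have "\<dots> = (\<integral>\<tau>. c n * indicator {T / 2<..<T} \<tau> \<partial>lborel)"
        by (rule Bochner_Integration.integral_cong) (use T_pos in \<open>auto simp: indicator_def\<close>)
      also have "\<dots> = c n * (T / 2)" using T_pos by simp
      finally show ?thesis .
    qed
    moreover have "c n * (T / 2) = 2 * (\<integral>s. D n s \<partial>Mt T) + T / 2 * (1 / sc n)"
      unfolding c_def distrib_right using T_pos by simp
    moreover have "0 \<le> (\<integral>s. D n s \<partial>Mt T)" using D0 by simp
    moreover have "0 < T / 2 * (1 / sc n)" using T_pos by simp
    ultimately show False by linarith
  qed
  then obtain \<tau> where \<tau>: "\<And>n. T / 2 < \<tau> n \<and> \<tau> n < T \<and> P ((sc n)\<^sup>2 * \<tau> n) \<and> D n (\<tau> n) \<le> c n" by metis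
  have "c \<longlonglongrightarrow> 4 / T * 0 + 0" unfolding c_def by (intro tendsto_add tendsto_mult_left D_tendsto one_over_sc)
  then have c0: "c \<longlonglongrightarrow> 0" by simp
  have "(\<lambda>n. D n (\<tau> n)) \<longlonglongrightarrow> 0"
    by (rule tendsto_sandwich[OF _ _ tendsto_const c0]) (use \<tau> D0 in auto)
  then show ?thesis using that \<tau> by blast
qed

end

text \<open>The substitution y = l x maps the window to |x| <= J \<sigma>, where rho >= 1 / (1 + (J
  \<sigma>)^2); this bounds the unweighted average by the weighted integral. The function w itself
  is known only up to a null set, hence the Lebesgue integral on the left.\<close>

lemma rescaled_slice:
  fixes w W c :: "real \<Rightarrow> real"
  assumes ae: "AE y in lborel. w y = W y" and W[measurable]: "W \<in> borel_measurable borel" and WB: "\<And>y. \<bar>W y\<bar> \<le> B"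
    and c[measurable]: "c \<in> borel_measurable borel" and cB: "\<And>y. \<bar>c y\<bar> \<le> B"
    and l: "l > 0" and \<sigma>: "\<sigma> > 0" and J: "J > 0"
  shows "set_integrable lebesgue {- J * (l * \<sigma>) .. J * (l * \<sigma>)} (\<lambda>y. \<bar>w y - c (y / (l * \<sigma>))\<bar>\<^sup>2)"
    "1 / (l * \<sigma>) * (\<integral>y\<in>{- J * (l * \<sigma>) .. J * (l * \<sigma>)}. \<bar>w y - c (y / (l * \<sigma>))\<bar>\<^sup>2 \<partial>lebesgue)
       \<le> (1 + (J * \<sigma>)\<^sup>2) / \<sigma> * (\<integral>x. (W (l * x) - c (x / \<sigma>))\<^sup>2 \<partial>Mx)"
proof -
  let ?I = "{- J * (l * \<sigma>) .. J * (l * \<sigma>)}"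
  define g where "g y = indicator ?I y * (W y - c (y / (l * \<sigma>)))\<^sup>2" for y
  have dB: "(W y - c z)\<^sup>2 \<le> (2 * B)\<^sup>2" for y z
  proof -
    have "\<bar>W y - c z\<bar> \<le> \<bar>2 * B\<bar>" using WB[of y] cB[of z] by linarith
    then show ?thesis by (simp only: abs_le_square_iff)
  qed
  have gi: "integrable lborel g" unfolding g_def
    by (rule integrable_bounded_Icc[where B="(2 * B)\<^sup>2"]) (measurable, use dB in simp)
  have gm: "g \<in> borel_measurable borel" using gi by auto
  have "AE y in lebesgue. w y = W y" using ae by (simp add: AE_completion_iff)
  then have ae': "AE y in lebesgue. indicator ?I y *\<^sub>R \<bar>w y - c (y / (l * \<sigma>))\<bar>\<^sup>2 = g y"
    by eventually_elim (simp add: g_def)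
  show "set_integrable lebesgue ?I (\<lambda>y. \<bar>w y - c (y / (l * \<sigma>))\<bar>\<^sup>2)"
    unfolding set_integrable_def by (rule lebesgue_integral_AE_eq(3)[OF gm ae' gi])
  have "(\<integral>y\<in>?I. \<bar>w y - c (y / (l * \<sigma>))\<bar>\<^sup>2 \<partial>lebesgue) = (\<integral>y. g y \<partial>lborel)"
    unfolding set_lebesgue_integral_def by (rule lebesgue_integral_AE_eq(2)[OF gm ae'])
  also have "\<dots> = l * (\<integral>x. g (l * x) \<partial>lborel)"
    using lborel_integral_real_affine[of l g 0] l by simp
  also have "(\<integral>x. g (l * x) \<partial>lborel) \<le> (\<integral>x. (1 + (J * \<sigma>)\<^sup>2) * (rho x * (W (l * x) - c (x / \<sigma>))\<^sup>2) \<partial>lborel)"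
  proof (rule integral_mono)
    show "integrable lborel (\<lambda>x. g (l * x))"
      using lborel_integrable_real_affine[OF gi, of l 0] l by simp
    have "integrable lborel (\<lambda>x. (W (l * x) - c (x / \<sigma>))\<^sup>2 * rho x)"
      by (rule integrable_mult_bounded[OF integrable_rho, where B="(2 * B)\<^sup>2"]) (measurable, use dB in simp)
    then show "integrable lborel (\<lambda>x. (1 + (J * \<sigma>)\<^sup>2) * (rho x * (W (l * x) - c (x / \<sigma>))\<^sup>2))"
      by (intro integrable_mult_right) (simp add: mult.commute)
    fix x
    show "g (l * x) \<le> (1 + (J * \<sigma>)\<^sup>2) * (rho x * (W (l * x) - c (x / \<sigma>))\<^sup>2)"
    proof (cases "l * x \<in> ?I")
      case True
      then have "\<bar>l * x\<bar> \<le> l * (J * \<sigma>)" by (simp add: abs_le_iff mult_ac)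
      then have "\<bar>x\<bar> \<le> J * \<sigma>" using l by (simp add: abs_mult)
      then have "x\<^sup>2 \<le> (J * \<sigma>)\<^sup>2" using abs_le_square_iff[of x "J * \<sigma>"] J \<sigma> by simp
      then have "(1 + x\<^sup>2) * rho x \<le> (1 + (J * \<sigma>)\<^sup>2) * rho x" using rho_pos[of x] by (intro mult_right_mono) simp_all
      then have "1 \<le> (1 + (J * \<sigma>)\<^sup>2) * rho x" using rho_mult[of x] by (simp add: mult.commute)
      then have "1 * (W (l * x) - c (x / \<sigma>))\<^sup>2 \<le> ((1 + (J * \<sigma>)\<^sup>2) * rho x) * (W (l * x) - c (x / \<sigma>))\<^sup>2"
        by (intro mult_right_mono) simp_all
      moreover have "l * x / (l * \<sigma>) = x / \<sigma>" using l by simp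
      ultimately show ?thesis using True unfolding g_def by (simp add: mult.assoc)
    next
      case False
      then show ?thesis using rho_pos[of x] unfolding g_def by (simp add: add_nonneg_nonneg)
    qed
  qed
  also have "(\<integral>x. (1 + (J * \<sigma>)\<^sup>2) * (rho x * (W (l * x) - c (x / \<sigma>))\<^sup>2) \<partial>lborel) = (1 + (J * \<sigma>)\<^sup>2) * (\<integral>x. (W (l * x) - c (x / \<sigma>))\<^sup>2 \<partial>Mx)"
    by (subst integral_Mx) simp_all
  finally have "(\<integral>y\<in>?I. \<bar>w y - c (y / (l * \<sigma>))\<bar>\<^sup>2 \<partial>lebesgue) \<le> l * ((1 + (J * \<sigma>)\<^sup>2) * (\<integral>x. (W (l * x) - c (x / \<sigma>))\<^sup>2 \<partial>Mx))"
    using l by simp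
  then have "1 / (l * \<sigma>) * (\<integral>y\<in>?I. \<bar>w y - c (y / (l * \<sigma>))\<bar>\<^sup>2 \<partial>lebesgue)
      \<le> 1 / (l * \<sigma>) * (l * ((1 + (J * \<sigma>)\<^sup>2) * (\<integral>x. (W (l * x) - c (x / \<sigma>))\<^sup>2 \<partial>Mx)))"
    using l \<sigma> by (intro mult_left_mono) simp_all
  then show "1 / (l * \<sigma>) * (\<integral>y\<in>?I. \<bar>w y - c (y / (l * \<sigma>))\<bar>\<^sup>2 \<partial>lebesgue)
       \<le> (1 + (J * \<sigma>)\<^sup>2) / \<sigma> * (\<integral>x. (W (l * x) - c (x / \<sigma>))\<^sup>2 \<partial>Mx)"
    using l by simp
qed

context selfsimilar_setup
begin

lemma filterlim_sc_time:
  assumes \<tau>: "\<And>n. T / 2 < \<tau> n"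
  shows "filterlim (\<lambda>n. (sc n)\<^sup>2 * \<tau> n) at_top sequentially"
proof (rule filterlim_at_top_mono)
  show "filterlim (\<lambda>n. T / 2 * real n) at_top sequentially"
    using T_pos by (intro filterlim_tendsto_pos_mult_at_top[OF tendsto_const _ filterlim_real_sequentially]) simp
  have "T / 2 * real n \<le> (sc n)\<^sup>2 * \<tau> n" for n
  proof -
    have "real n \<le> sc n * sc n" by (simp add: algebra_simps)
    then have "real n * (T / 2) \<le> (sc n)\<^sup>2 * (T / 2)" using T_pos unfolding power2_eq_square by (intro mult_right_mono) simp_all
    also have "\<dots> \<le> (sc n)\<^sup>2 * \<tau> n" using \<tau>[of n] by (intro mult_left_mono) simp_all
    finally show ?thesis by (simp add: mult.commute)
  qed
  then show "\<forall>\<^sub>F n in sequentially. T / 2 * real n \<le> (sc n)\<^sup>2 * \<tau> n" by simp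
qed

lemma rescaled_convergence:
  fixes w :: "real \<Rightarrow> real \<Rightarrow> real" and W :: "real \<times> real \<Rightarrow> real" and c :: "real \<Rightarrow> real"
  assumes \<tau>: "\<And>n. T / 2 < \<tau> n" "\<And>n. \<tau> n < T"
    and ae: "\<And>n. AE y in lborel. w y ((sc n)\<^sup>2 * \<tau> n) = W (y, (sc n)\<^sup>2 * \<tau> n)"
    and W[measurable]: "W \<in> borel_measurable (borel \<Otimes>\<^sub>M borel)" and WB: "\<And>p. \<bar>W p\<bar> \<le> M"
    and c[measurable]: "c \<in> borel_measurable borel" and cB: "\<And>y. \<bar>c y\<bar> \<le> M" and J: "J > 0"
    and le: "\<And>n. (\<integral>x. (W (sc n * x, (sc n)\<^sup>2 * \<tau> n) - c (x / sqrt (\<tau> n)))\<^sup>2 \<partial>Mx) \<le> d n" and d: "d \<longlonglongrightarrow> 0"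
  defines "t \<equiv> \<lambda>n. (sc n)\<^sup>2 * \<tau> n"
  shows "set_integrable lebesgue {- J * sqrt (t n) .. J * sqrt (t n)} (\<lambda>y. \<bar>w y (t n) - c (y / sqrt (t n))\<bar>\<^sup>2)"
    "(\<lambda>n. 1 / sqrt (t n) * (\<integral>y\<in>{- J * sqrt (t n) .. J * sqrt (t n)}. \<bar>w y (t n) - c (y / sqrt (t n))\<bar>\<^sup>2 \<partial>lebesgue)) \<longlonglongrightarrow> 0"
proof -
  have \<tau>0: "\<tau> n > 0" for n using \<tau>(1)[of n] T_pos by simp
  have sq: "sqrt (t n) = sc n * sqrt (\<tau> n)" for n unfolding t_def by (simp add: real_sqrt_mult)
  have ae': "AE y in lborel. w y (t n) = W (y, t n)" for n unfolding t_def by (rule ae)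
  have Wn: "(\<lambda>y. W (y, t n)) \<in> borel_measurable borel" for n by measurable
  note rs = rescaled_slice[where w="\<lambda>y. w y (t n)" and W="\<lambda>y. W (y, t n)" and c=c and B=M and l="sc n" and \<sigma>="sqrt (\<tau> n)" and J=J for n,
      OF ae' Wn WB c cB]
  show "set_integrable lebesgue {- J * sqrt (t n) .. J * sqrt (t n)} (\<lambda>y. \<bar>w y (t n) - c (y / sqrt (t n))\<bar>\<^sup>2)" for n
    unfolding sq by (rule rs(1)) (use \<tau>0 J in simp_all)
  \<comment> \<open>As \<open>\<tau>\<close> stays between T / 2 and T, this bounds the factor (1 +
    J^2 \<open>\<tau>\<close>) / sqrt \<open>\<tau>\<close> uniformly in n.\<close>
  define C where "C = (1 + J\<^sup>2 * T) / sqrt (T / 2)"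
  have up: "1 / sqrt (t n) * (\<integral>y\<in>{- J * sqrt (t n) .. J * sqrt (t n)}. \<bar>w y (t n) - c (y / sqrt (t n))\<bar>\<^sup>2 \<partial>lebesgue) \<le> C * d n" for n
  proof -
    let ?I = "\<integral>x. (W (sc n * x, t n) - c (x / sqrt (\<tau> n)))\<^sup>2 \<partial>Mx"
    have "1 / sqrt (t n) * (\<integral>y\<in>{- J * sqrt (t n) .. J * sqrt (t n)}. \<bar>w y (t n) - c (y / sqrt (t n))\<bar>\<^sup>2 \<partial>lebesgue)
        \<le> (1 + (J * sqrt (\<tau> n))\<^sup>2) / sqrt (\<tau> n) * ?I"
      unfolding sq by (rule rs(2)) (use \<tau>0 J in simp_all)
    also have "\<dots> \<le> C * d n"
    proof (rule mult_mono)
      have "(J * sqrt (\<tau> n))\<^sup>2 \<le> J\<^sup>2 * T"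
        using mult_left_mono[OF less_imp_le[OF \<tau>(2)[of n]], of "J\<^sup>2"] \<tau>0[of n] by (simp add: power_mult_distrib)
      then show "(1 + (J * sqrt (\<tau> n))\<^sup>2) / sqrt (\<tau> n) \<le> C"
        unfolding C_def using \<tau>(1)[of n] T_pos by (intro frac_le) simp_all
      show "?I \<le> d n" unfolding t_def by (rule le)
      show "0 \<le> C" unfolding C_def using T_pos by simp
    qed simp
    finally show ?thesis .
  qed
  have lo: "0 \<le> 1 / sqrt (t n) * (\<integral>y\<in>{- J * sqrt (t n) .. J * sqrt (t n)}. \<bar>w y (t n) - c (y / sqrt (t n))\<bar>\<^sup>2 \<partial>lebesgue)" for n
    unfolding sq set_lebesgue_integral_def using \<tau>0[of n]
    by (intro mult_nonneg_nonneg Bochner_Integration.integral_nonneg) simp_all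
  show "(\<lambda>n. 1 / sqrt (t n) * (\<integral>y\<in>{- J * sqrt (t n) .. J * sqrt (t n)}. \<bar>w y (t n) - c (y / sqrt (t n))\<bar>\<^sup>2 \<partial>lebesgue)) \<longlonglongrightarrow> 0"
  proof (rule tendsto_sandwich[OF _ _ tendsto_const])
    show "(\<lambda>n. C * d n) \<longlonglongrightarrow> 0" using tendsto_mult_left[OF d, of C] by simp
  qed (rule always_eventually, rule allI, rule lo, rule always_eventually, rule allI, rule up)
qed

lemma convergence_along_times:
  fixes u v :: "real \<Rightarrow> real \<Rightarrow> real"
  assumes ua: "AE p in lebesgue. 0 < snd p \<longrightarrow> u (fst p) (snd p) = U p"
    and va: "AE p in lebesgue. 0 < snd p \<longrightarrow> v (fst p) (snd p) = V p" and J: "J > 0"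
  shows "\<exists>t :: nat \<Rightarrow> real. (\<forall>n. t n > 0) \<and> filterlim t at_top sequentially \<and>
      (\<forall>n. set_integrable lebesgue {- J * sqrt (t n) .. J * sqrt (t n)}
             (\<lambda>y. \<bar>u y (t n) - max (f (y / sqrt (t n))) 0\<bar>\<^sup>2) \<and>
           set_integrable lebesgue {- J * sqrt (t n) .. J * sqrt (t n)}
             (\<lambda>y. \<bar>v y (t n) + min (f (y / sqrt (t n))) 0\<bar>\<^sup>2)) \<and>
      (\<lambda>n. 1 / sqrt (t n) * (\<integral>y\<in>{- J * sqrt (t n) .. J * sqrt (t n)}.
             \<bar>u y (t n) - max (f (y / sqrt (t n))) 0\<bar>\<^sup>2 \<partial>lebesgue)) \<longlonglongrightarrow> 0 \<and>
      (\<lambda>n. 1 / sqrt (t n) * (\<integral>y\<in>{- J * sqrt (t n) .. J * sqrt (t n)}.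
             \<bar>v y (t n) + min (f (y / sqrt (t n))) 0\<bar>\<^sup>2 \<partial>lebesgue)) \<longlonglongrightarrow> 0"
proof -
  \<comment> \<open>At such times the slices of u and v agree almost everywhere with those of U and
    V, so the convergence proved for the representatives applies to the solution itself.\<close>
  define P where "P t \<longleftrightarrow> (AE x in lborel. u x t = U (x, t)) \<and> (AE x in lborel. v x t = V (x, t))" for t
  have "AE t in lborel. 0 < t \<longrightarrow> P t"
    using AE_lebesgue_slices[OF ua] AE_lebesgue_slices[OF va]
    by eventually_elim (simp add: P_def)
  then obtain \<tau> where \<tau>: "\<And>n. T / 2 < \<tau> n" "\<And>n. \<tau> n < T" and P: "\<And>n. P ((sc n)\<^sup>2 * \<tau> n)" and D: "(\<lambda>n. D n (\<tau> n)) \<longlonglongrightarrow> 0"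
    by (rule time_selection) (rule that; assumption)
  let ?t = "\<lambda>n. (sc n)\<^sup>2 * \<tau> n"
  have t0: "?t n > 0" for n using \<tau>(1)[of n] T_pos by simp
  have d1: "(\<integral>x. (U (sc n * x, ?t n) - max (f (x / sqrt (\<tau> n))) 0)\<^sup>2 \<partial>Mx) \<le> D n (\<tau> n)" for n
  proof -
    have "0 \<le> (\<integral>x. (errV (sc n) (x, \<tau> n))\<^sup>2 \<partial>Mx)" by simp
    then show ?thesis unfolding D_def errU_def Us_def wb_def selfsim_def f_def by simp
  qed
  have d2: "(\<integral>x. (V (sc n * x, ?t n) - (- min (f (x / sqrt (\<tau> n))) 0))\<^sup>2 \<partial>Mx) \<le> D n (\<tau> n)" for n
  proof -
    have "0 \<le> (\<integral>x. (errU (sc n) (x, \<tau> n))\<^sup>2 \<partial>Mx)" by simp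
    then show ?thesis unfolding D_def errV_def Vs_def wb_def selfsim_def f_def by simp
  qed
  have m1: "(\<lambda>y. max (f y) 0) \<in> borel_measurable borel" "(\<lambda>y. - min (f y) 0) \<in> borel_measurable borel" by measurable
  have b1: "\<bar>max (f y) 0\<bar> \<le> M" "\<bar>- min (f y) 0\<bar> \<le> M" for y using f_bound[of y] by (auto simp: max_def min_def abs_le_iff)
  have Ub': "\<bar>U p\<bar> \<le> M" and Vb': "\<bar>V p\<bar> \<le> M" for p using Ub[of p] Vb[of p] by auto
  have ae: "AE y in lborel. u y (?t n) = U (y, ?t n)" "AE y in lborel. v y (?t n) = V (y, ?t n)" for n
    using P[of n] unfolding P_def by simp_all
  note ru = rescaled_convergence[where w=u and W=U and c="\<lambda>y. max (f y) 0" and J=J, OF \<tau> ae(1) Um Ub' m1(1) b1(1) J d1 D]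
  note rv = rescaled_convergence[where w=v and W=V and c="\<lambda>y. - min (f y) 0" and J=J, OF \<tau> ae(2) Vm Vb' m1(2) b1(2) J d2 D]
  show ?thesis
  proof (intro exI[of _ ?t] conjI allI)
    show "filterlim ?t at_top sequentially" by (rule filterlim_sc_time[OF \<tau>(1)])
    fix n
    show "set_integrable lebesgue {- J * sqrt (?t n) .. J * sqrt (?t n)} (\<lambda>y. \<bar>u y (?t n) - max (f (y / sqrt (?t n))) 0\<bar>\<^sup>2)"
      by (rule ru(1))
    show "set_integrable lebesgue {- J * sqrt (?t n) .. J * sqrt (?t n)} (\<lambda>y. \<bar>v y (?t n) + min (f (y / sqrt (?t n))) 0\<bar>\<^sup>2)"
      using rv(1)[of n] by (simp only: diff_minus_eq_add)
  next
    show "(\<lambda>n. 1 / sqrt (?t n) * (\<integral>y\<in>{- J * sqrt (?t n) .. J * sqrt (?t n)}.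
             \<bar>u y (?t n) - max (f (y / sqrt (?t n))) 0\<bar>\<^sup>2 \<partial>lebesgue)) \<longlonglongrightarrow> 0"
      by (rule ru(2))
    show "(\<lambda>n. 1 / sqrt (?t n) * (\<integral>y\<in>{- J * sqrt (?t n) .. J * sqrt (?t n)}.
             \<bar>v y (?t n) + min (f (y / sqrt (?t n))) 0\<bar>\<^sup>2 \<partial>lebesgue)) \<longlonglongrightarrow> 0"
      using rv(2) by (simp only: diff_minus_eq_add)
  qed (use t0 in simp)
qed

end

theorem theorem4p1:
  fixes du dv k U0 V0 M :: real
    and F :: "real \<Rightarrow> real \<Rightarrow> real"
    and u0 v0 :: "real \<Rightarrow> real"
    and u v :: "real \<Rightarrow> real \<Rightarrow> real"
  assumes "k > 0" and "du > 0" and "dv \<ge> 0"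
    and "U0 > 0" and "V0 > 0" and "M \<ge> max U0 V0"
    and "reaction_rate F"
    and "C2_real u0" and "C2_real v0"
    and "\<forall>x. 0 \<le> u0 x \<and> u0 x \<le> M" and "\<forall>x. 0 \<le> v0 x \<and> v0 x \<le> M"
    and "integrable lborel (\<lambda>x. u0 x - u0_inf U0 x)"
    and "integrable lborel (\<lambda>x. v0 x - v0_inf V0 x)"
    and "(u0 \<longlongrightarrow> U0) at_bot" and "(u0 \<longlongrightarrow> 0) at_top"
    and "(v0 \<longlongrightarrow> 0) at_bot" and "(v0 \<longlongrightarrow> V0) at_top"
    and "\<forall>T>0. solution du dv k F u0 v0 M T u v"
  shows "\<exists>a. interface_eq du dv U0 V0 a \<and> (\<forall>b. interface_eq du dv U0 V0 b \<longrightarrow> b = a) \<and>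
    (\<forall>J>0. \<exists>t :: nat \<Rightarrow> real. (\<forall>n. t n > 0) \<and> filterlim t at_top sequentially \<and>
      (\<forall>n. set_integrable lebesgue {- J * sqrt (t n) .. J * sqrt (t n)}
             (\<lambda>y. \<bar>u y (t n) - max (profile du dv U0 V0 a (y / sqrt (t n))) 0\<bar>\<^sup>2) \<and>
           set_integrable lebesgue {- J * sqrt (t n) .. J * sqrt (t n)}
             (\<lambda>y. \<bar>v y (t n) + min (profile du dv U0 V0 a (y / sqrt (t n))) 0\<bar>\<^sup>2)) \<and>
      (\<lambda>n. 1 / sqrt (t n) * (\<integral>y\<in>{- J * sqrt (t n) .. J * sqrt (t n)}.
             \<bar>u y (t n) - max (profile du dv U0 V0 a (y / sqrt (t n))) 0\<bar>\<^sup>2 \<partial>lebesgue)) \<longlonglongrightarrow> 0 \<and>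
      (\<lambda>n. 1 / sqrt (t n) * (\<integral>y\<in>{- J * sqrt (t n) .. J * sqrt (t n)}.
             \<bar>v y (t n) + min (profile du dv U0 V0 a (y / sqrt (t n))) 0\<bar>\<^sup>2 \<partial>lebesgue)) \<longlonglongrightarrow> 0)"
proof -
  obtain a where a: "interface_eq du dv U0 V0 a" "\<And>b. interface_eq du dv U0 V0 b \<Longrightarrow> b = a"
    using interface_root[OF assms(2-5)] by blast
  have M: "M \<ge> 0" "U0 \<le> M" "V0 \<le> M" using assms(4-6) by auto
  have borel_C2: "g \<in> borel_measurable borel" if "C2_real g" for g
  proof -
    have "continuous_on UNIV g" using that unfolding C2_real_def
      by (metis DERIV_isCont continuous_at_imp_continuous_on)
    then show ?thesis by (rule borel_measurable_continuous_onI)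
  qed
  note init = borel_C2[OF assms(8)] assms(10)[rule_format] borel_C2[OF assms(9)] assms(11)[rule_format]
  obtain U V where UV: "U \<in> borel_measurable (borel \<Otimes>\<^sub>M borel)" "\<And>p. 0 \<le> U p \<and> U p \<le> M"
    "V \<in> borel_measurable (borel \<Otimes>\<^sub>M borel)" "\<And>p. 0 \<le> V p \<and> V p \<le> M"
    "AE p in lebesgue. 0 < snd p \<longrightarrow> u (fst p) (snd p) = U p" "AE p in lebesgue. 0 < snd p \<longrightarrow> v (fst p) (snd p) = V p"
    "evol U u0 (\<lambda>p. du * U p) (\<lambda>p. k * F (U p) (V p))" "evol V v0 (\<lambda>p. dv * V p) (\<lambda>p. k * F (U p) (V p))"
  \<comment> \<open>Both notions of solution supply the same kind of representatives and integrated
    equations; in the weak case the flux \<open>0 * V p\<close> is read as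
    \<open>dv * V p\<close>.\<close>
  proof (cases "dv > 0")
    case True
    then have cs: "classical_solution du dv k F u0 v0 M T u v" if "T > 0" for T using assms(18) that unfolding solution_def by simp
    show ?thesis by (rule classical_solution_evol[OF assms(7) M(1) assms(1) cs]) (assumption, (rule that; assumption))
  next
    case False
    then have "dv = 0" using assms(3) by simp
    have ws: "weak_solution du k F u0 v0 M T u v" if "T > 0" for T using assms(18) that False unfolding solution_def by simp
    show ?thesis by (rule weak_solution_evol[OF assms(7) M(1) assms(1,2) init ws]) (assumption, (rule that[unfolded \<open>dv = 0\<close>]; assumption))
  qed
  interpret selfsimilar_setup du dv k U0 V0 M a F u0 v0 U V
    by (rule selfsimilar_setup.intro[OF assms(1-5) M(2,3) assms(7) init assms(12,13) a(1) UV(1-4) UV(7,8)])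
  show ?thesis
  proof (intro exI[of _ a] conjI allI impI)
    fix J :: real assume "J > 0"
    from convergence_along_times[OF UV(5,6) this, unfolded f_def]
    show "\<exists>t :: nat \<Rightarrow> real. (\<forall>n. t n > 0) \<and> filterlim t at_top sequentially \<and>
      (\<forall>n. set_integrable lebesgue {- J * sqrt (t n) .. J * sqrt (t n)}
             (\<lambda>y. \<bar>u y (t n) - max (profile du dv U0 V0 a (y / sqrt (t n))) 0\<bar>\<^sup>2) \<and>
           set_integrable lebesgue {- J * sqrt (t n) .. J * sqrt (t n)}
             (\<lambda>y. \<bar>v y (t n) + min (profile du dv U0 V0 a (y / sqrt (t n))) 0\<bar>\<^sup>2)) \<and>
      (\<lambda>n. 1 / sqrt (t n) * (\<integral>y\<in>{- J * sqrt (t n) .. J * sqrt (t n)}.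
             \<bar>u y (t n) - max (profile du dv U0 V0 a (y / sqrt (t n))) 0\<bar>\<^sup>2 \<partial>lebesgue)) \<longlonglongrightarrow> 0 \<and>
      (\<lambda>n. 1 / sqrt (t n) * (\<integral>y\<in>{- J * sqrt (t n) .. J * sqrt (t n)}.
             \<bar>v y (t n) + min (profile du dv U0 V0 a (y / sqrt (t n))) 0\<bar>\<^sup>2 \<partial>lebesgue)) \<longlonglongrightarrow> 0" .
  qed (rule a, rule a(2), assumption)
qed

end
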